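(* Let $g$ be a non-constant modular form of weight $k$ for $\mathrm{SL}_2(\mathbb{Z})$ with real Fourier coefficients. Then for every $\lambda\in\mathbb{P}^1(\mathbb{Q})=\mathbb{Q}\cup\{\infty\}$ with $|\lambda|\notin\{\tfrac12,1\}$, \[ N_\lambda(g')\=\frac{k}{12}\+\begin{cases} C(g)+\frac13\,\delta_{g(\rho)=0} & |\lambda|\in(1,\infty],\\ -C(g) & |\lambda|\in(\tfrac12,1),\\ -C(g)+L(g) & |\lambda|\in[0,\tfrac12), \end{cases} \] where $\delta_{g(\rho)=0}$ equals $1$ if $g(\rho)=0$ and $0$ otherwise.
   Context: Let $\mathfrak{h}$ be the complex upper half plane, $q=e^{2\pi i\tau}$, and $\rho=-\tfrac12+\tfrac{\sqrt3}{2}i$. For a holomorphic function $g$ on $\mathfrak h$ write $g'=\frac{1}{2\pi i}\frac{dg}{d\tau}$. Let $E_2(\tau)=1-24\sum_{m,r\ge1} m q^{mr}$. A (holomorphic) quasimodular form of weight $k$ and depth $\le p$ for $\mathrm{SL}_2(\mathbb{Z})$ is a function $f=\sum_{j=0}^p f_jE_2^j$ with each $f_j$ a holomorphic modular form of weight $k-2j$; the derivative of a modular form of weight $k$ is quasimodular of weight $k+2$ and depth $\le1$. Let $\mathfrak{d}$ be the derivation on quasimodular forms with $\mathfrak{d}E_2=12$ that annihilates modular forms, i.e. $\mathfrak{d}^m f/m!=12^m\sum_{j}\binom{j}{m}f_jE_2^{j-m}$. Standard fundamental domain: $\mathcal{F}=\{z\in\mathfrak h: |z|>1,|\mathrm{Re}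 z|<\tfrac12\}\cup\{z\in\mathfrak h:|z|\ge1,-\tfrac12\le \mathrm{Re} z\le 0\}\cup\{\infty\}$, so for $\gamma\in\mathrm{SL}_2(\mathbb Z)$ the set $\gamma\mathcal F$ contains the cusp $\gamma(\infty)$. For $\tau\in\mathfrak h\cup\mathbb P^1(\mathbb Q)$, $e_\tau$ is the order of the stabilizer of $\tau$ in $\mathrm{PSL}_2(\mathbb Z)$ (so $e_\tau=3$ for $\mathrm{SL}_2(\mathbb Z)$-translates of $\rho$, $e_\tau=2$ for translates of $i$, and $e_\tau=1$ otherwise, including cusps). Order of vanishing: for $\tau_0\in\mathfrak h$, $v_{\tau_0}(f)$ is the usual order of vanishing. For a cusp $\tau_0=-d/c$ (with $c\neq 0$; for $\tau_0=\infty$ take $c=0,d=1$), choose $a,b$ with $\left(\begin{smallmatrix}a&b\\c&d\end{smallmatrix}\right)\in\mathrm{SL}_2(\mathbb Z)$; then $(c\tau+d)^kf(\tau)=\sum_{n\ge0}a_n(\tau)\exp\!\big(2\pi i n\tfrac{a\tau+b}{c\tau+d}\big)$ with $a_n(\tau)=\sum_{j=0}^p\frac{a_{n,j}}{j!}\big(\frac{-c(c\tau+d)}{2\pi i}\big)^j\in\mathbb C[\tau]$, where $a_{n,j}$ is the $n$-th Fourier coefficient of $\mathfrak d^jf$; $v_{\tau_0}(f)$ is the least $n$ such that $a_n$ is not the zero polynomial. For $\lambda\in\mathbb P^1(\mathbb Q)$ pick $\gamma=\left(\begin{smallmatrix}a&b\\c&d\end{smallmatrix}\right)\in\mathrm{SL}_2(\mathbb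 Z)$ with $\lambda=-d/c$ ($\lambda=\infty$ iff $c=0$) and set $N_\lambda(f)=\sum_{\tau\in\gamma\mathcal F}v_\tau(f)/e_\tau$; this is independent of the choice of $\gamma$. $C(g)$ is the number of distinct zeros $z$ of $g$ with $|z|=1$ and $-\tfrac12\le\mathrm{Re}(z)\le0$, each zero $z$ counted with weight $e_z^{-1}$ (so a zero at $\rho$ counts $\tfrac13$, a zero at $i$ counts $\tfrac12$). $L(g)$ is the number of distinct zeros $z$ of $g$ with $\mathrm{Re}(z)=-\tfrac12$ and $|z|>1$, plus $1$ if $g$ vanishes at the cusp $\infty$. *)

theory Defs
  imports "HOL-Complex_Analysis.Complex_Analysis"
begin

definition uhp :: "complex set" where
  "uhp = {z. Im z > 0}"

definition \<rho> :: complex where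
  "\<rho> = Complex (- (1/2)) (sqrt 3 / 2)"

definition nome :: "complex \<Rightarrow> complex" where
  "nome \<tau> = exp (2 * of_real pi * \<i> * \<tau>)"

definition normalized_deriv :: "(complex \<Rightarrow> complex) \<Rightarrow> complex \<Rightarrow> complex" where
  "normalized_deriv f \<tau> = deriv f \<tau> / (2 * of_real pi * \<i>)"


section \<open>The modular group and its action on the extended upper half plane\<close>

definition SL2Z :: "(int^2^2) set" where
  "SL2Z = {A. det A = 1}"

definition moebius :: "int^2^2 \<Rightarrow> complex \<Rightarrow> complex" where
  "moebius A z = (of_int (A$1$1) * z + of_int (A$1$2)) / (of_int (A$2$1) * z + of_int (A$2$2))"

text \<open>The projective line over the rationals.\<close>

datatype cusp = Infinity | Rational rat

fun cusp_abs :: "cusp \<Rightarrow> ereal" where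
  "cusp_abs Infinity = \<infinity>"
| "cusp_abs (Rational r) = ereal (real_of_rat \<bar>r\<bar>)"

text \<open>Points of the upper half plane together with the cusps. The constructor \<open>Pt\<close> is
  only meant to be applied to elements of \<^const>\<open>uhp\<close>.\<close>

datatype ext_point = Pt complex | Cusp cusp

fun cusp_action :: "int^2^2 \<Rightarrow> cusp \<Rightarrow> cusp" where
  "cusp_action A Infinity =
     (if A$2$1 = 0 then Infinity else Rational (of_int (A$1$1) / of_int (A$2$1)))"
| "cusp_action A (Rational r) =
     (if of_int (A$2$1) * r + of_int (A$2$2) = 0 then Infinity
      else Rational ((of_int (A$1$1) * r + of_int (A$1$2)) / (of_int (A$2$1) * r + of_int (A$2$2))))"

fun ext_action :: "int^2^2 \<Rightarrow> ext_point \<Rightarrow> ext_point" where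
  "ext_action A (Pt z) = Pt (moebius A z)"
| "ext_action A (Cusp x) = Cusp (cusp_action A x)"

definition fundamental_domain :: "ext_point set" where
  "fundamental_domain =
     Pt ` ({z \<in> uhp. norm z > 1 \<and> \<bar>Re z\<bar> < 1/2} \<union> {z \<in> uhp. norm z \<ge> 1 \<and> - (1/2) \<le> Re z \<and> Re z \<le> 0})
     \<union> {Cusp Infinity}"

text \<open>The order of the stabilizer in \<open>PSL\<^sub>2(\<int>) = SL\<^sub>2(\<int>) / {\<plusminus>1}\<close>, whose elements are the classes
  \<open>{A, - A}\<close>. The stabilizer of a cusp is infinite; there the value is \<open>1\<close> by convention.\<close>

fun stab_order :: "ext_point \<Rightarrow> nat" where
  "stab_order (Pt z) = card ((\<lambda>A. {A, - A}) ` {A \<in> SL2Z. ext_action A (Pt z) = Pt z})"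
| "stab_order (Cusp x) = 1"


section \<open>Modular and quasimodular forms\<close>

definition has_fourier_expansion :: "(complex \<Rightarrow> complex) \<Rightarrow> (nat \<Rightarrow> complex) \<Rightarrow> bool" where
  "has_fourier_expansion f a \<longleftrightarrow> (\<forall>\<tau>\<in>uhp. (\<lambda>n. a n * nome \<tau> ^ n) sums f \<tau>)"

definition fourier_coeff :: "(complex \<Rightarrow> complex) \<Rightarrow> nat \<Rightarrow> complex" where
  "fourier_coeff f = (THE a. has_fourier_expansion f a)"

text \<open>The last conjunct is holomorphy at the cusp \<open>\<infinity>\<close>. Here and below, functions on the upper
  half plane are total functions whose values outside \<^const>\<open>uhp\<close> are irrelevant.\<close>

definition modular_form :: "int \<Rightarrow> (complex \<Rightarrow> complex) \<Rightarrow> bool" where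
  "modular_form k f \<longleftrightarrow>
     f holomorphic_on uhp \<and>
     (\<forall>A\<in>SL2Z. \<forall>\<tau>\<in>uhp.
        f (moebius A \<tau>) = (of_int (A$2$1) * \<tau> + of_int (A$2$2)) powi k * f \<tau>) \<and>
     (\<exists>a. has_fourier_expansion f a)"

definition E2 :: "complex \<Rightarrow> complex" where
  "E2 \<tau> = 1 - 24 * (\<Sum>\<^sub>\<infinity>(m, r)\<in>{1..} \<times> {1..}. of_nat m * nome \<tau> ^ (m * r))"

text \<open>\<open>F\<close> is the family of coefficients exhibiting \<open>f\<close> as a quasimodular form of weight \<open>k\<close> and
  depth at most \<open>p\<close>. On \<^const>\<open>uhp\<close> the functions \<open>F j\<close> with \<open>j \<le> p\<close> are determined by \<open>f\<close>.\<close>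

definition quasimodular_expansion ::
    "int \<Rightarrow> nat \<Rightarrow> (complex \<Rightarrow> complex) \<Rightarrow> (nat \<Rightarrow> complex \<Rightarrow> complex) \<Rightarrow> bool" where
  "quasimodular_expansion k p f F \<longleftrightarrow>
     (\<forall>j\<le>p. modular_form (k - 2 * int j) (F j)) \<and>
     (\<forall>\<tau>\<in>uhp. f \<tau> = (\<Sum>j\<le>p. F j \<tau> * E2 \<tau> ^ j))"

definition quasimodular_coeffs ::
    "int \<Rightarrow> nat \<Rightarrow> (complex \<Rightarrow> complex) \<Rightarrow> nat \<Rightarrow> complex \<Rightarrow> complex" where
  "quasimodular_coeffs k p f = (SOME F. quasimodular_expansion k p f F)"

text \<open>The \<open>m\<close>-th iterate of the derivation that sends \<^const>\<open>E2\<close> to \<open>12\<close> and annihilates modular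
  forms, on quasimodular forms of weight \<open>k\<close> and depth at most \<open>p\<close>. The binomial coefficient
  vanishes where the subtraction \<open>j - m\<close> truncates.\<close>

definition frak_d_iter ::
    "int \<Rightarrow> nat \<Rightarrow> nat \<Rightarrow> (complex \<Rightarrow> complex) \<Rightarrow> complex \<Rightarrow> complex" where
  "frak_d_iter k p m f \<tau> =
     fact m * 12 ^ m *
       (\<Sum>j\<le>p. of_nat (j choose m) * quasimodular_coeffs k p f j \<tau> * E2 \<tau> ^ (j - m))"


section \<open>Order of vanishing\<close>

text \<open>For a matrix in \<open>SL\<^sub>2(\<int>)\<close> with rows \<open>(a, b)\<close> and \<open>(c, d)\<close>, and \<open>f\<close> quasimodular of weight \<open>k\<close> and
  depth at most \<open>p\<close>,
    \<open>(c\<tau> + d)\<^sup>k f(\<tau>) = (\<Sum>n. a\<^sub>n(\<tau>) exp (2\<pi>\<i>n (a\<tau> + b) / (c\<tau> + d)))\<close>,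
  where \<open>a\<^sub>n\<close> is the following polynomial in \<open>\<tau>\<close>, the linear factor being \<open>- c (c\<tau> + d) / (2\<pi>\<i>)\<close>.
  It does not involve \<open>a\<close> and \<open>b\<close>, and it is unchanged when \<open>(c, d)\<close> is replaced by \<open>(- c, - d)\<close>.\<close>

definition cusp_coeff_poly ::
    "int \<Rightarrow> nat \<Rightarrow> (complex \<Rightarrow> complex) \<Rightarrow> int \<Rightarrow> int \<Rightarrow> nat \<Rightarrow> complex poly" where
  "cusp_coeff_poly k p f c d n =
     (\<Sum>j\<le>p. smult (fourier_coeff (frak_d_iter k p j f) n / fact j)
        ([: - of_int (c * d) / (2 * of_real pi * \<i>), - of_int (c * c) / (2 * of_real pi * \<i>) :] ^ j))"

text \<open>The bottom row \<open>(c, d)\<close> of a matrix in \<open>SL\<^sub>2(\<int>)\<close> such that the given cusp is \<open>- d / c\<close>.\<close>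

fun cusp_row :: "cusp \<Rightarrow> int \<times> int" where
  "cusp_row Infinity = (0, 1)"
| "cusp_row (Rational r) = (snd (quotient_of r), - fst (quotient_of r))"

fun vanishing_order :: "int \<Rightarrow> nat \<Rightarrow> (complex \<Rightarrow> complex) \<Rightarrow> ext_point \<Rightarrow> int" where
  "vanishing_order k p f (Pt z) = zorder f z"
| "vanishing_order k p f (Cusp x) =
     int (LEAST n. cusp_coeff_poly k p f (fst (cusp_row x)) (snd (cusp_row x)) n \<noteq> 0)"


section \<open>Counting zeros\<close>

text \<open>The cusp \<open>- d / c\<close> attached to a matrix with bottom row \<open>(c, d)\<close>, i.e. the preimage of \<open>\<infinity>\<close>
  (in general not the cusp contained in the translate of the fundamental domain).\<close>

definition matrix_cusp :: "int^2^2 \<Rightarrow> cusp" where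
  "matrix_cusp A = (if A$2$1 = 0 then Infinity else Rational (- of_int (A$2$2) / of_int (A$2$1)))"

text \<open>The matrix is determined by \<open>l\<close> up to sign and integral translation from the left, which does
  not affect the sum as quasimodular forms are periodic. For \<open>f \<noteq> 0\<close> only finitely many terms of the
  sum are nonzero.\<close>

definition zero_count :: "int \<Rightarrow> nat \<Rightarrow> cusp \<Rightarrow> (complex \<Rightarrow> complex) \<Rightarrow> real" where
  "zero_count k p l f =
     (let A = (SOME A. A \<in> SL2Z \<and> matrix_cusp A = l)
      in \<Sum>\<^sub>\<infinity>x\<in>ext_action A ` fundamental_domain.
           real_of_int (vanishing_order k p f x) / real (stab_order x))"

definition arc_count :: "(complex \<Rightarrow> complex) \<Rightarrow> real" where
  "arc_count g =
     (\<Sum>z\<in>{z \<in> uhp. g z = 0 \<and> norm z = 1 \<and> - (1/2) \<le> Re z \<and> Re z \<le> 0}. 1 / real (stab_order (Pt z)))"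

definition line_count :: "(complex \<Rightarrow> complex) \<Rightarrow> nat" where
  "line_count g =
     card {z \<in> uhp. g z = 0 \<and> Re z = - (1/2) \<and> norm z > 1} + of_bool (fourier_coeff g 0 = 0)"

end

theory Submission
  imports Defs
begin

text \<open>Put \<open>h(z) = z + k g(z) / g'(z)\<close> with \<open>g' = dg/dz\<close>. This function is equivariant under the modular group, so
  the zeros of \<open>g'\<close> in \<open>\<gamma>F\<close> correspond to the solutions of \<open>h(z) = \<lambda>\<close> in \<open>F\<close>, that is, to the zeros of the
  pencil \<open>k g + (z - \<lambda>) g'\<close>, where \<open>\<lambda> = - d / c\<close>. As \<open>g\<close> has real Fourier coefficients, \<open>h\<close> maps the lines
  \<open>Re z = \<plusminus>1/2\<close> and the unit circle to themselves; hence for \<open>\<bar>\<lambda>\<bar> \<noteq> 1/2, 1\<close> none of the pencils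
  \<open>k g + \<epsilon> (z - \<lambda>) g'\<close> with \<open>0 < \<epsilon> \<le> 1\<close> vanishes on the boundary of \<open>F\<close>, apart from zeros of \<open>g\<close>. Their number
  of zeros is therefore constant in \<open>\<epsilon>\<close>. As \<open>\<epsilon> \<rightarrow> 0\<close> the zeros converge to those of \<open>g\<close>, and each boundary zero
  of \<open>g\<close> sends exactly one of its zeros towards \<open>\<lambda>\<close>, which is counted iff this direction points into \<open>F\<close>.
  (For \<open>\<bar>\<lambda>\<bar> > 1\<close> the point \<open>\<lambda>\<close> is first moved up vertically, so that all zeros on the arc move inwards.) If
  \<open>g\<close> vanishes to order \<open>n > 0\<close> at the cusp, one further zero comes from \<open>\<lambda> + \<i>k / (2\<pi>n\<epsilon>)\<close>, and it lies in the
  strip iff \<open>\<bar>\<lambda>\<bar> < 1/2\<close>. For \<open>\<lambda> = \<infinity>\<close> the same argument applies to \<open>k G + \<epsilon> q dG/dq\<close> in the variable \<open>q\<close>. The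
  number of zeros of \<open>g\<close> is given by the valence formula, which is proved with the same perturbation argument
  from a comparison of \<open>g\<^sup>1\<^sup>2\<close> with \<open>\<Delta>\<^sup>k\<close>.\<close>


section \<open>Counting zeros of holomorphic pencils\<close>

text \<open>Two obstacles shape the argument. A boundary zero of \<open>g\<close> of order at least
  2 is a zero of every member of the pencil, so counts that need a nonvanishing frontier do not
  apply to the pencil itself. A common factor of \<open>G\<close> and its derivative is therefore
  divided out, which leaves a simple zero at each such point; it moves at a speed given by the
  order. Secondly, if \<open>g\<close> vanishes at the cusp, the extra zero comes from infinite
  height, so no single truncation of the strip serves all \<epsilon>. The nome glues the vertical
  sides and turns the cusp into an interior point; this is why the valence formula and the case of
  infinite \<lambda> live on a bounded plane domain whose frontier is the image of one arc. For the
  valence formula the quotient of \<open>g^12\<close> by the power of the discriminant is compared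
  with the value \<open>\<i> * \<epsilon>\<close>: the quotient is real on the arc, so this value is
  never taken there, and modular transformations permute the solutions near an arc zero among the
  tiles that meet there. This symmetry produces the weights 1, 1/2 and 1/3.\<close>

definition zcount :: "(complex \<Rightarrow> complex) \<Rightarrow> complex set \<Rightarrow> int" where
  "zcount f U = (\<Sum>z\<in>{z\<in>U. f z = 0}. zorder f z)"

lemma holomorphic_eventually_nonzero:
  assumes "f holomorphic_on S" "open S" "z \<in> S" "f z \<noteq> 0"
  shows "\<forall>\<^sub>F w in at z. f w \<noteq> 0"
proof -
  have "isCont f z"
    using assms continuous_on_eq_continuous_at holomorphic_on_imp_continuous_on by blast
  then have "\<forall>\<^sub>F w in at z. f w \<noteq> 0"
    using assms(4) by (metis isCont_def tendsto_imp_eventually_ne)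
  then show ?thesis .
qed

lemma finite_zeros_in_compact:
  assumes "compact K" and "f holomorphic_on S" "open S" "K \<subseteq> S"
    and nz: "\<And>z. z \<in> K \<Longrightarrow> f z = 0 \<Longrightarrow> \<forall>\<^sub>F w in at z. f w \<noteq> 0"
  shows "finite {z\<in>K. f z = 0}"
proof (rule ccontr)
  assume inf: "infinite {z\<in>K. f z = 0}"
  then obtain x where x: "x \<in> K" "x islimpt {z\<in>K. f z = 0}"
    using Heine_Borel_imp_Bolzano_Weierstrass[OF assms(1) inf] by blast
  have fr: "\<exists>\<^sub>F w in at x. f w = 0"
    using x(2) unfolding islimpt_conv_frequently_at
    by (rule frequently_elim1) auto
  have "f x = 0"
  proof (rule ccontr)
    assume "f x \<noteq> 0"
    then have "\<forall>\<^sub>F w in at x. f w \<noteq> 0"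
      using holomorphic_eventually_nonzero assms x(1) by blast
    with fr show False by (simp add: frequently_def)
  qed
  then show False using nz[OF x(1)] fr by (simp add: frequently_def)
qed

text \<open>\<open>U\<close> may be disconnected, so \<open>f\<close> could vanish identically on
  one component. The frontier of a component lies in the frontier of \<open>U\<close>, and by
  continuity \<open>f\<close> would then vanish there too.\<close>

lemma nonzero_frontier_eventually_nonzero:
  assumes U: "open U" "bounded U" and V: "open V" "closure U \<subseteq> V" and f: "f holomorphic_on V"
    and fr: "\<And>z. z \<in> frontier U \<Longrightarrow> f z \<noteq> 0" and z: "z \<in> U"
  shows "\<forall>\<^sub>F w in at z. f w \<noteq> 0"
proof -
  define C where "C = connected_component_set U z"
  have C: "C \<in> components U" "z \<in> C" "open C" "connected C" "C \<subseteq> U"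
    using z U by (auto simp: C_def components_def open_connected_component connected_component_subset)
  have "frontier C \<noteq> {}"
    using C(2) U(2) C(5) by (metis bounded_subset empty_iff frontier_eq_empty not_bounded_UNIV)
  then obtain x where x: "x \<in> frontier C" by blast
  then have xU: "x \<in> frontier U" using frontier_of_components_subset[OF C(1)] by blast
  have "\<exists>w\<in>C. f w \<noteq> 0"
  proof (rule ccontr)
    assume "\<not> ?thesis"
    then have 0: "\<And>w. w \<in> C \<Longrightarrow> f w = 0" by blast
    have "closure C \<subseteq> V" using closure_mono[OF C(5)] V by blast
    then have "continuous_on (closure C) f"
      using f holomorphic_on_imp_continuous_on holomorphic_on_subset by blast
    then have "f x = 0"
      using continuous_constant_on_closure[of C f 0 x] 0 x unfolding frontier_def by blast
    then show False using fr xU by blast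
  qed
  then obtain w where w: "w \<in> C" "f w \<noteq> 0" by blast
  have "\<forall>\<^sub>F w in at z. f w \<noteq> 0 \<and> w \<in> C"
  proof (rule non_zero_neighbour_alt)
    show "f holomorphic_on C" using f C(5) V closure_subset[of U] holomorphic_on_subset by blast
  qed (use C w in auto)
  then show ?thesis by (rule eventually_mono) auto
qed

text \<open>A sum over an infinite set is 0 by convention, so \<open>zcount\<close> is meaningful
  only together with a finiteness statement of this kind.\<close>

lemma finite_zeros_nonzero_frontier:
  assumes U: "open U" "bounded U" and V: "open V" "closure U \<subseteq> V" and f: "f holomorphic_on V"
    and fr: "\<And>z. z \<in> frontier U \<Longrightarrow> f z \<noteq> 0"
  shows "finite {z\<in>U. f z = 0}"
proof -
  have "finite {z\<in>closure U. f z = 0}"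
  proof (rule finite_zeros_in_compact[OF _ f V])
    show "compact (closure U)" using U(2) by simp
    fix z assume "z \<in> closure U" "f z = 0"
    then have "z \<in> U" using fr closure_Un_frontier[of U] by blast
    then show "\<forall>\<^sub>F w in at z. f w \<noteq> 0"
      using nonzero_frontier_eventually_nonzero[OF U V f fr] by blast
  qed
  then show ?thesis
    by (rule rev_finite_subset) (use closure_subset in auto)
qed

text \<open>The general Rouche theorem counts zeros with winding numbers in an ambient domain that
  contains only finitely many of them. A slightly larger ball serves: both functions are nonzero on
  the sphere, hence not identically zero on the larger ball, and the winding numbers are 1 inside
  the circle and 0 beyond it.\<close>

lemma rouche_ball:
  assumes f: "f holomorphic_on V" and g: "g holomorphic_on V" and V: "open V" "cball a r \<subseteq> V" and "r > 0"
    and less: "\<And>z. z \<in> sphere a r \<Longrightarrow> norm (g z) < norm (f z)"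
  shows "zcount (\<lambda>z. f z + g z) (ball a r) = zcount f (ball a r)"
proof -
  obtain e where e: "e > 0" "(\<Union>x\<in>cball a r. ball x e) \<subseteq> V"
    using compact_subset_open_imp_ball_epsilon_subset[OF compact_cball V] by blast
  define s where "s = ball a (r + e)"
  have sV: "s \<subseteq> V"
  proof
    fix x assume "x \<in> s"
    then have d: "dist a x < r + e" by (simp add: s_def)
    show "x \<in> V"
    proof (cases "dist a x \<le> r")
      case True then show ?thesis using V by auto
    next
      case False
      \<comment> \<open>The radial projection of \<open>x\<close> to the sphere; its distance from
        \<open>x\<close> is \<open>dist a x - r\<close>, which is less than
        \<open>e\<close>.\<close>
      define y where "y = a + of_real (r / dist a x) * (x - a)"
      have dpos: "dist a x > 0" using False \<open>r > 0\<close> by linarith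
      have day: "dist a y = r" using dpos \<open>r > 0\<close>
        by (simp add: y_def dist_norm norm_mult norm_divide norm_minus_commute)
      have "x - y = of_real (1 - r / dist a x) * (x - a)"
        by (simp add: y_def algebra_simps)
      then have "norm (x - y) = \<bar>1 - r / dist a x\<bar> * norm (x - a)"
        by (metis norm_mult norm_of_real)
      then have "dist y x = \<bar>1 - r / dist a x\<bar> * dist a x"
        by (simp add: dist_norm norm_minus_commute)
      moreover have "\<bar>1 - r / dist a x\<bar> * dist a x = dist a x - r" using dpos False
        by (simp add: field_simps abs_if)
      ultimately have "dist y x < e" using d by simp
      then show ?thesis using e(2) day by force
    qed
  qed
  define s' where "s' = ball a (r + e/2)"
  have s's: "cball a (r + e/2) \<subseteq> s" "s' \<subseteq> s" using e(1) by (auto simp: s_def s'_def)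
  have sph: "a + of_real r \<in> sphere a r" using \<open>r > 0\<close> by (simp add: dist_norm)
  have ss: "sphere a r \<subseteq> s" "sphere a r \<subseteq> s'" using e(1) by (auto simp: s_def s'_def)
  have fin: "finite {p\<in>s'. h p = 0}" if h: "h holomorphic_on V" "\<And>z. z \<in> sphere a r \<Longrightarrow> h z \<noteq> 0" for h
  proof -
    have "finite {z \<in> cball a (r + e/2). h z = 0}"
    proof (rule finite_zeros_in_compact[where S = s])
      fix z assume z: "z \<in> cball a (r + e/2)"
      have "\<forall>\<^sub>F w in at z. h w \<noteq> 0 \<and> w \<in> s"
      proof (rule non_zero_neighbour_alt[of _ _ _ "a + of_real r"])
        show "h holomorphic_on s" using h(1) sV holomorphic_on_subset by blast
      qed (use z s's ss sph h in \<open>auto simp: s_def\<close>)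
      then show "\<forall>\<^sub>F w in at z. h w \<noteq> 0" by (rule eventually_mono) auto
    qed (use h sV holomorphic_on_subset s's in \<open>auto simp: s_def\<close>)
    then show ?thesis by (rule rev_finite_subset) (auto simp: s'_def)
  qed
  have nz1: "f z \<noteq> 0" if "z \<in> sphere a r" for z using less[OF that] by auto
  have nz2: "f z + g z \<noteq> 0" if "z \<in> sphere a r" for z
    using less[OF that] by (metis add_eq_0_iff norm_minus_cancel order_less_irrefl)
  have fg: "(\<lambda>z. f z + g z) holomorphic_on V" using f g by (intro holomorphic_intros)
  have main: "(\<Sum>p\<in>{p\<in>s'. f p + g p = 0}. winding_number (circlepath a r) p * zorder (\<lambda>p. f p + g p) p)
          = (\<Sum>p\<in>{p\<in>s'. f p = 0}. winding_number (circlepath a r) p * zorder f p)"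
  proof (rule Rouche_theorem)
    show "f holomorphic_on s'" "g holomorphic_on s'" using f g sV s's holomorphic_on_subset by blast+
    show "finite {p\<in>s'. f p + g p = 0}" "finite {p\<in>s'. f p = 0}"
      using fin[OF fg nz2] fin[OF f nz1] by auto
    show "path_image (circlepath a r) \<subseteq> s'" using ss \<open>r > 0\<close> by simp
    show "\<forall>z\<in>path_image (circlepath a r). cmod (g z) < cmod (f z)" using less \<open>r > 0\<close> by simp
    show "\<forall>z. z \<notin> s' \<longrightarrow> winding_number (circlepath a r) z = 0"
    proof (intro allI impI)
      fix z assume z: "z \<notin> s'"
      show "winding_number (circlepath a r) z = 0"
        by (rule simply_connected_imp_winding_number_zero[where S = s'])
          (use z ss \<open>r > 0\<close> in \<open>auto simp: s'_def convex_imp_simply_connected\<close>)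
    qed
  qed (auto simp: s'_def)
  have conv: "(\<Sum>p\<in>{p\<in>s'. h p = 0}. winding_number (circlepath a r) p * zorder h p) = of_int (zcount h (ball a r))"
    if h: "h holomorphic_on V" "\<And>z. z \<in> sphere a r \<Longrightarrow> h z \<noteq> 0" for h
  proof -
    have "(\<Sum>p\<in>{p\<in>s'. h p = 0}. winding_number (circlepath a r) p * zorder h p)
        = (\<Sum>p\<in>{p\<in>ball a r. h p = 0}. winding_number (circlepath a r) p * zorder h p)"
    proof (rule sum.mono_neutral_right)
      show "finite {p \<in> s'. h p = 0}" by (rule fin[OF h])
      show "{p \<in> ball a r. h p = 0} \<subseteq> {p \<in> s'. h p = 0}" using e(1) by (auto simp: s'_def)
      show "\<forall>i\<in>{p \<in> s'. h p = 0} - {p \<in> ball a r. h p = 0}. winding_number (circlepath a r) i * zorder h i = 0"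
      proof
        fix i assume i: "i \<in> {p \<in> s'. h p = 0} - {p \<in> ball a r. h p = 0}"
        then have "i \<notin> cball a r" using h(2)[of i] by fastforce
        then have "winding_number (circlepath a r) i = 0"
          by (intro simply_connected_imp_winding_number_zero[where S = "cball a r"])
            (use \<open>r > 0\<close> in \<open>auto simp: convex_imp_simply_connected\<close>)
        then show "winding_number (circlepath a r) i * zorder h i = 0" by simp
      qed
    qed
    also have "\<dots> = (\<Sum>p\<in>{p\<in>ball a r. h p = 0}. of_int (zorder h p))"
      by (rule sum.cong) (auto simp: winding_number_circlepath dist_norm norm_minus_commute)
    finally show ?thesis by (simp add: zcount_def)
  qed
  have "complex_of_int (zcount (\<lambda>z. f z + g z) (ball a r)) = of_int (zcount f (ball a r))"
    using main conv[OF fg nz2] conv[OF f nz1] by simp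
  then show ?thesis by (simp only: of_int_eq_iff)
qed

lemma zcount_single:
  assumes "z \<in> U" "f z = 0" "\<And>w. w \<in> U \<Longrightarrow> w \<noteq> z \<Longrightarrow> f w \<noteq> 0"
  shows "zcount f U = zorder f z"
proof -
  have "{z\<in>U. f z = 0} = {z}" using assms by auto
  then show ?thesis by (simp add: zcount_def)
qed

lemma zcount_empty: "(\<And>w. w \<in> U \<Longrightarrow> f w \<noteq> 0) \<Longrightarrow> zcount f U = 0"
  unfolding zcount_def by (rule sum.neutral) auto

lemma zcount_disjoint_Union:
  assumes "finite I" "\<And>i. i \<in> I \<Longrightarrow> finite {z\<in>B i. f z = 0}" "disjoint_family_on B I"
    "{z\<in>U. f z = 0} = (\<Union>i\<in>I. {z\<in>B i. f z = 0})"
  shows "zcount f U = (\<Sum>i\<in>I. zcount f (B i))"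
  unfolding zcount_def assms(4)
  by (rule sum.UNION_disjoint) (use assms in \<open>auto simp: disjoint_family_on_def\<close>)

lemma disjoint_small_balls:
  fixes Z :: "complex set"
  assumes "finite Z" "open W" "Z \<subseteq> W"
  obtains r where "r > 0" "\<And>z. z \<in> Z \<Longrightarrow> cball z r \<subseteq> W" "disjoint_family_on (\<lambda>z. cball z r) Z"
proof -
  have "\<exists>r>0. (\<forall>z\<in>Z. cball z r \<subseteq> W)"
    using assms(1,3)
  proof (induction Z rule: finite_induct)
    case (insert x F)
    then obtain r where r: "r > 0" "\<forall>z\<in>F. cball z r \<subseteq> W" by auto
    obtain r' where r': "r' > 0" "cball x r' \<subseteq> W"
      using insert.prems assms(2) by (auto simp: open_contains_cball)
    show ?case
    proof (intro exI[of _ "min r r'"] conjI ballI)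
      fix z assume "z \<in> insert x F"
      then show "cball z (min r r') \<subseteq> W"
        using r(2) r'(2) subset_cball[of "min r r'" r z] subset_cball[of "min r r'" r' x] by auto
    qed (use r r' in auto)
  qed (auto intro: exI[of _ 1])
  then obtain r where r: "r > 0" "\<And>z. z \<in> Z \<Longrightarrow> cball z r \<subseteq> W" by auto
  obtain d where d: "d > 0" "\<And>x y. x \<in> Z \<Longrightarrow> y \<in> Z \<Longrightarrow> x \<noteq> y \<Longrightarrow> d \<le> dist x y"
  proof -
    define P where "P = (\<lambda>(x,y). dist x y) ` {(x,y). x \<in> Z \<and> y \<in> Z \<and> x \<noteq> y}"
    have fP: "finite P" unfolding P_def
      by (rule finite_imageI, rule finite_subset[of _ "Z \<times> Z"]) (use assms(1) in auto)
    have pos: "\<And>p. p \<in> P \<Longrightarrow> p > 0" by (auto simp: P_def)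
    show ?thesis
    proof (rule that[of "Min (insert 1 P)"])
      show "0 < Min (insert 1 P)" using fP pos by simp
      show "Min (insert 1 P) \<le> dist x y" if "x \<in> Z" "y \<in> Z" "x \<noteq> y" for x y
        using that fP by (intro Min_le) (auto simp: P_def)
    qed
  qed
  show ?thesis
  proof (rule that[of "min r (d/3)"])
    show "disjoint_family_on (\<lambda>z. cball z (min r (d / 3))) Z"
      unfolding disjoint_family_on_def
    proof (intro ballI impI)
      fix x y assume xy: "x \<in> Z" "y \<in> Z" "x \<noteq> y"
      show "cball x (min r (d / 3)) \<inter> cball y (min r (d / 3)) = {}"
      proof (rule ccontr)
        assume "\<not> ?thesis"
        then obtain w where "dist x w \<le> d/3" "dist y w \<le> d/3" by auto
        then have "dist x y \<le> d/3 + d/3" by (metis dist_commute dist_triangle_le add_mono)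
        with d xy show False by fastforce
      qed
    qed
    show "\<And>z. z \<in> Z \<Longrightarrow> cball z (min r (d / 3)) \<subseteq> W"
      using r(2) by (meson min.cobounded1 order_trans subset_cball)
  qed (use r d in auto)
qed

text \<open>The set \<open>N\<close> shields the zeros on the frontier, where small perturbations may push zeros into \<open>U\<close>.\<close>

lemma zcount_stable:
  assumes U: "open U" "bounded U" and V: "open V" "closure U \<subseteq> V" and f: "f holomorphic_on V"
    and nz: "\<And>z. z \<in> U \<Longrightarrow> f z = 0 \<Longrightarrow> \<forall>\<^sub>F w in at z. f w \<noteq> 0"
    and N: "open N" "\<And>z. z \<in> frontier U \<Longrightarrow> f z = 0 \<Longrightarrow> z \<in> N"
      "\<And>z. z \<in> U \<inter> closure N \<Longrightarrow> f z \<noteq> 0"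
  obtains \<mu> where "\<mu> > 0"
    "\<And>h. h holomorphic_on V \<Longrightarrow> (\<And>z. z \<in> closure U \<Longrightarrow> norm (h z - f z) < \<mu>) \<Longrightarrow>
       finite {z\<in>U - N. h z = 0} \<and> zcount h (U - N) = zcount f U"
proof -
  define Z where "Z = {z\<in>U. f z = 0}"
  have Zeq: "Z = {z\<in>closure U - N. f z = 0}"
    using N(2,3) closure_subset[of N] closure_Un_frontier[of U] by (auto simp: Z_def)
  have "compact (closure U - N)"
    using U(2) N(1) by (simp add: compact_diff)
  then have finZ: "finite Z"
    unfolding Zeq
  proof (rule finite_zeros_in_compact[OF _ f V(1)])
    show "closure U - N \<subseteq> V" using V by auto
    show "\<forall>\<^sub>F w in at z. f w \<noteq> 0" if "z \<in> closure U - N" "f z = 0" for z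
      using nz[of z] that Zeq Z_def by blast
  qed
  have "open (U - closure N)" "Z \<subseteq> U - closure N" using U N(3) by (auto simp: Z_def)
  then obtain r where r: "r > 0" "\<And>z. z \<in> Z \<Longrightarrow> cball z r \<subseteq> U - closure N" "disjoint_family_on (\<lambda>z. cball z r) Z"
    using disjoint_small_balls[OF finZ] by metis
  \<comment> \<open>On this compact remainder \<open>f\<close> has no zeros and is bounded below by
    \<mu>. A function closer to \<open>f\<close> than \<mu> is nonzero there as well, so all its
    zeros outside \<open>N\<close> lie in the small balls, where Rouche applies.\<close>
  define K where "K = closure U - N - (\<Union>z\<in>Z. ball z r)"
  have "compact K" unfolding K_def
    using U(2) N(1) by (intro compact_diff) auto
  have Kf: "f z \<noteq> 0" if "z \<in> K" for z
    using that r(1) Zeq unfolding K_def by force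
  have KV: "K \<subseteq> V" using V K_def by auto
  obtain \<mu> where \<mu>: "\<mu> > 0" "\<And>z. z \<in> K \<Longrightarrow> \<mu> \<le> norm (f z)"
  proof (cases "K = {}")
    case False
    have "continuous_on K (\<lambda>z. norm (f z))"
      using f KV holomorphic_on_imp_continuous_on holomorphic_on_subset by (intro continuous_intros) blast
    then obtain x where "x \<in> K" "\<And>z. z \<in> K \<Longrightarrow> norm (f x) \<le> norm (f z)"
      using continuous_attains_inf[OF \<open>compact K\<close> False] by blast
    then show ?thesis using Kf[of x] that[of "norm (f x)"] by auto
  qed (use that[of 1] in auto)
  show ?thesis
  proof (rule that[OF \<mu>(1)])
    fix h assume h: "h holomorphic_on V" and close: "\<And>z. z \<in> closure U \<Longrightarrow> norm (h z - f z) < \<mu>"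
    have hK: "h z \<noteq> 0" if "z \<in> K" for z
      using close[of z] \<mu>(2)[OF that] that by (auto simp: K_def)
    have UcU: "U \<subseteq> closure U" by (rule closure_subset)
    have sphK: "sphere z r \<subseteq> K" if "z \<in> Z" for z
    proof
      fix x assume x: "x \<in> sphere z r"
      then have "x \<in> cball z r" by simp
      then have 1: "x \<in> U - closure N" using r(2)[OF that] by auto
      have "x \<notin> ball z' r" if "z' \<in> Z" for z'
      proof (cases "z' = z")
        case False
        then have "cball z r \<inter> cball z' r = {}"
          using r(3) \<open>z \<in> Z\<close> that unfolding disjoint_family_on_def by blast
        then show ?thesis using \<open>x \<in> cball z r\<close> ball_subset_cball[of z' r] by blast
      qed (use x in auto)
      then show "x \<in> K" using 1 UcU closure_subset[of N] by (auto simp: K_def)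
    qed
    have bU: "ball z r \<subseteq> U - N" if "z \<in> Z" for z
      using r(2)[OF that] closure_subset[of N] ball_subset_cball[of z r] by blast
    have eq: "{z\<in>U - N. h z = 0} = (\<Union>i\<in>Z. {z\<in>ball i r. h z = 0})"
      using bU hK UcU unfolding K_def by blast
    have Rou: "zcount h (ball z r) = zcount f (ball z r)" if "z \<in> Z" for z
    proof -
      have "zcount (\<lambda>w. f w + (h w - f w)) (ball z r) = zcount f (ball z r)"
      proof (rule rouche_ball[where V = V])
        show "cball z r \<subseteq> V" using r(2)[OF that] V UcU by blast
        show "norm (h w - f w) < norm (f w)" if "w \<in> sphere z r" for w
          using that sphK[OF \<open>z \<in> Z\<close>] \<mu>(2)[of w] close[of w] by (force simp: K_def)
      qed (use f h V r in \<open>auto intro!: holomorphic_intros\<close>)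
      then show ?thesis by simp
    qed
    have nzU: "\<forall>\<^sub>F w in at z. f w \<noteq> 0" if "z \<in> U" for z
      using nz[OF that] holomorphic_eventually_nonzero[OF f V(1), of z] that V UcU by blast
    have finb: "finite {w\<in>ball z r. h w = 0}" if "z \<in> Z" for z
    proof (rule finite_zeros_nonzero_frontier[OF open_ball bounded_ball V(1)])
      show "closure (ball z r) \<subseteq> V" using r(1) r(2)[OF that] V UcU by auto
      show "h w \<noteq> 0" if "w \<in> frontier (ball z r)" for w
        using that sphK[OF \<open>z \<in> Z\<close>] hK r(1) by auto
    qed (rule h)
    have disj: "disjoint_family_on (\<lambda>z. ball z r) Z"
      unfolding disjoint_family_on_def
    proof (intro ballI impI)
      fix x y assume "x \<in> Z" "y \<in> Z" "x \<noteq> y"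
      then have "cball x r \<inter> cball y r = {}" using r(3) unfolding disjoint_family_on_def by blast
      then show "ball x r \<inter> ball y r = {}" using ball_subset_cball[of x r] ball_subset_cball[of y r] by blast
    qed
    have "zcount h (U - N) = (\<Sum>z\<in>Z. zcount h (ball z r))"
      by (rule zcount_disjoint_Union[OF finZ finb disj eq])
    also have "\<dots> = (\<Sum>z\<in>Z. zorder f z)"
    proof (rule sum.cong[OF refl])
      fix z assume z: "z \<in> Z"
      have "zcount f (ball z r) = zorder f z"
      proof (rule zcount_single)
        fix w assume w: "w \<in> ball z r" "w \<noteq> z"
        show "f w \<noteq> 0"
        proof
          assume "f w = 0"
          then have "w \<in> Z" using bU[OF z] w by (auto simp: Z_def)
          then show False using r(3) z w r(1) unfolding disjoint_family_on_def
            by (metis centre_in_cball disjoint_iff less_imp_le mem_ball mem_cball)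
        qed
      qed (use z r in \<open>auto simp: Z_def\<close>)
      then show "zcount h (ball z r) = zorder f z" using Rou[OF z] by simp
    qed
    also have "\<dots> = zcount f U" by (simp add: zcount_def Z_def)
    finally show "finite {z\<in>U - N. h z = 0} \<and> zcount h (U - N) = zcount f U"
      unfolding eq using finb finZ by auto
  qed
qed

text \<open>By uniform continuity nearby members of the family are uniformly close, so
  \<open>zcount_stable\<close> with empty \<open>N\<close> makes the count locally constant on a
  connected interval.\<close>

theorem zcount_homotopy:
  fixes f :: "real \<Rightarrow> complex \<Rightarrow> complex"
  assumes U: "open U" "bounded U" and V: "open V" "closure U \<subseteq> V"
    and f: "\<And>t. t \<in> {0..1} \<Longrightarrow> f t holomorphic_on V"
    and cont: "continuous_on ({0..1} \<times> closure U) (\<lambda>(t,z). f t z)"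
    and fr: "\<And>t z. t \<in> {0..1} \<Longrightarrow> z \<in> frontier U \<Longrightarrow> f t z \<noteq> 0"
  shows "zcount (f 0) U = zcount (f 1) U"
proof (rule connected_local_const[where A = "{0..1::real}" and f = "\<lambda>t. zcount (f t) U"])
  show "\<forall>a\<in>{0..1}. \<forall>\<^sub>F b in at a within {0..1}. zcount (f a) U = zcount (f b) U"
  proof
    fix a :: real assume a: "a \<in> {0..1}"
    have nz: "\<forall>\<^sub>F w in at z. f a w \<noteq> 0" if "z \<in> U" for z
      using nonzero_frontier_eventually_nonzero[OF U V f[OF a] fr[OF a] that] .
    obtain \<mu> where \<mu>: "\<mu> > 0"
      "\<And>h. h holomorphic_on V \<Longrightarrow> (\<And>z. z \<in> closure U \<Longrightarrow> norm (h z - f a z) < \<mu>) \<Longrightarrow>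
        finite {z\<in>U - {}. h z = 0} \<and> zcount h (U - {}) = zcount (f a) U"
      using zcount_stable[OF U V f[OF a], of "{}"] nz fr[OF a] by auto
    have "compact ({0..1::real} \<times> closure U)" using U(2) by (intro compact_Times) auto
    then have "uniformly_continuous_on ({0..1} \<times> closure U) (\<lambda>(t,z). f t z)"
      using cont compact_uniformly_continuous by blast
    then obtain d where d: "d > 0" "\<And>x y. x \<in> {0..1} \<times> closure U \<Longrightarrow> y \<in> {0..1} \<times> closure U \<Longrightarrow> dist y x < d \<Longrightarrow>
      dist ((\<lambda>(t,z). f t z) y) ((\<lambda>(t,z). f t z) x) < \<mu>"
      using \<mu>(1) unfolding uniformly_continuous_on_def by metis
    have "zcount (f b) U = zcount (f a) U" if b: "b \<in> {0..1}" "dist b a < d" for b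
    proof -
      have "norm (f b z - f a z) < \<mu>" if "z \<in> closure U" for z
        using d(2)[of "(a,z)" "(b,z)"] a b that by (simp add: dist_norm dist_Pair_Pair)
      then show ?thesis using \<mu>(2)[OF f[OF b(1)]] by simp
    qed
    then show "\<forall>\<^sub>F b in at a within {0..1}. zcount (f a) U = zcount (f b) U"
      unfolding eventually_at using d(1) by (intro exI[of _ d]) auto
  qed
qed auto


section \<open>Motion of zeros under small perturbations\<close>

lemma zcount_Un:
  assumes "finite {z\<in>W1. f z = 0}" "finite {z\<in>W2. f z = 0}" "W1 \<inter> W2 = {}"
  shows "zcount f (W1 \<union> W2) = zcount f W1 + zcount f W2"
proof -
  have "{z\<in>W1 \<union> W2. f z = 0} = {z\<in>W1. f z = 0} \<union> {z\<in>W2. f z = 0}" by auto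
  then show ?thesis
    unfolding zcount_def using assms by (simp, intro sum.union_disjoint) auto
qed

lemma zorder_eq_1:
  assumes "f analytic_on {z}" "f z = 0" "deriv f z \<noteq> 0"
  shows "zorder f z = 1"
  by (rule zorder_zero_eqI') (use assms in auto)

lemma zorder_mult_nonzero:
  assumes "open S" "z \<in> S" "Q holomorphic_on S" "f holomorphic_on S" "Q z \<noteq> 0" "\<forall>\<^sub>F w in at z. f w \<noteq> 0"
  shows "zorder (\<lambda>w. Q w * f w) z = zorder f z"
proof -
  have an: "Q analytic_on {z}" "f analytic_on {z}"
    using assms analytic_at by blast+
  have "\<forall>\<^sub>F w in at z. Q w * f w \<noteq> 0"
    using holomorphic_eventually_nonzero[OF assms(3,1,2,5)] assms(6) by eventually_elim auto
  then show ?thesis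
    using zorder_times_analytic[OF an] zorder_eq_0I[OF an(1) assms(5)] by simp
qed

lemma zorder_cong_on:
  assumes "open S" "z \<in> S" "\<And>w. w \<in> S \<Longrightarrow> f w = h w"
  shows "zorder f z = zorder h z"
proof (rule zorder_cong)
  show "\<forall>\<^sub>F w in at z. f w = h w"
    using eventually_at_in_open'[OF assms(1,2)] by eventually_elim (use assms(3) in auto)
qed simp

text \<open>Perturbing \<open>A\<close> to \<open>A + \<epsilon> B\<close>: zeros of \<open>A\<close> inside \<open>U\<close> persist, those on the frontier may
  enter \<open>U\<close>.\<close>

lemma zcount_perturb:
  assumes U: "open U" "bounded U" and V: "open V" "closure U \<subseteq> V"
    and AB: "A holomorphic_on V" "B holomorphic_on V"
    and nz: "\<And>z. z \<in> U \<Longrightarrow> A z = 0 \<Longrightarrow> \<forall>\<^sub>F w in at z. A w \<noteq> 0"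
    and N: "open N" "\<And>z. z \<in> frontier U \<Longrightarrow> A z = 0 \<Longrightarrow> z \<in> N"
      "\<And>z. z \<in> U \<inter> closure N \<Longrightarrow> A z \<noteq> 0"
    and "e0 > 0" and fr: "\<And>\<epsilon> z. 0 < \<epsilon> \<Longrightarrow> \<epsilon> \<le> e0 \<Longrightarrow> z \<in> frontier U \<Longrightarrow> A z + of_real \<epsilon> * B z \<noteq> 0"
  shows "\<forall>\<^sub>F \<epsilon> in at_right 0. zcount (\<lambda>z. A z + of_real \<epsilon> * B z) U =
     zcount A U + zcount (\<lambda>z. A z + of_real \<epsilon> * B z) (U \<inter> N)"
proof -
  obtain \<mu> where \<mu>: "\<mu> > 0"
    "\<And>h. h holomorphic_on V \<Longrightarrow> (\<And>z. z \<in> closure U \<Longrightarrow> norm (h z - A z) < \<mu>) \<Longrightarrow>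
       finite {z\<in>U - N. h z = 0} \<and> zcount h (U - N) = zcount A U"
    using zcount_stable[OF U V AB(1) nz N] by blast
  have "bounded (B ` closure U)"
    using AB(2) V U(2) holomorphic_on_imp_continuous_on holomorphic_on_subset
    by (intro compact_imp_bounded compact_continuous_image) (blast, simp)
  then obtain M where M: "M > 0" "\<And>z. z \<in> closure U \<Longrightarrow> norm (B z) \<le> M"
    unfolding bounded_pos by auto
  have main: "zcount (\<lambda>z. A z + of_real \<epsilon> * B z) U = zcount A U + zcount (\<lambda>z. A z + of_real \<epsilon> * B z) (U \<inter> N)"
    if e: "0 < \<epsilon>" "\<epsilon> < min e0 (\<mu> / M)" for \<epsilon>
  proof -
    let ?f = "\<lambda>z. A z + of_real \<epsilon> * B z"
    have holo: "?f holomorphic_on V" using AB by (intro holomorphic_intros)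
    have "norm (?f z - A z) < \<mu>" if "z \<in> closure U" for z
    proof -
      have "norm (?f z - A z) = \<epsilon> * norm (B z)" using e by (simp add: norm_mult)
      also have "\<dots> \<le> \<epsilon> * M" using M(2)[OF that] e by simp
      also have "\<dots> < \<mu>" using e M(1) by (simp add: field_simps)
      finally show ?thesis .
    qed
    then have 1: "zcount ?f (U - N) = zcount A U" using \<mu>(2)[OF holo] by blast
    have fin: "finite {z\<in>U. ?f z = 0}"
      by (rule finite_zeros_nonzero_frontier[OF U V holo]) (use fr e in auto)
    have "zcount ?f ((U - N) \<union> (U \<inter> N)) = zcount ?f (U - N) + zcount ?f (U \<inter> N)"
      by (rule zcount_Un) (use fin in \<open>auto intro: rev_finite_subset\<close>)
    moreover have "(U - N) \<union> (U \<inter> N) = U" by auto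
    ultimately show ?thesis using 1 by simp
  qed
  show ?thesis
    unfolding eventually_at_right_field
    by (rule exI[of _ "min e0 (\<mu> / M)"]) (use main \<open>e0 > 0\<close> \<mu>(1) M(1) in auto)
qed

text \<open>Rouche compares \<open>F - c\<close> with \<open>F\<close> on a small circle. Since
  \<open>deriv F\<close> has no zeros in the punctured ball, every solution of
  \<open>F z = c\<close> with \<open>c \<noteq> 0\<close> is simple, which turns the count with
  multiplicity into a cardinality.\<close>

lemma local_preimages:
  assumes F: "F holomorphic_on S" "open S" "z0 \<in> S" "F z0 = 0" "\<forall>\<^sub>F w in at z0. F w \<noteq> 0"
  obtains r0 where "r0 > 0" "ball z0 r0 \<subseteq> S"
    "\<And>z. z \<in> ball z0 r0 \<Longrightarrow> z \<noteq> z0 \<Longrightarrow> F z \<noteq> 0 \<and> deriv F z \<noteq> 0"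
    "\<And>r. 0 < r \<Longrightarrow> r < r0 \<Longrightarrow> \<exists>\<delta>>0. \<forall>c. c \<noteq> 0 \<longrightarrow> norm c < \<delta> \<longrightarrow>
        finite {z\<in>ball z0 r. F z = c} \<and> int (card {z\<in>ball z0 r. F z = c}) = zorder F z0"
proof -
  obtain r1 where r1: "r1 > 0" "ball z0 r1 \<subseteq> S" using F openE by blast
  obtain r2 where r2: "r2 > 0" "\<And>w. w \<noteq> z0 \<Longrightarrow> dist w z0 < r2 \<Longrightarrow> F w \<noteq> 0"
    using F(5) unfolding eventually_at by auto
  define r3 where "r3 = min r1 r2"
  have r3: "r3 > 0" "ball z0 r3 \<subseteq> S" "\<And>w. w \<noteq> z0 \<Longrightarrow> w \<in> ball z0 r3 \<Longrightarrow> F w \<noteq> 0"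
    using r1 r2 by (auto simp: r3_def dist_commute)
  have Fb: "F holomorphic_on ball z0 r3" using F r3 holomorphic_on_subset by blast
  have "\<exists>w\<in>ball z0 r3. deriv F w \<noteq> 0"
  proof (rule ccontr)
    assume "\<not> ?thesis"
    then have 0: "deriv F w = 0" if "w \<in> ball z0 r3" for w using that by blast
    have "F constant_on ball z0 r3"
    proof (rule has_field_derivative_0_imp_constant_on)
      show "(F has_field_derivative 0) (at w)" if "w \<in> ball z0 r3" for w
        using holomorphic_derivI[OF Fb open_ball that] 0[OF that] by simp
    qed auto
    then obtain c where c: "\<And>w. w \<in> ball z0 r3 \<Longrightarrow> F w = c" unfolding constant_on_def by blast
    have "z0 + of_real (r3/2) \<in> ball z0 r3" using r3(1) by (simp add: dist_norm)
    then show False using c[of z0] c[of "z0 + of_real (r3/2)"] r3 F(4) r3(3)[of "z0 + of_real (r3/2)"] by auto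
  qed
  then obtain w where w: "w \<in> ball z0 r3" "deriv F w \<noteq> 0" by blast
  have "\<forall>\<^sub>F w in at z0. deriv F w \<noteq> 0 \<and> w \<in> ball z0 r3"
    by (rule non_zero_neighbour_alt[where \<beta> = w]) (use Fb r3 w in \<open>auto intro!: holomorphic_deriv\<close>)
  then obtain r4 where r4: "r4 > 0" "\<And>w. w \<noteq> z0 \<Longrightarrow> dist w z0 < r4 \<Longrightarrow> deriv F w \<noteq> 0"
    unfolding eventually_at by auto
  define r0 where "r0 = min r3 r4"
  have r0: "r0 > 0" "r0 \<le> r3" "\<And>z. z \<in> ball z0 r0 \<Longrightarrow> z \<noteq> z0 \<Longrightarrow> F z \<noteq> 0 \<and> deriv F z \<noteq> 0"
    using r3 r4 by (auto simp: r0_def dist_commute)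
  show ?thesis
  proof (rule that[OF r0(1)])
    fix r :: real assume r: "0 < r" "r < r0"
    have sub: "cball z0 r \<subseteq> ball z0 r0" using r by auto
    have ssub: "sphere z0 r \<subseteq> ball z0 r0" using r by auto
    have "continuous_on (sphere z0 r) (\<lambda>z. norm (F z))"
      using Fb ssub r0(2) holomorphic_on_imp_continuous_on holomorphic_on_subset
      by (intro continuous_intros) (meson order_trans subset_ball)
    moreover have "sphere z0 r \<noteq> {}" using r by simp
    ultimately obtain x where x: "x \<in> sphere z0 r" "\<And>z. z \<in> sphere z0 r \<Longrightarrow> norm (F x) \<le> norm (F z)"
      using continuous_attains_inf[OF compact_sphere] by blast
    have "F x \<noteq> 0" using r0(3)[of x] x(1) ssub r(1) by auto
    show "\<exists>\<delta>>0. \<forall>c. c \<noteq> 0 \<longrightarrow> norm c < \<delta> \<longrightarrow>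
        finite {z\<in>ball z0 r. F z = c} \<and> int (card {z\<in>ball z0 r. F z = c}) = zorder F z0"
    proof (intro exI[of _ "norm (F x)"] conjI allI impI)
      fix c :: complex assume c: "c \<noteq> 0" "norm c < norm (F x)"
      have Fc: "(\<lambda>z. F z + - c) holomorphic_on ball z0 r3" using Fb by (intro holomorphic_intros)
      have cb: "cball z0 r \<subseteq> ball z0 r3" using sub r0(2) by auto
      have less: "norm (- c) < norm (F z)" if "z \<in> sphere z0 r" for z using x(2)[OF that] c by simp
      have rou: "zcount (\<lambda>z. F z + - c) (ball z0 r) = zcount F (ball z0 r)"
        by (rule rouche_ball[OF Fb _ open_ball cb r(1)]) (use less in auto)
      have "zcount F (ball z0 r) = zorder F z0"
        by (rule zcount_single) (use r r0 F in auto)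
      moreover have fin: "finite {z\<in>ball z0 r. F z + - c = 0}"
      proof (rule finite_zeros_nonzero_frontier[OF open_ball bounded_ball open_ball _ Fc])
        show "closure (ball z0 r) \<subseteq> ball z0 r3" using cb r by simp
        show "F z + - c \<noteq> 0" if "z \<in> frontier (ball z0 r)" for z
          using less[of z] that r by auto
      qed
      have eq: "{z\<in>ball z0 r. F z + - c = 0} = {z\<in>ball z0 r. F z = c}" by auto
      have "zcount (\<lambda>z. F z + - c) (ball z0 r) = (\<Sum>z\<in>{z\<in>ball z0 r. F z = c}. 1)"
        unfolding zcount_def eq
      proof (rule sum.cong[OF refl])
        fix z assume z: "z \<in> {z\<in>ball z0 r. F z = c}"
        then have "z \<in> cball z0 r" by auto
        then have "z \<in> ball z0 r3" "z \<in> ball z0 r0" using cb sub by blast+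
        moreover have "z \<noteq> z0" using z c F(4) by auto
        ultimately have zz: "z \<in> ball z0 r3" "z \<noteq> z0" "z \<in> ball z0 r0" by blast+
        have "(F has_field_derivative deriv F z) (at z)"
          using holomorphic_derivI[OF Fb open_ball zz(1)] .
        then have "deriv (\<lambda>z. F z + - c) z = deriv F z"
          by (intro DERIV_imp_deriv) (auto intro!: derivative_eq_intros)
        then show "zorder (\<lambda>z. F z + - c) z = 1"
          using z zz r0(3)[of z] Fc
          by (intro zorder_eq_1) (auto simp: analytic_at intro!: exI[of _ "ball z0 r3"])
      qed
      ultimately show "int (card {z\<in>ball z0 r. F z = c}) = zorder F z0" using rou by simp
      show "finite {z\<in>ball z0 r. F z = c}" using fin eq by simp
    qed (use \<open>F x \<noteq> 0\<close> in auto)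
  next
    show "ball z0 r0 \<subseteq> S" using r3(2) r0(2) by auto
  qed (use r0 in auto)
qed

text \<open>\<open>A - c B\<close> is the product of the nonvanishing \<open>B\<close> and
  \<open>A / B - c\<close>, and the zeros of the second factor are simple by the assumption on the
  derivative of the quotient.\<close>

lemma zcount_quotient:
  assumes S: "open S" and AB: "A holomorphic_on S" "B holomorphic_on S" "\<And>z. z \<in> S \<Longrightarrow> B z \<noteq> 0"
    and W: "W \<subseteq> S" "\<And>z. z \<in> W \<Longrightarrow> A z / B z = c \<Longrightarrow> deriv (\<lambda>z. A z / B z) z \<noteq> 0"
  shows "zcount (\<lambda>z. A z - c * B z) W = int (card {z\<in>W. A z / B z = c})"
proof -
  have eq: "{z\<in>W. A z - c * B z = 0} = {z\<in>W. A z / B z = c}"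
    using AB(3) W(1) by (auto simp: field_simps)
  have "zcount (\<lambda>z. A z - c * B z) W = (\<Sum>z\<in>{z\<in>W. A z / B z = c}. 1)"
    unfolding zcount_def eq
  proof (rule sum.cong[OF refl])
    fix z assume z: "z \<in> {z\<in>W. A z / B z = c}"
    then have zS: "z \<in> S" using W by auto
    have q: "(\<lambda>z. A z / B z) holomorphic_on S" using AB by (intro holomorphic_intros) auto
    have "((\<lambda>w. B w * (A w / B w - c)) has_field_derivative
        deriv B z * (A z / B z - c) + B z * (deriv (\<lambda>z. A z / B z) z - 0)) (at z)"
      by (rule DERIV_mult'[THEN DERIV_cong] DERIV_diff DERIV_const holomorphic_derivI[OF AB(2) S zS] holomorphic_derivI[OF q S zS])+
        simp
    then have d: "deriv (\<lambda>w. B w * (A w / B w - c)) z = B z * deriv (\<lambda>z. A z / B z) z"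
      using z by (simp add: DERIV_imp_deriv)
    have "zorder (\<lambda>w. A w - c * B w) z = zorder (\<lambda>w. B w * (A w / B w - c)) z"
      by (rule zorder_cong_on[OF S zS]) (use AB(3) in \<open>auto simp: field_simps\<close>)
    also have "\<dots> = 1"
    proof (rule zorder_eq_1)
      have "(\<lambda>w. B w * (A w / B w - c)) holomorphic_on S"
        using AB q by (intro holomorphic_intros) auto
      then show "(\<lambda>w. B w * (A w / B w - c)) analytic_on {z}"
        using S zS analytic_at by blast
    qed (use z d AB(3)[OF zS] W in auto)
    finally show "zorder (\<lambda>w. A w - c * B w) z = 1" .
  qed
  then show ?thesis by simp
qed

text \<open>To first order \<open>F z = - \<epsilon>\<close> reads
  \<open>(z - z0) / u0 = \<epsilon>\<close>, so \<open>u0\<close> is the velocity of the moving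
  solution. The proof bounds the error of this linearization.\<close>

lemma simple_zero_moves:
  assumes F: "F holomorphic_on S" "open S" "z0 \<in> S" "F z0 = 0" and u0: "u0 \<noteq> 0" "deriv F z0 = - 1 / u0"
    and "\<eta> > 0"
  obtains r0 where "r0 > 0" "ball z0 r0 \<subseteq> S" "\<And>z. z \<in> ball z0 r0 \<Longrightarrow> deriv F z \<noteq> 0"
    "\<And>z. z \<in> ball z0 r0 \<Longrightarrow> z \<noteq> z0 \<Longrightarrow> F z \<noteq> 0"
    "\<And>r. 0 < r \<Longrightarrow> r < r0 \<Longrightarrow> \<forall>\<^sub>F \<epsilon> in at_right 0.
        \<exists>u. norm (u - u0) < \<eta> \<and> {z\<in>ball z0 r. F z = - of_real \<epsilon>} = {z0 + of_real \<epsilon> * u}"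
proof -
  have d: "(F has_field_derivative - 1 / u0) (at z0)"
    using holomorphic_derivI[OF F(1-3)] u0(2) by simp
  have nz: "\<forall>\<^sub>F w in at z0. F w \<noteq> 0"
  proof -
    have "((\<lambda>w. (F w - F z0) / (w - z0)) \<longlongrightarrow> - 1 / u0) (at z0)"
      using d by (simp add: has_field_derivative_iff)
    then have "\<forall>\<^sub>F w in at z0. (F w - F z0) / (w - z0) \<noteq> 0"
      by (rule tendsto_imp_eventually_ne) (use u0 in auto)
    then show ?thesis by eventually_elim (use F(4) in auto)
  qed
  obtain r1 where r1: "r1 > 0" "ball z0 r1 \<subseteq> S"
    "\<And>z. z \<in> ball z0 r1 \<Longrightarrow> z \<noteq> z0 \<Longrightarrow> F z \<noteq> 0 \<and> deriv F z \<noteq> 0"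
    "\<And>r. 0 < r \<Longrightarrow> r < r1 \<Longrightarrow> \<exists>\<delta>>0. \<forall>c. c \<noteq> 0 \<longrightarrow> norm c < \<delta> \<longrightarrow>
        finite {z\<in>ball z0 r. F z = c} \<and> int (card {z\<in>ball z0 r. F z = c}) = zorder F z0"
    using local_preimages[OF F nz] by blast
  have ord: "zorder F z0 = 1"
    using F u0 by (intro zorder_eq_1) (auto simp: analytic_at)
  \<comment> \<open>The first bound makes the linearization error at most half of
    \<open>norm u\<close>, hence \<open>norm u \<le> 2 * norm u0\<close>. Inserted again, this
    bounds the error by \<open>2 * \<kappa> * (norm u0)^2\<close>, which by the second bound is at
    most half of \<eta>.\<close>
  define \<kappa> where "\<kappa> = min (1 / (2 * norm u0)) (\<eta> / (4 * (norm u0)\<^sup>2))"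
  have \<kappa>: "\<kappa> > 0" "\<kappa> * norm u0 \<le> 1/2" "2 * \<kappa> * (norm u0)\<^sup>2 < \<eta>"
  proof -
    show "\<kappa> > 0" using u0 \<open>\<eta> > 0\<close> by (simp add: \<kappa>_def)
    have "\<kappa> \<le> 1 / (2 * norm u0)" "\<kappa> \<le> \<eta> / (4 * (norm u0)\<^sup>2)" by (auto simp: \<kappa>_def)
    then show "\<kappa> * norm u0 \<le> 1/2" using u0 by (simp add: field_simps)
    have "\<kappa> * (4 * (norm u0)\<^sup>2) \<le> \<eta>"
      using \<open>\<kappa> \<le> \<eta> / (4 * (norm u0)\<^sup>2)\<close> u0 by (simp add: pos_le_divide_eq)
    then show "2 * \<kappa> * (norm u0)\<^sup>2 < \<eta>" using \<open>\<eta> > 0\<close> by simp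
  qed
  obtain r2 where r2: "r2 > 0" "\<And>z. norm (z - z0) < r2 \<Longrightarrow> norm (F z - F z0 - (- 1 / u0) * (z - z0)) \<le> \<kappa> * norm (z - z0)"
    using d \<kappa>(1) unfolding has_field_derivative_def has_derivative_at_alt by metis
  show ?thesis
  proof (rule that[of "min r1 r2"])
    fix r assume r: "0 < r" "r < min r1 r2"
    then obtain \<delta> where \<delta>: "\<delta> > 0" "\<And>c. c \<noteq> 0 \<Longrightarrow> norm c < \<delta> \<Longrightarrow>
        int (card {z\<in>ball z0 r. F z = c}) = zorder F z0"
      using r1(4)[of r] by (metis min_less_iff_conj)
    have "\<exists>u. norm (u - u0) < \<eta> \<and> {z\<in>ball z0 r. F z = - of_real \<epsilon>} = {z0 + of_real \<epsilon> * u}"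
      if e: "0 < \<epsilon>" "\<epsilon> < \<delta>" for \<epsilon>
    proof -
      have "card {z\<in>ball z0 r. F z = - of_real \<epsilon>} = 1"
        using \<delta>(2)[of "- of_real \<epsilon>"] e ord by simp
      then obtain z where z: "{z\<in>ball z0 r. F z = - of_real \<epsilon>} = {z}"
        using card_1_singletonE by blast
      then have zz: "z \<in> ball z0 r" "F z = - of_real \<epsilon>" by auto
      define u where "u = (z - z0) / of_real \<epsilon>"
      have zu: "z = z0 + of_real \<epsilon> * u" "z - z0 = of_real \<epsilon> * u" using e by (auto simp: u_def)
      have "norm (z - z0) < r2" using zz(1) r by (simp add: dist_norm norm_minus_commute)
      then have "norm (- of_real \<epsilon> + of_real \<epsilon> * u / u0) \<le> \<kappa> * norm (of_real \<epsilon> * u)"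
        using r2(2)[of z] zz(2) F(4) zu(2) by simp
      moreover have "- of_real \<epsilon> + of_real \<epsilon> * u / u0 = of_real \<epsilon> * ((u - u0) / u0)"
        using u0 by (simp add: field_simps)
      ultimately have "\<epsilon> * (norm (u - u0) / norm u0) \<le> \<epsilon> * (\<kappa> * norm u)"
        using e by (simp add: norm_mult norm_divide mult_ac)
      then have "norm (u - u0) / norm u0 \<le> \<kappa> * norm u" using e(1) mult_le_cancel_left_pos by blast
      then have 1: "norm (u - u0) \<le> \<kappa> * norm u0 * norm u" using u0 by (simp add: field_simps)
      also have "\<dots> \<le> 1/2 * norm u" using \<kappa>(2) by (intro mult_right_mono) auto
      finally have "norm u \<le> 2 * norm u0" using norm_triangle_sub[of u u0] by simp
      then have "\<kappa> * norm u0 * norm u \<le> \<kappa> * norm u0 * (2 * norm u0)"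
        using \<kappa>(1) by (intro mult_left_mono) auto
      with 1 have "norm (u - u0) \<le> 2 * \<kappa> * (norm u0)\<^sup>2" by (simp add: power2_eq_square mult_ac)
      then show ?thesis using z zu \<kappa>(3) by (intro exI[of _ u]) auto
    qed
    then show "\<forall>\<^sub>F \<epsilon> in at_right 0. \<exists>u. norm (u - u0) < \<eta> \<and> {z\<in>ball z0 r. F z = - of_real \<epsilon>} = {z0 + of_real \<epsilon> * u}"
      unfolding eventually_at_right_field using \<delta>(1) by blast
  next
    show "deriv F z \<noteq> 0" if "z \<in> ball z0 (min r1 r2)" for z
      using r1(3)[of z] u0 that by (cases "z = z0") auto
  qed (use r1 r2 in auto)
qed


section \<open>Pencils of a function and its derivative\<close>

lemma factor_zero_global:
  assumes f: "f holomorphic_on V" "open V" "a \<in> V" and a: "f a = 0" "\<forall>\<^sub>F w in at a. f w \<noteq> 0"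
  obtains m u where "m \<ge> 1" "int m = zorder f a" "u holomorphic_on V" "u a \<noteq> 0" "\<And>z. f z = (z - a) ^ m * u z"
proof -
  obtain r where r: "r > 0" "ball a r \<subseteq> V" using f openE by blast
  have "\<exists>w\<in>ball a r. f w \<noteq> 0"
  proof -
    have "\<forall>\<^sub>F w in at a. f w \<noteq> 0 \<and> w \<in> ball a r"
      using a(2) eventually_at_in_open'[OF open_ball, of a a r] r(1) by (simp add: eventually_conj_iff)
    then show ?thesis using eventually_happens'[OF at_neq_bot] by blast
  qed
  moreover have "f holomorphic_on ball a r" using f r holomorphic_on_subset by blast
  moreover have "connected (ball a r)" "open (ball a r)" "a \<in> ball a r" using r by auto
  ultimately obtain r' where z: "zorder f a > 0" "r' > 0" "cball a r' \<subseteq> ball a r" "zor_poly f a holomorphic_on cball a r'"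
    "\<And>w. w \<in> cball a r' \<Longrightarrow> f w = zor_poly f a w * (w - a) ^ nat (zorder f a) \<and> zor_poly f a w \<noteq> 0"
    using zorder_exist_zero[of f "ball a r" a] a(1) by auto
  define m where "m = nat (zorder f a)"
  \<comment> \<open>Plain division away from \<open>a\<close> makes the factorization hold on the
    whole plane, even outside \<open>V\<close>. Near \<open>a\<close> the quotient agrees with
    \<open>zor_poly f a\<close>, which removes the singularity.\<close>
  define u where "u z = (if z = a then zor_poly f a a else f z / (z - a) ^ m)" for z
  have "u holomorphic_on (V - {a}) \<union> ball a r'"
  proof (rule holomorphic_on_Un)
    have "(\<lambda>z. f z / (z - a) ^ m) holomorphic_on V - {a}"
      using f holomorphic_on_subset by (intro holomorphic_intros) auto
    then show "u holomorphic_on V - {a}" by (rule holomorphic_transform) (auto simp: u_def)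
    have "zor_poly f a holomorphic_on ball a r'" using z(4) by (rule holomorphic_on_subset) auto
    then show "u holomorphic_on ball a r'"
    proof (rule holomorphic_transform)
      fix w assume "w \<in> ball a r'"
      then show "zor_poly f a w = u w" using z(5)[of w] by (auto simp: u_def m_def)
    qed
  qed (use f in auto)
  moreover have "ball a r' \<subseteq> V" using ball_subset_cball[of a r'] z(3) r(2) by blast
  then have "(V - {a}) \<union> ball a r' = V" using z(2) f(3) by auto
  ultimately have "u holomorphic_on V" by simp
  moreover have "u a \<noteq> 0" using z(5)[of a] z(2) by (auto simp: u_def)
  moreover have "f w = (w - a) ^ m * u w" for w
    using a(1) z(1) by (auto simp: u_def m_def)
  ultimately show ?thesis using that[of m u] z(1) by (auto simp: m_def)
qed

text \<open>The common factor \<open>Q\<close> of \<open>G\<close> and \<open>G'\<close> over \<open>Z\<close> makes the pencil \<open>p G + q G'\<close> nonzero there.\<close>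

definition common_factor_on ::
    "complex set \<Rightarrow> complex set \<Rightarrow> (complex \<Rightarrow> complex) \<Rightarrow> (complex \<Rightarrow> complex) \<Rightarrow>
     (complex \<Rightarrow> complex) \<Rightarrow> (complex \<Rightarrow> complex) \<Rightarrow> bool" where
  "common_factor_on V Z G Q G1 D1 \<longleftrightarrow> Q holomorphic_on V \<and> G1 holomorphic_on V \<and> D1 holomorphic_on V \<and>
    (\<forall>z\<in>V. G z = Q z * G1 z \<and> deriv G z = Q z * D1 z) \<and> (\<forall>z\<in>V - Z. Q z \<noteq> 0) \<and>
    (\<forall>z\<in>Z. G1 z = 0 \<and> deriv G1 z \<noteq> 0 \<and> (\<exists>m\<ge>1. D1 z = of_nat m * deriv G1 z))"

lemma common_factor_onD:
  assumes "common_factor_on V Z G Q G1 D1"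
  shows "Q holomorphic_on V" "G1 holomorphic_on V" "D1 holomorphic_on V"
    "\<And>z. z \<in> V \<Longrightarrow> G z = Q z * G1 z" "\<And>z. z \<in> V \<Longrightarrow> deriv G z = Q z * D1 z"
    "\<And>z. z \<in> V - Z \<Longrightarrow> Q z \<noteq> 0"
    "\<And>z. z \<in> Z \<Longrightarrow> G1 z = 0 \<and> deriv G1 z \<noteq> 0 \<and> (\<exists>m\<ge>1. D1 z = of_nat m * deriv G1 z)"
  using assms unfolding common_factor_on_def by simp_all

text \<open>The points of \<open>Z\<close> are treated one at a time. If the remaining factor of
  \<open>G\<close> is \<open>(z - a)^m u\<close>, then \<open>(z - a)^(m-1)\<close> is moved into
  \<open>Q\<close>, which leaves a simple zero. The derivative loses the same power, and the value
  of its cofactor at \<open>a\<close> is \<open>m\<close> times the derivative of the new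
  \<open>G1\<close>; this is how the order of the zero is remembered.\<close>

lemma common_factor_deriv:
  assumes "finite Z" and G: "G holomorphic_on V" "open V" "Z \<subseteq> V"
    and Z: "\<And>z. z \<in> Z \<Longrightarrow> G z = 0 \<and> (\<forall>\<^sub>F w in at z. G w \<noteq> 0)"
  obtains Q G1 D1 where "common_factor_on V Z G Q G1 D1"
proof -
  have "\<exists>Q G1 D1. common_factor_on V Z G Q G1 D1"
    using assms(1) G(3) Z
  proof (induction Z rule: finite_induct)
    case empty
    show ?case
      by (rule exI[of _ "\<lambda>_. 1"], rule exI[of _ G], rule exI[of _ "deriv G"])
        (use G in \<open>auto simp: common_factor_on_def intro: holomorphic_deriv\<close>)
  next
    case (insert a Z)
    have "\<exists>Q G1 D1. common_factor_on V Z G Q G1 D1"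
      by (rule insert.IH) (use insert.prems in auto)
    then obtain Q G1 D1 where "common_factor_on V Z G Q G1 D1" by blast
    note H = common_factor_onD[OF this]
    have aV: "a \<in> V" using insert by auto
    have Qa: "Q a \<noteq> 0" using H(6) aV insert by auto
    have Ga: "G a = 0" "\<forall>\<^sub>F w in at a. G w \<noteq> 0" using insert.prems(2) by auto
    have "G1 a = 0" using H(4)[OF aV] Ga(1) Qa by simp
    moreover have "\<forall>\<^sub>F w in at a. G1 w \<noteq> 0"
    proof -
      have "\<forall>\<^sub>F w in at a. w \<in> V" using eventually_at_in_open'[OF G(2) aV] .
      with Ga(2) show ?thesis by eventually_elim (use H(4) in auto)
    qed
    ultimately obtain m u where u: "m \<ge> 1" "u holomorphic_on V" "u a \<noteq> 0" "\<And>z. G1 z = (z - a) ^ m * u z"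
      using factor_zero_global[OF H(2) G(2) aV] by metis
    define m' where "m' = m - 1"
    have m: "m = Suc m'" using u(1) by (simp add: m'_def)
    define d where "d z = (if z = a then of_nat m * u a else D1 z / (z - a) ^ m')" for z
    \<comment> \<open>The product rule for \<open>G = Q (z - a)^m u\<close>, divided by
      \<open>Q (z - a)^(m-1)\<close>. This form is visibly holomorphic near \<open>a\<close>, where
      \<open>Q\<close> is nonzero, while \<open>d\<close> is visibly holomorphic away from
      \<open>a\<close>.\<close>
    define b where "b z = (z - a) * u z * deriv Q z / Q z + of_nat m * u z + (z - a) * deriv u z" for z
    have "isCont Q a"
      using H(1) aV G(2) continuous_on_eq_continuous_at holomorphic_on_imp_continuous_on by blast
    then have "\<forall>\<^sub>F w in nhds a. Q w \<noteq> 0"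
      using Qa by (simp add: continuous_at_imp_continuous_at_within eventually_nhds_conv_at isCont_def tendsto_imp_eventually_ne)
    then have "\<forall>\<^sub>F w in nhds a. Q w \<noteq> 0 \<and> w \<in> V" using eventually_nhds_in_open[OF G(2) aV] by (rule eventually_conj)
    then obtain T where T: "open T" "a \<in> T" "\<And>w. w \<in> T \<Longrightarrow> Q w \<noteq> 0 \<and> w \<in> V"
      unfolding eventually_nhds by blast
    have TV: "T \<subseteq> V" using T by auto
    have bd: "d z = b z" if z: "z \<in> T" for z
    proof (cases "z = a")
      case True then show ?thesis by (simp add: b_def d_def)
    next
      case False
      have zV: "z \<in> V" "Q z \<noteq> 0" using T z by auto
      have "deriv G z = deriv (\<lambda>z. Q z * ((z - a) ^ m * u z)) z"
        by (rule complex_derivative_transform_within_open[OF G(1) _ G(2) zV(1)])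
          (use H u(2) in \<open>auto intro!: holomorphic_intros simp: u(4)\<close>)
      also have "\<dots> = deriv Q z * ((z - a) ^ m * u z) + Q z * (of_nat m * (z - a) ^ m' * u z + (z - a) ^ m * deriv u z)"
      proof (rule DERIV_imp_deriv)
        have "((\<lambda>z. (z - a) ^ m) has_field_derivative of_nat m * (z - a) ^ m') (at z)"
          by (rule DERIV_cong[OF DERIV_power[where n = m, OF DERIV_diff[OF DERIV_ident DERIV_const]]])
            (simp add: m)
        from DERIV_mult[OF holomorphic_derivI[OF H(1) G(2) zV(1)] DERIV_mult[OF this holomorphic_derivI[OF u(2) G(2) zV(1)]]]
        show "((\<lambda>z. Q z * ((z - a) ^ m * u z)) has_field_derivative deriv Q z * ((z - a) ^ m * u z) +
            Q z * (of_nat m * (z - a) ^ m' * u z + (z - a) ^ m * deriv u z)) (at z)"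
          by (rule DERIV_cong) (simp add: algebra_simps)
      qed
      also have "\<dots> = Q z * ((z - a) ^ m' * b z)"
        using zV(2) by (simp add: b_def m field_simps)
      finally have "D1 z = (z - a) ^ m' * b z" using H(5)[OF zV(1)] zV(2) by simp
      then show ?thesis using False by (simp add: d_def)
    qed
    have "d holomorphic_on (V - {a}) \<union> T"
    proof (rule holomorphic_on_Un)
      have "(\<lambda>z. D1 z / (z - a) ^ m') holomorphic_on V - {a}"
        using H(3) holomorphic_on_subset by (intro holomorphic_intros) auto
      then show "d holomorphic_on V - {a}" by (rule holomorphic_transform) (auto simp: d_def)
      have "b holomorphic_on T" unfolding b_def
        using holomorphic_on_subset[OF H(1) TV] holomorphic_on_subset[OF u(2) TV] T
        by (intro holomorphic_intros holomorphic_deriv) auto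
      then show "d holomorphic_on T" by (rule holomorphic_transform) (simp add: bd)
    qed (use G T in auto)
    moreover have "(V - {a}) \<union> T = V" using T aV by auto
    ultimately have dh: "d holomorphic_on V" by simp
    have D1d: "D1 z = (z - a) ^ m' * d z" if "z \<in> V" for z
    proof (cases "z = a")
      case True
      have "b a = of_nat m * u a" by (simp add: b_def)
      \<comment> \<open>At \<open>a\<close> itself the division says nothing. If
        \<open>m = 1\<close>, then \<open>deriv G a = Q a * u a\<close>; if \<open>m > 1\<close>,
        both sides vanish.\<close>
      show ?thesis
      proof (cases m')
        case 0
        have "deriv G a = deriv (\<lambda>z. Q z * ((z - a) ^ m * u z)) a"
          by (rule complex_derivative_transform_within_open[OF G(1) _ G(2) aV])
            (use H u(2) in \<open>auto intro!: holomorphic_intros simp: u(4)\<close>)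
        also have "\<dots> = Q a * u a"
          by (rule DERIV_imp_deriv)
            (use holomorphic_derivI[OF H(1) G(2) aV] holomorphic_derivI[OF u(2) G(2) aV] 0 in
              \<open>auto intro!: derivative_eq_intros simp: m algebra_simps\<close>)
        finally show ?thesis using True H(5)[OF aV] Qa 0 m by (simp add: d_def)
      next
        case (Suc n)
        have "deriv G a = deriv (\<lambda>z. Q z * ((z - a) ^ m * u z)) a"
          by (rule complex_derivative_transform_within_open[OF G(1) _ G(2) aV])
            (use H u(2) in \<open>auto intro!: holomorphic_intros simp: u(4)\<close>)
        also have "\<dots> = 0"
          by (rule DERIV_imp_deriv)
            (use holomorphic_derivI[OF H(1) G(2) aV] holomorphic_derivI[OF u(2) G(2) aV] Suc in
              \<open>auto intro!: derivative_eq_intros simp: m algebra_simps\<close>)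
        finally show ?thesis using True H(5)[OF aV] Qa Suc by simp
      qed
    qed (simp add: d_def)
    have dG: "deriv (\<lambda>w. (w - a) * u w) z = u z + (z - a) * deriv u z" if "z \<in> V" for z
      by (rule DERIV_imp_deriv)
        (use holomorphic_derivI[OF u(2) G(2) that] in \<open>auto intro!: derivative_eq_intros\<close>)
    show ?case
    proof (rule exI[of _ "\<lambda>z. Q z * (z - a) ^ m'"], rule exI[of _ "\<lambda>z. (z - a) * u z"], rule exI[of _ d], unfold common_factor_on_def, intro conjI ballI)
      show "(\<lambda>z. Q z * (z - a) ^ m') holomorphic_on V" "(\<lambda>z. (z - a) * u z) holomorphic_on V" "d holomorphic_on V"
        using H u dh by (auto intro!: holomorphic_intros)
      fix z
      show "G z = Q z * (z - a) ^ m' * ((z - a) * u z)" if "z \<in> V"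
        using H(4)[OF that] u(4)[of z] by (simp add: m)
      show "deriv G z = Q z * (z - a) ^ m' * d z" if "z \<in> V"
        using H(5)[OF that] D1d[OF that] by simp
      show "Q z * (z - a) ^ m' \<noteq> 0" if "z \<in> V - insert a Z" using H(6)[of z] that by auto
      assume z: "z \<in> insert a Z"
      then have zV: "z \<in> V" using insert.prems by auto
      have *: "(z - a) * u z = 0 \<and> deriv (\<lambda>z. (z - a) * u z) z \<noteq> 0 \<and>
        (\<exists>m\<ge>1. d z = of_nat m * deriv (\<lambda>z. (z - a) * u z) z)"
      proof (cases "z = a")
        case True
        then show ?thesis using u dG[OF aV] by (auto simp: d_def)
      next
        case False
        then have zZ: "z \<in> Z" using z by auto
        have u0: "u z = 0" using H(7)[OF zZ] u(4)[of z] False by simp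
        have "deriv G1 z = (z - a) ^ m * deriv u z"
          using holomorphic_derivI[OF u(2) G(2) zV] u0 unfolding u(4)
          by (intro DERIV_imp_deriv) (auto intro!: derivative_eq_intros)
        then show ?thesis using H(7)[OF zZ] D1d[OF zV] u0 dG[OF zV] False by (auto simp: m)
      qed
      then show "(z - a) * u z = 0" "deriv (\<lambda>z. (z - a) * u z) z \<noteq> 0"
        "\<exists>m\<ge>1. d z = of_nat m * deriv (\<lambda>z. (z - a) * u z) z" by auto
    qed
  qed
  then show ?thesis using that by blast
qed

lemma zcount_mult_nonzero:
  assumes V: "open V" "Q holomorphic_on V" "f holomorphic_on V"
    and U: "U \<subseteq> V" "\<And>z. z \<in> U \<Longrightarrow> Q z \<noteq> 0" "\<And>z. z \<in> U \<Longrightarrow> f z = 0 \<Longrightarrow> \<forall>\<^sub>F w in at z. f w \<noteq> 0"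
    and h: "\<And>z. z \<in> V \<Longrightarrow> h z = Q z * f z"
  shows "zcount h U = zcount f U"
  unfolding zcount_def
proof (rule sum.cong)
  show "{z \<in> U. h z = 0} = {z \<in> U. f z = 0}" using U h by auto
  fix z assume "z \<in> {z \<in> U. f z = 0}"
  then have z: "z \<in> U" "z \<in> V" "f z = 0" using U by auto
  have "zorder h z = zorder (\<lambda>z. Q z * f z) z"
    by (rule zorder_cong_on[OF V(1) z(2)]) (rule h)
  then show "zorder h z = zorder f z"
    using zorder_mult_nonzero[OF V(1) z(2) V(2,3) U(2)[OF z(1)] U(3)[OF z(1,3)]] by simp
qed

text \<open>At a boundary zero of \<open>G\<close> of order m the pencil vanishes to order m - 1 for
  all t, so \<open>zcount_homotopy\<close> is applied to the pencil divided by the common factor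
  \<open>Q\<close>. There its value is \<open>q t z\<close> times a positive multiple of
  \<open>deriv G1 z\<close>, hence nonzero. As \<open>Q\<close> has no zeros in \<open>U\<close>,
  the division does not change the count.\<close>

theorem zcount_pencil_homotopy:
  fixes p q :: "real \<Rightarrow> complex \<Rightarrow> complex"
  assumes U: "open U" "bounded U" and V: "open V" "closure U \<subseteq> V" and G: "G holomorphic_on V"
    and nz: "\<And>z. z \<in> frontier U \<Longrightarrow> G z = 0 \<Longrightarrow> \<forall>\<^sub>F w in at z. G w \<noteq> 0"
    and pq: "\<And>t. t \<in> {0..1} \<Longrightarrow> p t holomorphic_on V" "\<And>t. t \<in> {0..1} \<Longrightarrow> q t holomorphic_on V"
      "continuous_on ({0..1} \<times> closure U) (\<lambda>(t,z). p t z)" "continuous_on ({0..1} \<times> closure U) (\<lambda>(t,z). q t z)"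
    and fr: "\<And>t z. t \<in> {0..1} \<Longrightarrow> z \<in> frontier U \<Longrightarrow> G z \<noteq> 0 \<Longrightarrow> p t z * G z + q t z * deriv G z \<noteq> 0"
      "\<And>t z. t \<in> {0..1} \<Longrightarrow> z \<in> frontier U \<Longrightarrow> G z = 0 \<Longrightarrow> q t z \<noteq> 0"
  shows "zcount (\<lambda>z. p 0 z * G z + q 0 z * deriv G z) U = zcount (\<lambda>z. p 1 z * G z + q 1 z * deriv G z) U"
proof -
  define Z where "Z = {z\<in>frontier U. G z = 0}"
  have frV: "frontier U \<subseteq> V" using V by (auto simp: frontier_def)
  have finZ: "finite Z" unfolding Z_def
    by (rule finite_zeros_in_compact[OF _ G V(1) frV]) (use U nz in \<open>auto intro: compact_frontier_bounded\<close>)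
  have UZ: "U \<subseteq> V - Z" using U V closure_subset[of U] unfolding Z_def frontier_def by (auto simp: interior_open)
  have ZV: "Z \<subseteq> V" and Znz: "\<And>z. z \<in> Z \<Longrightarrow> G z = 0 \<and> (\<forall>\<^sub>F w in at z. G w \<noteq> 0)"
    using frV nz by (auto simp: Z_def)
  obtain Q G1 D1 where "common_factor_on V Z G Q G1 D1"
    using common_factor_deriv[OF finZ G V(1) ZV Znz] by blast
  note H = common_factor_onD[OF this]
  define f where "f t z = p t z * G1 z + q t z * D1 z" for t z
  have fh: "f t holomorphic_on V" if "t \<in> {0..1}" for t
    unfolding f_def using pq that H by (intro holomorphic_intros) auto
  have ffr: "f t z \<noteq> 0" if t: "t \<in> {0..1}" and z: "z \<in> frontier U" for t z
  proof (cases "G z = 0")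
    case True
    then have "z \<in> Z" using z by (simp add: Z_def)
    with H(7)[of z] obtain m where "G1 z = 0" "deriv G1 z \<noteq> 0" "m \<ge> (1::nat)" "D1 z = of_nat m * deriv G1 z" by blast
    then show ?thesis using fr(2)[OF t z True] by (simp add: f_def)
  next
    case False
    have "z \<in> V" using z frV by auto
    then have "Q z * f t z \<noteq> 0" using fr(1)[OF t z False] H(4,5)[of z] by (simp add: f_def algebra_simps)
    then show ?thesis by auto
  qed
  have "continuous_on (closure U) h" if "h holomorphic_on V" for h
    using that V holomorphic_on_imp_continuous_on holomorphic_on_subset by blast
  then have c: "continuous_on ({0..1} \<times> closure U) (\<lambda>x. h (snd x))" if "h holomorphic_on V" for h
    using that by (intro continuous_on_compose2[of "closure U" h _ snd]) (auto intro: continuous_intros)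
  have "continuous_on ({0..1} \<times> closure U) (\<lambda>(t,z). f t z)"
    using pq(3,4) c[OF H(2)] c[OF H(3)] unfolding f_def case_prod_beta by (intro continuous_intros)
  then have "zcount (f 0) U = zcount (f 1) U"
    by (intro zcount_homotopy[OF U V fh _ ffr]) auto
  moreover have "zcount (\<lambda>z. p t z * G z + q t z * deriv G z) U = zcount (f t) U" if "t \<in> {0..1}" for t
  proof (rule zcount_mult_nonzero[OF V(1) H(1) fh[OF that]])
    show "\<forall>\<^sub>F w in at z. f t w \<noteq> 0" if "z \<in> U" for z
      by (rule nonzero_frontier_eventually_nonzero[OF U V fh ffr that]) (use \<open>t \<in> {0..1}\<close> in auto)
  qed (use UZ H in \<open>auto simp: f_def algebra_simps\<close>)
  ultimately show ?thesis by simp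
qed

text \<open>In the pencil \<open>k G + \<epsilon> v G'\<close>, a zero of \<open>G\<close> of order \<open>m\<close> at \<open>z\<close> splits into a zero of order
  \<open>m - 1\<close> that stays and a simple one near \<open>z - \<epsilon> (m/k) v(z)\<close>.\<close>

definition points_into :: "complex set \<Rightarrow> complex \<Rightarrow> complex \<Rightarrow> bool" where
  "points_into U z u \<longleftrightarrow> (\<exists>\<delta>>0. \<exists>\<eta>>0. \<forall>s u'. 0 < s \<longrightarrow> s < \<delta> \<longrightarrow> norm (u' - u) < \<eta> \<longrightarrow> z + of_real s * u' \<in> U)"

lemma points_into_scale:
  assumes "points_into U z u" "c > 0"
  shows "points_into U z (of_real c * u)"
proof -
  obtain \<delta> \<eta> where de: "\<delta> > 0" "\<eta> > 0"
    "\<And>s u'. 0 < s \<Longrightarrow> s < \<delta> \<Longrightarrow> norm (u' - u) < \<eta> \<Longrightarrow> z + of_real s * u' \<in> U"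
    using assms(1) unfolding points_into_def by metis
  show ?thesis unfolding points_into_def
  proof (rule exI[of _ "\<delta> / c"], intro conjI, goal_cases)
    case 2
    show ?case
    proof (rule exI[of _ "c * \<eta>"], intro conjI allI impI, goal_cases)
      case (2 s u')
      have "u' / of_real c - u = (u' - of_real c * u) / of_real c" using assms(2) by (simp add: field_simps)
      then have "norm (u' / of_real c - u) < \<eta>" using 2 assms(2) by (simp add: norm_divide field_simps)
      moreover have "s * c < \<delta>" using 2 assms(2) by (simp add: field_simps)
      ultimately have "z + of_real (s * c) * (u' / of_real c) \<in> U" using de(3)[of "s * c" "u' / of_real c"] 2 assms(2) by simp
      then show ?case using assms(2) by simp
    qed (use de assms in auto)
  qed (use de assms in auto)
qed

text \<open>After division by the common factor the pencil is \<open>A + \<epsilon> B\<close> with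
  \<open>A = k G1\<close> and \<open>B = v D1\<close>. At a boundary zero of \<open>G\<close> the
  quotient \<open>A / B\<close> has a simple zero, and the unique nearby solution of
  \<open>A / B = - \<epsilon>\<close> departs in the direction \<open>- v\<close>;
  \<open>points_into\<close> decides whether it lies in \<open>U\<close>. Zeros inside
  \<open>U\<close> persist by \<open>zcount_perturb\<close>.\<close>

theorem zcount_pencil_limit:
  fixes k :: real
  assumes U: "open U" "bounded U" and V: "open V" "closure U \<subseteq> V" and G: "G holomorphic_on V"
    and nz: "\<And>z. z \<in> closure U \<Longrightarrow> G z = 0 \<Longrightarrow> \<forall>\<^sub>F w in at z. G w \<noteq> 0"
    and k: "k > 0" and v: "v holomorphic_on V"
    and e0: "e0 > 0" and fr: "\<And>\<epsilon> z. 0 < \<epsilon> \<Longrightarrow> \<epsilon> \<le> e0 \<Longrightarrow> z \<in> frontier U \<Longrightarrow> G z \<noteq> 0 \<Longrightarrow> of_real k * G z + of_real \<epsilon> * (v z * deriv G z) \<noteq> 0"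
      "\<And>z. z \<in> frontier U \<Longrightarrow> G z = 0 \<Longrightarrow> v z \<noteq> 0"
    and I: "\<And>z. z \<in> frontier U \<Longrightarrow> G z = 0 \<Longrightarrow> z \<in> I \<Longrightarrow> points_into U z (- v z)"
      "\<And>z. z \<in> frontier U \<Longrightarrow> G z = 0 \<Longrightarrow> z \<notin> I \<Longrightarrow> points_into (- U) z (- v z)"
  shows "\<forall>\<^sub>F \<epsilon> in at_right 0. zcount (\<lambda>z. of_real k * G z + of_real \<epsilon> * (v z * deriv G z)) U =
    zcount G U + int (card {z\<in>frontier U. G z = 0 \<and> z \<in> I})"
proof -
  define Z where "Z = {z\<in>frontier U. G z = 0}"
  have frV: "frontier U \<subseteq> V" using V by (auto simp: frontier_def)
  have frc: "frontier U \<subseteq> closure U" by (auto simp: frontier_def)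
  have finZ: "finite Z" unfolding Z_def
    by (rule finite_zeros_in_compact[OF _ G V(1) frV]) (use U nz frc in \<open>auto intro: compact_frontier_bounded\<close>)
  have UZ: "U \<subseteq> V - Z" using U V closure_subset[of U] unfolding Z_def frontier_def by (auto simp: interior_open)
  have ZV: "Z \<subseteq> V" and Znz: "\<And>z. z \<in> Z \<Longrightarrow> G z = 0 \<and> (\<forall>\<^sub>F w in at z. G w \<noteq> 0)"
    using frV frc nz by (auto simp: Z_def)
  obtain Q G1 D1 where "common_factor_on V Z G Q G1 D1"
    using common_factor_deriv[OF finZ G V(1) ZV Znz] by blast
  note H = common_factor_onD[OF this]
  define A where "A z = of_real k * G1 z" for z
  define B where "B z = v z * D1 z" for z
  have AB: "A holomorphic_on V" "B holomorphic_on V"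
    unfolding A_def B_def using H v by (auto intro!: holomorphic_intros)
  define F where "F z = A z / B z" for z
  define good where "good z0 r \<longleftrightarrow> (\<forall>z\<in>ball z0 r - {z0}. A z \<noteq> 0) \<and> (\<forall>\<^sub>F \<epsilon> in at_right 0.
        zcount (\<lambda>z. A z + of_real \<epsilon> * B z) (U \<inter> ball z0 r) = of_bool (z0 \<in> I) \<and>
        finite {z\<in>U \<inter> ball z0 r. A z + of_real \<epsilon> * B z = 0})" for z0 r
  have local: "\<exists>r0. 0 < r0 \<and> (\<forall>r. 0 < r \<longrightarrow> r < r0 \<longrightarrow> good z0 r)" if z0: "z0 \<in> Z" for z0
  proof -
    have z0': "z0 \<in> frontier U" "G z0 = 0" "z0 \<in> V" "z0 \<notin> U"
      using z0 frV UZ by (auto simp: Z_def)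
    obtain m where m: "G1 z0 = 0" "deriv G1 z0 \<noteq> 0" "m \<ge> (1::nat)" "D1 z0 = of_nat m * deriv G1 z0"
      using H(7)[OF z0] by blast
    have B0: "B z0 \<noteq> 0" using m fr(2)[OF z0'(1,2)] by (simp add: B_def)
    have "isCont B z0"
      using AB(2) z0'(3) V(1) continuous_on_eq_continuous_at holomorphic_on_imp_continuous_on by blast
    then have "\<forall>\<^sub>F w in nhds z0. B w \<noteq> 0"
      using B0 by (simp add: continuous_at_imp_continuous_at_within eventually_nhds_conv_at isCont_def tendsto_imp_eventually_ne)
    then have "\<forall>\<^sub>F w in nhds z0. B w \<noteq> 0 \<and> w \<in> V" using eventually_nhds_in_open[OF V(1) z0'(3)] by (rule eventually_conj)
    then obtain S where S: "open S" "z0 \<in> S" "\<And>w. w \<in> S \<Longrightarrow> B w \<noteq> 0 \<and> w \<in> V"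
      unfolding eventually_nhds by blast
    have ABS: "A holomorphic_on S" "B holomorphic_on S" using AB S(3) holomorphic_on_subset by blast+
    have FS: "F holomorphic_on S" unfolding F_def using ABS S by (intro holomorphic_intros) auto
    \<comment> \<open>Since \<open>D1 = m G1'\<close> at \<open>z0\<close>, the derivative of
      \<open>A / B\<close> there is \<open>k / (m v)\<close>, which is \<open>- 1 / u0\<close> for
      this choice.\<close>
    define u0 where "u0 = of_real (real m / k) * (- v z0)"
    have u0: "u0 \<noteq> 0" using m(3) k fr(2)[OF z0'(1,2)] by (simp add: u0_def)
    have "(F has_field_derivative ((of_real k * deriv G1 z0) * B z0 - A z0 * deriv B z0) / (B z0 * B z0)) (at z0)"
      unfolding F_def A_def
      by (rule DERIV_divide DERIV_cmult holomorphic_derivI[OF H(2) V(1) z0'(3)] holomorphic_derivI[OF AB(2) V(1) z0'(3)] B0)+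
    then have "deriv F z0 = of_real k * deriv G1 z0 / B z0"
      using m(1) B0 by (simp add: DERIV_imp_deriv A_def)
    then have dF: "deriv F z0 = - 1 / u0"
      using m fr(2)[OF z0'(1,2)] k by (simp add: B_def u0_def field_simps)
    \<comment> \<open>The set in which the moving zero ends up; it lets both alternatives for
      \<open>z0\<close> be treated at once.\<close>
    define W where "W = (if z0 \<in> I then U else - U)"
    have "points_into W z0 (- v z0)" using I z0' by (auto simp: W_def)
    then have "points_into W z0 u0" unfolding u0_def by (rule points_into_scale) (use m k in auto)
    then obtain \<delta> \<eta> where de: "\<delta> > 0" "\<eta> > 0"
      "\<And>s u'. 0 < s \<Longrightarrow> s < \<delta> \<Longrightarrow> norm (u' - u0) < \<eta> \<Longrightarrow> z0 + of_real s * u' \<in> W"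
      unfolding points_into_def by metis
    have F0: "F z0 = 0" by (simp add: F_def A_def m)
    obtain r0 where r0: "r0 > 0" "ball z0 r0 \<subseteq> S" "\<And>z. z \<in> ball z0 r0 \<Longrightarrow> deriv F z \<noteq> 0"
      "\<And>z. z \<in> ball z0 r0 \<Longrightarrow> z \<noteq> z0 \<Longrightarrow> F z \<noteq> 0"
      "\<And>r. 0 < r \<Longrightarrow> r < r0 \<Longrightarrow> \<forall>\<^sub>F \<epsilon> in at_right 0.
        \<exists>u. norm (u - u0) < \<eta> \<and> {z\<in>ball z0 r. F z = - of_real \<epsilon>} = {z0 + of_real \<epsilon> * u}"
      using simple_zero_moves[OF FS S(1,2) F0 u0 dF de(2)] by blast
    show ?thesis
    proof (rule exI[of _ r0], unfold good_def, intro conjI allI impI)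
      fix r assume r: "0 < r" "r < r0"
      have sub: "ball z0 r \<subseteq> S" "ball z0 r \<subseteq> ball z0 r0" using r r0(2) by auto
      show "\<forall>z\<in>ball z0 r - {z0}. A z \<noteq> 0"
        using r0(4) sub by (force simp: F_def)
      have "\<forall>\<^sub>F \<epsilon> in at_right 0. \<epsilon> > 0 \<and> \<epsilon> < \<delta>"
        unfolding eventually_at_right_field using de(1) by auto
      with r0(5)[OF r] show "\<forall>\<^sub>F \<epsilon> in at_right 0.
        zcount (\<lambda>z. A z + of_real \<epsilon> * B z) (U \<inter> ball z0 r) = of_bool (z0 \<in> I) \<and>
        finite {z\<in>U \<inter> ball z0 r. A z + of_real \<epsilon> * B z = 0}"
      proof eventually_elim
        case (elim \<epsilon>)
        then obtain u where u: "norm (u - u0) < \<eta>" "{z\<in>ball z0 r. F z = - of_real \<epsilon>} = {z0 + of_real \<epsilon> * u}" by blast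
        have inW: "z0 + of_real \<epsilon> * u \<in> W" using de(3) elim u by auto
        have "{z\<in>U \<inter> ball z0 r. F z = - of_real \<epsilon>} = {z\<in>ball z0 r. F z = - of_real \<epsilon>} \<inter> U" by auto
        also have "\<dots> = (if z0 \<in> I then {z0 + of_real \<epsilon> * u} else {})"
          unfolding u(2) using inW by (auto simp: W_def)
        finally have eq: "{z\<in>U \<inter> ball z0 r. F z = - of_real \<epsilon>} = (if z0 \<in> I then {z0 + of_real \<epsilon> * u} else {})" .
        have "zcount (\<lambda>z. A z - (- of_real \<epsilon>) * B z) (U \<inter> ball z0 r) = int (card {z\<in>U \<inter> ball z0 r. A z / B z = - of_real \<epsilon>})"
          by (rule zcount_quotient[OF S(1) ABS]) (use S sub r0(3) in \<open>auto simp: F_def[abs_def]\<close>)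
        then have "zcount (\<lambda>z. A z + of_real \<epsilon> * B z) (U \<inter> ball z0 r) = of_bool (z0 \<in> I)"
          using eq by (simp add: F_def split: if_splits)
        moreover have "{z\<in>U \<inter> ball z0 r. A z + of_real \<epsilon> * B z = 0} \<subseteq> {z\<in>U \<inter> ball z0 r. F z = - of_real \<epsilon>}"
        proof
          fix z assume z: "z \<in> {z\<in>U \<inter> ball z0 r. A z + of_real \<epsilon> * B z = 0}"
          then have "B z \<noteq> 0" using S sub by auto
          then show "z \<in> {z\<in>U \<inter> ball z0 r. F z = - of_real \<epsilon>}"
            using z by (simp add: F_def field_simps eq_neg_iff_add_eq_0)
        qed
        ultimately show ?case unfolding eq by (auto intro: finite_subset split: if_splits)
      qed
    qed (use r0 in auto)
  qed
  then have "\<forall>z0\<in>Z. \<exists>r0. 0 < r0 \<and> (\<forall>r. 0 < r \<longrightarrow> r < r0 \<longrightarrow> good z0 r)" by blast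
  from bchoice[OF this] obtain R where R: "\<forall>z0\<in>Z. 0 < R z0 \<and> (\<forall>r. 0 < r \<longrightarrow> r < R z0 \<longrightarrow> good z0 r)" by blast
  obtain r1 where r1: "r1 > 0" "disjoint_family_on (\<lambda>z. cball z r1) Z"
    using disjoint_small_balls[OF finZ open_UNIV] by auto
  \<comment> \<open>The factor 1/2 leaves room for a good radius strictly larger than
    \<open>r\<close>, which is needed because \<open>closure N\<close> reaches the closed
    balls.\<close>
  define r where "r = Min (insert r1 (R ` Z)) / 2"
  have "r > 0" unfolding r_def using finZ r1(1) R by simp
  have "2 * r \<le> r1" unfolding r_def using finZ by simp
  have "2 * r \<le> R z" if "z \<in> Z" for z unfolding r_def using finZ that by simp
  then have rR: "r < R z" if "z \<in> Z" for z using that \<open>r > 0\<close> by force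
  define N where "N = (\<Union>z\<in>Z. ball z r)"
  have disj: "disjoint_family_on (\<lambda>z. U \<inter> ball z r) Z"
    unfolding disjoint_family_on_def
  proof (intro ballI impI)
    fix x y assume "x \<in> Z" "y \<in> Z" "x \<noteq> y"
    then have "cball x r1 \<inter> cball y r1 = {}" using r1(2) unfolding disjoint_family_on_def by blast
    moreover have "ball x r \<subseteq> cball x r1" "ball y r \<subseteq> cball y r1" using \<open>2 * r \<le> r1\<close> \<open>r > 0\<close> by auto
    ultimately show "(U \<inter> ball x r) \<inter> (U \<inter> ball y r) = {}" by blast
  qed
  have UV: "U \<subseteq> V" using UZ by auto
  have Aiff: "A z = 0 \<longleftrightarrow> G z = 0" if "z \<in> U" for z
    using H(4,6)[of z] that UZ k by (auto simp: A_def)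
  have AnzU: "\<forall>\<^sub>F w in at z. A w \<noteq> 0" if "z \<in> U" "A z = 0" for z
  proof -
    have "\<forall>\<^sub>F w in at z. G w \<noteq> 0" using nz[of z] that Aiff closure_subset[of U] by blast
    moreover have "\<forall>\<^sub>F w in at z. w \<in> U" using eventually_at_in_open'[OF U(1) that(1)] .
    ultimately show ?thesis by eventually_elim (use Aiff in auto)
  qed
  have ABfr: "A z + of_real \<epsilon> * B z \<noteq> 0" if e: "0 < \<epsilon>" "\<epsilon> \<le> e0" and z: "z \<in> frontier U" for \<epsilon> z
  proof (cases "G z = 0")
    case True
    then have "z \<in> Z" using z by (simp add: Z_def)
    with H(7)[of z] obtain m where "G1 z = 0" "deriv G1 z \<noteq> 0" "m \<ge> (1::nat)" "D1 z = of_nat m * deriv G1 z" by blast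
    then show ?thesis using fr(2)[OF z True] e by (simp add: A_def B_def)
  next
    case False
    have "z \<in> V" using z frV by auto
    then have "Q z * (A z + of_real \<epsilon> * B z) \<noteq> 0" using fr(1)[OF e z False] H(4,5)[of z] by (simp add: A_def B_def algebra_simps)
    then show ?thesis by auto
  qed
  have "\<forall>\<^sub>F \<epsilon> in at_right 0. zcount (\<lambda>z. A z + of_real \<epsilon> * B z) U =
     zcount A U + zcount (\<lambda>z. A z + of_real \<epsilon> * B z) (U \<inter> N)"
  proof (rule zcount_perturb[OF U V AB AnzU _ _ _ e0 ABfr])
    show "open N" by (auto simp: N_def)
    show "z \<in> N" if "z \<in> frontier U" "A z = 0" for z
    proof -
      have "G z = 0" using that H(4)[of z] frV k by (auto simp: A_def)
      then have "z \<in> Z" using that by (simp add: Z_def)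
      moreover have "z \<in> ball z r" using \<open>r > 0\<close> by simp
      ultimately show ?thesis unfolding N_def by blast
    qed
    show "A z \<noteq> 0" if z: "z \<in> U \<inter> closure N" for z
    proof -
      have "closure N \<subseteq> (\<Union>z\<in>Z. cball z r)"
        unfolding N_def by (rule closure_minimal) (use finZ in auto)
      then obtain z0 where z0: "z0 \<in> Z" "z \<in> cball z0 r" using z by auto
      define r' where "r' = (r + R z0) / 2"
      have r': "r < r'" "r' < R z0" using rR[OF z0(1)] by (auto simp: r'_def)
      have "z \<in> ball z0 r' - {z0}" using z0 r' z UZ by auto
      then show ?thesis using R z0(1) r' \<open>r > 0\<close> unfolding good_def by (meson less_trans)
    qed
  qed
  moreover have "\<forall>\<^sub>F \<epsilon> in at_right 0. \<forall>z0\<in>Z. zcount (\<lambda>z. A z + of_real \<epsilon> * B z) (U \<inter> ball z0 r) = of_bool (z0 \<in> I) \<and>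
        finite {z\<in>U \<inter> ball z0 r. A z + of_real \<epsilon> * B z = 0}"
    using R rR \<open>r > 0\<close> finZ by (intro eventually_ball_finite) (auto simp: good_def)
  moreover have "\<forall>\<^sub>F \<epsilon> in at_right 0. \<epsilon> > 0 \<and> \<epsilon> < e0"
    unfolding eventually_at_right_field using e0 by auto
  ultimately show ?thesis
  proof eventually_elim
    case (elim \<epsilon>)
    let ?f = "\<lambda>z. A z + of_real \<epsilon> * B z"
    have fh: "?f holomorphic_on V" using AB by (intro holomorphic_intros)
    have "zcount ?f (U \<inter> N) = (\<Sum>z0\<in>Z. zcount ?f (U \<inter> ball z0 r))"
      by (rule zcount_disjoint_Union[OF finZ _ disj]) (use elim in \<open>auto simp: N_def\<close>)
    also have "\<dots> = (\<Sum>z0\<in>Z. of_bool (z0 \<in> I))" using elim by (intro sum.cong) auto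
    also have "\<dots> = int (card {z\<in>Z. z \<in> I})" using finZ by (simp add: sum_of_bool_eq Int_def)
    also have "{z\<in>Z. z \<in> I} = {z\<in>frontier U. G z = 0 \<and> z \<in> I}" by (auto simp: Z_def)
    finally have 1: "zcount ?f (U \<inter> N) = int (card {z\<in>frontier U. G z = 0 \<and> z \<in> I})" .
    have 2: "zcount (\<lambda>z. of_real k * G z + of_real \<epsilon> * (v z * deriv G z)) U = zcount ?f U"
    proof (rule zcount_mult_nonzero[OF V(1) H(1) fh UV])
      show "\<forall>\<^sub>F w in at z. ?f w \<noteq> 0" if "z \<in> U" for z
        by (rule nonzero_frontier_eventually_nonzero[OF U V fh ABfr that]) (use elim in auto)
    qed (use UZ H in \<open>auto simp: A_def B_def algebra_simps\<close>)
    have 3: "zcount G U = zcount A U"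
    proof (rule zcount_mult_nonzero[OF V(1) _ AB(1) UV])
      show "(\<lambda>z. Q z / of_real k) holomorphic_on V" using H(1) k by (intro holomorphic_intros) auto
    qed (use UZ H k AnzU in \<open>auto simp: A_def\<close>)
    show ?case using elim 1 2 3 by simp
  qed
qed


section \<open>The transformation law of the Eisenstein series of weight 2\<close>

lemma int_UNIV_split: "(UNIV :: int set) = range int \<union> range (\<lambda>n. - int n - 1)"
proof (intro equalityI subsetI)
  fix x :: int
  show "x \<in> range int \<union> range (\<lambda>n. - int n - 1)"
  proof (cases "x \<ge> 0")
    case True
    then have "x = int (nat x)" by simp
    then show ?thesis by blast
  next
    case False
    then have "x = - int (nat (- x - 1)) - 1" by simp
    then show ?thesis by blast
  qed
qed simp

lemma has_sum_int:
  fixes f :: "int \<Rightarrow> 'a :: topological_comm_monoid_add"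
  assumes "((\<lambda>n. f (int n)) has_sum a) UNIV" "((\<lambda>n. f (- int n - 1)) has_sum b) UNIV"
  shows "(f has_sum (a + b)) UNIV"
proof -
  have 1: "(f has_sum a) (range int)"
    using assms(1) by (subst has_sum_reindex) (auto simp: o_def inj_on_def)
  have 2: "(f has_sum b) (range (\<lambda>n. - int n - 1))"
    using assms(2) by (subst has_sum_reindex) (auto simp: o_def inj_on_def)
  show ?thesis
    unfolding int_UNIV_split using 1 2 by (rule has_sum_Un_disjoint) auto
qed

text \<open>An unconditional sum may be computed along any exhaustion by finite sets. The windows
  consist of the pairs \<open>n\<close>, \<open>- n - 1\<close> with \<open>n < N\<close>, the same
  pairing as in \<open>has_sum_int\<close>, and they suit the telescoping sums used later.\<close>

lemma has_sum_int_symmetric_limit: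
  fixes f :: "int \<Rightarrow> 'a :: topological_comm_monoid_add"
  assumes "(f has_sum S) UNIV"
  shows "(\<lambda>N. \<Sum>m\<in>{- int N..<int N}. f m) \<longlonglongrightarrow> S"
proof -
  have "filterlim (\<lambda>N. {- int N..<int N}) (finite_subsets_at_top UNIV) sequentially"
    unfolding filterlim_finite_subsets_at_top
  proof (intro allI impI)
    fix X :: "int set" assume X: "finite X \<and> X \<subseteq> UNIV"
    obtain M where M: "\<And>x. x \<in> X \<Longrightarrow> \<bar>x\<bar> \<le> M"
      using X finite_abs_int_segment by (metis Max_ge finite_imageI image_eqI)
    show "\<forall>\<^sub>F N in sequentially. finite {- int N..<int N} \<and> X \<subseteq> {- int N..<int N} \<and> {- int N..<int N} \<subseteq> UNIV"
      using eventually_gt_at_top[of "nat M"]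
    proof eventually_elim
      case (elim N)
      have "- int N \<le> x \<and> x < int N" if "x \<in> X" for x using M[OF that] elim by linarith
      then show ?case by auto
    qed
  qed
  then show ?thesis
    using assms unfolding has_sum_def by (rule filterlim_compose[rotated])
qed

lemma abs_summable_inverse_square_nat:
  fixes z :: complex
  shows "summable (\<lambda>k. norm (1 / (z + of_nat k)\<^sup>2))"
proof (rule summable_comparison_test_ev)
  show "summable (\<lambda>k. 4 * inverse (real k ^ 2))"
    by (intro summable_mult inverse_power_summable) simp
  show "\<forall>\<^sub>F k in sequentially. norm (norm (1 / (z + of_nat k)\<^sup>2)) \<le> 4 * inverse (real k ^ 2)"
    using eventually_gt_at_top[of "nat \<lceil>2 * norm z\<rceil>"]
  proof eventually_elim
    case (elim k)
    then have k: "2 * norm z < real k" by linarith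
    have "real k - norm z \<le> norm (z + of_nat k)"
      using norm_triangle_ineq4[of "z + of_nat k" z] by simp
    then have "real k / 2 \<le> norm (z + of_nat k)" using k by linarith
    then have "(real k / 2)\<^sup>2 \<le> (norm (z + of_nat k))\<^sup>2" by (intro power_mono) auto
    moreover have "0 < real k" using k norm_ge_zero[of z] by linarith
    ultimately have "1 / (norm (z + of_nat k))\<^sup>2 \<le> 1 / (real k / 2)\<^sup>2"
      by (intro divide_left_mono) (auto intro!: mult_pos_pos zero_less_power simp: zero_less_norm_iff)
    then show ?case by (simp add: norm_divide norm_power power_divide field_simps)
  qed
qed

text \<open>The logarithmic derivative of the reflection formula of the Gamma function.\<close>

lemma Digamma_reflection:
  fixes z :: complex
  assumes "z \<notin> \<int>"
  shows "Digamma (1 - z) - Digamma z = of_real pi * cot (of_real pi * z)"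
proof -
  have z1: "1 - z \<notin> \<int>"
    using assms by (metis Ints_1 Ints_diff diff_diff_eq2 add_diff_cancel_left')
  have nz: "z \<notin> \<int>\<^sub>\<le>\<^sub>0" "1 - z \<notin> \<int>\<^sub>\<le>\<^sub>0"
    using assms z1 nonpos_Ints_Int by blast+
  have s0: "sin (of_real pi * w) \<noteq> 0" if "w \<notin> \<int>" for w :: complex
  proof
    assume "sin (of_real pi * w) = 0"
    then obtain n :: int where "of_real pi * w = of_real n * of_real pi" by (auto simp: sin_eq_0)
    then have "w = of_int n" by simp
    then show False using that by simp
  qed
  have G0: "Gamma z * Gamma (1 - z) \<noteq> 0"
    unfolding Gamma_reflection_complex using s0[OF assms] by simp
  have d1: "((\<lambda>w. Gamma w * Gamma (1 - w)) has_field_derivative Gamma z * Gamma (1 - z) * (Digamma z - Digamma (1 - z))) (at z)"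
    by (rule DERIV_cong, (rule derivative_eq_intros refl nz)+) (simp add: algebra_simps)
  have d2: "((\<lambda>w. of_real pi / sin (of_real pi * w)) has_field_derivative
      - (of_real pi * (cos (of_real pi * z) * of_real pi)) / (sin (of_real pi * z) * sin (of_real pi * z))) (at z)"
    by (rule DERIV_cong, (rule derivative_eq_intros refl s0[OF assms])+) simp
  have "Gamma z * Gamma (1 - z) * (Digamma z - Digamma (1 - z)) =
      - (of_real pi * (cos (of_real pi * z) * of_real pi)) / (sin (of_real pi * z) * sin (of_real pi * z))"
    using DERIV_unique[OF d1[unfolded Gamma_reflection_complex] d2] unfolding Gamma_reflection_complex .
  then have "(of_real pi / sin (of_real pi * z)) * (Digamma z - Digamma (1 - z)) =
      (of_real pi / sin (of_real pi * z)) * (- (of_real pi * cos (of_real pi * z)) / sin (of_real pi * z))"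
    unfolding Gamma_reflection_complex by (simp add: mult_ac)
  then have "Digamma z - Digamma (1 - z) = - (of_real pi * cos (of_real pi * z)) / sin (of_real pi * z)"
    using s0[OF assms] unfolding mult_cancel_left by simp
  then show ?thesis by (simp add: cot_def algebra_simps)
qed

text \<open>The derivative of \<open>Digamma_reflection\<close>. As \<open>Polygamma 1 z\<close>
  sums \<open>1 / (z + n)^2\<close> over natural \<open>n\<close>, the value at \<open>1 - z\<close>
  supplies the negative integers.\<close>

lemma Polygamma_1_reflection:
  fixes z :: complex
  assumes "z \<notin> \<int>"
  shows "Polygamma 1 (1 - z) + Polygamma 1 z = (of_real pi / sin (of_real pi * z))\<^sup>2"
proof -
  have z1: "1 - z \<notin> \<int>"
    using assms by (metis Ints_1 Ints_diff diff_diff_eq2 add_diff_cancel_left')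
  have nz: "z \<notin> \<int>\<^sub>\<le>\<^sub>0" "1 - z \<notin> \<int>\<^sub>\<le>\<^sub>0"
    using assms z1 nonpos_Ints_Int by blast+
  have s0: "sin (of_real pi * z) \<noteq> 0"
  proof
    assume "sin (of_real pi * z) = 0"
    then obtain n :: int where "of_real pi * z = of_real n * of_real pi" by (auto simp: sin_eq_0)
    then have "z = of_int n" by simp
    then show False using assms by simp
  qed
  have op: "open (- (\<int> :: complex set))" using closed_Ints by blast
  have P: "(Digamma has_field_derivative Polygamma 1 w) (at w)" if "w \<notin> \<int>\<^sub>\<le>\<^sub>0" for w :: complex
    using has_field_derivative_Polygamma[OF that, of 0 UNIV] by simp
  have d1: "((\<lambda>w. Digamma (1 - w) - Digamma w) has_field_derivative Polygamma 1 (1 - z) * (0 - 1) - Polygamma 1 z) (at z)"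
    by (intro DERIV_diff DERIV_chain2[OF P] P nz DERIV_const DERIV_ident)
  have d2: "((\<lambda>w. of_real pi * cot (of_real pi * w)) has_field_derivative
      of_real pi * (- inverse ((sin (of_real pi * z))\<^sup>2) * (of_real pi * 1))) (at z)"
    by (intro DERIV_cmult DERIV_chain2[OF DERIV_cot] DERIV_ident s0)
  have "((\<lambda>w. of_real pi * cot (of_real pi * w)) has_field_derivative Polygamma 1 (1 - z) * (0 - 1) - Polygamma 1 z) (at z)"
    using d1 op by (rule has_field_derivative_transform_within_open) (use assms Digamma_reflection in auto)
  from DERIV_unique[OF this d2]
  have "Polygamma 1 (1 - z) * (0 - 1) - Polygamma 1 z = of_real pi * (- inverse ((sin (of_real pi * z))\<^sup>2) * (of_real pi * 1))" .
  then show ?thesis by (simp add: power_divide field_simps power2_eq_square)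
qed

lemma has_sum_inverse_squares:
  fixes z :: complex
  assumes "z \<notin> \<int>"
  shows "((\<lambda>n::int. 1 / (z + of_int n)\<^sup>2) has_sum (of_real pi / sin (of_real pi * z))\<^sup>2) UNIV"
proof -
  have z: "z \<noteq> 0" "1 - z \<noteq> 0" using assms by auto
  have e: "inverse ((w + of_nat k) ^ Suc 1) = 1 / (w + of_nat k)\<^sup>2" for w :: complex and k
    by (simp add: field_simps power2_eq_square)
  have a: "((\<lambda>n. 1 / (z + of_int (int n))\<^sup>2) has_sum Polygamma 1 z) UNIV"
    using norm_summable_imp_has_sum[OF abs_summable_inverse_square_nat[of z]]
      Polygamma_LIMSEQ[OF z(1), of 1] unfolding e by simp
  have "((\<lambda>n. 1 / (1 - z + of_nat n)\<^sup>2) has_sum Polygamma 1 (1 - z)) UNIV"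
    using norm_summable_imp_has_sum[OF abs_summable_inverse_square_nat[of "1 - z"]]
      Polygamma_LIMSEQ[OF z(2), of 1] unfolding e by simp
  moreover have "(1 - z + of_nat n)\<^sup>2 = (z + of_int (- int n - 1))\<^sup>2" for n
    by (simp add: power2_eq_square algebra_simps)
  ultimately have b: "((\<lambda>n. 1 / (z + of_int (- int n - 1))\<^sup>2) has_sum Polygamma 1 (1 - z)) UNIV"
    by simp
  show ?thesis
    using has_sum_int[OF a b] Polygamma_1_reflection[OF assms] by (simp add: add.commute)
qed

lemma uhp_not_Ints: "z \<in> uhp \<Longrightarrow> z \<notin> \<int>"
  by (auto simp: uhp_def elim!: Ints_cases)

lemma norm_nome_less: "z \<in> uhp \<Longrightarrow> norm (nome z) < 1"
  by (simp add: uhp_def nome_def norm_exp_eq_Re)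

lemma nome_nonzero [simp]: "nome z \<noteq> 0"
  by (simp add: nome_def)

lemma sin_via_nome:
  "(sin (of_real pi * z))\<^sup>2 = - ((1 - nome z)\<^sup>2) / (4 * nome z)"
proof -
  define w where "w = exp (\<i> * (of_real pi * z))"
  have w: "w \<noteq> 0" "exp (- (\<i> * (of_real pi * z))) = 1 / w" by (auto simp: w_def exp_minus field_simps)
  have n: "nome z = w\<^sup>2"
    by (simp add: w_def nome_def exp_double[symmetric] mult_ac)
  have S: "sin (of_real pi * z) = (w - 1 / w) / (2 * \<i>)"
    using w(2) by (simp add: sin_exp_eq w_def)
  have "(w - 1 / w)\<^sup>2 = (1 - w\<^sup>2)\<^sup>2 / w\<^sup>2"
    using w(1) by (simp add: power2_eq_square field_simps)
  then show ?thesis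
    unfolding n S power_divide power_mult_distrib by simp
qed

text \<open>In terms of the nome q of \<open>z\<close>, the square of \<open>pi / sin (pi z)\<close>
  is \<open>- 4 pi^2 q / (1 - q)^2\<close>, and \<open>q / (1 - q)^2\<close> is the series with
  terms \<open>r q^r\<close>.\<close>

lemma has_sum_lipschitz:
  assumes "z \<in> uhp"
  shows "((\<lambda>n::int. 1 / (z + of_int n)\<^sup>2) has_sum
    (- 4 * of_real pi ^ 2 * (\<Sum>\<^sub>\<infinity>r\<in>{1..}. of_nat r * nome z ^ r))) UNIV"
proof -
  have q: "norm (nome z) < 1" using norm_nome_less assms by blast
  have "(\<lambda>n. nome z * (of_nat (Suc n) * nome z ^ n)) sums (nome z * (1 / (1 - nome z)\<^sup>2))"
    by (intro sums_mult geometric_deriv_sums q)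
  then have s: "(\<lambda>n. of_nat (Suc n) * nome z ^ Suc n) sums (nome z / (1 - nome z)\<^sup>2)"
    by (simp add: mult_ac)
  have "summable (\<lambda>n. norm (nome z) * (of_nat (Suc n) * norm (nome z) ^ n))"
    by (intro summable_mult sums_summable[OF geometric_deriv_sums]) (use q in auto)
  then have "summable (\<lambda>n. norm (of_nat (Suc n) * nome z ^ Suc n))"
    by (simp add: norm_mult norm_power mult_ac del: of_nat_Suc)
  from norm_summable_imp_has_sum[OF this s]
  have "((\<lambda>r. of_nat r * nome z ^ r) \<circ> Suc has_sum nome z / (1 - nome z)\<^sup>2) UNIV" by (simp add: o_def)
  then have "((\<lambda>r. of_nat r * nome z ^ r) has_sum nome z / (1 - nome z)\<^sup>2) (range Suc)"
    by (subst has_sum_reindex) auto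
  also have "range Suc = {1..}" by (auto simp: image_def) (metis Suc_le_D)
  finally have 1: "(\<Sum>\<^sub>\<infinity>r\<in>{1..}. of_nat r * nome z ^ r) = nome z / (1 - nome z)\<^sup>2"
    by (rule infsumI)
  have "nome z \<noteq> 1" using q by auto
  then have "(of_real pi / sin (of_real pi * z))\<^sup>2 = - 4 * of_real pi ^ 2 * (nome z / (1 - nome z)\<^sup>2)"
    unfolding power_divide sin_via_nome by (simp add: field_simps)
  then show ?thesis
    using has_sum_inverse_squares[OF uhp_not_Ints[OF assms]] 1 by simp
qed

text \<open>The terms are not absolutely summable, which is why the window matters. The logarithms
  in the limits defining \<open>Digamma (1 - u)\<close> and \<open>Digamma u\<close> cancel in the
  difference, and \<open>Digamma_reflection\<close> evaluates it.\<close>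

lemma cot_symmetric_limit:
  fixes u :: complex
  assumes "u \<notin> \<int>"
  shows "(\<lambda>N. \<Sum>m\<in>{- int N..<int N}. 1 / (u + of_int m)) \<longlonglongrightarrow> of_real pi * cot (of_real pi * u)"
proof -
  have u: "u \<noteq> 0" "1 - u \<noteq> 0" using assms by auto
  have "(\<lambda>m. (of_real (ln (real m)) - (\<Sum>n<m. inverse (1 - u + of_nat n))) -
        (of_real (ln (real m)) - (\<Sum>n<m. inverse (u + of_nat n)))) \<longlonglongrightarrow> Digamma (1 - u) - Digamma u"
    by (intro tendsto_diff Digamma_LIMSEQ u)
  moreover have "(of_real (ln (real N)) - (\<Sum>n<N. inverse (1 - u + of_nat n))) -
        (of_real (ln (real N)) - (\<Sum>n<N. inverse (u + of_nat n))) = (\<Sum>m\<in>{- int N..<int N}. 1 / (u + of_int m))" for N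
  proof -
    have eq: "{- int N..<int N} = int ` {..<N} \<union> (\<lambda>n. - int n - 1) ` {..<N}" (is "?L = ?R")
    proof (intro equalityI subsetI)
      fix x assume x: "x \<in> ?L"
      show "x \<in> ?R"
      proof (cases "x \<ge> 0")
        case True then show ?thesis using x by (auto intro!: image_eqI[of _ _ "nat x"])
      next
        case False then show ?thesis using x by (auto intro!: image_eqI[of _ _ "nat (- x - 1)"])
      qed
    qed auto
    have "(\<Sum>m\<in>{- int N..<int N}. 1 / (u + of_int m)) =
        (\<Sum>m\<in>int ` {..<N}. 1 / (u + of_int m)) + (\<Sum>m\<in>(\<lambda>n. - int n - 1) ` {..<N}. 1 / (u + of_int m))"
      unfolding eq by (rule sum.union_disjoint) auto
    also have "(\<Sum>m\<in>int ` {..<N}. 1 / (u + of_int m)) = (\<Sum>n<N. inverse (u + of_nat n))"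
      by (subst sum.reindex) (auto simp: inj_on_def field_simps)
    also have "(\<Sum>m\<in>(\<lambda>n. - int n - 1) ` {..<N}. 1 / (u + of_int m)) = (\<Sum>n<N. 1 / (u + of_int (- int n - 1)))"
      by (subst sum.reindex) (auto simp: inj_on_def)
    also have "\<dots> = (\<Sum>n<N. - inverse (1 - u + of_nat n))"
    proof (rule sum.cong[OF refl])
      fix n
      have "u + of_int (- int n - 1) = - (1 - u + of_nat n)" by simp
      then show "1 / (u + of_int (- int n - 1)) = - inverse (1 - u + of_nat n)"
        by (metis inverse_eq_divide inverse_minus_eq)
    qed
    finally show ?thesis by (simp add: sum_negf)
  qed
  ultimately show ?thesis using Digamma_reflection[OF assms] by simp
qed


section \<open>Lattice sums and the inversion law of \<open>E2\<close>\<close>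

lemma summable_on_int_inverse_square: "(\<lambda>m::int. 1 / (1 + (of_int m)\<^sup>2) :: real) summable_on UNIV"
proof -
  have "summable (\<lambda>n. norm (1 / (1 + (real (n + j))\<^sup>2)))" for j
  proof (rule summable_comparison_test_ev)
    show "summable (\<lambda>k. inverse (real k ^ 2))" by (intro inverse_power_summable) simp
    show "\<forall>\<^sub>F k in sequentially. norm (norm (1 / (1 + (real (k + j))\<^sup>2))) \<le> inverse (real k ^ 2)"
      using eventually_gt_at_top[of 0]
    proof eventually_elim
      case (elim k)
      have "(real k)\<^sup>2 \<le> (real (k + j))\<^sup>2" by (intro power_mono) auto
      moreover have "0 < (real k)\<^sup>2" using elim by simp
      ultimately have "1 / (1 + (real (k + j))\<^sup>2) \<le> 1 / (real k)\<^sup>2"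
        by (intro divide_left_mono mult_pos_pos) linarith+
      then show ?case by (simp add: inverse_eq_divide)
    qed
  qed
  then have s: "(\<lambda>n. 1 / (1 + (real (n + j))\<^sup>2)) summable_on UNIV" for j
    by (rule norm_summable_imp_summable_on)
  have "((\<lambda>n. 1 / (1 + (of_int (int n))\<^sup>2) :: real) has_sum infsum (\<lambda>n. 1 / (1 + (real (n + 0))\<^sup>2)) UNIV) UNIV"
    using has_sum_infsum[OF s[of 0]] by simp
  moreover have "((\<lambda>n. 1 / (1 + (of_int (- int n - 1))\<^sup>2) :: real) has_sum infsum (\<lambda>n. 1 / (1 + (real (n + 1))\<^sup>2)) UNIV) UNIV"
  proof -
    have e: "(real_of_int (- int n - 1))\<^sup>2 = (real (n + 1))\<^sup>2" for n by (simp add: power2_eq_square algebra_simps)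
    show ?thesis unfolding e using has_sum_infsum[OF s[of 1]] .
  qed
  ultimately have "((\<lambda>m::int. 1 / (1 + (of_int m)\<^sup>2) :: real) has_sum
      (infsum (\<lambda>n. 1 / (1 + (real (n + 0))\<^sup>2)) UNIV + infsum (\<lambda>n. 1 / (1 + (real (n + 1))\<^sup>2)) UNIV)) UNIV"
    by (rule has_sum_int)
  then show ?thesis by (rule has_sum_imp_summable)
qed

lemma has_sum_diff:
  fixes f g :: "'a \<Rightarrow> 'b :: topological_ab_group_add"
  assumes "(f has_sum a) A" "(g has_sum b) A"
  shows "((\<lambda>x. f x - g x) has_sum (a - b)) A"
  using has_sum_add[OF assms(1), of "\<lambda>x. - g x" "- b"] assms(2) by (simp add: has_sum_uminus)

lemma has_sum_finite_sum:
  fixes f :: "'a \<Rightarrow> 'i \<Rightarrow> 'b :: topological_comm_monoid_add"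
  assumes "finite I" "\<And>i. i \<in> I \<Longrightarrow> ((\<lambda>x. f x i) has_sum s i) A"
  shows "((\<lambda>x. \<Sum>i\<in>I. f x i) has_sum (\<Sum>i\<in>I. s i)) A"
  using assms by (induction I rule: finite_induct) (auto intro!: has_sum_add)

lemma summable_on_Times_real:
  fixes a :: "'a \<Rightarrow> real" and b :: "'b \<Rightarrow> real"
  assumes "a summable_on A" "b summable_on B" "\<And>x. x \<in> A \<Longrightarrow> a x \<ge> 0" "\<And>y. y \<in> B \<Longrightarrow> b y \<ge> 0"
  shows "(\<lambda>(x,y). a x * b y) summable_on A \<times> B"
proof (rule summable_on_SigmaI)
  show "((\<lambda>y. case (x, y) of (x, y) \<Rightarrow> a x * b y) has_sum a x * infsum b B) B" for x
    using has_sum_cmult_right[OF has_sum_infsum[OF assms(2)]] by simp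
  show "(\<lambda>x. a x * infsum b B) summable_on A"
    using assms(1) by (rule summable_on_cmult_left)
qed (use assms in auto)

text \<open>The imaginary part of the lattice point controls \<open>m\<close>, and with it the
  triangle inequality controls \<open>n\<close>.\<close>

lemma lattice_norm_bound:
  assumes "\<tau> \<in> uhp"
  obtains \<delta> :: real where "\<delta> > 0" "\<And>m n::int. \<delta> * (\<bar>of_int m\<bar> + \<bar>of_int n\<bar>) \<le> norm (of_int m * \<tau> + of_int n)"
proof -
  define y where "y = Im \<tau>"
  have y: "y > 0" using assms by (simp add: uhp_def y_def)
  define \<delta> where "\<delta> = 1 / (1 / y + 1 + norm \<tau> / y)"
  have D: "1 / y + 1 + norm \<tau> / y > 0" using y by (intro add_pos_nonneg) auto
  show ?thesis
  proof (rule that[of \<delta>])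
    show "\<delta> > 0" using D by (simp add: \<delta>_def)
    fix m n :: int
    let ?x = "of_int m * \<tau> + of_int n"
    have "\<bar>Im ?x\<bar> \<le> norm ?x" by (rule abs_Im_le_cmod)
    then have m: "\<bar>of_int m\<bar> * y \<le> norm ?x" using y by (simp add: abs_mult y_def)
    then have m': "\<bar>of_int m\<bar> \<le> norm ?x / y" using y by (simp add: field_simps)
    have "norm (of_int n :: complex) \<le> norm ?x + norm (of_int m * \<tau>)"
      using norm_triangle_ineq4[of ?x "of_int m * \<tau>"] by simp
    then have "\<bar>of_int n\<bar> \<le> norm ?x + \<bar>of_int m\<bar> * norm \<tau>" by (simp add: norm_mult)
    also have "\<dots> \<le> norm ?x + norm ?x / y * norm \<tau>"
      using m' by (intro add_left_mono mult_right_mono) auto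
    finally have "\<bar>of_int m\<bar> + \<bar>of_int n\<bar> \<le> norm ?x * (1 / y + 1 + norm \<tau> / y)"
      using m' by (simp add: algebra_simps)
    then show "\<delta> * (\<bar>of_int m\<bar> + \<bar>of_int n\<bar>) \<le> norm ?x"
      using D by (simp add: \<delta>_def field_simps)
  qed
qed

text \<open>The term \<open>1/x\<^sup>2\<close> at \<open>x = 0\<close> is the junk value \<open>0\<close>, which is what the Eisenstein sum needs there.\<close>

definition eis_diff :: "complex \<Rightarrow> int \<Rightarrow> int \<Rightarrow> complex" where
  "eis_diff \<tau> m n = 1 / (of_int m * \<tau> + of_int n)\<^sup>2 - 1 / ((of_int m * \<tau> + of_int n)\<^sup>2 - 1/4)"

definition eis_row :: "complex \<Rightarrow> int \<Rightarrow> complex" where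
  "eis_row \<tau> m = (\<Sum>\<^sub>\<infinity>n. 1 / (of_int m * \<tau> + of_int n)\<^sup>2)"

lemma lattice_ne_half:
  assumes "\<tau> \<in> uhp"
  shows "of_int m * \<tau> + of_int n - 1/2 \<noteq> 0" "of_int m * \<tau> + of_int n + 1/2 \<noteq> 0"
proof -
  have *: False if "of_int m * \<tau> + of_int n = c" "Im c = 0" "2 * Re c = of_int j" "odd j" for c j
  proof -
    have "of_int m * Im \<tau> = 0" using that(1,2) by (auto simp: complex_eq_iff)
    then have "m = 0" using assms by (simp add: uhp_def)
    then have "2 * real_of_int n = of_int j" using that by (auto simp: complex_eq_iff)
    then have "2 * n = j" by linarith
    then show False using that by auto
  qed
  show "of_int m * \<tau> + of_int n - 1/2 \<noteq> 0" using *[of "1/2" 1] by auto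
  show "of_int m * \<tau> + of_int n + 1/2 \<noteq> 0" using *[of "-1/2" "-1"] by (auto simp: eq_neg_iff_add_eq_0)
qed

text \<open>The terms \<open>1 / x^2\<close> are not absolutely summable over the lattice.
  Subtracting \<open>1 / (x^2 - 1/4)\<close> leaves \<open>- 1 / (x^2 (2x - 1) (2x + 1))\<close>,
  and since \<open>2x - 1\<close> and \<open>2x + 1\<close> are lattice points too, this decays with
  the fourth power. The subtracted term is chosen because it telescopes.\<close>

lemma eis_diff_summable:
  assumes "\<tau> \<in> uhp"
  shows "(\<lambda>(m,n). eis_diff \<tau> m n) summable_on UNIV \<times> UNIV"
proof -
  obtain \<delta> :: real where \<delta>: "\<delta> > 0" "\<And>m n::int. \<delta> * (\<bar>of_int m\<bar> + \<bar>of_int n\<bar>) \<le> norm (of_int m * \<tau> + of_int n)"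
    using lattice_norm_bound[OF assms] by metis
  \<comment> \<open>The summand 4 is the value of \<open>eis_diff\<close> at
    \<open>m = n = 0\<close>; the other one serves all remaining lattice points.\<close>
  define K where "K = 4 + 4 / \<delta> ^ 4"
  have bound: "norm (eis_diff \<tau> m n) \<le> K * (1 / (1 + (of_int m)\<^sup>2) * (1 / (1 + (of_int n)\<^sup>2)))" for m n
  proof (cases "m = 0 \<and> n = 0")
    case True
    then show ?thesis using \<delta>(1) by (simp add: eis_diff_def K_def)
  next
    case False
    define x where "x = of_int m * \<tau> + of_int n"
    define s where "s = (\<bar>of_int m\<bar> + \<bar>of_int n\<bar> :: real)"
    have s1: "s \<ge> 1" using False by (simp add: s_def) linarith
    have x1: "\<delta> * s \<le> norm x" using \<delta>(2) by (simp add: x_def s_def)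
    then have "norm x > 0" using \<delta>(1) s1 by (smt (verit) mult_pos_pos)
    then have x0: "x \<noteq> 0" by simp
    have h: "x - 1/2 \<noteq> 0" "x + 1/2 \<noteq> 0" using lattice_ne_half[OF assms] by (auto simp: x_def)
    have "\<bar>n\<bar> \<le> \<bar>2 * n - 1\<bar>" "\<bar>n\<bar> \<le> \<bar>2 * n + 1\<bar>" by arith+
    then have abs2: "\<bar>of_int n\<bar> \<le> \<bar>real_of_int (2 * n - 1)\<bar>" "\<bar>of_int n\<bar> \<le> \<bar>real_of_int (2 * n + 1)\<bar>"
      unfolding of_int_abs[symmetric] of_int_le_iff .
    have "\<delta> * s \<le> \<delta> * (\<bar>of_int (2 * m)\<bar> + \<bar>of_int (2 * n - 1)\<bar>)"
      using \<delta>(1) abs2(1) unfolding s_def by (intro mult_left_mono add_mono) auto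
    also have "\<dots> \<le> norm (2 * x - 1)" using \<delta>(2)[of "2*m" "2*n-1"] by (simp add: x_def algebra_simps)
    finally have x2: "\<delta> * s \<le> norm (2 * x - 1)" .
    have "\<delta> * s \<le> \<delta> * (\<bar>of_int (2 * m)\<bar> + \<bar>of_int (2 * n + 1)\<bar>)"
      using \<delta>(1) abs2(2) unfolding s_def by (intro mult_left_mono add_mono) auto
    also have "\<dots> \<le> norm (2 * x + 1)" using \<delta>(2)[of "2*m" "2*n+1"] by (simp add: x_def algebra_simps)
    finally have x3: "\<delta> * s \<le> norm (2 * x + 1)" .
    define y where "y = (2 * x - 1) * (2 * x + 1)"
    have x4: "x\<^sup>2 - 1/4 = y / 4" "y = 4 * x\<^sup>2 - 1" by (simp_all add: y_def power2_eq_square algebra_simps)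
    have h': "2 * x - 1 \<noteq> 0" "2 * x + 1 \<noteq> 0"
    proof -
      show "2 * x - 1 \<noteq> 0" using h(1) by (auto simp: field_simps)
      show "2 * x + 1 \<noteq> 0" using h(2) by (auto simp: add_eq_0_iff field_simps)
    qed
    have y0: "y \<noteq> 0" using h' by (simp add: y_def)
    have "eis_diff \<tau> m n = 1 / x\<^sup>2 - 4 / y"
      unfolding eis_diff_def x_def[symmetric] x4(1) by simp
    also have "\<dots> = (y - 4 * x\<^sup>2) / (x\<^sup>2 * y)" using x0 y0 by (simp add: field_simps)
    also have "y - 4 * x\<^sup>2 = - 1" by (simp add: x4(2))
    finally have "eis_diff \<tau> m n = - 1 / (x\<^sup>2 * ((2 * x - 1) * (2 * x + 1)))" by (simp add: y_def)
    then have "norm (eis_diff \<tau> m n) = 1 / (norm x * norm x * (norm (2 * x - 1) * norm (2 * x + 1)))"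
      by (simp add: norm_divide norm_mult norm_power power2_eq_square)
    also have "\<dots> \<le> 1 / (\<delta> * s * (\<delta> * s) * (\<delta> * s * (\<delta> * s)))"
      using x1 x2 x3 \<delta>(1) s1 x0 h' by (intro divide_left_mono mult_mono mult_pos_pos) auto
    also have "\<dots> = 4 / \<delta> ^ 4 * (1 / (2 * s\<^sup>2) * (1 / (2 * s\<^sup>2)))"
      by (simp add: power2_eq_square power4_eq_xxxx)
    also have "\<dots> \<le> K * (1 / (1 + (of_int m)\<^sup>2) * (1 / (1 + (of_int n)\<^sup>2)))"
    proof -
      have "(of_int m)\<^sup>2 \<le> s\<^sup>2" "(of_int n)\<^sup>2 \<le> s\<^sup>2" "1 \<le> s\<^sup>2"
        using s1 by (auto simp: s_def abs_le_square_iff[symmetric])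
      then have "1 + (of_int m)\<^sup>2 \<le> 2 * s\<^sup>2" "1 + (of_int n)\<^sup>2 \<le> 2 * s\<^sup>2" by linarith+
      then have "1 / (2 * s\<^sup>2) \<le> 1 / (1 + (of_int m)\<^sup>2)" "1 / (2 * s\<^sup>2) \<le> 1 / (1 + (of_int n)\<^sup>2)"
        using s1 by (auto intro!: divide_left_mono mult_pos_pos add_pos_nonneg zero_less_power)
      then show ?thesis using \<delta>(1) unfolding K_def by (intro mult_mono) auto
    qed
    finally show ?thesis .
  qed
  have "(\<lambda>(m,n). 1 / (1 + (of_int m)\<^sup>2) * (1 / (1 + (of_int n)\<^sup>2)) :: real) summable_on (UNIV :: int set) \<times> (UNIV :: int set)"
    by (rule summable_on_Times_real) (use summable_on_int_inverse_square in auto)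
  then have "(\<lambda>(m,n). K * (1 / (1 + (of_int m)\<^sup>2) * (1 / (1 + (of_int n)\<^sup>2))) :: real) summable_on (UNIV :: int set) \<times> (UNIV :: int set)"
    unfolding case_prod_beta by (rule summable_on_cmult_right)
  then have "(\<lambda>p. norm (case p of (m,n) \<Rightarrow> eis_diff \<tau> m n)) summable_on UNIV \<times> UNIV"
    by (rule summable_on_comparison_test) (use bound in auto)
  then show ?thesis by (rule abs_summable_summable)
qed

lemma has_sum_eis_row:
  assumes "\<tau> \<in> uhp" "m \<noteq> 0"
  shows "((\<lambda>n::int. 1 / (of_int m * \<tau> + of_int n)\<^sup>2) has_sum
    (- 4 * of_real pi ^ 2 * (\<Sum>\<^sub>\<infinity>r\<in>{1..}. of_nat r * nome \<tau> ^ (nat \<bar>m\<bar> * r)))) UNIV"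
proof -
  define M where "M = nat \<bar>m\<bar>"
  have M: "M > 0" using assms(2) by (simp add: M_def)
  have u: "of_nat M * \<tau> \<in> uhp" using assms(1) M by (simp add: uhp_def)
  have n: "nome (of_nat M * \<tau>) = nome \<tau> ^ M"
    by (simp add: nome_def exp_of_nat_mult[symmetric] mult_ac)
  have 1: "((\<lambda>n::int. 1 / (of_nat M * \<tau> + of_int n)\<^sup>2) has_sum
    (- 4 * of_real pi ^ 2 * (\<Sum>\<^sub>\<infinity>r\<in>{1..}. of_nat r * nome \<tau> ^ (M * r)))) UNIV"
    using has_sum_lipschitz[OF u] unfolding n power_mult .
  show ?thesis
  proof (cases "m > 0")
    case True
    then have "of_nat M = (of_int m :: complex)" by (simp add: M_def)
    then show ?thesis using 1 by (simp add: M_def)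
  next
    case False
    then have eq: "(of_int m * \<tau> + of_int (- n))\<^sup>2 = (of_nat M * \<tau> + of_int n)\<^sup>2" for n
    proof -
      have "of_int m = - (of_nat M :: complex)" using False by (simp add: M_def)
      then have "of_int m * \<tau> + of_int (- n) = - (of_nat M * \<tau> + of_int n)" by simp
      then show ?thesis by (metis power2_minus)
    qed
    have "bij_betw uminus (UNIV :: int set) UNIV" by (rule bij_uminus)
    from has_sum_reindex_bij_betw[OF this, of "\<lambda>n. 1 / (of_int m * \<tau> + of_int n)\<^sup>2"]
    show ?thesis using 1 unfolding eq M_def by blast
  qed
qed

lemma has_sum_eis_row_0: "((\<lambda>n::int. 1 / (of_int n)\<^sup>2) has_sum (of_real pi ^ 2 / 3 :: complex)) UNIV"
proof -
  have "((\<lambda>n. 1 / (real n + 1)\<^sup>2) has_sum (pi\<^sup>2 / 6)) UNIV"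
    by (rule sums_nonneg_imp_has_sum) (use inverse_squares_sums in \<open>auto simp: add_ac\<close>)
  then have r: "((\<lambda>n. of_real (1 / (real n + 1)\<^sup>2) :: complex) has_sum of_real (pi\<^sup>2 / 6)) UNIV"
    by (rule has_sum_of_real)
  then have 2: "((\<lambda>n. 1 / (of_int (- int n - 1))\<^sup>2 :: complex) has_sum of_real (pi\<^sup>2 / 6)) UNIV"
  proof (rule has_sum_cong[THEN iffD1, rotated])
    fix n
    have "(of_int (- int n - 1) :: complex) = - (of_nat n + 1)" by simp
    then show "of_real (1 / (real n + 1)\<^sup>2) = (1 / (of_int (- int n - 1))\<^sup>2 :: complex)"
      by (simp only: power2_minus) simp
  qed
  have "((\<lambda>n. 1 / (of_int (int n))\<^sup>2 :: complex) has_sum of_real (pi\<^sup>2 / 6)) (range Suc)"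
    by (subst has_sum_reindex) (use r in \<open>auto simp: o_def add_ac\<close>)
  then have "((\<lambda>n. 1 / (of_int (int n))\<^sup>2 :: complex) has_sum of_real (pi\<^sup>2 / 6)) UNIV"
    by (rule has_sum_cong_neutral[THEN iffD1, rotated -1]) (auto simp: image_iff, metis not0_implies_Suc)
  from has_sum_int[OF this 2] show ?thesis by (simp add: of_real_power)
qed

lemma eis_row_0: "eis_row \<tau> 0 = of_real pi ^ 2 / 3"
  unfolding eis_row_def using infsumI[OF has_sum_eis_row_0] by simp

lemma has_sum_eis_row':
  assumes "\<tau> \<in> uhp"
  shows "((\<lambda>n::int. 1 / (of_int m * \<tau> + of_int n)\<^sup>2) has_sum eis_row \<tau> m) UNIV"
proof (cases "m = 0")
  case True
  then show ?thesis using has_sum_eis_row_0 unfolding True eis_row_0 by simp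
next
  case False
  from has_sum_eis_row[OF assms this] show ?thesis
    unfolding eis_row_def using has_sum_infsum summable_on_def by blast
qed

lemma E2_double_summable:
  assumes "\<tau> \<in> uhp"
  shows "(\<lambda>(m, r). norm (of_nat m * nome \<tau> ^ (m * r))) summable_on {1..} \<times> {1..}"
proof -
  define x where "x = norm (nome \<tau>)"
  have x: "0 < x" "x < 1" using norm_nome_less[OF assms] by (auto simp: x_def)
  have s1: "(\<lambda>m. real m * x ^ m) summable_on {1..}"
  proof -
    have "summable (\<lambda>n. x * (of_nat (Suc n) * x ^ n))"
      by (intro summable_mult sums_summable[OF geometric_deriv_sums]) (use x in auto)
    then have "summable (\<lambda>n. norm (real (Suc n) * x ^ Suc n))"
      using x by (simp add: mult_ac del: of_nat_Suc)
    then have "(\<lambda>n. real (Suc n) * x ^ Suc n) summable_on UNIV" by (rule norm_summable_imp_summable_on)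
    then have "(\<lambda>m. real m * x ^ m) summable_on range Suc"
      by (subst summable_on_reindex) (auto simp: o_def)
    also have "range Suc = {1..}" by (auto simp: image_def) (metis Suc_le_D)
    finally show ?thesis .
  qed
  have s2: "(\<lambda>r. x ^ r) summable_on {1..}"
  proof (rule summable_on_subset)
    show "(\<lambda>r. x ^ r) summable_on UNIV"
      by (rule norm_summable_imp_summable_on) (use x in \<open>simp add: summable_geometric\<close>)
  qed simp
  have "(\<lambda>(m, r). real m * x ^ m * (x ^ r)) summable_on {1..} \<times> {1..}"
    by (rule summable_on_Times_real[OF s1 s2]) (use x in auto)
  then have "(\<lambda>(m, r). (1 / x) * (real m * x ^ m * (x ^ r))) summable_on {1..} \<times> {1..}"
    unfolding case_prod_beta by (rule summable_on_cmult_right)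
  then show ?thesis
  proof (rule summable_on_comparison_test)
    fix p :: "nat \<times> nat" assume "p \<in> {1..} \<times> {1..}"
    then obtain m r where p: "p = (m, r)" "m \<ge> 1" "r \<ge> 1" by auto
    \<comment> \<open>Equivalent to \<open>(m - 1) (r - 1) \<ge> 0\<close>; it separates the two
      variables at the price of one factor \<open>1 / x\<close>.\<close>
    have "m + r \<le> m * r + 1" using p(2,3) by (cases m; cases r) auto
    then have "x ^ (m * r + 1) \<le> x ^ (m + r)" using x by (intro power_decreasing) auto
    then have "x ^ (m * r) \<le> (1 / x) * (x ^ m * x ^ r)" using x by (simp add: field_simps power_add)
    then have "real m * x ^ (m * r) \<le> real m * ((1 / x) * (x ^ m * x ^ r))" by (intro mult_left_mono) auto
    then show "(case p of (m, r) \<Rightarrow> norm (of_nat m * nome \<tau> ^ (m * r))) \<le> (case p of (m, r) \<Rightarrow> (1 / x) * (real m * x ^ m * x ^ r))"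
      using p by (simp add: norm_mult norm_power x_def mult_ac)
  qed (auto simp: case_prod_beta)
qed

text \<open>Row 0 contributes twice zeta(2), which is \<open>pi^2 / 3\<close>. The rows
  \<open>m\<close> and \<open>- m\<close> agree, and the Lipschitz formula turns each into a series
  in the nome; the factor \<open>r\<close> there plays the part of \<open>m\<close> in the
  definition of \<open>E2\<close>, so the double series is swapped.\<close>

lemma has_sum_eis_row_E2:
  assumes "\<tau> \<in> uhp"
  shows "(eis_row \<tau> has_sum (of_real pi ^ 2 / 3 * E2 \<tau>)) UNIV"
proof -
  define P where "P = (\<Sum>\<^sub>\<infinity>(m, r)\<in>{1..} \<times> {1..}. of_nat m * nome \<tau> ^ (m * r))"
  define f where "f = (\<lambda>(m, r). of_nat m * nome \<tau> ^ (m * r))"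
  have "(\<lambda>p. norm (f p)) = (\<lambda>(m, r). norm (of_nat m * nome \<tau> ^ (m * r)))"
    by (auto simp: f_def fun_eq_iff)
  then have "f summable_on {1..} \<times> {1..}"
    using E2_double_summable[OF assms] by (metis abs_summable_summable)
  then have P1: "(f has_sum P) ({1..} \<times> {1..})" unfolding P_def f_def by (rule has_sum_infsum)
  then have P2: "((\<lambda>(r, m). f (m, r)) has_sum P) ({1..} \<times> {1..})" by (subst (asm) has_sum_swap)
  have sl: "(\<lambda>r. of_nat r * nome \<tau> ^ (m * r)) summable_on {1..}" if "m \<in> {1..}" for m
  proof -
    have "(\<lambda>(r, m). f (m, r)) summable_on {1..} \<times> {1..}" using P2 summable_on_def by blast
    from summable_on_SigmaD1[OF this that] show ?thesis by (simp add: f_def mult_ac)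
  qed
  have "((\<lambda>m. \<Sum>\<^sub>\<infinity>r\<in>{1..}. of_nat r * nome \<tau> ^ (m * r)) has_sum P) {1..}"
  proof (rule has_sum_SigmaD[OF P2])
    show "((\<lambda>r. case (m, r) of (r, m) \<Rightarrow> f (m, r)) has_sum (\<Sum>\<^sub>\<infinity>r\<in>{1..}. of_nat r * nome \<tau> ^ (m * r))) {1..}"
      if "m \<in> {1..}" for m
      using has_sum_infsum[OF sl[OF that]] by (simp add: f_def mult_ac)
  qed
  then have *: "((\<lambda>m. - 4 * of_real pi ^ 2 * (\<Sum>\<^sub>\<infinity>r\<in>{1..}. of_nat r * nome \<tau> ^ (m * r))) has_sum - 4 * of_real pi ^ 2 * P) {1..}"
    by (rule has_sum_cmult_right)
  have row: "eis_row \<tau> m = - 4 * of_real pi ^ 2 * (\<Sum>\<^sub>\<infinity>r\<in>{1..}. of_nat r * nome \<tau> ^ (nat \<bar>m\<bar> * r))" if "m \<noteq> 0" for m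
    unfolding eis_row_def using infsumI[OF has_sum_eis_row[OF assms that]] .
  have a: "((\<lambda>m. eis_row \<tau> (int m)) has_sum - 4 * of_real pi ^ 2 * P) {1..}"
    using * by (rule has_sum_cong[THEN iffD1, rotated]) (simp add: row)
  then have "((\<lambda>m. eis_row \<tau> (int m)) has_sum (of_real pi ^ 2 / 3 + - 4 * of_real pi ^ 2 * P)) ({0} \<union> {1..})"
    using eis_row_0 by (intro has_sum_Un_disjoint) (auto simp: has_sum_finite_iff)
  moreover have "{0} \<union> {1..} = (UNIV :: nat set)" by auto
  ultimately have 1: "((\<lambda>m. eis_row \<tau> (int m)) has_sum (of_real pi ^ 2 / 3 + - 4 * of_real pi ^ 2 * P)) UNIV" by simp
  have 2: "((\<lambda>m. eis_row \<tau> (- int m - 1)) has_sum - 4 * of_real pi ^ 2 * P) UNIV"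
  proof -
    have r: "range Suc = {1..}" by (auto simp: image_def) (metis Suc_le_D)
    have "((\<lambda>m. eis_row \<tau> (int m)) has_sum - 4 * of_real pi ^ 2 * P) (range Suc)" using a unfolding r .
    then have "((\<lambda>m. eis_row \<tau> (int (Suc m))) has_sum - 4 * of_real pi ^ 2 * P) UNIV"
      by (subst (asm) has_sum_reindex) (auto simp: o_def)
    moreover have "eis_row \<tau> (int (Suc m)) = eis_row \<tau> (- int m - 1)" for m
    proof -
      have "\<bar>- int m - 1\<bar> = \<bar>int (Suc m)\<bar>" by simp
      then show ?thesis using row[of "int (Suc m)"] row[of "- int m - 1"] by simp
    qed
    ultimately show ?thesis by simp
  qed
  have E: "of_real pi ^ 2 / 3 * E2 \<tau> = (of_real pi ^ 2 / 3 + - 4 * of_real pi ^ 2 * P) + - 4 * of_real pi ^ 2 * P"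
    unfolding E2_def P_def[symmetric] by (simp add: field_simps)
  show ?thesis unfolding E by (rule has_sum_int[OF 1 2])
qed

lemma cot_via_nome:
  assumes "nome (- u) \<noteq> 1"
  shows "cot (of_real pi * u) = \<i> * (1 + nome (- u)) / (1 - nome (- u))"
proof -
  define w where "w = exp (\<i> * (of_real pi * u))"
  have w: "w \<noteq> 0" "exp (- (\<i> * (of_real pi * u))) = 1 / w" by (auto simp: w_def exp_minus field_simps)
  have n: "nome (- u) = 1 / w\<^sup>2"
  proof -
    have "nome (- u) = exp (2 * (- (\<i> * (of_real pi * u))))" by (simp add: nome_def mult_ac)
    also have "\<dots> = (1 / w)\<^sup>2" unfolding exp_double w(2) ..
    finally show ?thesis by (simp add: power_divide)
  qed
  have ww: "w\<^sup>2 - 1 \<noteq> 0" using assms w(1) unfolding n by auto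
  have S: "sin (of_real pi * u) = (w - 1 / w) / (2 * \<i>)" "cos (of_real pi * u) = (w + 1 / w) / 2"
    using w(2) by (auto simp: sin_exp_eq cos_exp_eq w_def)
  have "cot (of_real pi * u) = \<i> * (w + 1 / w) / (w - 1 / w)"
  proof -
    have "(a / 2) / (b / (2 * \<i>)) = \<i> * a / b" for a b by (cases "b = 0") (auto simp: field_simps)
    then show ?thesis unfolding cot_def S .
  qed
  also have "w + 1 / w = (w\<^sup>2 + 1) / w" using w(1) by (simp add: field_simps power2_eq_square)
  also have "w - 1 / w = (w\<^sup>2 - 1) / w" using w(1) by (simp add: field_simps power2_eq_square)
  also have "\<i> * ((w\<^sup>2 + 1) / w) / ((w\<^sup>2 - 1) / w) = \<i> * (w\<^sup>2 + 1) / (w\<^sup>2 - 1)" using w(1) by simp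
  also have "\<dots> = \<i> * (1 + nome (- u)) / (1 - nome (- u))"
    unfolding n using w(1) ww by (simp add: divide_simps)
  finally show ?thesis .
qed

text \<open>Eisenstein's double sum of \<open>1 / x^2\<close> gives \<open>E2\<close> at \<tau> when
  summed by rows and at \<open>- 1 / \<tau>\<close> when summed by columns. The sum \<open>T\<close>
  of \<open>eis_diff\<close> is the same in both orders, so the discrepancy is that of the
  subtracted terms \<open>b\<close>. Their row sums vanish by telescoping, whereas summing the
  columns first leaves a limit of cotangents. This is the origin of the nonmodular term.\<close>

theorem E2_inversion:
  assumes "\<tau> \<in> uhp"
  shows "E2 (- 1 / \<tau>) = \<tau>\<^sup>2 * E2 \<tau> + 6 * \<tau> / (of_real pi * \<i>)"
proof -
  define \<tau>' where "\<tau>' = - 1 / \<tau>"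
  have t0: "\<tau> \<noteq> 0" using assms by (auto simp: uhp_def)
  have u': "\<tau>' \<in> uhp"
    using assms t0 by (simp add: uhp_def \<tau>'_def Im_divide cmod_def[symmetric] complex_neq_0 add_pos_nonneg)
  define x where "x m n = of_int m * \<tau> + (of_int n :: complex)" for m n :: int
  define b where "b m n = 1 / ((x m n)\<^sup>2 - 1/4)" for m n :: int
  have bd: "b m n = 1 / (x m n - 1/2) - 1 / (x m n + 1/2)" for m n
  proof -
    have "(x m n)\<^sup>2 - 1/4 = (x m n - 1/2) * (x m n + 1/2)" by (simp add: power2_eq_square algebra_simps)
    then show ?thesis using lattice_ne_half[OF assms, of m n] unfolding b_def x_def[symmetric]
      by (simp add: diff_frac_eq)
  qed
  have ed: "eis_diff \<tau> m n = 1 / (x m n)\<^sup>2 - b m n" for m n by (simp add: eis_diff_def x_def b_def)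
  define T where "T = (\<Sum>\<^sub>\<infinity>(m,n). eis_diff \<tau> m n)"
  have T1: "((\<lambda>(m,n). eis_diff \<tau> m n) has_sum T) (UNIV \<times> UNIV)"
    unfolding T_def using has_sum_infsum[OF eis_diff_summable[OF assms]] by simp
  then have T2: "((\<lambda>(n,m). eis_diff \<tau> m n) has_sum T) (UNIV \<times> UNIV)"
    by (subst (asm) has_sum_swap) simp
  have rows: "((\<lambda>n. 1 / (x m n)\<^sup>2) has_sum eis_row \<tau> m) UNIV" for m
    using has_sum_eis_row'[OF assms] by (simp add: x_def)
  have cols: "((\<lambda>m. 1 / (x m n)\<^sup>2) has_sum (1 / \<tau>\<^sup>2) * eis_row \<tau>' n) UNIV" for n
  proof -
    have e: "1 / \<tau>\<^sup>2 * (1 / (of_int n * \<tau>' + of_int m)\<^sup>2) = 1 / (x (- m) n)\<^sup>2" for m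
    proof -
      have "x (- m) n = - (\<tau> * (of_int n * \<tau>' + of_int m))"
        using t0 by (simp add: x_def \<tau>'_def field_simps)
      then show ?thesis by (simp add: power_mult_distrib)
    qed
    have "((\<lambda>m. 1 / \<tau>\<^sup>2 * (1 / (of_int n * \<tau>' + of_int m)\<^sup>2)) has_sum (1 / \<tau>\<^sup>2) * eis_row \<tau>' n) UNIV"
      by (rule has_sum_cmult_right[OF has_sum_eis_row'[OF u']])
    then have "((\<lambda>m. 1 / (x (- m) n)\<^sup>2) has_sum (1 / \<tau>\<^sup>2) * eis_row \<tau>' n) UNIV" unfolding e .
    moreover have "bij_betw uminus (UNIV :: int set) UNIV" by (rule bij_uminus)
    ultimately show ?thesis
      using has_sum_reindex_bij_betw[of uminus "UNIV :: int set" UNIV "\<lambda>m. 1 / (x m n)\<^sup>2"] by blast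
  qed
  have esum1: "(\<lambda>n. eis_diff \<tau> m n) summable_on UNIV" for m
    using summable_on_SigmaD1[of "eis_diff \<tau>" UNIV "\<lambda>_. UNIV" m] T1 summable_on_def by auto
  have esum2: "(\<lambda>m. eis_diff \<tau> m n) summable_on UNIV" for n
    using summable_on_SigmaD1[of "\<lambda>n m. eis_diff \<tau> m n" UNIV "\<lambda>_. UNIV" n] T2 summable_on_def by auto
  \<comment> \<open>The two partial fractions of \<open>b\<close> differ by a shift of
    \<open>n\<close> by 1.\<close>
  have tel: "(\<Sum>n\<in>{- int N..<int N}. b m n) = 1 / (of_int m * \<tau> - of_nat N - 1/2) - 1 / (of_int m * \<tau> + of_nat N - 1/2)" for m N
  proof (induction N)
    case (Suc N)
    have "{- int (Suc N)..<int (Suc N)} = insert (- int N - 1) (insert (int N) {- int N..<int N})" by auto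
    then have "(\<Sum>n\<in>{- int (Suc N)..<int (Suc N)}. b m n) = b m (- int N - 1) + b m (int N) + (\<Sum>n\<in>{- int N..<int N}. b m n)"
      by simp
    also have "\<dots> = 1 / (of_int m * \<tau> - of_nat (Suc N) - 1/2) - 1 / (of_int m * \<tau> + of_nat (Suc N) - 1/2)"
    proof -
      have e1: "x m (- int N - 1) - 1/2 = of_int m * \<tau> - of_nat (Suc N) - 1/2"
               "x m (- int N - 1) + 1/2 = of_int m * \<tau> - of_nat N - 1/2"
               "x m (int N) - 1/2 = of_int m * \<tau> + of_nat N - 1/2"
               "x m (int N) + 1/2 = of_int m * \<tau> + of_nat (Suc N) - 1/2"
        by (auto simp: x_def)
      show ?thesis unfolding Suc.IH unfolding bd e1 by simp
    qed
    finally show ?case .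
  qed simp
  have brow: "((\<lambda>n. b m n) has_sum 0) UNIV" for m
  proof -
    have "(\<lambda>n. 1 / (x m n)\<^sup>2 - eis_diff \<tau> m n) summable_on UNIV"
      using has_sum_diff[OF rows has_sum_infsum[OF esum1]] unfolding summable_on_def by blast
    then have s: "(\<lambda>n. b m n) summable_on UNIV" by (simp add: ed)
    then obtain S where S: "((\<lambda>n. b m n) has_sum S) UNIV" using summable_on_def by blast
    have "(\<lambda>N. \<Sum>n\<in>{- int N..<int N}. b m n) \<longlonglongrightarrow> S" by (rule has_sum_int_symmetric_limit[OF S])
    moreover have "(\<lambda>N. 1 / (of_int m * \<tau> - of_nat N - 1/2) - 1 / (of_int m * \<tau> + of_nat N - 1/2)) \<longlonglongrightarrow> 0 - 0"
    proof (intro tendsto_diff)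
      have l: "filterlim (\<lambda>N. c + of_nat N :: complex) at_infinity sequentially" for c
        by (intro tendsto_add_filterlim_at_infinity[OF tendsto_const] tendsto_of_nat)
      have "(\<lambda>N. 1 / (c + of_nat N :: complex)) \<longlonglongrightarrow> 0" for c
        using filterlim_compose[OF tendsto_inverse_0 l[of c]] by (simp add: inverse_eq_divide)
      note L = this
      show "(\<lambda>N. 1 / (of_int m * \<tau> + of_nat N - 1/2)) \<longlonglongrightarrow> 0"
        using L[of "of_int m * \<tau> - 1/2"] by (simp add: algebra_simps)
      have "(\<lambda>N. - (1 / (- (of_int m * \<tau>) + 1/2 + of_nat N))) \<longlonglongrightarrow> - 0"
        by (intro tendsto_minus L)
      moreover have "- (1 / (- (of_int m * \<tau>) + 1/2 + of_nat N)) = 1 / (of_int m * \<tau> - of_nat N - 1/2)" for N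
      proof -
        have "of_int m * \<tau> - of_nat N - 1/2 = - (- (of_int m * \<tau>) + 1/2 + of_nat N)" by simp
        then show ?thesis by (metis divide_minus_right)
      qed
      ultimately show "(\<lambda>N. 1 / (of_int m * \<tau> - of_nat N - 1/2)) \<longlonglongrightarrow> 0" by simp
    qed
    ultimately have "S = 0" using LIMSEQ_unique by (simp add: tel)
    then show ?thesis using S by simp
  qed
  have "(eis_row \<tau> has_sum T) UNIV"
  proof (rule has_sum_SigmaD[OF T1])
    show "((\<lambda>n. case (m, n) of (m, n) \<Rightarrow> eis_diff \<tau> m n) has_sum eis_row \<tau> m) UNIV" for m
      using has_sum_diff[OF rows brow] by (simp add: ed)
  qed
  then have TE: "T = of_real pi ^ 2 / 3 * E2 \<tau>" using has_sum_eis_row_E2[OF assms] has_sum_unique by blast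
  \<comment> \<open>The column sums of \<open>b\<close>. Only their sums over windows of
    \<open>n\<close> are evaluated: the finite sum over \<open>n\<close> is moved inside the sum
    over \<open>m\<close>, where it telescopes.\<close>
  define W where "W n = (\<Sum>\<^sub>\<infinity>m. b m n)" for n
  have bcol: "((\<lambda>m. b m n) has_sum W n) UNIV" for n
  proof -
    have "(\<lambda>m. 1 / (x m n)\<^sup>2 - eis_diff \<tau> m n) summable_on UNIV"
      using has_sum_diff[OF cols has_sum_infsum[OF esum2]] unfolding summable_on_def by blast
    then have "(\<lambda>m. b m n) summable_on UNIV" by (simp add: ed)
    then show ?thesis unfolding W_def by (rule has_sum_infsum)
  qed
  have "((\<lambda>n. (1 / \<tau>\<^sup>2) * eis_row \<tau>' n - W n) has_sum T) UNIV"
  proof (rule has_sum_SigmaD[OF T2])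
    show "((\<lambda>m. case (n, m) of (n, m) \<Rightarrow> eis_diff \<tau> m n) has_sum (1 / \<tau>\<^sup>2) * eis_row \<tau>' n - W n) UNIV" for n
      using has_sum_diff[OF cols bcol] by (simp add: ed)
  qed
  moreover have "((\<lambda>n. (1 / \<tau>\<^sup>2) * eis_row \<tau>' n) has_sum (1 / \<tau>\<^sup>2) * (of_real pi ^ 2 / 3 * E2 \<tau>')) UNIV"
    by (rule has_sum_cmult_right[OF has_sum_eis_row_E2[OF u']])
  ultimately have "((\<lambda>n. (1 / \<tau>\<^sup>2) * eis_row \<tau>' n - ((1 / \<tau>\<^sup>2) * eis_row \<tau>' n - W n)) has_sum
      ((1 / \<tau>\<^sup>2) * (of_real pi ^ 2 / 3 * E2 \<tau>') - T)) UNIV"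
    by (intro has_sum_diff)
  then have "(W has_sum ((1 / \<tau>\<^sup>2) * (of_real pi ^ 2 / 3 * E2 \<tau>') - T)) UNIV" by simp
  then have lim1: "(\<lambda>N. \<Sum>n\<in>{- int N..<int N}. W n) \<longlonglongrightarrow> (1 / \<tau>\<^sup>2) * (of_real pi ^ 2 / 3 * E2 \<tau>') - T"
    by (rule has_sum_int_symmetric_limit)
  have nI: "of_real c * \<tau>' \<notin> \<int>" "- (of_real c * \<tau>') \<notin> \<int>" if "c \<noteq> 0" for c :: real
  proof -
    have "Im (of_real c * \<tau>') \<noteq> 0" using that u' by (simp add: uhp_def)
    then show "of_real c * \<tau>' \<notin> \<int>" "- (of_real c * \<tau>') \<notin> \<int>" by (auto elim!: Ints_cases simp: complex_eq_iff)
  qed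
  have Wsum: "(\<Sum>n\<in>{- int N..<int N}. W n) =
      (1 / \<tau>) * (of_real pi * cot (of_real pi * (of_real (real N + 1/2) * \<tau>'))) -
      (1 / \<tau>) * (of_real pi * cot (of_real pi * (- (of_real (real N - 1/2) * \<tau>'))))" for N
  proof -
    have "((\<lambda>m. \<Sum>n\<in>{- int N..<int N}. b m n) has_sum (\<Sum>n\<in>{- int N..<int N}. W n)) UNIV"
      by (rule has_sum_finite_sum) (use bcol in auto)
    then have "(\<lambda>M. \<Sum>m\<in>{- int M..<int M}. \<Sum>n\<in>{- int N..<int N}. b m n) \<longlonglongrightarrow> (\<Sum>n\<in>{- int N..<int N}. W n)"
      by (rule has_sum_int_symmetric_limit)
    moreover have "(\<Sum>n\<in>{- int N..<int N}. b m n) = (1 / \<tau>) * (1 / (of_real (real N + 1/2) * \<tau>' + of_int m)) -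
        (1 / \<tau>) * (1 / (- (of_real (real N - 1/2) * \<tau>') + of_int m))" for m
    proof -
      note tel[of m N]
      moreover have "of_int m * \<tau> - of_nat N - 1/2 = \<tau> * (of_real (real N + 1/2) * \<tau>' + of_int m)"
        using t0 by (simp add: \<tau>'_def field_simps)
      moreover have "of_int m * \<tau> + of_nat N - 1/2 = \<tau> * (- (of_real (real N - 1/2) * \<tau>') + of_int m)"
        using t0 by (simp add: \<tau>'_def field_simps)
      ultimately show ?thesis by simp
    qed
    ultimately have "(\<lambda>M. (1 / \<tau>) * (\<Sum>m\<in>{- int M..<int M}. 1 / (of_real (real N + 1/2) * \<tau>' + of_int m)) -
        (1 / \<tau>) * (\<Sum>m\<in>{- int M..<int M}. 1 / (- (of_real (real N - 1/2) * \<tau>') + of_int m))) \<longlonglongrightarrow> (\<Sum>n\<in>{- int N..<int N}. W n)"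
      by (simp add: sum_subtractf sum_distrib_left)
    moreover have "real N - 1/2 \<noteq> 0"
    proof
      assume "real N - 1/2 = 0"
      then have "real (2 * N) = real 1" by simp
      then have "2 * N = 1" by (simp only: of_nat_eq_iff)
      then show False by presburger
    qed
    then have "(\<lambda>M. (1 / \<tau>) * (\<Sum>m\<in>{- int M..<int M}. 1 / (of_real (real N + 1/2) * \<tau>' + of_int m)) -
        (1 / \<tau>) * (\<Sum>m\<in>{- int M..<int M}. 1 / (- (of_real (real N - 1/2) * \<tau>') + of_int m))) \<longlonglongrightarrow>
        (1 / \<tau>) * (of_real pi * cot (of_real pi * (of_real (real N + 1/2) * \<tau>'))) -
        (1 / \<tau>) * (of_real pi * cot (of_real pi * (- (of_real (real N - 1/2) * \<tau>'))))"
      by (intro tendsto_intros cot_symmetric_limit nI) auto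
    ultimately show ?thesis by (rule LIMSEQ_unique)
  qed
  have nlim: "(\<lambda>N. nome (of_real (real N + c) * \<tau>')) \<longlonglongrightarrow> 0" for c
  proof -
    have "nome (of_real (real N + c) * \<tau>') = nome (of_real c * \<tau>') * nome \<tau>' ^ N" for N
      by (simp add: nome_def exp_of_nat_mult[symmetric] exp_add[symmetric] algebra_simps)
    moreover have "(\<lambda>N. nome (of_real c * \<tau>') * nome \<tau>' ^ N) \<longlonglongrightarrow> nome (of_real c * \<tau>') * 0"
      using norm_nome_less[OF u'] by (intro tendsto_mult tendsto_const LIMSEQ_power_zero)
    ultimately show ?thesis by simp
  qed
  have clim: "(\<lambda>N. cot (of_real pi * (- (of_real (real N + c) * \<tau>')))) \<longlonglongrightarrow> \<i>" for c
  proof -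
    have "(\<lambda>N. \<i> * (1 + nome (of_real (real N + c) * \<tau>')) / (1 - nome (of_real (real N + c) * \<tau>'))) \<longlonglongrightarrow> \<i> * (1 + 0) / (1 - 0)"
      by (intro tendsto_intros nlim) auto
    moreover have "\<forall>\<^sub>F N in sequentially. \<i> * (1 + nome (of_real (real N + c) * \<tau>')) / (1 - nome (of_real (real N + c) * \<tau>')) =
        cot (of_real pi * (- (of_real (real N + c) * \<tau>')))"
    proof -
      have "\<forall>\<^sub>F N in sequentially. nome (of_real (real N + c) * \<tau>') \<noteq> 1"
        by (rule tendsto_imp_eventually_ne[OF nlim]) simp
      then show ?thesis by eventually_elim (subst cot_via_nome, auto)
    qed
    ultimately show ?thesis by (simp add: Lim_transform_eventually)
  qed
  \<comment> \<open>Oddness of the cotangent brings both arguments into the lower half plane, where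
    they move off to infinity and the cotangent tends to \<i>. The two contributions add up to
    \<open>- 2 pi \<i> / \<tau>\<close>.\<close>
  have Wsum': "(\<Sum>n\<in>{- int N..<int N}. W n) =
      (1 / \<tau>) * (of_real pi * - cot (of_real pi * (- (of_real (real N + 1/2) * \<tau>')))) -
      (1 / \<tau>) * (of_real pi * cot (of_real pi * (- (of_real (real N + (- 1/2)) * \<tau>'))))" for N
    unfolding Wsum by (simp add: cot_def)
  have "(\<lambda>N. \<Sum>n\<in>{- int N..<int N}. W n) \<longlonglongrightarrow> (1 / \<tau>) * (of_real pi * - \<i>) - (1 / \<tau>) * (of_real pi * \<i>)"
    unfolding Wsum' by (intro tendsto_intros clim)
  with lim1 have "(1 / \<tau>\<^sup>2) * (of_real pi ^ 2 / 3 * E2 \<tau>') - T = (1 / \<tau>) * (of_real pi * - \<i>) - (1 / \<tau>) * (of_real pi * \<i>)"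
    by (rule LIMSEQ_unique)
  then have "(1 / \<tau>\<^sup>2) * (of_real pi ^ 2 / 3 * E2 \<tau>') = of_real pi ^ 2 / 3 * E2 \<tau> - 2 * of_real pi * \<i> / \<tau>"
    unfolding TE by (simp add: algebra_simps)
  then have "\<tau>\<^sup>2 * 3 / of_real pi ^ 2 * ((1 / \<tau>\<^sup>2) * (of_real pi ^ 2 / 3 * E2 \<tau>')) =
      \<tau>\<^sup>2 * 3 / of_real pi ^ 2 * (of_real pi ^ 2 / 3 * E2 \<tau> - 2 * of_real pi * \<i> / \<tau>)" by simp
  then have "E2 \<tau>' = \<tau>\<^sup>2 * 3 / of_real pi ^ 2 * (of_real pi ^ 2 / 3 * E2 \<tau> - 2 * of_real pi * \<i> / \<tau>)"
    using t0 by simp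
  also have "\<dots> = \<tau>\<^sup>2 * E2 \<tau> + 6 * \<tau> / (of_real pi * \<i>)"
    using t0 by (simp add: field_simps power2_eq_square)
  finally show ?thesis by (simp add: \<tau>'_def)
qed


section \<open>Expansions in the nome\<close>

lemma open_uhp: "open uhp"
  unfolding uhp_def by (rule open_halfspace_Im_gt)

lemma convex_uhp: "convex uhp"
  unfolding uhp_def by (rule convex_halfspace_Im_gt)

lemma nome_holomorphic [holomorphic_intros]:
  "f holomorphic_on A \<Longrightarrow> (\<lambda>z. nome (f z)) holomorphic_on A"
  unfolding nome_def by (intro holomorphic_intros)

lemma has_field_derivative_nome:
  "(nome has_field_derivative 2 * of_real pi * \<i> * nome z) (at z)"
  unfolding nome_def by (auto intro!: derivative_eq_intros)

lemma nome_add_of_int [simp]: "nome (z + of_int n) = nome z"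
  unfolding nome_def exp_eq by (rule exI[of _ n]) (simp add: algebra_simps)

lemma nome_surj:
  assumes "q \<noteq> 0" "norm q < 1"
  obtains z where "z \<in> uhp" "nome z = q"
proof -
  define z where "z = Ln q / (2 * of_real pi * \<i>)"
  have "nome z = q" using assms by (simp add: z_def nome_def)
  moreover have "z \<in> uhp"
  proof -
    have "z = of_real (1 / (2 * pi)) * (- \<i> * Ln q)" by (simp add: z_def field_simps)
    then have "Im z = 1 / (2 * pi) * - ln (norm q)" using assms by simp
    then show ?thesis using assms unfolding uhp_def by (auto intro!: divide_neg_pos)
  qed
  ultimately show ?thesis using that by blast
qed

lemma nome_eq_iff: "nome z = nome w \<longleftrightarrow> (\<exists>n::int. z = w + of_int n)"
proof
  assume "nome z = nome w"
  then obtain n :: int where "2 * of_real pi * \<i> * z = 2 * of_real pi * \<i> * w + of_int (2 * n) * of_real pi * \<i>"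
    unfolding nome_def exp_eq by auto
  then have "2 * of_real pi * \<i> * z = 2 * of_real pi * \<i> * (w + of_int n)" by (simp add: algebra_simps)
  then have "z = w + of_int n" by simp
  then show "\<exists>n::int. z = w + of_int n" by blast
qed auto

text \<open>Besides the coefficients \<open>A\<close> this keeps the extension \<open>F\<close> to
  the unit disc, so that the cusp becomes the ordinary point 0, to which \<open>zorder\<close> and
  Rouche arguments apply. \<open>F\<close> is constrained only on the disc.\<close>

definition q_expands :: "(complex \<Rightarrow> complex) \<Rightarrow> (complex \<Rightarrow> complex) \<Rightarrow> complex fps \<Rightarrow> bool" where
  "q_expands f F A \<longleftrightarrow> F holomorphic_on ball 0 1 \<and> F has_fps_expansion A \<and> (\<forall>\<tau>\<in>uhp. f \<tau> = F (nome \<tau>))"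

lemma q_expands_sums:
  assumes "q_expands f F A" "norm q < 1"
  shows "(\<lambda>n. fps_nth A n * q ^ n) sums F q"
proof -
  have "((\<lambda>n. (deriv ^^ n) F 0 / (fact n) * (q - 0) ^ n) sums F q)"
    by (rule holomorphic_power_series[where r = 1]) (use assms in \<open>auto simp: q_expands_def\<close>)
  then show ?thesis
    using assms fps_nth_fps_expansion[of F A] by (simp add: q_expands_def)
qed

lemma q_expands_imp_fourier: "q_expands f F A \<Longrightarrow> has_fourier_expansion f (fps_nth A)"
  unfolding has_fourier_expansion_def using q_expands_sums norm_nome_less by (auto simp: q_expands_def)

lemma fourier_imp_q_expands:
  assumes "has_fourier_expansion f a"
  obtains F where "q_expands f F (Abs_fps a)"
proof -
  have "conv_radius a \<ge> 1"
  proof (rule conv_radius_geI_ex)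
    fix r :: real assume r: "0 < r" "ereal r < 1"
    then obtain z where z: "z \<in> uhp" "nome z = of_real r"
      using nome_surj[of "of_real r"] by auto
    show "\<exists>z. norm z = r \<and> summable (\<lambda>n. a n * z ^ n)"
      using assms z r unfolding has_fourier_expansion_def
      by (intro exI[of _ "of_real r"]) (metis norm_of_real abs_of_pos sums_summable)
  qed
  then have R: "fps_conv_radius (Abs_fps a) \<ge> 1" by (simp add: fps_conv_radius_def)
  have "q_expands f (eval_fps (Abs_fps a)) (Abs_fps a)"
    unfolding q_expands_def
  proof (intro conjI ballI)
    show "eval_fps (Abs_fps a) holomorphic_on ball 0 1"
    proof (rule holomorphic_on_eval_fps)
      show "(ball 0 1 :: complex set) \<subseteq> eball 0 (fps_conv_radius (Abs_fps a))"
      proof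
        fix x :: complex assume "x \<in> ball 0 1"
        then have "ereal (norm x) < 1" by simp
        then have "ereal (norm x) < fps_conv_radius (Abs_fps a)" using R by (rule less_le_trans)
        then show "x \<in> eball 0 (fps_conv_radius (Abs_fps a))"
          by (simp add: in_eball_iff)
      qed
    qed
    have "0 < fps_conv_radius (Abs_fps a)" using R by (simp add: less_le_trans[of 0 1])
    then show "eval_fps (Abs_fps a) has_fps_expansion Abs_fps a" by (rule eval_fps_has_fps_expansion)
    show "f \<tau> = eval_fps (Abs_fps a) (nome \<tau>)" if "\<tau> \<in> uhp" for \<tau>
      using assms that unfolding has_fourier_expansion_def eval_fps_def by (simp add: sums_iff)
  qed
  then show ?thesis using that by blast
qed

text \<open>Every nonzero point of the disc is a nome, and continuity settles the point 0. This is
  what gives \<open>fourier_coeff\<close>, defined by a definite description, its expected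
  value.\<close>

lemma q_expands_unique:
  assumes "q_expands f F A" "q_expands f F' A'"
  shows "A = A'" "norm q < 1 \<Longrightarrow> F q = F' q"
proof -
  have eq: "F q = F' q" if "norm q < 1" "q \<noteq> 0" for q
    using nome_surj[OF that(2,1)] assms unfolding q_expands_def by metis
  have c: "continuous_on (ball 0 1) F" "continuous_on (ball 0 1) F'"
    using assms holomorphic_on_imp_continuous_on unfolding q_expands_def by blast+
  have "F 0 = F' 0"
  proof -
    have "(F \<longlongrightarrow> F 0) (at 0)" "(F' \<longlongrightarrow> F' 0) (at 0)"
      using c by (auto simp: continuous_on_eq_continuous_at isCont_def)
    moreover have "\<forall>\<^sub>F q in at 0. F q = F' q"
      unfolding eventually_at using eq by (intro exI[of _ 1]) auto
    ultimately show ?thesis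
      by (metis (mono_tags, lifting) Lim_transform_eventually tendsto_unique trivial_limit_at)
  qed
  then show all: "F q = F' q" if "norm q < 1" for q using eq that by (cases "q = 0") auto
  have "\<forall>\<^sub>F q in nhds 0. F q = F' q"
    unfolding eventually_nhds by (rule exI[of _ "ball 0 1"]) (use all in auto)
  then have "F' has_fps_expansion A"
    using assms(1) has_fps_expansion_cong unfolding q_expands_def by blast
  then show "A = A'" using assms(2) fps_expansion_unique_complex unfolding q_expands_def by blast
qed

lemma fourier_coeff_q_expands:
  assumes "q_expands f F A"
  shows "fourier_coeff f = fps_nth A"
  unfolding fourier_coeff_def
proof (rule the_equality)
  show "has_fourier_expansion f (fps_nth A)" by (rule q_expands_imp_fourier[OF assms])
  fix a assume "has_fourier_expansion f a"
  then obtain F' where "q_expands f F' (Abs_fps a)" using fourier_imp_q_expands by blast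
  then have "A = Abs_fps a" using q_expands_unique(1) assms by blast
  then show "a = fps_nth A" by (simp add: fun_eq_iff)
qed

lemma q_expands_cnj:
  assumes "q_expands f F A" "\<And>n. fps_nth A n \<in> \<real>" "norm q < 1"
  shows "F (cnj q) = cnj (F q)"
proof -
  have "(\<lambda>n. cnj (fps_nth A n * q ^ n)) sums cnj (F q)"
    using q_expands_sums[OF assms(1,3)] by (simp only: sums_cnj)
  moreover have e: "cnj (fps_nth A n * q ^ n) = fps_nth A n * cnj q ^ n" for n
    using assms(2)[of n] by (simp add: Reals_cnj_iff)
  ultimately have "(\<lambda>n. fps_nth A n * cnj q ^ n) sums cnj (F q)" by (simp only:)
  moreover have "(\<lambda>n. fps_nth A n * cnj q ^ n) sums F (cnj q)"
    by (rule q_expands_sums[OF assms(1)]) (use assms(3) in simp)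
  ultimately show ?thesis by (simp add: sums_unique2)
qed

lemma q_expands_mult:
  "q_expands f F A \<Longrightarrow> q_expands g G B \<Longrightarrow> q_expands (\<lambda>z. f z * g z) (\<lambda>q. F q * G q) (A * B)"
  unfolding q_expands_def by (auto intro!: holomorphic_intros fps_expansion_intros)

lemma q_expands_diff:
  "q_expands f F A \<Longrightarrow> q_expands g G B \<Longrightarrow> q_expands (\<lambda>z. f z - g z) (\<lambda>q. F q - G q) (A - B)"
  unfolding q_expands_def by (auto intro!: holomorphic_intros fps_expansion_intros)

lemma q_expands_cmult:
  "q_expands f F A \<Longrightarrow> q_expands (\<lambda>z. c * f z) (\<lambda>q. c * F q) (fps_const c * A)"
  unfolding q_expands_def by (auto intro!: holomorphic_intros fps_expansion_intros)

lemma q_expands_holomorphic: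
  assumes "q_expands f F A"
  shows "f holomorphic_on uhp"
proof -
  have "(F \<circ> nome) holomorphic_on uhp"
    using assms norm_nome_less unfolding q_expands_def
    by (intro holomorphic_on_compose_gen[of _ _ _ "ball 0 1"] holomorphic_intros) auto
  then show ?thesis
    by (rule holomorphic_transform) (use assms in \<open>auto simp: q_expands_def\<close>)
qed

lemma q_expands_deriv:
  assumes "q_expands f F A" "\<tau> \<in> uhp"
  shows "deriv f \<tau> = 2 * of_real pi * \<i> * nome \<tau> * deriv F (nome \<tau>)"
proof -
  have F: "F holomorphic_on ball 0 1" using assms by (simp add: q_expands_def)
  have "((\<lambda>z. F (nome z)) has_field_derivative deriv F (nome \<tau>) * (2 * of_real pi * \<i> * nome \<tau>)) (at \<tau>)"
    by (rule DERIV_chain2[OF holomorphic_derivI[OF F open_ball] has_field_derivative_nome])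
      (use norm_nome_less assms(2) in auto)
  then have "(f has_field_derivative deriv F (nome \<tau>) * (2 * of_real pi * \<i> * nome \<tau>)) (at \<tau>)"
    by (rule has_field_derivative_transform_within_open[OF _ open_uhp assms(2)])
      (use assms(1) in \<open>auto simp: q_expands_def\<close>)
  then show ?thesis by (simp add: DERIV_imp_deriv mult_ac)
qed

lemma q_expands_normalized_deriv:
  assumes "q_expands f F A"
  shows "q_expands (normalized_deriv f) (\<lambda>q. q * deriv F q) (fps_X * fps_deriv A)"
  unfolding q_expands_def
proof (intro conjI ballI)
  show "(\<lambda>q. q * deriv F q) holomorphic_on ball 0 1"
    using assms by (auto simp: q_expands_def intro!: holomorphic_intros holomorphic_deriv)
  show "(\<lambda>q. q * deriv F q) has_fps_expansion fps_X * fps_deriv A"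
    using assms by (auto simp: q_expands_def intro!: fps_expansion_intros)
qed (use q_expands_deriv[OF assms] in \<open>simp add: normalized_deriv_def\<close>)

text \<open>The divisor sum; the bound \<open>m \<le> n\<close> makes the index set empty at
  \<open>n = 0\<close>, where every number is a divisor.\<close>

definition sigma1 :: "nat \<Rightarrow> nat" where
  "sigma1 n = (\<Sum>m | m dvd n \<and> m \<ge> 1 \<and> m \<le> n. m)"

text \<open>The double series converges absolutely and may be regrouped by the product
  \<open>n = m r\<close>, that is, by pairs of \<open>n\<close> and a divisor of
  \<open>n\<close>.\<close>

lemma has_fourier_expansion_E2:
  "has_fourier_expansion E2 (\<lambda>n. if n = 0 then 1 else - 24 * of_nat (sigma1 n))"
  unfolding has_fourier_expansion_def
proof
  fix \<tau> assume t: "\<tau> \<in> uhp"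
  define f where "f = (\<lambda>(m, r). of_nat m * nome \<tau> ^ (m * r))"
  define P where "P = infsum f ({1..} \<times> {1..})"
  have an: "(\<lambda>p. norm (f p)) = (\<lambda>(m, r). norm (of_nat m * nome \<tau> ^ (m * r)))"
    by (auto simp: f_def fun_eq_iff)
  have ab: "(\<lambda>p. norm (f p)) summable_on {1..} \<times> {1..}"
    using E2_double_summable[OF t] unfolding an .
  then have P1: "(f has_sum P) ({1..} \<times> {1..})"
    unfolding P_def by (intro has_sum_infsum) (rule abs_summable_summable)
  define D where "D n = {m. m dvd n \<and> m \<ge> 1 \<and> m \<le> n}" for n :: nat
  have Dfin: "finite (D n)" for n by (rule finite_subset[of _ "{..n}"]) (auto simp: D_def)
  define h where "h = (\<lambda>(n::nat, m::nat). (m, n div m))"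
  have bij: "bij_betw h (Sigma {1..} D) ({1..} \<times> {1..})"
  proof (rule bij_betw_byWitness[where f' = "\<lambda>(m, r). (m * r, m)"])
    show "\<forall>a\<in>Sigma {1..} D. (case h a of (m, r) \<Rightarrow> (m * r, m)) = a"
      by (auto simp: h_def D_def)
    show "\<forall>a'\<in>{1..} \<times> {1..}. h (case a' of (m, r) \<Rightarrow> (m * r, m)) = a'"
      by (auto simp: h_def)
    show "h ` Sigma {1..} D \<subseteq> {1..} \<times> {1..}"
      by (auto simp: h_def D_def) (metis Suc_le_eq div_greater_zero_iff)
    show "(\<lambda>(m, r). (m * r, m)) ` ({1..} \<times> {1..}) \<subseteq> Sigma {1..} D"
      by (auto simp: D_def)
  qed
  have "((\<lambda>x. f (h x)) has_sum P) (Sigma {1..} D)"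
    using has_sum_reindex_bij_betw[OF bij, of f] P1 by blast
  moreover have "f (h (n, m)) = of_nat m * nome \<tau> ^ n" if "m \<in> D n" for n m
    using that by (auto simp: f_def h_def D_def)
  then have "((\<lambda>m. f (h (n, m))) has_sum (\<Sum>m\<in>D n. of_nat m * nome \<tau> ^ n)) (D n)" for n
    using Dfin by (intro has_sum_finiteI) auto
  ultimately have "((\<lambda>n. \<Sum>m\<in>D n. of_nat m * nome \<tau> ^ n) has_sum P) {1..}"
    by (rule has_sum_SigmaD)
  then have "((\<lambda>n. of_nat (sigma1 n) * nome \<tau> ^ n) has_sum P) {1..}"
    by (simp add: sigma1_def D_def sum_distrib_right)
  then have "((\<lambda>n. - 24 * (of_nat (sigma1 n) * nome \<tau> ^ n)) has_sum - 24 * P) {1..}"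
    by (rule has_sum_cmult_right)
  then have "((\<lambda>n. (if n = 0 then 1 else - 24 * of_nat (sigma1 n)) * nome \<tau> ^ n) has_sum - 24 * P) {1..}"
    by (rule has_sum_cong[THEN iffD1, rotated]) auto
  then have "((\<lambda>n. (if n = 0 then 1 else - 24 * of_nat (sigma1 n)) * nome \<tau> ^ n) has_sum (1 + - 24 * P)) ({0} \<union> {1..})"
    by (intro has_sum_Un_disjoint) (auto simp: has_sum_finite_iff)
  moreover have "{0} \<union> {1..} = (UNIV :: nat set)" by auto
  ultimately have "(\<lambda>n. (if n = 0 then 1 else - 24 * of_nat (sigma1 n)) * nome \<tau> ^ n) sums (1 + - 24 * P)"
    using has_sum_imp_sums by simp
  then show "(\<lambda>n. (if n = 0 then 1 else - 24 * of_nat (sigma1 n)) * nome \<tau> ^ n) sums E2 \<tau>"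
    by (simp add: E2_def P_def f_def)
qed

lemma E2_q_expands:
  obtains F A where "q_expands E2 F A" "fps_nth A 0 = 1" "\<And>n. fps_nth A n \<in> \<real>"
proof -
  obtain F where F: "q_expands E2 F (Abs_fps (\<lambda>n. if n = 0 then 1 else - 24 * of_nat (sigma1 n)))"
    using fourier_imp_q_expands[OF has_fourier_expansion_E2] by blast
  show ?thesis by (rule that[OF F]) auto
qed

lemma E2_add_of_int: "\<tau> \<in> uhp \<Longrightarrow> E2 (\<tau> + of_int n) = E2 \<tau>"
  unfolding E2_def by simp

section \<open>\<open>E2\<close> under the full modular group, and the discriminant\<close>

lemma moebius_denom_nonzero:
  assumes "a * d - b * c = (1::int)" "\<tau> \<in> uhp"
  shows "of_int c * \<tau> + of_int d \<noteq> 0"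
proof
  assume 0: "of_int c * \<tau> + of_int d = 0"
  then have "of_int c * Im \<tau> = 0" by (simp add: complex_eq_iff)
  then have "c = 0" using assms(2) by (simp add: uhp_def)
  then show False using 0 assms(1) by auto
qed

lemma Im_moebius:
  assumes "a * d - b * c = (1::int)" "\<tau> \<in> uhp"
  shows "Im ((of_int a * \<tau> + of_int b) / (of_int c * \<tau> + of_int d)) = Im \<tau> / (norm (of_int c * \<tau> + of_int d))\<^sup>2"
proof -
  have "real_of_int (a * d - b * c) = 1" using assms(1) by simp
  then have e: "of_int a * of_int d - of_int b * of_int c = (1::real)" by simp
  have "Im ((of_int a * \<tau> + of_int b) / (of_int c * \<tau> + of_int d)) =
      (of_int a * of_int d - of_int b * of_int c) * Im \<tau> / (norm (of_int c * \<tau> + of_int d))\<^sup>2"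
    by (simp add: Im_divide cmod_power2 algebra_simps)
  then show ?thesis unfolding e by simp
qed

lemma moebius_uhp':
  assumes "a * d - b * c = (1::int)" "\<tau> \<in> uhp"
  shows "(of_int a * \<tau> + of_int b) / (of_int c * \<tau> + of_int d) \<in> uhp"
  using Im_moebius[OF assms] moebius_denom_nonzero[OF assms] assms(2) by (simp add: uhp_def)

lemma has_field_derivative_moebius:
  assumes "a * d - b * c = (1::int)" "z \<in> uhp"
  shows "((\<lambda>w. (of_int a * w + of_int b) / (of_int c * w + of_int d)) has_field_derivative
    1 / (of_int c * z + of_int d)\<^sup>2) (at z)"
proof -
  define j where "j = of_int c * z + of_int d"
  have j0: "j \<noteq> 0" unfolding j_def by (rule moebius_denom_nonzero[OF assms])
  have det: "of_int a * of_int d - of_int b * of_int c = (1::complex)"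
    using arg_cong[OF assms(1), of of_int] by simp
  have "((\<lambda>w. (of_int a * w + of_int b) / (of_int c * w + of_int d)) has_field_derivative
      (of_int a * j - (of_int a * z + of_int b) * of_int c) / (j * j)) (at z)"
    using j0 unfolding j_def by (auto intro!: derivative_eq_intros)
  moreover have "of_int a * j - (of_int a * z + of_int b) * of_int c = 1" using det by (simp add: j_def algebra_simps)
  ultimately show ?thesis unfolding j_def[symmetric] by (simp add: power2_eq_square)
qed

lemma uhp_inversion: "\<tau> \<in> uhp \<Longrightarrow> - 1 / \<tau> \<in> uhp"
  using moebius_uhp'[of 0 0 "-1" 1 \<tau>] by simp

text \<open>Euclidean algorithm on the bottom row. With \<open>d = c n + r\<close> the matrix acts
  as the translation by \<open>n\<close>, then the inversion, then a matrix with bottom row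
  \<open>(r, - c)\<close>, and \<open>\<bar>r\<bar> < \<bar>c\<bar>\<close>. So periodicity and
  \<open>E2_inversion\<close> suffice.\<close>

lemma E2_moebius:
  assumes "a * d - b * c = (1::int)" "\<tau> \<in> uhp"
  shows "E2 ((of_int a * \<tau> + of_int b) / (of_int c * \<tau> + of_int d)) =
    (of_int c * \<tau> + of_int d)\<^sup>2 * E2 \<tau> + 6 * of_int c * (of_int c * \<tau> + of_int d) / (of_real pi * \<i>)"
  using assms
proof (induction "nat \<bar>c\<bar>" arbitrary: a b c d \<tau> rule: less_induct)
  case less
  show ?case
  proof (cases "c = 0")
    case True
    then have "a * d = 1" using less.prems by simp
    then have ad: "(a = 1 \<and> d = 1) \<or> (a = - 1 \<and> d = - 1)" by (simp add: zmult_eq_1_iff)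
    then show ?thesis
    proof
      assume "a = 1 \<and> d = 1"
      then show ?thesis using True E2_add_of_int[OF less.prems(2), of b] by simp
    next
      assume *: "a = - 1 \<and> d = - 1"
      have "(of_int a * \<tau> + of_int b) / (of_int c * \<tau> + of_int d) = \<tau> + of_int (- b)"
        using * True by (simp add: field_simps)
      then show ?thesis using True * E2_add_of_int[OF less.prems(2), of "- b"] by simp
    qed
  next
    case False
    define n r b' where "n = d div c" and "r = d mod c" and "b' = b - n * a"
    have dn: "d = c * n + r" by (simp add: n_def r_def)
    define u where "u = \<tau> + of_int n"
    define \<sigma> where "\<sigma> = - 1 / u"
    have u: "u \<in> uhp" using less.prems(2) by (simp add: u_def uhp_def)
    have u0: "u \<noteq> 0" using u by (auto simp: uhp_def)
    have s: "\<sigma> \<in> uhp" unfolding \<sigma>_def by (rule uhp_inversion[OF u])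
    have small: "nat \<bar>r\<bar> < nat \<bar>c\<bar>" using False abs_mod_less[of c d] by (simp add: r_def)
    have det: "b' * (- c) - (- a) * r = 1"
      using less.prems(1) dn by (simp add: b'_def algebra_simps)
    define j where "j = of_int c * \<tau> + of_int d"
    have j: "j = of_int r + of_int c * u" by (simp add: j_def u_def dn algebra_simps)
    have jn: "j \<noteq> 0" unfolding j_def by (rule moebius_denom_nonzero[OF less.prems])
    have rs: "of_int r * \<sigma> + of_int (- c) = - (j / u)"
      using u0 by (simp add: \<sigma>_def j field_simps)
    have bs: "of_int b' * \<sigma> + of_int (- a) = - ((of_int a * \<tau> + of_int b) / u)"
      using u0 by (simp add: \<sigma>_def b'_def u_def field_simps)
    have "(of_int b' * \<sigma> + of_int (- a)) / (of_int r * \<sigma> + of_int (- c)) = (of_int a * \<tau> + of_int b) / j"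
    proof -
      have "- (X / u) / - (j / u) = X / j" for X using u0 jn by simp
      then show ?thesis unfolding rs bs .
    qed
    then have "E2 ((of_int a * \<tau> + of_int b) / j) = (- (j / u))\<^sup>2 * E2 \<sigma> + 6 * of_int r * (- (j / u)) / (of_real pi * \<i>)"
      using less.hyps[OF small det s] unfolding rs by simp
    also have "E2 \<sigma> = u\<^sup>2 * E2 \<tau> + 6 * u / (of_real pi * \<i>)"
      using E2_inversion[OF u] E2_add_of_int[OF less.prems(2), of n] by (simp add: \<sigma>_def u_def)
    also have "(- (j / u))\<^sup>2 * (u\<^sup>2 * E2 \<tau> + 6 * u / (of_real pi * \<i>)) + 6 * of_int r * (- (j / u)) / (of_real pi * \<i>) =
        j\<^sup>2 * E2 \<tau> + 6 / (of_real pi * \<i>) * (j * (j - of_int r) / u)"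
      using u0 by (simp add: field_simps power2_eq_square)
    also have "j * (j - of_int r) / u = of_int c * j" using u0 by (simp add: j)
    finally show ?thesis unfolding j_def[symmetric] by (simp add: mult_ac)
  qed
qed

lemma nome_cnj: "nome (- cnj z) = cnj (nome z)"
  by (simp add: nome_def exp_cnj)

text \<open>The discriminant form, as the exponential of a primitive of \<open>2\<pi>\<i> E\<^sub>2\<close>; in contrast to the
  product expansion, this makes it obvious that it does not vanish.\<close>

lemma discriminant_exists:
  obtains D where "D holomorphic_on ball 0 1" "D 0 = 0" "deriv D 0 \<noteq> 0"
    "\<And>q. norm q < 1 \<Longrightarrow> q \<noteq> 0 \<Longrightarrow> D q \<noteq> 0"
    "\<And>q. norm q < 1 \<Longrightarrow> D (cnj q) = cnj (D q)"
    "\<And>\<tau>. \<tau> \<in> uhp \<Longrightarrow> D (nome (- 1 / \<tau>)) = \<tau> ^ 12 * D (nome \<tau>)"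
proof -
  obtain F A where F: "q_expands E2 F A" "fps_nth A 0 = 1" "\<And>n. fps_nth A n \<in> \<real>"
    using E2_q_expands by metis
  have Fh: "F holomorphic_on ball 0 1" using F(1) by (simp add: q_expands_def)
  have F0: "F 0 = 1" using F(1,2) has_fps_expansion_imp_0_eq_fps_nth_0 by (fastforce simp: q_expands_def)
  \<comment> \<open>This is \<open>(F q - 1) / q\<close> with the singularity at 0 removed. If
    \<open>H\<close> is a primitive of it, the logarithmic derivative of \<open>q exp (H q)\<close>
    is \<open>F q / q\<close>, which in the variable \<tau> becomes
    \<open>2 pi \<i> E2\<close>.\<close>
  define K where "K q = (if q = 0 then deriv F 0 else (F q - F 0) / (q - 0))" for q
  have Kh: "K holomorphic_on ball 0 1" unfolding K_def by (rule pole_lemma_open[OF Fh open_ball])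
  obtain H0 where H0: "\<And>x. x \<in> ball 0 1 \<Longrightarrow> (H0 has_field_derivative K x) (at x within ball 0 1)"
    using holomorphic_convex_primitive'[OF convex_ball open_ball Kh] by blast
  define H where "H q = H0 q - H0 0" for q
  have Hd: "(H has_field_derivative K x) (at x)" if "norm x < 1" for x
    unfolding H_def using H0[of x] that by (auto intro!: derivative_eq_intros simp: at_within_open[of x "ball 0 1"])
  have Hh: "H holomorphic_on ball 0 1"
    unfolding holomorphic_on_def using Hd
    by (metis field_differentiable_at_within field_differentiable_def mem_ball_0)
  have Kc: "K (cnj q) = cnj (K q)" if "norm q < 1" for q
  proof (cases "q = 0")
    case True
    have "fps_nth A 1 = deriv F 0"
      using F(1) fps_nth_fps_expansion[of F A 1] by (simp add: q_expands_def)
    then show ?thesis using True F(3)[of 1] by (simp add: K_def Reals_cnj_iff)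
  next
    case False
    then show ?thesis using q_expands_cnj[OF F(1,3) that] F0 by (simp add: K_def)
  qed
  have Hc: "H (cnj q) = cnj (H q)" if q: "norm q < 1" for q
  proof -
    have d: "((\<lambda>q. cnj (H (cnj q)) - H q) has_field_derivative 0) (at x within ball 0 1)" if "x \<in> ball 0 1" for x
    proof -
      have "((cnj \<circ> H \<circ> cnj) has_field_derivative cnj (K (cnj x))) (at x)"
        by (rule has_field_derivative_cnj_cnj) (use Hd that in auto)
      then have "((\<lambda>q. cnj (H (cnj q)) - H q) has_field_derivative cnj (K (cnj x)) - K x) (at x)"
        using Hd[of x] that by (intro DERIV_diff) (auto simp: o_def)
      then show ?thesis using Kc[of x] that by (simp add: has_field_derivative_at_within)
    qed
    have "cnj (H (cnj q)) - H q = cnj (H (cnj 0)) - H 0"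
      using has_field_derivative_zero_constant[of "ball 0 1" "\<lambda>q. cnj (H (cnj q)) - H q", OF convex_ball d] q
      by (metis centre_in_ball mem_ball_0 zero_less_one)
    then have "cnj (H (cnj q)) = H q" by (simp add: H_def)
    then show ?thesis by (metis complex_cnj_cnj)
  qed
  define D where "D q = q * exp (H q)" for q
  have Dh: "D holomorphic_on ball 0 1" unfolding D_def using Hh by (intro holomorphic_intros)
  have D0: "(D has_field_derivative exp (H 0)) (at 0)"
    unfolding D_def using Hd[of 0] by (auto intro!: derivative_eq_intros)
  define N where "N \<tau> = D (nome \<tau>)" for \<tau>
  have N0: "N \<tau> \<noteq> 0" for \<tau> by (simp add: N_def D_def)
  have Nd: "(N has_field_derivative 2 * of_real pi * \<i> * E2 \<tau> * N \<tau>) (at \<tau>)" if "\<tau> \<in> uhp" for \<tau>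
  proof -
    have q: "norm (nome \<tau>) < 1" using norm_nome_less that by blast
    have "(D has_field_derivative exp (H (nome \<tau>)) + nome \<tau> * (exp (H (nome \<tau>)) * K (nome \<tau>))) (at (nome \<tau>))"
      unfolding D_def using Hd[OF q] by (auto intro!: derivative_eq_intros)
    then have "(N has_field_derivative (exp (H (nome \<tau>)) + nome \<tau> * (exp (H (nome \<tau>)) * K (nome \<tau>))) * (2 * of_real pi * \<i> * nome \<tau>)) (at \<tau>)"
      unfolding N_def using has_field_derivative_nome by (rule DERIV_chain2)
    moreover have "nome \<tau> * K (nome \<tau>) = E2 \<tau> - 1"
      using F(1) that F0 by (simp add: K_def q_expands_def)
    then have "exp (H (nome \<tau>)) * (1 + nome \<tau> * K (nome \<tau>)) = exp (H (nome \<tau>)) * E2 \<tau>" by simp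
    then have "exp (H (nome \<tau>)) + nome \<tau> * (exp (H (nome \<tau>)) * K (nome \<tau>)) = exp (H (nome \<tau>)) * E2 \<tau>"
      by (simp add: algebra_simps)
    then have "(exp (H (nome \<tau>)) + nome \<tau> * (exp (H (nome \<tau>)) * K (nome \<tau>))) * (2 * of_real pi * \<i> * nome \<tau>) = 2 * of_real pi * \<i> * E2 \<tau> * N \<tau>"
      unfolding N_def D_def by (simp only: mult_ac)
    ultimately show ?thesis by simp
  qed
  \<comment> \<open>By the inversion law of \<open>E2\<close> numerator and denominator have the
    same logarithmic derivative \<open>2 pi \<i> E2 + 12 / \<tau>\<close>, so \<open>R\<close> is
    constant. Its value is read off at \<i>, which the inversion fixes and where
    \<open>\<tau>^12 = 1\<close>.\<close>
  define R where "R \<tau> = N (- 1 / \<tau>) / (\<tau> ^ 12 * N \<tau>)" for \<tau>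
  have Rd: "(R has_field_derivative 0) (at \<tau> within uhp)" if t: "\<tau> \<in> uhp" for \<tau>
  proof -
    have t0: "\<tau> \<noteq> 0" using t by (auto simp: uhp_def)
    have "((\<lambda>\<tau>. - 1 / \<tau>) has_field_derivative 1 / \<tau>\<^sup>2) (at \<tau>)"
      using t0 by (auto intro!: derivative_eq_intros simp: power2_eq_square)
    from DERIV_chain2[OF Nd[OF uhp_inversion[OF t]] this]
    have 1: "((\<lambda>\<tau>. N (- 1 / \<tau>)) has_field_derivative 2 * of_real pi * \<i> * E2 (- 1 / \<tau>) * N (- 1 / \<tau>) * (1 / \<tau>\<^sup>2)) (at \<tau>)" .
    have 2: "((\<lambda>\<tau>. \<tau> ^ 12 * N \<tau>) has_field_derivative 12 * \<tau> ^ 11 * N \<tau> + \<tau> ^ 12 * (2 * of_real pi * \<i> * E2 \<tau> * N \<tau>)) (at \<tau>)"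
      using Nd[OF t] by (auto intro!: derivative_eq_intros)
    have e: "2 * of_real pi * \<i> * E2 (- 1 / \<tau>) * N (- 1 / \<tau>) * (1 / \<tau>\<^sup>2) = (2 * of_real pi * \<i> * E2 \<tau> + 12 / \<tau>) * N (- 1 / \<tau>)"
      unfolding E2_inversion[OF t] using t0 by (simp add: field_simps power2_eq_square)
    have e': "12 * \<tau> ^ 11 * N \<tau> + \<tau> ^ 12 * (2 * of_real pi * \<i> * E2 \<tau> * N \<tau>) = (2 * of_real pi * \<i> * E2 \<tau> + 12 / \<tau>) * (\<tau> ^ 12 * N \<tau>)"
      using t0 by (simp add: field_simps power_Suc[of \<tau> 11, simplified])
    have "(R has_field_derivative ((2 * of_real pi * \<i> * E2 \<tau> + 12 / \<tau>) * N (- 1 / \<tau>) * (\<tau> ^ 12 * N \<tau>) -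
        N (- 1 / \<tau>) * ((2 * of_real pi * \<i> * E2 \<tau> + 12 / \<tau>) * (\<tau> ^ 12 * N \<tau>))) / ((\<tau> ^ 12 * N \<tau>) * (\<tau> ^ 12 * N \<tau>))) (at \<tau>)"
      unfolding R_def by (rule DERIV_divide[OF 1[unfolded e] 2[unfolded e']]) (use t0 N0 in auto)
    then show ?thesis by (simp add: mult_ac has_field_derivative_at_within)
  qed
  have iu: "\<i> \<in> uhp" by (simp add: uhp_def)
  have i12: "\<i> ^ 12 = (1::complex)" by (simp add: power_mult[of \<i> 2 6, simplified])
  have "R \<tau> = R \<i>" if "\<tau> \<in> uhp" for \<tau>
    using has_field_derivative_zero_constant[OF convex_uhp Rd] that iu by metis
  moreover have "R \<i> = 1" unfolding R_def i12 using N0 by simp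
  ultimately have NS: "N (- 1 / \<tau>) = \<tau> ^ 12 * N \<tau>" if "\<tau> \<in> uhp" for \<tau>
    using that N0[of \<tau>] by (auto simp: R_def uhp_def divide_eq_1_iff)
  show ?thesis
  proof (rule that[OF Dh])
    show "deriv D 0 \<noteq> 0" using D0 by (simp add: DERIV_imp_deriv)
    show "D (cnj q) = cnj (D q)" if "norm q < 1" for q
      using Hc[OF that] by (simp add: D_def exp_cnj)
    show "D (nome (- 1 / \<tau>)) = \<tau> ^ 12 * D (nome \<tau>)" if "\<tau> \<in> uhp" for \<tau>
      using NS[OF that] by (simp add: N_def)
  qed (auto simp: D_def)
qed


section \<open>The valence formula\<close>

lemma compose_local_biholomorphic:
  assumes \<phi>: "\<phi> holomorphic_on S" "open S" "z \<in> S" "deriv \<phi> z \<noteq> 0"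
    and h: "h holomorphic_on T" "open T" "\<phi> z \<in> T" "\<forall>\<^sub>F w in at (\<phi> z). h w \<noteq> 0"
  shows "zorder (\<lambda>w. h (\<phi> w)) z = zorder h (\<phi> z)" "\<forall>\<^sub>F w in at z. h (\<phi> w) \<noteq> 0"
proof -
  have han: "h analytic_on {\<phi> z}" using h analytic_at by blast
  have pan: "\<phi> analytic_on {z}" using \<phi> analytic_at by blast
  have d: "((\<lambda>w. \<phi> w - \<phi> z) has_field_derivative deriv \<phi> z) (at z)"
    using holomorphic_derivI[OF \<phi>(1-3)] by (auto intro!: derivative_eq_intros)
  have o1: "zorder (\<lambda>w. \<phi> w - \<phi> z) z = 1"
    by (rule zorder_eq_1) (use pan d \<phi>(4) in \<open>auto intro!: analytic_intros simp: DERIV_imp_deriv\<close>)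
  have "((\<lambda>w. (\<phi> w - \<phi> z) / (w - z)) \<longlongrightarrow> deriv \<phi> z) (at z)"
    using d by (simp add: has_field_derivative_iff)
  then have "\<forall>\<^sub>F w in at z. (\<phi> w - \<phi> z) / (w - z) \<noteq> 0"
    by (rule tendsto_imp_eventually_ne) (rule \<phi>(4))
  then have ne: "\<forall>\<^sub>F w in at z. \<phi> w \<noteq> \<phi> z" by eventually_elim auto
  have "zorder (h \<circ> \<phi>) z = zorder h (\<phi> z) * zorder (\<lambda>w. \<phi> w - \<phi> z) z"
    by (rule zorder_compose')
      (use han pan h ne in \<open>auto intro: isolated_singularity_at_analytic not_essential_analytic\<close>)
  then show "zorder (\<lambda>w. h (\<phi> w)) z = zorder h (\<phi> z)" by (simp add: o1 o_def)
  have "isCont \<phi> z" using pan analytic_at_imp_isCont by blast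
  then have "filterlim \<phi> (at (\<phi> z)) (at z)"
    using ne by (simp add: filterlim_at isCont_def)
  then show "\<forall>\<^sub>F w in at z. h (\<phi> w) \<noteq> 0"
    using h(4) by (rule eventually_compose_filterlim[rotated])
qed

lemma zcount_superset:
  assumes "finite T" "{z\<in>U. f z = 0} \<subseteq> T" "T \<subseteq> U" "f holomorphic_on V" "open V" "U \<subseteq> V"
  shows "zcount f U = (\<Sum>z\<in>T. zorder f z)"
  unfolding zcount_def
proof (rule sum.mono_neutral_left[OF assms(1,2)])
  show "\<forall>z\<in>T - {z\<in>U. f z = 0}. zorder f z = 0"
    using assms(3-6) analytic_at by (auto intro!: zorder_eq_0I)
qed

section \<open>The fundamental domain in the nome disc\<close>

definition tiles :: "complex set" where
  "tiles = {z\<in>uhp. \<forall>n::int. norm (z - of_int n) > 1}"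

text \<open>\<open>tiles\<close> is invariant under integral translations, so this is its quotient
  by them with the cusp filled in as 0. The vertical sides of the fundamental domain are glued
  together in the interior, and only the bottom arc is left as frontier.\<close>

definition disc_domain :: "complex set" where
  "disc_domain = insert 0 (nome ` tiles)"

definition arc :: "complex set" where
  "arc = {z\<in>uhp. norm z = 1 \<and> - (1/2) \<le> Re z \<and> Re z < 1/2}"

text \<open>The squared norms differ by \<open>n^2 - 2 n Re z\<close>, and \<open>2 n Re z\<close>
  is at most \<open>\<bar>n\<bar>\<close>, which is at most \<open>n^2\<close> for an
  integer.\<close>

lemma norm_sub_int_ge:
  assumes "\<bar>Re z\<bar> \<le> 1/2"
  shows "norm (z - of_int n) \<ge> norm z"
proof -
  have "2 * of_int n * Re z \<le> \<bar>of_int n\<bar>"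
  proof -
    have "2 * of_int n * Re z \<le> \<bar>2 * of_int n * Re z\<bar>" by simp
    also have "\<dots> = \<bar>of_int n\<bar> * (2 * \<bar>Re z\<bar>)" by (simp add: abs_mult)
    also have "\<dots> \<le> \<bar>of_int n\<bar> * 1" using assms by (intro mult_left_mono) auto
    finally show ?thesis by simp
  qed
  also have "\<bar>of_int n\<bar> \<le> (of_int n :: real)\<^sup>2"
  proof -
    have "\<bar>n\<bar> * 1 \<le> \<bar>n\<bar> * \<bar>n\<bar>" by (cases "n = 0") (simp, intro mult_left_mono, auto)
    then have "real_of_int (\<bar>n\<bar> * 1) \<le> of_int (\<bar>n\<bar> * \<bar>n\<bar>)" by (simp only: of_int_le_iff)
    then show ?thesis by (simp add: power2_eq_square)
  qed
  finally have "(norm z)\<^sup>2 \<le> (norm (z - of_int n))\<^sup>2"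
    by (simp add: cmod_power2 power2_diff mult_ac)
  then show ?thesis by (rule power2_le_imp_le) simp
qed

lemma translate_to_strip:
  obtains n :: int where "- (1/2) \<le> Re (z + of_int n)" "Re (z + of_int n) < 1/2" "\<bar>Re (z + of_int n)\<bar> \<le> 1/2"
proof -
  have *: "- (1/2) \<le> Re (z + of_int (- \<lfloor>Re z + 1/2\<rfloor>))" "Re (z + of_int (- \<lfloor>Re z + 1/2\<rfloor>)) < 1/2"
    by (simp, linarith)+
  then have "\<bar>Re (z + of_int (- \<lfloor>Re z + 1/2\<rfloor>))\<bar> \<le> 1/2" by linarith
  with * show ?thesis using that by blast
qed

lemma tiles_strip:
  assumes "\<bar>Re z\<bar> \<le> 1/2"
  shows "z \<in> tiles \<longleftrightarrow> z \<in> uhp \<and> norm z > 1"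
  using norm_sub_int_ge[OF assms] unfolding tiles_def by (auto intro: less_le_trans dest: spec[of _ 0])

lemma tiles_add_int: "z + of_int n \<in> tiles \<longleftrightarrow> z \<in> tiles"
proof -
  have "w + of_int m \<in> tiles" if "w \<in> tiles" for w m
    using that unfolding tiles_def uhp_def
  proof (clarsimp, goal_cases)
    case (1 n)
    have "w + of_int m - of_int n = w - of_int (n - m)" by simp
    then show ?case using 1 by metis
  qed
  from this[of z n] this[of "z + of_int n" "- n"] show ?thesis by auto
qed

lemma nome_mem_disc_domain: "nome z \<in> disc_domain \<longleftrightarrow> z \<in> tiles"
proof
  assume "nome z \<in> disc_domain"
  then obtain w where "w \<in> tiles" "nome z = nome w" by (auto simp: disc_domain_def)
  then show "z \<in> tiles" using tiles_add_int by (auto simp: nome_eq_iff)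
qed (simp add: disc_domain_def)

lemma exp_4pi: "exp (- 4 * pi) < (1::real)"
  by simp

lemma norm_nome: "norm (nome z) = exp (- 2 * pi * Im z)"
  by (simp add: nome_def norm_exp_eq_Re)

lemma high_tiles: "Im z > 1 \<Longrightarrow> z \<in> tiles"
proof -
  assume z: "Im z > 1"
  have "norm (z - of_int n) > 1" for n
    using abs_Im_le_cmod[of "z - of_int n"] z by simp
  then show ?thesis using z by (simp add: tiles_def uhp_def)
qed

text \<open>Infinitely many strict inequalities are involved. The smallest distance from
  \<open>z\<close> to an integer is \<open>m\<close>, attained by the translate with
  \<open>\<bar>Re\<bar> \<le> 1/2\<close>, so \<open>m - 1\<close> is a common margin.\<close>

lemma open_tiles: "open tiles"
  unfolding open_contains_ball
proof
  fix z assume z: "z \<in> tiles"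
  obtain n0 :: int where n0: "\<bar>Re (z + of_int n0)\<bar> \<le> 1/2"
    using translate_to_strip by blast
  define m where "m = norm (z + of_int n0)"
  have m1: "m > 1" using z unfolding tiles_def m_def by (auto dest: spec[of _ "- n0"])
  have mle: "m \<le> norm (z - of_int n)" for n
    using norm_sub_int_ge[OF n0, of "n + n0"] by (simp add: m_def)
  have "z \<in> uhp" using z by (simp add: tiles_def)
  then obtain e where e: "e > 0" "ball z e \<subseteq> uhp" using open_uhp openE by blast
  have "ball z (min e (m - 1)) \<subseteq> tiles"
  proof
    fix w assume w: "w \<in> ball z (min e (m - 1))"
    have "norm (w - of_int n) > 1" for n
    proof -
      have "m \<le> norm (z - of_int n)" by (rule mle)
      also have "\<dots> \<le> norm (z - w) + norm (w - of_int n)" by norm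
      finally show ?thesis using w by (simp add: dist_norm)
    qed
    moreover have "w \<in> uhp" using w e by auto
    ultimately show "w \<in> tiles" by (simp add: tiles_def)
  qed
  then show "\<exists>e>0. ball z e \<subseteq> tiles"
    using e m1 by (intro exI[of _ "min e (m - 1)"]) auto
qed

text \<open>Away from 0 this is the open mapping theorem for the nome. The radius
  \<open>exp (- 4 * pi)\<close> is the modulus of the nome at height 2, and all points above height
  1 belong to \<open>tiles\<close>.\<close>

lemma open_disc_domain: "open disc_domain"
proof -
  have "open (nome ` tiles)"
  proof (rule open_mapping_thm[of nome UNIV])
    show "\<not> nome constant_on UNIV"
    proof
      assume "nome constant_on UNIV"
      then have "nome 0 = nome (1/2)" unfolding constant_on_def by force
      then obtain n :: int where "(0::complex) = 1/2 + of_int n" unfolding nome_eq_iff by blast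
      then have "Re 0 = Re (1/2 + of_int n)" by simp
      then have "real_of_int (2 * n) = real_of_int (- 1)" by simp
      then have "2 * n = - 1" by (simp only: of_int_eq_iff)
      then show False by presburger
    qed
  qed (auto intro!: holomorphic_intros open_tiles)
  moreover have "ball 0 (exp (- 4 * pi)) \<subseteq> disc_domain"
  proof
    fix q :: complex assume q: "q \<in> ball 0 (exp (- 4 * pi))"
    show "q \<in> disc_domain"
    proof (cases "q = 0")
      case False
      have "norm q < exp (- 4 * pi)" using q by simp
      then have "norm q < 1" using exp_4pi by (rule less_trans)
      then obtain z where z: "z \<in> uhp" "nome z = q" using nome_surj[OF False] by blast
      then have "exp (- 2 * pi * Im z) < exp (- 4 * pi)" using q norm_nome[of z] by simp
      then have "Im z > 2" by simp
      then have "z \<in> tiles" by (intro high_tiles) simp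
      then show ?thesis using z by (auto simp: disc_domain_def)
    qed (simp add: disc_domain_def)
  qed
  moreover have "disc_domain = nome ` tiles \<union> ball 0 (exp (- 4 * pi))"
    using calculation(2) by (auto simp: disc_domain_def)
  ultimately show ?thesis by (metis open_Un open_ball)
qed

text \<open>A compact cover inside the unit disc: the closed strip cut off at height 2 and a closed
  disc for everything above. It controls closure, frontier and boundedness of
  \<open>disc_domain\<close>.\<close>

lemma disc_domain_subset:
  "disc_domain \<subseteq> nome ` {z. \<bar>Re z\<bar> \<le> 1/2 \<and> norm z \<ge> 1 \<and> 0 \<le> Im z \<and> Im z \<le> 2} \<union> cball 0 (exp (- 4 * pi))"
proof
  fix q assume "q \<in> disc_domain"
  then consider "q = 0" | z where "z \<in> tiles" "q = nome z" by (auto simp: disc_domain_def)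
  then show "q \<in> nome ` {z. \<bar>Re z\<bar> \<le> 1/2 \<and> norm z \<ge> 1 \<and> 0 \<le> Im z \<and> Im z \<le> 2} \<union> cball 0 (exp (- 4 * pi))"
  proof cases
    case (2 z)
    obtain n :: int where n: "\<bar>Re (z + of_int n)\<bar> \<le> 1/2"
      using translate_to_strip by blast
    have t: "z + of_int n \<in> tiles" using 2 tiles_add_int by blast
    have q: "q = nome (z + of_int n)" using 2 by simp
    show ?thesis
    proof (cases "Im z \<le> 2")
      case True
      have "norm (z + of_int n) > 1" "z + of_int n \<in> uhp" using t tiles_strip[OF n] by auto
      then have "z + of_int n \<in> {z. \<bar>Re z\<bar> \<le> 1/2 \<and> norm z \<ge> 1 \<and> 0 \<le> Im z \<and> Im z \<le> 2}"
        using True n by (simp add: uhp_def)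
      then show ?thesis unfolding q by blast
    next
      case False
      then have "norm q \<le> exp (- 4 * pi)" using 2 by (simp add: norm_nome)
      then show ?thesis by simp
    qed
  qed simp
qed

lemma compact_disc_cover:
  "compact (nome ` {z. \<bar>Re z\<bar> \<le> 1/2 \<and> norm z \<ge> 1 \<and> 0 \<le> Im z \<and> Im z \<le> 2} \<union> cball 0 (exp (- 4 * pi)))"
proof (intro compact_Un compact_continuous_image compact_cball)
  show "continuous_on {z. \<bar>Re z\<bar> \<le> 1/2 \<and> norm z \<ge> 1 \<and> 0 \<le> Im z \<and> Im z \<le> 2} nome"
    by (intro holomorphic_on_imp_continuous_on holomorphic_intros)
  have "{z. \<bar>Re z\<bar> \<le> 1/2 \<and> norm z \<ge> 1 \<and> 0 \<le> Im z \<and> Im z \<le> 2} \<subseteq> cball 0 3"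
  proof clarify
    fix z :: complex assume "\<bar>Re z\<bar> \<le> 1/2" "0 \<le> Im z" "Im z \<le> 2"
    then show "z \<in> cball 0 3" using cmod_le[of z] by simp
  qed
  then have "bounded {z. \<bar>Re z\<bar> \<le> 1/2 \<and> norm z \<ge> 1 \<and> 0 \<le> Im z \<and> Im z \<le> 2}"
    using bounded_cball bounded_subset by blast
  moreover have "closed {z. \<bar>Re z\<bar> \<le> 1/2 \<and> norm z \<ge> 1 \<and> 0 \<le> Im z \<and> Im z \<le> 2}"
    by (intro closed_Collect_conj closed_Collect_le continuous_intros)
  ultimately show "compact {z. \<bar>Re z\<bar> \<le> 1/2 \<and> norm z \<ge> 1 \<and> 0 \<le> Im z \<and> Im z \<le> 2}"
    by (simp add: compact_eq_bounded_closed)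
qed

lemma closure_disc_domain:
  "closure disc_domain \<subseteq> nome ` {z. \<bar>Re z\<bar> \<le> 1/2 \<and> norm z \<ge> 1 \<and> 0 \<le> Im z \<and> Im z \<le> 2} \<union> cball 0 (exp (- 4 * pi))"
  using closure_minimal[OF disc_domain_subset] compact_disc_cover compact_imp_closed by blast

lemma bounded_disc_domain: "bounded disc_domain"
  using compact_imp_bounded[OF compact_disc_cover] disc_domain_subset bounded_subset by blast

lemma unit_norm_strip_uhp:
  assumes "\<bar>Re z\<bar> \<le> 1/2" "norm z \<ge> 1" "0 \<le> Im z"
  shows "z \<in> uhp" "Im z \<ge> sqrt 3 / 2"
proof -
  have "1 \<le> (norm z)\<^sup>2" using assms(2) by (simp add: one_le_power)
  then have "1 \<le> (Re z)\<^sup>2 + (Im z)\<^sup>2" by (simp add: cmod_power2)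
  moreover have "(Re z)\<^sup>2 \<le> (1/2)\<^sup>2" using assms(1) by (subst abs_le_square_iff[symmetric]) simp
  ultimately have "3/4 \<le> (Im z)\<^sup>2" by (simp add: power2_eq_square)
  then have "sqrt 3 \<le> 2 * Im z" using assms(3) by (intro real_le_lsqrt) (auto simp: power_mult_distrib)
  then show *: "Im z \<ge> sqrt 3 / 2" by simp
  have "sqrt 3 / 2 > (0::real)" by simp
  then have "Im z > 0" using * by linarith
  then show "z \<in> uhp" by (simp add: uhp_def)
qed

lemma closure_disc_domain_ball: "closure disc_domain \<subseteq> ball 0 1"
proof
  fix q assume "q \<in> closure disc_domain"
  then have "q \<in> nome ` {z. \<bar>Re z\<bar> \<le> 1/2 \<and> norm z \<ge> 1 \<and> 0 \<le> Im z \<and> Im z \<le> 2} \<union> cball 0 (exp (- 4 * pi))"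
    using closure_disc_domain by blast
  then show "q \<in> ball 0 1"
  proof
    assume "q \<in> cball 0 (exp (- 4 * pi))"
    then have "norm q \<le> exp (- 4 * pi)" by simp
    then have "norm q < 1" using exp_4pi by (rule le_less_trans)
    then show ?thesis by simp
  qed (use unit_norm_strip_uhp(1) norm_nome_less in auto)
qed

lemma arc_strip: "z \<in> arc \<Longrightarrow> \<bar>Re z\<bar> \<le> 1/2"
  by (auto simp: arc_def)

lemma inj_on_nome_arc: "inj_on nome arc"
proof (rule inj_onI)
  fix z w assume *: "z \<in> arc" "w \<in> arc" "nome z = nome w"
  then obtain n :: int where n: "z = w + of_int n" unfolding nome_eq_iff by blast
  then have "\<bar>of_int n :: real\<bar> < 1" using * by (auto simp: arc_def)
  then have "n = 0" by simp
  then show "z = w" using n by simp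
qed

lemma frontier_disc_domain: "frontier disc_domain = nome ` arc"
proof
  have fr: "frontier disc_domain = closure disc_domain - disc_domain"
    using open_disc_domain by (simp add: frontier_def interior_open)
  show "frontier disc_domain \<subseteq> nome ` arc"
  proof
    fix q assume q: "q \<in> frontier disc_domain"
    then have "q \<in> nome ` {z. \<bar>Re z\<bar> \<le> 1/2 \<and> norm z \<ge> 1 \<and> 0 \<le> Im z \<and> Im z \<le> 2} \<union> cball 0 (exp (- 4 * pi))"
      using closure_disc_domain fr by blast
    then show "q \<in> nome ` arc"
    proof
      assume "q \<in> nome ` {z. \<bar>Re z\<bar> \<le> 1/2 \<and> norm z \<ge> 1 \<and> 0 \<le> Im z \<and> Im z \<le> 2}"
      then obtain z where z: "q = nome z" "\<bar>Re z\<bar> \<le> 1/2" "norm z \<ge> 1" "0 \<le> Im z" by blast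
      have u: "z \<in> uhp" using unit_norm_strip_uhp(1) z by blast
      have "z \<notin> tiles" using q fr z(1) nome_mem_disc_domain by blast
      then have nz: "norm z = 1" using tiles_strip[OF z(2)] u z(3) by auto
      show ?thesis
      proof (cases "Re z < 1/2")
        case True
        then show ?thesis using z u nz by (auto simp: arc_def)
      next
        case False
        then have re: "Re z = 1/2" using z(2) by simp
        have "norm (z - 1) = norm z"
          by (simp add: cmod_def re)
        then have "z - 1 \<in> arc" using nz re u by (simp add: arc_def uhp_def)
        moreover have "nome (z - 1) = nome z" using nome_add_of_int[of z "- 1"] by simp
        ultimately show ?thesis using z(1) by (metis image_eqI)
      qed
    next
      assume "q \<in> cball 0 (exp (- 4 * pi))"
      then have qn: "norm q \<le> exp (- 4 * pi)" by simp
      have "q \<noteq> 0" using q fr by (auto simp: disc_domain_def)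
      have "norm q < 1" using qn exp_4pi by (rule le_less_trans)
      then obtain z where z: "z \<in> uhp" "nome z = q" using nome_surj[OF \<open>q \<noteq> 0\<close>] by blast
      then have "Im z \<ge> 2" using qn norm_nome[of z] by simp
      then have "q \<in> disc_domain" using z high_tiles[of z] nome_mem_disc_domain by force
      then show ?thesis using q fr by blast
    qed
  qed
  show "nome ` arc \<subseteq> frontier disc_domain"
  proof
    fix q assume "q \<in> nome ` arc"
    then obtain z where z: "z \<in> arc" "q = nome z" by blast
    have "z \<notin> tiles" using z tiles_strip[OF arc_strip[OF z(1)]] by (auto simp: arc_def)
    then have nq: "q \<notin> disc_domain" using z nome_mem_disc_domain by blast
    have lim: "(\<lambda>n. nome (z + \<i> * of_real (1 / real (Suc n)))) \<longlonglongrightarrow> nome (z + \<i> * of_real 0)"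
    proof (intro isCont_tendsto_compose[of _ nome] tendsto_intros)
      show "isCont nome (z + \<i> * complex_of_real 0)"
        using has_field_derivative_nome DERIV_isCont by blast
      show "(\<lambda>n. 1 / real (Suc n)) \<longlonglongrightarrow> 0" by (rule lim_1_over_n[THEN LIMSEQ_Suc])
    qed
    \<comment> \<open>Moving straight up keeps the real part and increases the norm, so every arc
      point is a limit of points of \<open>tiles\<close>.\<close>
    have step: "nome (z + \<i> * of_real t) \<in> disc_domain" if t: "t > 0" for t :: real
    proof -
      have iz: "Im z > 0" using z(1) by (simp add: arc_def uhp_def)
      have ri: "Re (z + \<i> * of_real t) = Re z" "Im (z + \<i> * of_real t) = Im z + t" by simp_all
      have "(norm z)\<^sup>2 < (norm (z + \<i> * of_real t))\<^sup>2"
        using t iz unfolding cmod_power2 ri by (intro add_le_less_mono power_strict_mono) auto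
      then have "norm z < norm (z + \<i> * of_real t)" by (rule power_less_imp_less_base) simp
      moreover have "norm z = 1" using z(1) by (simp add: arc_def)
      moreover have "z + \<i> * of_real t \<in> uhp" unfolding uhp_def using ri iz t by simp
      ultimately have "z + \<i> * of_real t \<in> tiles"
        using arc_strip[OF z(1)] tiles_strip[of "z + \<i> * of_real t"] unfolding ri by simp
      then show ?thesis using nome_mem_disc_domain by blast
    qed
    have "nome (z + \<i> * of_real (1 / real (Suc n))) \<in> disc_domain" for n
      by (rule step) simp
    with lim have "q \<in> closure disc_domain"
      unfolding closure_sequential z(2) by (intro exI[of _ "\<lambda>n. nome (z + \<i> * of_real (1 / real (Suc n)))"] conjI allI) simp_all
    then show "q \<in> frontier disc_domain" using nq fr by blast
  qed
qed

section \<open>Symmetries of a modular form with real Fourier coefficients\<close>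

lemma inverse_on_circle: "norm z = 1 \<Longrightarrow> - 1 / z = - cnj z"
proof -
  assume z: "norm z = 1"
  then have "z * cnj z = 1" "z \<noteq> 0" by (auto simp: complex_norm_square[symmetric])
  then have "1 / z = cnj z" by (metis nonzero_eq_divide_eq mult.commute)
  then show ?thesis by simp
qed

text \<open>The sign of \<open>k\<close> is left open because positivity is derived in
  \<open>k_pos\<close>, where the locale is interpreted a second time with weight 0.\<close>

locale real_modular_form =
  fixes g :: "complex \<Rightarrow> complex" and k :: int and G :: "complex \<Rightarrow> complex" and A :: "complex fps"
  assumes modular: "modular_form k g" and nonconst: "\<not> g constant_on uhp"
    and q_exp: "q_expands g G A" and real_coeff: "\<And>n. fps_nth A n \<in> \<real>"
begin

lemma g_holomorphic: "g holomorphic_on uhp"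
  using modular by (simp add: modular_form_def)

lemma G_holomorphic: "G holomorphic_on ball 0 1"
  using q_exp by (simp add: q_expands_def)

lemma g_eq: "z \<in> uhp \<Longrightarrow> g z = G (nome z)"
  using q_exp by (simp add: q_expands_def)

lemma uhp_add_of_int: "z \<in> uhp \<Longrightarrow> z + of_int n \<in> uhp"
  by (simp add: uhp_def)

lemma uhp_minus_cnj: "z \<in> uhp \<Longrightarrow> - cnj z \<in> uhp"
  by (simp add: uhp_def)

lemma g_add_of_int: "z \<in> uhp \<Longrightarrow> g (z + of_int n) = g z"
  using g_eq uhp_add_of_int by simp

lemma deriv_g: "z \<in> uhp \<Longrightarrow> deriv g z = 2 * of_real pi * \<i> * nome z * deriv G (nome z)"
  by (rule q_expands_deriv[OF q_exp])

lemma deriv_g_add_of_int: "z \<in> uhp \<Longrightarrow> deriv g (z + of_int n) = deriv g z"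
  using deriv_g uhp_add_of_int by simp

lemma g_cnj: "z \<in> uhp \<Longrightarrow> g (- cnj z) = cnj (g z)"
  using g_eq uhp_minus_cnj q_expands_cnj[OF q_exp real_coeff norm_nome_less] by (simp add: nome_cnj)

lemma deriv_g_cnj:
  assumes "z \<in> uhp"
  shows "deriv g (- cnj z) = - cnj (deriv g z)"
proof -
  have q': "q_expands (normalized_deriv g) (\<lambda>q. q * deriv G q) (fps_X * fps_deriv A)"
    by (rule q_expands_normalized_deriv[OF q_exp])
  have "fps_nth (fps_X * fps_deriv A) n \<in> \<real>" for n
    using real_coeff by (cases n) (auto intro!: Reals_mult Reals_add simp del: of_nat_Suc)
  from q_expands_cnj[OF q' this norm_nome_less[OF assms]]
  have "normalized_deriv g (- cnj z) = cnj (normalized_deriv g z)"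
    using q' assms uhp_minus_cnj by (simp add: q_expands_def nome_cnj)
  then show ?thesis by (simp add: normalized_deriv_def field_simps)
qed

lemma g_moebius:
  assumes "a * d - b * c = (1::int)" "z \<in> uhp"
  shows "g ((of_int a * z + of_int b) / (of_int c * z + of_int d)) = (of_int c * z + of_int d) powi k * g z"
proof -
  define M :: "int^2^2" where "M = vector [vector [a, b], vector [c, d]]"
  have e: "M$1$1 = a" "M$1$2 = b" "M$2$1 = c" "M$2$2 = d" by (simp_all add: M_def)
  have "M \<in> SL2Z" using assms(1) by (simp add: SL2Z_def det_2 e)
  then show ?thesis using modular assms(2) unfolding modular_form_def moebius_def by (metis e)
qed

lemma deriv_g_moebius:
  assumes "a * d - b * c = (1::int)" "z \<in> uhp"
  defines "j \<equiv> of_int c * z + of_int d"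
  shows "deriv g ((of_int a * z + of_int b) / j) = j powi (k + 2) * deriv g z + of_int k * of_int c * j powi (k + 1) * g z"
proof -
  have j0: "j \<noteq> 0" unfolding j_def by (rule moebius_denom_nonzero[OF assms(1,2)])
  have u: "(of_int a * z + of_int b) / j \<in> uhp" unfolding j_def by (rule moebius_uhp'[OF assms(1,2)])
  note m = has_field_derivative_moebius[OF assms(1,2), folded j_def]
  have "((\<lambda>w. g ((of_int a * w + of_int b) / (of_int c * w + of_int d))) has_field_derivative
      deriv g ((of_int a * z + of_int b) / j) * (1 / j\<^sup>2)) (at z)"
    by (rule DERIV_chain2[OF _ m]) (use holomorphic_derivI[OF g_holomorphic open_uhp u] in \<open>simp add: j_def\<close>)
  then have 1: "((\<lambda>w. (of_int c * w + of_int d) powi k * g w) has_field_derivative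
      deriv g ((of_int a * z + of_int b) / j) * (1 / j\<^sup>2)) (at z)"
    by (rule has_field_derivative_transform_within_open[OF _ open_uhp assms(2)]) (rule g_moebius[OF assms(1)])
  have 2: "((\<lambda>w. (of_int c * w + of_int d) powi k * g w) has_field_derivative
      of_int k * of_int c * j powi (k - 1) * g z + j powi k * deriv g z) (at z)"
    using j0 holomorphic_derivI[OF g_holomorphic open_uhp assms(2)] unfolding j_def
    by (auto intro!: derivative_eq_intros)
  have "deriv g ((of_int a * z + of_int b) / j) * (1 / j\<^sup>2) = of_int k * of_int c * j powi (k - 1) * g z + j powi k * deriv g z"
    by (rule DERIV_unique[OF 1 2])
  then have "deriv g ((of_int a * z + of_int b) / j) = (of_int k * of_int c * j powi (k - 1) * g z + j powi k * deriv g z) * j\<^sup>2"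
    using j0 by (simp add: field_simps)
  also have "\<dots> = of_int k * of_int c * (j powi (k - 1) * j powi 2) * g z + (j powi k * j powi 2) * deriv g z"
    by (simp add: algebra_simps power_int_numeral)
  also have "j powi (k - 1) * j powi 2 = j powi (k + 1)" using j0 by (subst power_int_add[symmetric]) (auto simp: add.commute)
  also have "j powi k * j powi 2 = j powi (k + 2)" using j0 by (subst power_int_add[symmetric]) auto
  finally show ?thesis by (simp add: algebra_simps)
qed

lemma g_inversion: "z \<in> uhp \<Longrightarrow> g (- 1 / z) = z powi k * g z"
  using g_moebius[of 0 0 "-1" 1 z] by simp

text \<open>On these lines the reflection \<open>- cnj z\<close> is a translation by 1 or -1.
  Periodicity and the reality of the coefficients then give \<open>cnj (g z) = g z\<close> and
  \<open>cnj (deriv g z) = - deriv g z\<close>.\<close>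

lemma line_symmetry:
  assumes "z \<in> uhp" "Re z = 1/2 \<or> Re z = - (1/2)"
  shows "g z \<in> \<real>" "Re (deriv g z) = 0"
proof -
  have "\<exists>n::int. - cnj z = z + of_int n"
    using assms(2) by (auto simp: complex_eq_iff intro: exI[of _ "-1"] exI[of _ 1])
  then obtain n :: int where n: "- cnj z = z + of_int n" by blast
  have "cnj (g z) = g z" using g_cnj[OF assms(1)] g_add_of_int[OF assms(1), of n] n by simp
  then show "g z \<in> \<real>" by (simp add: Reals_cnj_iff)
  have "- cnj (deriv g z) = deriv g z"
    using deriv_g_cnj[OF assms(1)] deriv_g_add_of_int[OF assms(1), of n] n by simp
  then have "Re (- cnj (deriv g z)) = Re (deriv g z)" by simp
  then show "Re (deriv g z) = 0" by simp
qed

text \<open>As \<open>g\<close> is real and \<open>deriv g\<close> imaginary on these lines, the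
  imaginary part of the pencil is \<open>Re v * Im (deriv g z)\<close>. A zero therefore forces
  \<open>deriv g z = 0\<close>, and then \<open>g z = 0\<close>.\<close>

lemma line_pencil_nonzero:
  assumes z: "z \<in> uhp" "Re z = 1/2 \<or> Re z = - (1/2)" and g0: "g z \<noteq> 0" and v: "Re v \<noteq> 0" and k0: "k \<noteq> 0"
  shows "of_int k * g z + v * deriv g z \<noteq> 0"
proof
  assume 0: "of_int k * g z + v * deriv g z = 0"
  obtain y where y: "g z = of_real y" using line_symmetry(1)[OF z] by (auto elim: Reals_cases)
  define d where "d = Im (deriv g z)"
  have d: "deriv g z = \<i> * of_real d" using line_symmetry(2)[OF z] by (simp add: d_def complex_eq_iff)
  have "Im (of_int k * g z + v * deriv g z) = Re v * d" unfolding y d by simp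
  then have "d = 0" using 0 v by simp
  then show False using 0 g0 k0 d by simp
qed

text \<open>In terms of the equivariant function \<open>h(z) = z + k g(z)/g'(z)\<close>, for which \<open>h(z) = z - v\<close>, this says that
  \<open>h\<close> maps the unit circle to itself.\<close>

lemma circle_pencil_zero:
  assumes z: "z \<in> uhp" "norm z = 1" and g0: "g z \<noteq> 0" and 0: "of_int k * g z + v * deriv g z = 0" and k0: "k \<noteq> 0"
  shows "norm (z - v) = 1"
proof -
  define d where "d = deriv g z"
  have zz: "z * cnj z = 1" using z(2) by (simp add: complex_norm_square[symmetric])
  have z0: "z \<noteq> 0" using z by auto
  note S = inverse_on_circle[OF z(2)]
  have kg: "of_int k * g z = - v * d" using 0 by (simp add: d_def add_eq_0_iff)
  have k0': "(of_int k :: complex) \<noteq> 0" using k0 by simp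
  have d0: "d \<noteq> 0" using kg g0 k0' by auto
  have 1: "cnj (g z) = z powi k * g z" using g_cnj[OF z(1)] g_inversion[OF z(1)] S by simp
  have "- cnj d = deriv g (- 1 / z)" using deriv_g_cnj[OF z(1)] S by (simp add: d_def)
  also have "\<dots> = z powi (k + 2) * d + of_int k * z powi (k + 1) * g z"
    using deriv_g_moebius[of 0 0 "-1" 1 z] z(1) by (simp add: d_def)
  also have "\<dots> = z powi (k + 1) * (z * d + of_int k * g z)"
  proof -
    have "z powi (k + 2) = z powi (k + 1) * z"
      using z0 power_int_add_1[of z "k + 1"] by (simp add: add.assoc)
    then show ?thesis by (simp add: algebra_simps)
  qed
  also have "\<dots> = z powi k * (z * (z - v) * d)"
  proof -
    have p: "z powi (k + 1) = z powi k * z" using z0 by (simp add: power_int_add_1)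
    show ?thesis unfolding kg p by (simp add: algebra_simps)
  qed
  finally have 2: "cnj d = - (z powi k * (z * (z - v) * d))" by (metis minus_minus)
  have "cnj (- v * d) = cnj (of_int k * g z)" by (simp only: kg)
  also have "\<dots> = z powi k * (of_int k * g z)" by (simp add: 1 mult_ac)
  also have "\<dots> = z powi k * (- v * d)" by (simp only: kg)
  finally have "cnj v * cnj d = z powi k * (v * d)" by simp
  then have 3: "cnj v * - (z * (z - v)) * (z powi k * d) = v * (z powi k * d)" unfolding 2 by (simp add: mult_ac)
  have W: "z powi k * d \<noteq> 0" using d0 z0 by simp
  have "cnj v * - (z * (z - v)) = v" by (rule mult_right_cancel[OF W, THEN iffD1, OF 3])
  then have "cnj z * (cnj v * - (z * (z - v))) = cnj z * v" by simp
  moreover have "cnj z * (cnj v * - (z * (z - v))) = (z * cnj z) * (cnj v * - (z - v))" by (simp add: algebra_simps)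
  ultimately have "cnj v * - (z - v) = cnj z * v" using zz by simp
  \<comment> \<open>This says that the squared norm of \<open>v\<close> is twice the real part of
    \<open>z * cnj v\<close>, which for \<open>norm z = 1\<close> means that \<open>z - v\<close> is
    on the unit circle.\<close>
  then have e: "v * cnj v - z * cnj v - cnj z * v = 0" by (simp add: algebra_simps)
  have "of_real ((norm (z - v))\<^sup>2) = (z - v) * cnj (z - v)" by (rule complex_norm_square)
  also have "\<dots> = z * cnj z + (v * cnj v - z * cnj v - cnj z * v)" by (simp add: algebra_simps)
  also have "\<dots> = 1" using e zz by simp
  finally have "(norm (z - v))\<^sup>2 = 1" by (metis of_real_1 of_real_eq_iff)
  then show ?thesis by (simp add: power2_eq_1_iff) (smt (verit) norm_ge_zero)
qed

lemma G_not_zero: "\<exists>q\<in>ball 0 1. G q \<noteq> 0"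
proof (rule ccontr)
  assume "\<not> ?thesis"
  then have "g z = 0" if "z \<in> uhp" for z using g_eq[OF that] norm_nome_less[OF that] by auto
  then show False using nonconst unfolding constant_on_def by blast
qed

lemma G_eventually_nonzero:
  assumes "norm q < 1"
  shows "\<forall>\<^sub>F w in at q. G w \<noteq> 0"
proof -
  obtain q0 where "q0 \<in> ball 0 1" "G q0 \<noteq> 0" using G_not_zero by blast
  then have "\<forall>\<^sub>F w in at q. G w \<noteq> 0 \<and> w \<in> ball 0 1"
    using assms by (intro non_zero_neighbour_alt[OF G_holomorphic]) auto
  then show ?thesis by (rule eventually_mono) simp
qed

lemma zorder_g:
  assumes "z \<in> uhp"
  shows "zorder g z = zorder G (nome z)" "\<forall>\<^sub>F w in at z. g w \<noteq> 0"
proof -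
  have q: "norm (nome z) < 1" by (rule norm_nome_less[OF assms])
  have d: "deriv nome z \<noteq> 0" using has_field_derivative_nome[of z] by (simp add: DERIV_imp_deriv)
  have 1: "zorder (\<lambda>w. G (nome w)) z = zorder G (nome z)" "\<forall>\<^sub>F w in at z. G (nome w) \<noteq> 0"
    by (rule compose_local_biholomorphic[OF _ open_UNIV UNIV_I d G_holomorphic open_ball _ G_eventually_nonzero[OF q]],
        use q in \<open>auto intro!: holomorphic_intros\<close>)+
  have "zorder g z = zorder (\<lambda>w. G (nome w)) z"
    by (rule zorder_cong_on[OF open_uhp assms]) (rule g_eq)
  then show "zorder g z = zorder G (nome z)" using 1(1) by simp
  have "\<forall>\<^sub>F w in at z. w \<in> uhp" by (rule eventually_at_in_open'[OF open_uhp assms])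
  with 1(2) show "\<forall>\<^sub>F w in at z. g w \<noteq> 0" by eventually_elim (simp add: g_eq)
qed

end


text \<open>The value is taken imaginary because the functions to which this is applied are real on
  the walls between tiles: no solution lies on a wall, so each belongs to a definite tile.\<close>

definition near_solutions :: "(complex \<Rightarrow> complex) \<Rightarrow> complex \<Rightarrow> real \<Rightarrow> real \<Rightarrow> complex set" where
  "near_solutions F z0 r \<epsilon> = {z\<in>ball z0 r. F z = \<i> * of_real \<epsilon>}"

text \<open>The count is required for every smaller radius. This forces the solutions for two
  different radii to coincide as soon as \<epsilon> is small, so the radius may be shrunk
  freely.\<close>

definition good_radius :: "(complex \<Rightarrow> complex) \<Rightarrow> complex \<Rightarrow> real \<Rightarrow> bool" where
  "good_radius F z0 r0 \<longleftrightarrow> r0 > 0 \<and> (\<forall>z\<in>ball z0 r0. z \<noteq> z0 \<longrightarrow> F z \<noteq> 0 \<and> deriv F z \<noteq> 0) \<and>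
    (\<forall>r. 0 < r \<longrightarrow> r < r0 \<longrightarrow> (\<forall>\<^sub>F \<epsilon> in at_right 0. finite (near_solutions F z0 r \<epsilon>) \<and>
        int (card (near_solutions F z0 r \<epsilon>)) = zorder F z0))"

lemma good_radius_exists:
  assumes "F holomorphic_on S" "open S" "z0 \<in> S" "F z0 = 0" "\<forall>\<^sub>F w in at z0. F w \<noteq> 0"
  obtains r0 where "good_radius F z0 r0"
proof -
  obtain r0 where r0: "r0 > 0" "ball z0 r0 \<subseteq> S"
    "\<And>z. z \<in> ball z0 r0 \<Longrightarrow> z \<noteq> z0 \<Longrightarrow> F z \<noteq> 0 \<and> deriv F z \<noteq> 0"
    "\<And>r. 0 < r \<Longrightarrow> r < r0 \<Longrightarrow> \<exists>\<delta>>0. \<forall>c. c \<noteq> 0 \<longrightarrow> norm c < \<delta> \<longrightarrow>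
        finite {z\<in>ball z0 r. F z = c} \<and> int (card {z\<in>ball z0 r. F z = c}) = zorder F z0"
    using local_preimages[OF assms] by blast
  have "\<forall>\<^sub>F \<epsilon> in at_right 0. finite (near_solutions F z0 r \<epsilon>) \<and> int (card (near_solutions F z0 r \<epsilon>)) = zorder F z0"
    if r: "0 < r" "r < r0" for r
  proof -
    obtain \<delta> where d: "\<delta> > 0" "\<And>c. c \<noteq> 0 \<Longrightarrow> norm c < \<delta> \<Longrightarrow>
        finite {z\<in>ball z0 r. F z = c} \<and> int (card {z\<in>ball z0 r. F z = c}) = zorder F z0"
      using r0(4)[OF r] by blast
    have "finite (near_solutions F z0 r \<epsilon>) \<and> int (card (near_solutions F z0 r \<epsilon>)) = zorder F z0"
      if "0 < \<epsilon>" "\<epsilon> < \<delta>" for \<epsilon>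
      unfolding near_solutions_def by (rule d(2)) (use that in \<open>auto simp: norm_mult\<close>)
    then show ?thesis unfolding eventually_at_right_field using d(1) by blast
  qed
  then show ?thesis using that[of r0] r0 unfolding good_radius_def by blast
qed

lemma good_radius_mono:
  "good_radius F z0 r0 \<Longrightarrow> 0 < r1 \<Longrightarrow> r1 \<le> r0 \<Longrightarrow> good_radius F z0 r1"
  unfolding good_radius_def by (auto simp: dist_commute)

lemma near_solutions_eq:
  assumes "good_radius F z0 r0" "0 < r" "r < r0" "0 < r'" "r' < r0"
  shows "\<forall>\<^sub>F \<epsilon> in at_right 0. near_solutions F z0 r \<epsilon> = near_solutions F z0 r' \<epsilon>"
proof -
  have *: "\<forall>\<^sub>F \<epsilon> in at_right 0. near_solutions F z0 a \<epsilon> = near_solutions F z0 b \<epsilon>"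
    if "0 < a" "a \<le> b" "b < r0" for a b
  proof -
    have "\<forall>\<^sub>F \<epsilon> in at_right 0. finite (near_solutions F z0 a \<epsilon>) \<and> int (card (near_solutions F z0 a \<epsilon>)) = zorder F z0"
      "\<forall>\<^sub>F \<epsilon> in at_right 0. finite (near_solutions F z0 b \<epsilon>) \<and> int (card (near_solutions F z0 b \<epsilon>)) = zorder F z0"
      using assms(1) that unfolding good_radius_def by auto
    then show ?thesis
    proof eventually_elim
      case (elim \<epsilon>)
      have "near_solutions F z0 a \<epsilon> \<subseteq> near_solutions F z0 b \<epsilon>"
        using that by (auto simp: near_solutions_def)
      then show ?case using elim by (intro card_subset_eq) auto
    qed
  qed
  show ?thesis
  proof (cases "r \<le> r'")
    case True then show ?thesis using * assms by blast
  next
    case False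
    then have "\<forall>\<^sub>F \<epsilon> in at_right 0. near_solutions F z0 r' \<epsilon> = near_solutions F z0 r \<epsilon>" using * assms by simp
    then show ?thesis by eventually_elim simp
  qed
qed

text \<open>\<gamma> preserves \<open>F\<close> and maps the solutions near \<open>z0\<close>
  injectively to solutions near \<open>z1\<close>. Both sets have the same number of elements, so
  this is a bijection, and it carries any condition \<open>P\<close> along. It is used for group
  elements that fix an arc zero or map one arc zero to another.\<close>

lemma near_solutions_transport:
  assumes g0: "good_radius F z0 r0" "0 < r" "r < r0" and g1: "good_radius F z1 r1" "0 < s" "s < r1"
    and \<gamma>: "isCont \<gamma> z0" "\<gamma> z0 = z1" "\<And>z. z \<in> ball z0 r0 \<Longrightarrow> F (\<gamma> z) = F z" "inj_on \<gamma> (ball z0 r0)"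
    and ord: "zorder F z0 = zorder F z1"
  shows "\<forall>\<^sub>F \<epsilon> in at_right 0. card {z\<in>near_solutions F z0 r \<epsilon>. P (\<gamma> z)} = card {z\<in>near_solutions F z1 s \<epsilon>. P z}"
proof -
  obtain d where d: "d > 0" "\<And>z. dist z z0 < d \<Longrightarrow> dist (\<gamma> z) z1 < s"
    using \<gamma>(1,2) g1(2) unfolding continuous_at_eps_delta by metis
  define r' where "r' = min d r / 2"
  have r': "0 < r'" "r' < d" "r' < r0" using d(1) g0 by (auto simp: r'_def)
  have "\<forall>\<^sub>F \<epsilon> in at_right 0. finite (near_solutions F z0 r' \<epsilon>) \<and> int (card (near_solutions F z0 r' \<epsilon>)) = zorder F z0"
      "\<forall>\<^sub>F \<epsilon> in at_right 0. finite (near_solutions F z1 s \<epsilon>) \<and> int (card (near_solutions F z1 s \<epsilon>)) = zorder F z1"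
    using g0(1) g1 r' unfolding good_radius_def by auto
  moreover have "\<forall>\<^sub>F \<epsilon> in at_right 0. near_solutions F z0 r \<epsilon> = near_solutions F z0 r' \<epsilon>"
    by (rule near_solutions_eq[OF g0 r'(1,3)])
  ultimately show ?thesis
  proof eventually_elim
    case (elim \<epsilon>)
    have inj: "inj_on \<gamma> (near_solutions F z0 r' \<epsilon>)"
      using \<gamma>(4) by (rule inj_on_subset) (use r' in \<open>auto simp: near_solutions_def\<close>)
    have "\<gamma> ` near_solutions F z0 r' \<epsilon> \<subseteq> near_solutions F z1 s \<epsilon>"
    proof
      fix w assume "w \<in> \<gamma> ` near_solutions F z0 r' \<epsilon>"
      then obtain z where z: "w = \<gamma> z" "z \<in> ball z0 r'" "F z = \<i> * of_real \<epsilon>" by (auto simp: near_solutions_def)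
      have "dist w z1 < s" using d(2)[of z] z r' by (simp add: dist_commute)
      moreover have "F w = F z" using \<gamma>(3)[of z] z r' by simp
      ultimately show "w \<in> near_solutions F z1 s \<epsilon>" using z by (simp add: near_solutions_def dist_commute)
    qed
    moreover have "card (\<gamma> ` near_solutions F z0 r' \<epsilon>) = card (near_solutions F z1 s \<epsilon>)"
      using elim ord card_image[OF inj] by simp
    ultimately have eq: "\<gamma> ` near_solutions F z0 r' \<epsilon> = near_solutions F z1 s \<epsilon>"
      using elim by (intro card_subset_eq) auto
    have "{z\<in>near_solutions F z1 s \<epsilon>. P z} = \<gamma> ` {z\<in>near_solutions F z0 r' \<epsilon>. P (\<gamma> z)}"
      unfolding eq[symmetric] by blast
    moreover have "card (\<gamma> ` {z\<in>near_solutions F z0 r' \<epsilon>. P (\<gamma> z)}) = card {z\<in>near_solutions F z0 r' \<epsilon>. P (\<gamma> z)}"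
      by (rule card_image) (rule inj_on_subset[OF inj], auto)
    ultimately show ?case using elim by simp
  qed
qed

lemma zcount_image:
  assumes \<phi>: "\<phi> holomorphic_on S" "open S" "W \<subseteq> S" "inj_on \<phi> W" "\<And>z. z \<in> W \<Longrightarrow> deriv \<phi> z \<noteq> 0"
    and h: "h holomorphic_on T" "open T" "\<phi> ` W \<subseteq> T" "\<And>z. z \<in> W \<Longrightarrow> \<forall>\<^sub>F w in at (\<phi> z). h w \<noteq> 0"
  shows "zcount h (\<phi> ` W) = zcount (\<lambda>z. h (\<phi> z)) W"
proof -
  have eq: "{q\<in>\<phi> ` W. h q = 0} = \<phi> ` {z\<in>W. h (\<phi> z) = 0}" by blast
  have "zcount h (\<phi> ` W) = (\<Sum>z\<in>{z\<in>W. h (\<phi> z) = 0}. zorder h (\<phi> z))"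
    unfolding zcount_def eq by (subst sum.reindex) (auto intro: inj_on_subset[OF \<phi>(4)])
  also have "\<dots> = zcount (\<lambda>z. h (\<phi> z)) W"
    unfolding zcount_def
  proof (rule sum.cong[OF refl])
    fix z assume "z \<in> {z\<in>W. h (\<phi> z) = 0}"
    then have z: "z \<in> W" "z \<in> S" "\<phi> z \<in> T" using \<phi>(3) h(3) by auto
    show "zorder h (\<phi> z) = zorder (\<lambda>z. h (\<phi> z)) z"
      using compose_local_biholomorphic(1)[OF \<phi>(1,2) z(2) \<phi>(5)[OF z(1)] h(1,2) z(3) h(4)[OF z(1)]] by simp
  qed
  finally show ?thesis .
qed

definition arc_left :: "complex set" where
  "arc_left = {z\<in>uhp. norm z = 1 \<and> - (1/2) \<le> Re z \<and> Re z \<le> 0}"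

text \<open>On the fundamental domain this is the reciprocal of the stabilizer order, see
  \<open>stab_order_fund_points\<close>; at other translates of \<rho> and \<i> it is not. The
  explicit form keeps the analytic part free of stabilizers.\<close>

definition ell_weight :: "complex \<Rightarrow> real" where
  "ell_weight z = (if z = \<rho> then 1/3 else if z = \<i> then 1/2 else 1)"

lemma rho_simps: "Re \<rho> = - (1/2)" "Im \<rho> = sqrt 3 / 2" "norm \<rho> = 1" "\<rho> \<in> uhp"
proof -
  show r: "Re \<rho> = - (1/2)" "Im \<rho> = sqrt 3 / 2" by (auto simp: \<rho>_def)
  show "norm \<rho> = 1" unfolding cmod_def r by (simp add: power_divide)
  show "\<rho> \<in> uhp" by (simp add: uhp_def r)
qed

lemma arc_eqI:
  assumes "z \<in> uhp" "w \<in> uhp" "norm z = norm w" "Re z = Re w"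
  shows "z = w"
proof -
  have "(norm z)\<^sup>2 = (norm w)\<^sup>2" using assms by simp
  then have "(Im z)\<^sup>2 = (Im w)\<^sup>2" unfolding cmod_power2 using assms(4) by simp
  then have "Im z = Im w" using assms(1,2) by (simp add: uhp_def power2_eq_iff)
  then show ?thesis using assms(4) by (simp add: complex_eq_iff)
qed

lemma i_neq_rho: "\<i> \<noteq> \<rho>"
  using rho_simps(1) by (auto dest: arg_cong[of _ _ Re])

lemma zorder_power_nat:
  assumes "f analytic_on {z}" "\<forall>\<^sub>F w in at z. f w \<noteq> 0"
  shows "zorder (\<lambda>w. f w ^ n) z = int n * zorder f z"
  using zorder_power[OF analytic_on_imp_meromorphic_on[OF assms(1)], of n] assms(2)
  by (simp add: eventually_frequently)

section \<open>Zeros on the arc and the valence formula\<close>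

context real_modular_form
begin

definition arc_inner_zeros :: "complex set" where
  "arc_inner_zeros = {z\<in>arc. g z = 0 \<and> Re z < 0 \<and> z \<noteq> \<rho>}"

lemma frontier_zeros: "nome ` {z\<in>arc. g z = 0} = {q\<in>frontier disc_domain. G q = 0}"
  unfolding frontier_disc_domain using g_eq by (force simp: arc_def)

lemma finite_arc_zeros: "finite {z\<in>arc. g z = 0}"
proof (rule finite_imageD[of nome])
  have "finite {q\<in>frontier disc_domain. G q = 0}"
  proof (rule finite_zeros_in_compact[OF _ G_holomorphic open_ball])
    show "compact (frontier disc_domain)" using bounded_disc_domain by (rule compact_frontier_bounded)
    show "frontier disc_domain \<subseteq> ball 0 1" using closure_disc_domain_ball by (auto simp: frontier_def)
    show "\<forall>\<^sub>F w in at z. G w \<noteq> 0" if "z \<in> frontier disc_domain" for z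
      using that closure_disc_domain_ball by (intro G_eventually_nonzero) (auto simp: frontier_def)
  qed
  then show "finite (nome ` {z\<in>arc. g z = 0})" by (simp only: frontier_zeros)
  show "inj_on nome {z\<in>arc. g z = 0}" by (rule inj_on_subset[OF inj_on_nome_arc]) auto
qed

text \<open>The reflection \<open>- cnj z\<close> preserves the zeros of \<open>g\<close> and the
  circle. Its only fixed point on the arc is \<i>, and the mirror image of \<rho> is the endpoint
  that the half-open arc omits.\<close>

lemma arc_zeros_partition:
  "{z\<in>arc. g z = 0} = (arc_inner_zeros \<union> (\<lambda>z. - cnj z) ` arc_inner_zeros) \<union> {z. z = \<i> \<and> g z = 0} \<union> {z. z = \<rho> \<and> g z = 0}"
  (is "?Z = ?R")
proof (intro equalityI subsetI)
  fix z assume z: "z \<in> ?Z"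
  have u: "z \<in> uhp" "norm z = 1" "- (1/2) \<le> Re z" "Re z < 1/2" "g z = 0" using z by (auto simp: arc_def)
  show "z \<in> ?R"
  proof (cases "Re z < 0 \<or> Re z = 0")
    case True
    then show ?thesis
    proof
      assume "Re z = 0"
      then have "z = \<i>" using arc_eqI[of z \<i>] u by (simp add: uhp_def)
      then show ?thesis using u by simp
    qed (use z in \<open>auto simp: arc_inner_zeros_def\<close>)
  next
    case False
    have "- cnj z \<noteq> \<rho>"
    proof
      assume "- cnj z = \<rho>"
      then have "Re (- cnj z) = - (1/2)" by (simp add: rho_simps)
      then show False using u by simp
    qed
    then have "- cnj z \<in> arc_inner_zeros"
      using u g_cnj[OF u(1)] False by (auto simp: arc_inner_zeros_def arc_def uhp_def)
    moreover have "z = - cnj (- cnj z)" by simp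
    ultimately show ?thesis by blast
  qed
next
  fix z assume "z \<in> ?R"
  moreover have "- cnj z \<in> ?Z" if z: "z \<in> arc_inner_zeros" for z
  proof -
    have u: "z \<in> uhp" "norm z = 1" "- (1/2) \<le> Re z" "Re z < 0" "g z = 0" "z \<noteq> \<rho>" using z by (auto simp: arc_inner_zeros_def arc_def)
    have "Re z \<noteq> - (1/2)" using u arc_eqI[of z \<rho>] rho_simps by auto
    then show ?thesis using u g_cnj[OF u(1)] by (auto simp: arc_def uhp_def)
  qed
  ultimately show "z \<in> ?Z" using rho_simps by (auto simp: arc_inner_zeros_def arc_def uhp_def)
qed

lemma finite_arc_inner_zeros: "finite arc_inner_zeros"
  by (rule finite_subset[OF _ finite_arc_zeros]) (auto simp: arc_inner_zeros_def)

lemma sum_singleton_if: "sum f {z. z = a \<and> P z} = (if P a then f a else 0)"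
  by (cases "P a") (auto simp: Collect_conv_if)

lemma sum_arc_zeros:
  fixes f :: "complex \<Rightarrow> 'b :: comm_monoid_add"
  shows "(\<Sum>z\<in>{z\<in>arc. g z = 0}. f z) =
    (\<Sum>z\<in>arc_inner_zeros. f z + f (- cnj z)) + (if g \<i> = 0 then f \<i> else 0) + (if g \<rho> = 0 then f \<rho> else 0)"
proof -
  let ?X = "arc_inner_zeros"
  have inj: "inj_on (\<lambda>z. - cnj z) ?X" by (auto simp: inj_on_def)
  have d1: "?X \<inter> (\<lambda>z. - cnj z) ` ?X = {}" by (auto simp: arc_inner_zeros_def)
  have d2: "(?X \<union> (\<lambda>z. - cnj z) ` ?X) \<inter> {z. z = \<i> \<and> g z = 0} = {}"
    by (auto simp: arc_inner_zeros_def dest: arg_cong[of _ _ Re])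
  have d3: "((?X \<union> (\<lambda>z. - cnj z) ` ?X) \<union> {z. z = \<i> \<and> g z = 0}) \<inter> {z. z = \<rho> \<and> g z = 0} = {}"
    using i_neq_rho rho_simps(1) by (auto simp: arc_inner_zeros_def dest: arg_cong[of _ _ Re])
  have "(\<Sum>z\<in>{z\<in>arc. g z = 0}. f z) =
      sum f ?X + sum f ((\<lambda>z. - cnj z) ` ?X) + sum f {z. z = \<i> \<and> g z = 0} + sum f {z. z = \<rho> \<and> g z = 0}"
    unfolding arc_zeros_partition using finite_arc_inner_zeros d1 d2 d3 by (simp add: sum.union_disjoint)
  also have "sum f ((\<lambda>z. - cnj z) ` ?X) = (\<Sum>z\<in>?X. f (- cnj z))" by (subst sum.reindex[OF inj]) simp
  finally show ?thesis by (simp add: sum.distrib sum_singleton_if)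
qed

lemma sum_arc_left_zeros:
  fixes f :: "complex \<Rightarrow> 'b :: comm_monoid_add"
  shows "(\<Sum>z\<in>{z\<in>arc_left. g z = 0}. f z) =
    sum f arc_inner_zeros + (if g \<i> = 0 then f \<i> else 0) + (if g \<rho> = 0 then f \<rho> else 0)"
proof -
  have "{z\<in>arc_left. g z = 0} = arc_inner_zeros \<union> {z. z = \<i> \<and> g z = 0} \<union> {z. z = \<rho> \<and> g z = 0}"
  proof (intro equalityI subsetI)
    fix z assume z: "z \<in> {z\<in>arc_left. g z = 0}"
    then have "Re z < 0 \<or> Re z = 0" by (auto simp: arc_left_def)
    then show "z \<in> arc_inner_zeros \<union> {z. z = \<i> \<and> g z = 0} \<union> {z. z = \<rho> \<and> g z = 0}"
    proof
      assume "Re z = 0"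
      then have "z = \<i>" using arc_eqI[of z \<i>] z by (simp add: arc_left_def uhp_def)
      then show ?thesis using z by simp
    qed (use z in \<open>auto simp: arc_inner_zeros_def arc_left_def arc_def\<close>)
  qed (use rho_simps in \<open>auto simp: arc_inner_zeros_def arc_def arc_left_def uhp_def\<close>)
  moreover have "arc_inner_zeros \<inter> {z. z = \<i> \<and> g z = 0} = {}" by (auto simp: arc_inner_zeros_def)
  moreover have "(arc_inner_zeros \<union> {z. z = \<i> \<and> g z = 0}) \<inter> {z. z = \<rho> \<and> g z = 0} = {}"
    using i_neq_rho by (auto simp: arc_inner_zeros_def)
  ultimately show ?thesis
    using finite_arc_inner_zeros by (simp add: sum.union_disjoint sum_singleton_if)
qed

text \<open>\<open>F\<close>, the quotient of the 12th power of \<open>g\<close> by the discriminant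
  to the power \<open>k\<close>, is invariant under the modular group and real on the arc. The
  solutions of \<open>F = \<i> \<epsilon>\<close> in the domain are counted twice: exactly for each
  positive \<epsilon> by a homotopy that discards the numerator, and for small \<epsilon> as zeros
  of the numerator inside plus solutions near the arc zeros. The group relations between the latter
  determine their total.\<close>

theorem valence:
  "real_of_int k / 12 = of_int (zcount G disc_domain) + (\<Sum>z\<in>{z\<in>arc_left. g z = 0}. ell_weight z * of_int (zorder g z))"
proof -
  obtain D where D: "D holomorphic_on ball 0 1" "D 0 = 0" "deriv D 0 \<noteq> 0"
    "\<And>q. norm q < 1 \<Longrightarrow> q \<noteq> 0 \<Longrightarrow> D q \<noteq> 0"
    "\<And>q. norm q < 1 \<Longrightarrow> D (cnj q) = cnj (D q)"
    "\<And>\<tau>. \<tau> \<in> uhp \<Longrightarrow> D (nome (- 1 / \<tau>)) = \<tau> ^ 12 * D (nome \<tau>)"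
    using discriminant_exists by metis
  \<comment> \<open>Splitting \<open>k\<close> as \<open>b - a\<close> with natural numbers keeps
    numerator and denominator holomorphic at the cusp for either sign of \<open>k\<close>.\<close>
  define a where "a = nat (- k)"
  define b where "b = nat k"
  have kab: "k = int b - int a" by (simp add: a_def b_def)
  define F1 where "F1 q = G q ^ 12 * D q ^ a" for q
  define F2 where "F2 q = D q ^ b" for q
  define F where "F z = F1 (nome z) / F2 (nome z)" for z
  have Fh: "F1 holomorphic_on ball 0 1" "F2 holomorphic_on ball 0 1"
    unfolding F1_def F2_def using D(1) G_holomorphic by (auto intro!: holomorphic_intros)
  have qn: "norm (nome z) < 1" if "z \<in> uhp" for z using norm_nome_less that by blast
  have Dn: "D (nome z) \<noteq> 0" if "z \<in> uhp" for z using D(4)[OF qn[OF that]] by simp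
  have F2n: "F2 (nome z) \<noteq> 0" if "z \<in> uhp" for z using Dn[OF that] by (simp add: F2_def)
  have nomeh: "nome holomorphic_on S" for S by (intro holomorphic_intros)
  have nu: "nome ` uhp \<subseteq> ball 0 1" using qn by auto
  have F12z: "(\<lambda>z. F1 (nome z)) holomorphic_on uhp" "(\<lambda>z. F2 (nome z)) holomorphic_on uhp"
    using holomorphic_on_compose_gen[OF nomeh Fh(1) nu] holomorphic_on_compose_gen[OF nomeh Fh(2) nu]
    by (auto simp: o_def)
  have Fz: "F holomorphic_on uhp" unfolding F_def using F12z F2n by (intro holomorphic_intros) auto
  have FT: "F (z + of_int n) = F z" for z n by (simp add: F_def)
  have FC: "F (- cnj z) = cnj (F z)" if "z \<in> uhp" for z
    using q_expands_cnj[OF q_exp real_coeff qn[OF that]] D(5)[OF qn[OF that]]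
    by (simp add: F_def F1_def F2_def nome_cnj)
  have FS: "F (- 1 / z) = F z" if z: "z \<in> uhp" for z
  proof -
    have z0: "z \<noteq> 0" using z by (auto simp: uhp_def)
    have "G (nome (- 1 / z)) = z powi k * G (nome z)"
      using g_inversion[OF z] g_eq[OF z] g_eq[OF uhp_inversion[OF z]] by simp
    also have "z powi k = z ^ b / z ^ a" unfolding kab using z0 by (simp add: power_int_diff)
    finally have 1: "G (nome (- 1 / z)) = z ^ b / z ^ a * G (nome z)" .
    have p: "(z ^ b) ^ 12 = (z ^ 12) ^ b" "(z ^ a) ^ 12 = (z ^ 12) ^ a" by (simp_all add: power_mult[symmetric] mult.commute)
    have "F1 (nome (- 1 / z)) = (z ^ 12) ^ b * F1 (nome z)"
      unfolding F1_def 1 D(6)[OF z] power_mult_distrib power_divide p using z0 by simp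
    moreover have "F2 (nome (- 1 / z)) = (z ^ 12) ^ b * F2 (nome z)"
      unfolding F2_def D(6)[OF z] power_mult_distrib by simp
    ultimately show ?thesis unfolding F_def using z0 by simp
  qed
  have Freal1: "F z \<in> \<real>" if "z \<in> uhp" "norm z = 1" for z
    using FS[OF that(1)] FC[OF that(1)] inverse_on_circle[OF that(2)] by (simp add: Reals_cnj_iff)
  \<comment> \<open>The circles about 0 and -1 and the line \<open>Re z = - 1/2\<close> are the
    walls that meet at \<rho>; \<open>F\<close> is real on all three.\<close>
  have Freal2: "F z \<in> \<real>" if "z \<in> uhp" "norm (z + 1) = 1" for z
    using Freal1[of "z + 1"] FT[of z 1] that by (simp add: uhp_def)
  have Freal3: "F z \<in> \<real>" if "z \<in> uhp" "norm (z + 1) = norm z" for z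
  proof -
    have "(norm (z + 1))\<^sup>2 = (norm z)\<^sup>2" using that by simp
    then have "Re z = - (1/2)" unfolding cmod_power2 by (simp add: power2_eq_square algebra_simps)
    then have "- cnj z = z + of_int 1" by (simp add: complex_eq_iff)
    then have "cnj (F z) = F z" using FC[OF that(1)] FT[of z 1] by metis
    then show ?thesis by (simp add: Reals_cnj_iff)
  qed
  have nonreal: "z \<notin> near_solutions F z0 r \<epsilon>" if "F z \<in> \<real>" "\<epsilon> > 0" for z z0 r \<epsilon>
  proof
    assume "z \<in> near_solutions F z0 r \<epsilon>"
    then have "Im (F z) = \<epsilon>" by (simp add: near_solutions_def)
    then show False using that by (simp add: complex_is_Real_iff)
  qed
  have arcu: "z \<in> uhp" "norm z = 1" if "z \<in> arc" for z using that by (auto simp: arc_def)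
  have Fiff: "F z = 0 \<longleftrightarrow> g z = 0" if "z \<in> uhp" for z
    using F2n[OF that] Dn[OF that] g_eq[OF that] by (simp add: F_def F1_def)
  have Fne: "\<forall>\<^sub>F w in at z. F w \<noteq> 0" if "z \<in> uhp" for z
    using zorder_g(2)[OF that] eventually_at_in_open'[OF open_uhp that] by eventually_elim (simp add: Fiff)
  have Dh': "(\<lambda>z. D (nome z)) holomorphic_on uhp"
    using holomorphic_on_compose_gen[OF nomeh D(1) nu] by (auto simp: o_def)
  have Ford: "zorder F z = 12 * zorder g z" if z: "z \<in> uhp" for z
  proof -
    have "zorder F z = zorder (\<lambda>w. (D (nome w) ^ a / D (nome w) ^ b) * g w ^ 12) z"
      by (rule zorder_cong_on[OF open_uhp z]) (simp add: F_def F1_def F2_def g_eq)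
    also have "\<dots> = zorder (\<lambda>w. g w ^ 12) z"
      by (rule zorder_mult_nonzero[OF open_uhp z])
        (use Dh' Dn z g_holomorphic zorder_g(2)[OF z] in \<open>auto intro!: holomorphic_intros\<close>)
    also have "\<dots> = 12 * zorder g z"
      using zorder_power_nat[of g z 12] zorder_g(2)[OF z] g_holomorphic z open_uhp analytic_at by auto
    finally show ?thesis .
  qed
  have cl: "closure disc_domain \<subseteq> ball 0 1" by (rule closure_disc_domain_ball)
  have sub: "disc_domain \<subseteq> ball 0 1" using cl closure_subset by blast
  have Dord: "zorder D 0 = 1"
    by (rule zorder_eq_1) (use D analytic_at[of D 0] in \<open>auto intro: exI[of _ "ball 0 1"]\<close>)
  have D0an: "D analytic_on {0}" using D(1) analytic_at[of D 0] by (auto intro: exI[of _ "ball 0 1"])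
  have D0ne: "\<forall>\<^sub>F w in at 0. D w \<noteq> 0"
    unfolding eventually_at using D(4) by (intro exI[of _ 1]) auto
  have cont: "continuous_on (closure disc_domain) h" if "h holomorphic_on ball 0 1" for h
    using that cl holomorphic_on_imp_continuous_on holomorphic_on_subset by blast
  have nofr: "of_real t * F1 q + of_real \<epsilon> * (- \<i> * F2 q) \<noteq> 0" if q: "q \<in> frontier disc_domain" and e: "\<epsilon> > 0" for q t \<epsilon>
  proof
    assume 0: "of_real t * F1 q + of_real \<epsilon> * (- \<i> * F2 q) = 0"
    obtain z where z: "z \<in> arc" "q = nome z" using q frontier_disc_domain by auto
    have "of_real t * F z = \<i> * of_real \<epsilon>"
      using 0 F2n[OF arcu(1)[OF z(1)]] unfolding F_def z(2) by (simp add: field_simps)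
    then have "Im (of_real t * F z) = \<epsilon>" by simp
    moreover have "F z \<in> \<real>" using Freal1 arcu z(1) by blast
    ultimately show False using e by (simp add: complex_is_Real_iff)
  qed
  \<comment> \<open>The numerator is scaled down to 0. What remains is a multiple of
    \<open>D^b\<close>, whose only possible zero in the domain is the cusp, with order
    \<open>b\<close>.\<close>
  have total: "zcount (\<lambda>q. F1 q + of_real \<epsilon> * (- \<i> * F2 q)) disc_domain = int b" if e: "\<epsilon> > 0" for \<epsilon>
  proof -
    define f where "f t q = of_real t * F1 q + of_real \<epsilon> * (- \<i> * F2 q)" for t :: real and q
    have "zcount (f 0) disc_domain = zcount (f 1) disc_domain"
    proof (rule zcount_homotopy[OF open_disc_domain bounded_disc_domain open_ball cl])
      show "f t holomorphic_on ball 0 1" for t unfolding f_def using Fh by (intro holomorphic_intros)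
      have c: "continuous_on ({0..1} \<times> closure disc_domain) (\<lambda>x. h (snd x))" if "h holomorphic_on ball 0 1" for h
        using cont[OF that] by (intro continuous_on_compose2[of "closure disc_domain" h _ snd]) (auto intro: continuous_intros)
      show "continuous_on ({0..1} \<times> closure disc_domain) (\<lambda>(t, z). f t z)"
        unfolding f_def case_prod_beta by (intro continuous_intros c Fh)
      show "f t z \<noteq> 0" if "z \<in> frontier disc_domain" for t z unfolding f_def by (rule nofr[OF that e])
    qed
    moreover have "zcount (f 0) disc_domain = int b"
    proof (cases "b = 0")
      case True
      then have "f 0 q \<noteq> 0" for q using e by (simp add: f_def F2_def)
      then show ?thesis using True zcount_empty by simp
    next
      case False
      have "zcount (f 0) disc_domain = zorder (f 0) 0"
      proof (rule zcount_single)
        show "0 \<in> disc_domain" by (simp add: disc_domain_def)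
        show "f 0 0 = 0" using D(2) False by (simp add: f_def F2_def)
        show "f 0 w \<noteq> 0" if "w \<in> disc_domain" "w \<noteq> 0" for w
          using D(4)[of w] that sub e by (auto simp: f_def F2_def)
      qed
      also have "zorder (f 0) 0 = zorder (\<lambda>q. (of_real \<epsilon> * - \<i>) * D q ^ b) 0"
        by (rule arg_cong[of _ _ "\<lambda>f. zorder f 0"]) (simp add: f_def F2_def fun_eq_iff)
      also have "\<dots> = zorder (\<lambda>q. D q ^ b) 0" by (rule zorder_cmult) (use e in simp)
      also have "\<dots> = int b" using zorder_power_nat[OF D0an D0ne] Dord by simp
      finally show ?thesis .
    qed
    moreover have "f 1 = (\<lambda>q. F1 q + of_real \<epsilon> * (- \<i> * F2 q))" by (simp add: f_def fun_eq_iff)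
    ultimately show ?thesis by (simp only:)
  qed
  define Z where "Z = {z\<in>arc. g z = 0}"
  have Gz: "G (nome z) = g z" if "z \<in> uhp" for z using g_eq[OF that] by simp
  have Zfr: "nome ` Z = {q\<in>frontier disc_domain. G q = 0}"
    unfolding Z_def by (rule frontier_zeros)
  have finZ: "finite Z" unfolding Z_def by (rule finite_arc_zeros)
  have Zu: "z \<in> arc" "z \<in> uhp" "norm z = 1" "F z = 0" if "z \<in> Z" for z
    using that arcu Fiff by (auto simp: Z_def)
  obtain s where s: "s > 0" "disjoint_family_on (\<lambda>q. cball q s) (nome ` Z)"
    using disjoint_small_balls[OF finite_imageI[OF finZ] open_UNIV] by auto
  \<comment> \<open>The bound 1/4 makes the nome injective on the ball. The bound
    \<open>1/2 - \<bar>Re z\<bar>\<close> keeps the ball in the strip, where belonging to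
    \<open>tiles\<close> just means \<open>norm > 1\<close>; this is impossible at \<rho>, which
    lies on the edge. The last condition makes the images of different balls disjoint.\<close>
  have "\<exists>R. good_radius F z R \<and> R < 1/4 \<and> ball z R \<subseteq> uhp \<and> (z \<noteq> \<rho> \<longrightarrow> R < 1/2 - \<bar>Re z\<bar>) \<and> nome ` ball z R \<subseteq> ball (nome z) s"
    if z: "z \<in> Z" for z
  proof -
    obtain R1 where R1: "good_radius F z R1"
      using good_radius_exists[OF Fz open_uhp Zu(2)[OF z] Zu(4)[OF z] Fne[OF Zu(2)[OF z]]] by blast
    obtain R2 where R2: "R2 > 0" "ball z R2 \<subseteq> uhp" using open_uhp Zu(2)[OF z] openE by blast
    obtain R3 where R3: "R3 > 0" "\<And>w. dist w z < R3 \<Longrightarrow> dist (nome w) (nome z) < s"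
      using DERIV_isCont[OF has_field_derivative_nome[of z]] s(1) unfolding continuous_at_eps_delta by metis
    define R4 where "R4 = (if z = \<rho> then 1 else 1/2 - \<bar>Re z\<bar>)"
    have R4: "R4 > 0"
    proof (cases "z = \<rho>")
      case False
      have "Re z \<noteq> - (1/2)" using False arc_eqI[of z \<rho>] Zu[OF z] rho_simps by auto
      then show ?thesis using Zu(1)[OF z] False by (auto simp: R4_def arc_def)
    qed (simp add: R4_def)
    define R where "R = min (min R1 R2) (min R3 (min R4 (1/4))) / 2"
    have R1p: "R1 > 0" using R1 by (simp add: good_radius_def)
    have R: "R > 0" "R < R1" "R < R2" "R < R3" "R < R4" "R < 1/4"
      using R1p R2(1) R3(1) R4 by (auto simp: R_def min_def)
    show ?thesis
    proof (intro exI[of _ R] conjI impI)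
      show "good_radius F z R" using good_radius_mono[OF R1 R(1)] R(2) by simp
      show "ball z R \<subseteq> uhp" using R2 R(3) by (meson less_imp_le order_trans subset_ball)
      show "R < 1/2 - \<bar>Re z\<bar>" if "z \<noteq> \<rho>" using R(5) that by (simp add: R4_def)
      show "nome ` ball z R \<subseteq> ball (nome z) s" using R3(2) R(4) by (auto simp: dist_commute)
    qed (rule R(6))
  qed
  then have "\<forall>z\<in>Z. \<exists>R. good_radius F z R \<and> R < 1/4 \<and> ball z R \<subseteq> uhp \<and> (z \<noteq> \<rho> \<longrightarrow> R < 1/2 - \<bar>Re z\<bar>) \<and> nome ` ball z R \<subseteq> ball (nome z) s"
    by blast
  from bchoice[OF this] obtain R where R: "\<And>z. z \<in> Z \<Longrightarrow> good_radius F z (R z)" "\<And>z. z \<in> Z \<Longrightarrow> R z < 1/4"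
    "\<And>z. z \<in> Z \<Longrightarrow> ball z (R z) \<subseteq> uhp" "\<And>z. z \<in> Z \<Longrightarrow> z \<noteq> \<rho> \<Longrightarrow> R z < 1/2 - \<bar>Re z\<bar>"
    "\<And>z. z \<in> Z \<Longrightarrow> nome ` ball z (R z) \<subseteq> ball (nome z) s"
    by blast
  have Rp: "R z > 0" if "z \<in> Z" for z using R(1)[OF that] by (simp add: good_radius_def)
  define r where "r z = R z / 2" for z
  have r: "0 < r z" "r z < R z" if "z \<in> Z" for z using Rp[OF that] by (auto simp: r_def)
  have rsub: "ball z (r z) \<subseteq> ball z (R z)" "cball z (r z) \<subseteq> ball z (R z)" if "z \<in> Z" for z using r[OF that] by auto
  define B where "B z = nome ` ball z (r z)" for z
  define N where "N = (\<Union>z\<in>Z. B z)"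
  have injn: "inj_on nome (ball z (R z))" if "z \<in> Z" for z
  proof (rule inj_onI)
    fix x y assume xy: "x \<in> ball z (R z)" "y \<in> ball z (R z)" "nome x = nome y"
    then obtain n :: int where n: "x = y + of_int n" unfolding nome_eq_iff by blast
    have "dist x y < 1/4 + 1/4" using xy R(2)[OF that] by (metis add_strict_mono dist_commute dist_triangle_lt less_trans mem_ball)
    then have "\<bar>of_int n :: real\<bar> < 1" using n by (simp add: dist_norm)
    then show "x = y" using n by simp
  qed
  have dn: "deriv nome z \<noteq> 0" for z using has_field_derivative_nome[of z] by (simp add: DERIV_imp_deriv)
  have openB: "open (B z)" if "z \<in> Z" for z
    unfolding B_def
  proof (rule open_mapping_thm3)
    show "inj_on nome (ball z (r z))" using injn[OF that] rsub[OF that] inj_on_subset by blast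
  qed (auto intro!: holomorphic_intros)
  have Afr: "F1 q = 0 \<longleftrightarrow> G q = 0" if "q \<in> ball 0 1" "q \<noteq> 0" for q
    using D(4)[of q] that by (simp add: F1_def)
  have F1ne: "\<forall>\<^sub>F w in at q. F1 w \<noteq> 0" if q: "q \<in> ball 0 1" for q
  proof -
    have "\<forall>\<^sub>F w in at q. G w \<noteq> 0" using G_eventually_nonzero q by simp
    moreover have "\<forall>\<^sub>F w in at q. D w \<noteq> 0"
    proof (cases "q = 0")
      case False
      then show ?thesis using holomorphic_eventually_nonzero[OF D(1) open_ball q] D(4) q by simp
    qed (simp add: D0ne)
    ultimately show ?thesis by eventually_elim (simp add: F1_def)
  qed
  have pert: "\<forall>\<^sub>F \<epsilon> in at_right 0. zcount (\<lambda>q. F1 q + of_real \<epsilon> * (- \<i> * F2 q)) disc_domain =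
     zcount F1 disc_domain + zcount (\<lambda>q. F1 q + of_real \<epsilon> * (- \<i> * F2 q)) (disc_domain \<inter> N)"
  proof (rule zcount_perturb[OF open_disc_domain bounded_disc_domain open_ball cl Fh(1)])
    show "(\<lambda>q. - \<i> * F2 q) holomorphic_on ball 0 1" using Fh by (intro holomorphic_intros)
    show "\<forall>\<^sub>F w in at z. F1 w \<noteq> 0" if "z \<in> disc_domain" for z using F1ne that sub by blast
    show "open N" using openB by (auto simp: N_def)
    show "z \<in> N" if zz: "z \<in> frontier disc_domain" "F1 z = 0" for z
    proof -
      have "z \<in> ball 0 1" using zz(1) cl by (auto simp: frontier_def)
      moreover have "z \<noteq> 0" using zz(1) open_disc_domain by (auto simp: frontier_def interior_open disc_domain_def)
      ultimately have "z \<in> nome ` Z" using zz Afr Zfr by blast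
      then show ?thesis using r(1) unfolding N_def B_def by force
    qed
    show "F1 z \<noteq> 0" if zz: "z \<in> disc_domain \<inter> closure N" for z
    proof -
      have "compact (\<Union>z\<in>Z. nome ` cball z (r z))"
        using finZ by (intro compact_UN compact_continuous_image holomorphic_on_imp_continuous_on nomeh) auto
      then have "closure N \<subseteq> (\<Union>z\<in>Z. nome ` cball z (r z))"
        by (intro closure_minimal compact_imp_closed) (auto simp: N_def B_def)
      then obtain z0 w where w: "z0 \<in> Z" "w \<in> cball z0 (r z0)" "z = nome w" using zz by blast
      have wb: "w \<in> ball z0 (R z0)" using w rsub by blast
      have "w \<noteq> z0"
      proof
        assume "w = z0"
        then have "z0 \<in> tiles" using zz w nome_mem_disc_domain by blast
        then show False using Zu[OF w(1)] tiles_strip[OF arc_strip[OF Zu(1)[OF w(1)]]] by simp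
      qed
      then have "F w \<noteq> 0" using R(1)[OF w(1)] wb by (simp add: good_radius_def)
      then show ?thesis using w(3) by (auto simp: F_def)
    qed
    show "F1 z + of_real \<epsilon> * (- \<i> * F2 z) \<noteq> 0" if "0 < \<epsilon>" "z \<in> frontier disc_domain" for \<epsilon> z
      using nofr[OF that(2,1), of 1] by simp
  qed (rule zero_less_one)
  \<comment> \<open>The contribution of an arc zero to the count inside the domain. It is not
    computed for single zeros on the open arc, only for a zero together with its mirror
    image.\<close>
  define \<kappa> where "\<kappa> \<epsilon> z = card {w\<in>near_solutions F z (r z) \<epsilon>. w \<in> tiles}" for \<epsilon> z
  have good: "\<forall>\<^sub>F \<epsilon> in at_right 0. finite (near_solutions F z (r z) \<epsilon>) \<and> int (card (near_solutions F z (r z) \<epsilon>)) = 12 * zorder g z"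
    if z: "z \<in> Z" for z
    using R(1)[OF z] r[OF z] Ford[OF Zu(2)[OF z]] unfolding good_radius_def by auto
  have local: "zcount (\<lambda>q. F1 q + of_real \<epsilon> * (- \<i> * F2 q)) (disc_domain \<inter> B z) = int (\<kappa> \<epsilon> z)
      \<and> finite {q\<in>disc_domain \<inter> B z. F1 q + of_real \<epsilon> * (- \<i> * F2 q) = 0}"
    if z: "z \<in> Z" and e: "\<epsilon> > 0" and fin: "finite (near_solutions F z (r z) \<epsilon>)" for z \<epsilon>
  proof -
    let ?h = "\<lambda>q. F1 q + of_real \<epsilon> * (- \<i> * F2 q)"
    define W where "W = ball z (r z) \<inter> tiles"
    have Wu: "W \<subseteq> ball z (R z)" "W \<subseteq> uhp" using rsub[OF z] R(3)[OF z] by (auto simp: W_def)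
    have im: "disc_domain \<inter> B z = nome ` W"
      unfolding B_def W_def using nome_mem_disc_domain by blast
    have hh: "?h holomorphic_on ball 0 1" using Fh by (intro holomorphic_intros)
    have "zcount ?h (nome ` W) = zcount (\<lambda>z. ?h (nome z)) W"
    proof (rule zcount_image[OF nomeh open_UNIV _ _ dn hh open_ball])
      show "inj_on nome W" using injn[OF z] Wu(1) inj_on_subset by blast
      show "nome ` W \<subseteq> ball 0 1" using Wu(2) qn by auto
      show "\<forall>\<^sub>F q in at (nome w). ?h q \<noteq> 0" if "w \<in> W" for w
      proof (rule nonzero_frontier_eventually_nonzero[OF open_disc_domain bounded_disc_domain open_ball cl hh])
        show "nome w \<in> disc_domain" using that nome_mem_disc_domain by (simp add: W_def)
        show "?h q \<noteq> 0" if "q \<in> frontier disc_domain" for q using nofr[OF that e, of 1] by simp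
      qed
    qed simp
    also have "\<dots> = zcount (\<lambda>w. F1 (nome w) - (\<i> * of_real \<epsilon>) * F2 (nome w)) W"
      by (simp add: algebra_simps)
    also have "\<dots> = int (card {w\<in>W. F1 (nome w) / F2 (nome w) = \<i> * of_real \<epsilon>})"
    proof (rule zcount_quotient[where S = "ball z (R z)"])
      show "(\<lambda>z. F1 (nome z)) holomorphic_on ball z (R z)" "(\<lambda>z. F2 (nome z)) holomorphic_on ball z (R z)"
        using F12z R(3)[OF z] holomorphic_on_subset by blast+
      show "F2 (nome w) \<noteq> 0" if "w \<in> ball z (R z)" for w using F2n R(3)[OF z] that by blast
      show "deriv (\<lambda>z. F1 (nome z) / F2 (nome z)) w \<noteq> 0" if "w \<in> W" "F1 (nome w) / F2 (nome w) = \<i> * of_real \<epsilon>" for w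
      proof -
        have "w \<noteq> z" using that(2) Zu(4)[OF z] e by (auto simp: F_def)
        then have "deriv F w \<noteq> 0" using R(1)[OF z] that(1) Wu(1) by (auto simp: good_radius_def)
        then show ?thesis by (simp add: F_def[abs_def])
      qed
    qed (use Wu in auto)
    also have "{w\<in>W. F1 (nome w) / F2 (nome w) = \<i> * of_real \<epsilon>} = {w\<in>near_solutions F z (r z) \<epsilon>. w \<in> tiles}"
      by (auto simp: W_def near_solutions_def F_def)
    finally have 1: "zcount ?h (disc_domain \<inter> B z) = int (\<kappa> \<epsilon> z)" by (simp add: im \<kappa>_def)
    have "{q\<in>disc_domain \<inter> B z. ?h q = 0} \<subseteq> nome ` near_solutions F z (r z) \<epsilon>"
    proof
      fix q assume "q \<in> {q\<in>disc_domain \<inter> B z. ?h q = 0}"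
      then obtain w where w: "w \<in> W" "q = nome w" "?h (nome w) = 0" unfolding im by blast
      have "F2 (nome w) \<noteq> 0" using F2n w(1) Wu(2) by blast
      then have "F w = \<i> * of_real \<epsilon>" using w(3) unfolding F_def by (simp add: field_simps)
      then show "q \<in> nome ` near_solutions F z (r z) \<epsilon>" using w by (auto simp: near_solutions_def W_def)
    qed
    then show ?thesis using 1 fin by (auto intro: finite_subset)
  qed
  have disjB: "disjoint_family_on (\<lambda>z. disc_domain \<inter> B z) Z"
    unfolding disjoint_family_on_def
  proof (intro ballI impI)
    fix x y assume xy: "x \<in> Z" "y \<in> Z" "x \<noteq> y"
    then have "nome x \<noteq> nome y" using inj_on_nome_arc Zu(1) by (auto simp: inj_on_def)
    then have "cball (nome x) s \<inter> cball (nome y) s = {}"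
      using s(2) xy unfolding disjoint_family_on_def by blast
    moreover have "B w \<subseteq> cball (nome w) s" if "w \<in> Z" for w
      using R(5)[OF that] rsub(1)[OF that] ball_subset_cball[of "nome w" s] unfolding B_def by blast
    ultimately show "(disc_domain \<inter> B x) \<inter> (disc_domain \<inter> B y) = {}" using xy by blast
  qed
  have F1count: "zcount F1 disc_domain = 12 * zcount G disc_domain + int a"
  proof -
    define T where "T = insert 0 {q\<in>disc_domain. G q = 0}"
    have finG: "finite {q\<in>disc_domain. G q = 0}"
    proof -
      have "finite {q\<in>closure disc_domain. G q = 0}"
        by (rule finite_zeros_in_compact[OF _ G_holomorphic open_ball cl])
          (use bounded_disc_domain cl G_eventually_nonzero in auto)
      then show ?thesis by (rule rev_finite_subset) (use closure_subset in auto)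
    qed
    have T: "finite T" "T \<subseteq> disc_domain" using finG by (auto simp: T_def disc_domain_def)
    have "zcount F1 disc_domain = (\<Sum>q\<in>T. zorder F1 q)"
    proof (rule zcount_superset[OF T(1) _ T(2) Fh(1) open_ball sub])
      show "{z\<in>disc_domain. F1 z = 0} \<subseteq> T" using Afr sub by (auto simp: T_def)
    qed
    also have "\<dots> = (\<Sum>q\<in>T. 12 * zorder G q + (if q = 0 then int a else 0))"
    proof (rule sum.cong[OF refl])
      fix q assume "q \<in> T"
      then have q: "q \<in> ball 0 1" "norm q < 1" using T(2) sub by auto
      have an: "G analytic_on {q}" "D analytic_on {q}" using q(1) G_holomorphic D(1) analytic_at by blast+
      have Gq: "\<forall>\<^sub>F w in at q. G w \<noteq> 0" by (rule G_eventually_nonzero[OF q(2)])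
      have Dq: "\<forall>\<^sub>F w in at q. D w \<noteq> 0"
      proof (cases "q = 0")
        case False
        then show ?thesis using holomorphic_eventually_nonzero[OF D(1) open_ball q(1)] D(4) q by simp
      qed (simp add: D0ne)
      have "zorder F1 q = zorder (\<lambda>q. G q ^ 12) q + zorder (\<lambda>q. D q ^ a) q"
        unfolding F1_def
        by (rule zorder_times_analytic) (use an Gq Dq in \<open>auto intro!: analytic_intros elim: eventually_elim2\<close>)
      also have "zorder (\<lambda>q. G q ^ 12) q = 12 * zorder G q" using zorder_power_nat[OF an(1) Gq] by simp
      also have "zorder (\<lambda>q. D q ^ a) q = int a * zorder D q" using zorder_power_nat[OF an(2) Dq] by simp
      also have "zorder D q = (if q = 0 then 1 else 0)"
        using Dord zorder_eq_0I[OF an(2)] D(4)[OF q(2)] by auto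
      finally show "zorder F1 q = 12 * zorder G q + (if q = 0 then int a else 0)" by simp
    qed
    also have "\<dots> = 12 * (\<Sum>q\<in>T. zorder G q) + int a"
      using T(1) by (simp add: sum.distrib sum_distrib_left) (simp add: T_def)
    also have "(\<Sum>q\<in>T. zorder G q) = zcount G disc_domain"
      by (rule zcount_superset[OF T(1) _ T(2) G_holomorphic open_ball sub, symmetric]) (auto simp: T_def)
    finally show ?thesis .
  qed
  have near_tiles: "w \<in> tiles \<longleftrightarrow> norm w > 1" if z: "z \<in> Z" "z \<noteq> \<rho>" and w: "w \<in> ball z (r z)" for z w
  proof -
    have "\<bar>Re w - Re z\<bar> \<le> norm (w - z)" using abs_Re_le_cmod[of "w - z"] by simp
    also have "\<dots> < r z" using w by (simp add: dist_norm norm_minus_commute)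
    finally have "\<bar>Re w\<bar> \<le> 1/2" using R(4)[OF z] r[OF z(1)] by linarith
    moreover have "w \<in> uhp" using w rsub R(3) z(1) by blast
    ultimately show ?thesis using tiles_strip by simp
  qed
  define Zl where "Zl = arc_inner_zeros"
  have Zl_def': "Zl = {z\<in>Z. Re z < 0 \<and> z \<noteq> \<rho>}" by (auto simp: Zl_def arc_inner_zeros_def Z_def)
  have finZl: "finite Zl" using finZ by (simp add: Zl_def')
  have Zlc: "- cnj z \<in> Z" if "z \<in> Zl" for z using arc_zeros_partition that by (auto simp: Zl_def Z_def)
  have inZ: "\<i> \<in> Z \<longleftrightarrow> g \<i> = 0" "\<rho> \<in> Z \<longleftrightarrow> g \<rho> = 0"
    using rho_simps by (auto simp: Z_def arc_def uhp_def)
  have sumZ: "sum f Z = (\<Sum>z\<in>Zl. f z + f (- cnj z)) + (if \<i> \<in> Z then f \<i> else 0) + (if \<rho> \<in> Z then f \<rho> else 0)"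
    for f :: "complex \<Rightarrow> nat"
    unfolding inZ unfolding Z_def Zl_def by (rule sum_arc_zeros)
  have contS: "isCont (\<lambda>z. - 1 / z) z" "inj_on (\<lambda>z. - 1 / z) X" if "z \<noteq> 0" for z :: complex and X :: "complex set"
  proof -
    show "isCont (\<lambda>z. - 1 / z) z" using that by (intro continuous_intros) auto
    show "inj_on (\<lambda>z. - 1 / z) X" 
    proof (rule inj_onI)
      fix x y :: complex assume "- 1 / x = - 1 / y"
      then have "- inverse x = - inverse y" unfolding divide_inverse by simp
      then show "x = y" by simp
    qed
  qed
  have FSb: "F (- 1 / w) = F w" if "z \<in> Z" "w \<in> ball z (R z)" for z w using FS R(3) that by blast
  have nS: "norm (- 1 / w) > 1 \<longleftrightarrow> norm w < 1" if "w \<noteq> 0" for w :: complex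
    using that by (simp add: norm_divide field_simps)
  \<comment> \<open>The inversion maps a neighbourhood of \<open>z\<close> to one of
    \<open>- cnj z\<close> and exchanges the two sides of the unit circle. So the solutions outside
    the circle near \<open>- cnj z\<close> match those inside near \<open>z\<close>, and together
    with those outside near \<open>z\<close> they account for all \<open>12 * zorder g z\<close>. At
    \<i> the two points coincide, which gives the factor 1/2.\<close>
  have pairS: "\<forall>\<^sub>F \<epsilon> in at_right 0. int (\<kappa> \<epsilon> z + \<kappa> \<epsilon> (- cnj z)) = 12 * zorder g z"
    if z: "z \<in> Z" "- cnj z \<in> Z" "z \<noteq> \<rho>" "- cnj z \<noteq> \<rho>" for z
  proof -
    have zi: "- 1 / z = - cnj z" using inverse_on_circle Zu(3)[OF z(1)] by blast
    have z0: "z \<noteq> 0" using Zu(3)[OF z(1)] by auto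
    have o: "zorder F z = zorder F (- cnj z)"
    proof -
      have "zorder F z = zorder (\<lambda>w. F (- 1 / w)) z"
        by (rule zorder_cong_on[OF open_uhp Zu(2)[OF z(1)]]) (rule FS[symmetric])
      also have "\<dots> = zorder F (- 1 / z)"
      proof (rule compose_local_biholomorphic(1)[where S = uhp and T = uhp])
        show "(\<lambda>w. - 1 / w) holomorphic_on uhp" by (intro holomorphic_intros) (auto simp: uhp_def)
        have "((\<lambda>w. - 1 / w) has_field_derivative 1 / z\<^sup>2) (at z)"
          using z0 by (auto intro!: derivative_eq_intros simp: power2_eq_square)
        then show "deriv (\<lambda>w. - 1 / w) z \<noteq> 0" using z0 by (simp add: DERIV_imp_deriv)
      qed (use Zu z open_uhp Fz uhp_inversion Fne in auto)
      finally show ?thesis unfolding zi .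
    qed
    have "\<forall>\<^sub>F \<epsilon> in at_right 0. card {w\<in>near_solutions F z (r z) \<epsilon>. norm (- 1 / w) > 1} =
        card {w\<in>near_solutions F (- cnj z) (r (- cnj z)) \<epsilon>. norm w > 1}"
    proof (rule near_solutions_transport[where \<gamma> = "\<lambda>w. - 1 / w" and P = "\<lambda>w. norm w > 1",
        OF R(1)[OF z(1)] r[OF z(1)] R(1)[OF z(2)] r[OF z(2)]])
      show "isCont (\<lambda>w. - 1 / w) z" "inj_on (\<lambda>w. - 1 / w) (ball z (R z))" by (rule contS[OF z0])+
      show "- 1 / z = - cnj z" by (rule zi)
      show "F (- 1 / w) = F w" if "w \<in> ball z (R z)" for w by (rule FSb[OF z(1) that])
      show "zorder F z = zorder F (- cnj z)" by (rule o)
    qed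
    moreover note good[OF z(1)]
    moreover have "\<forall>\<^sub>F \<epsilon> in at_right 0. \<epsilon> > (0::real)" by (simp add: eventually_at_right_less)
    ultimately show ?thesis
    proof eventually_elim
      case (elim \<epsilon>)
      define X where "X = near_solutions F z (r z) \<epsilon>"
      have Xu: "w \<in> uhp" "w \<in> ball z (r z)" if "w \<in> X" for w
        using that rsub R(3) z(1) unfolding X_def near_solutions_def by blast+
      have k1: "\<kappa> \<epsilon> z = card {w\<in>X. norm w > 1}"
        unfolding \<kappa>_def X_def[symmetric]
        by (rule arg_cong[of _ _ card]) (use near_tiles[OF z(1,3)] Xu(2) in blast)
      have k2: "\<kappa> \<epsilon> (- cnj z) = card {w\<in>near_solutions F (- cnj z) (r (- cnj z)) \<epsilon>. norm w > 1}"
        unfolding \<kappa>_def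
        by (rule arg_cong[of _ _ card]) (use near_tiles[OF z(2,4)] in \<open>auto simp: near_solutions_def\<close>)
      have "norm (- 1 / w) > 1 \<longleftrightarrow> norm w < 1" if "w \<in> X" for w
      proof -
        have "w \<noteq> 0" using Xu(1)[OF that] by (auto simp: uhp_def)
        then show ?thesis by (rule nS)
      qed
      then have "{w\<in>X. norm (- 1 / w) > 1} = {w\<in>X. norm w < 1}" by blast
      then have k2': "\<kappa> \<epsilon> (- cnj z) = card {w\<in>X. norm w < 1}" using elim k2 by (simp add: X_def)
      have "norm w \<noteq> 1" if "w \<in> X" for w
        using nonreal[of w \<epsilon> z "r z"] Freal1[OF Xu(1)[OF that]] elim that by (auto simp: X_def)
      then have "X = {w\<in>X. norm w > 1} \<union> {w\<in>X. norm w < 1}" by force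
      moreover have "card ({w\<in>X. norm w > 1} \<union> {w\<in>X. norm w < 1}) = card {w\<in>X. norm w > 1} + card {w\<in>X. norm w < 1}"
        using elim by (intro card_Un_disjoint) (auto simp: X_def)
      ultimately have "card X = \<kappa> \<epsilon> z + \<kappa> \<epsilon> (- cnj z)" using k1 k2' by simp
      then show ?case using elim by (simp add: X_def)
    qed
  qed
  have ieq: "- cnj \<i> = \<i>" by simp
  have ine: "\<i> \<noteq> \<rho>" using rho_simps(1) by (auto dest: arg_cong[of _ _ Re])
  have pairi: "\<forall>\<^sub>F \<epsilon> in at_right 0. 2 * int (\<kappa> \<epsilon> \<i>) = 12 * zorder g \<i>" if "\<i> \<in> Z"
    using pairS[of \<i>] that ine unfolding ieq by (auto elim!: eventually_mono)
  have triple: "\<forall>\<^sub>F \<epsilon> in at_right 0. 3 * int (\<kappa> \<epsilon> \<rho>) = 12 * zorder g \<rho>" if z: "\<rho> \<in> Z"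
  proof -
    \<comment> \<open>\<gamma> and \<open>\<gamma>'\<close> are the two nontrivial elements of order
      3 in the stabilizer of \<rho>, inverse to each other.\<close>
    define \<gamma> where "\<gamma> z = - 1 / (z + 1)" for z :: complex
    define \<gamma>' where "\<gamma>' z = - 1 - 1 / z" for z :: complex
    have rr: "\<rho> * \<rho> + \<rho> + 1 = 0"
      by (simp add: complex_eq_iff rho_simps power2_eq_square) 
    have r0: "\<rho> \<noteq> 0" "\<rho> + 1 \<noteq> 0" using rho_simps(4) by (auto simp: uhp_def complex_eq_iff)
    have fix1: "\<gamma> \<rho> = \<rho>"
    proof -
      have "\<rho> * (\<rho> + 1) = - 1" using rr by (simp add: algebra_simps eq_neg_iff_add_eq_0)
      then show ?thesis unfolding \<gamma>_def using r0 by (metis nonzero_divide_eq_eq mult.commute)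
    qed
    have fix2: "\<gamma>' \<rho> = \<rho>"
    proof -
      have "\<rho> * (- 1 - \<rho>) = 1" using rr by (simp add: algebra_simps) (metis add.commute add_eq_0_iff minus_add_distrib minus_minus diff_conv_add_uminus)
      then have "1 / \<rho> = - 1 - \<rho>" using r0 by (simp add: field_simps)
      then show ?thesis by (simp add: \<gamma>'_def)
    qed
    have wu: "w \<in> uhp" "w \<noteq> 0" "w + 1 \<noteq> 0" "w + 1 \<in> uhp" if "w \<in> ball \<rho> (R \<rho>)" for w
    proof -
      show u: "w \<in> uhp" using R(3)[OF z] that by blast
      show "w \<noteq> 0" "w + 1 \<noteq> 0" "w + 1 \<in> uhp" using u by (auto simp: uhp_def complex_eq_iff)
    qed
    have t1: "\<forall>\<^sub>F \<epsilon> in at_right 0. card {w\<in>near_solutions F \<rho> (r \<rho>) \<epsilon>. \<gamma> w \<in> tiles} = card {w\<in>near_solutions F \<rho> (r \<rho>) \<epsilon>. w \<in> tiles}"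
    proof (rule near_solutions_transport[where P = "\<lambda>w. w \<in> tiles", OF R(1)[OF z] r[OF z] R(1)[OF z] r[OF z]])
      show "\<gamma> \<rho> = \<rho>" by (rule fix1)

      show "isCont \<gamma> \<rho>" unfolding \<gamma>_def using r0 by (intro continuous_intros) auto
      show "F (\<gamma> w) = F w" if "w \<in> ball \<rho> (R \<rho>)" for w
        using FS[OF wu(4)[OF that]] FT[of w 1] by (simp add: \<gamma>_def)
      show "inj_on \<gamma> (ball \<rho> (R \<rho>))" using wu by (auto simp: inj_on_def \<gamma>_def)
    qed simp
    have t2: "\<forall>\<^sub>F \<epsilon> in at_right 0. card {w\<in>near_solutions F \<rho> (r \<rho>) \<epsilon>. \<gamma>' w \<in> tiles} = card {w\<in>near_solutions F \<rho> (r \<rho>) \<epsilon>. w \<in> tiles}"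
    proof (rule near_solutions_transport[where P = "\<lambda>w. w \<in> tiles", OF R(1)[OF z] r[OF z] R(1)[OF z] r[OF z]])
      show "\<gamma>' \<rho> = \<rho>" by (rule fix2)

      show "isCont \<gamma>' \<rho>" unfolding \<gamma>'_def using r0 by (intro continuous_intros) auto
      show "F (\<gamma>' w) = F w" if "w \<in> ball \<rho> (R \<rho>)" for w
        using FS[OF wu(1)[OF that]] FT[of "- 1 / w" "- 1"] by (simp add: \<gamma>'_def algebra_simps)
      show "inj_on \<gamma>' (ball \<rho> (R \<rho>))" using wu by (auto simp: inj_on_def \<gamma>'_def)
    qed simp
    have tile: "w \<in> tiles \<longleftrightarrow> norm w > 1 \<and> norm (w + 1) > 1" if w: "w \<in> uhp" "- 1 \<le> Re w" "Re w \<le> 0" for w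
    proof
      assume "w \<in> tiles"
      then have "\<forall>n::int. norm (w - of_int n) > 1" by (simp add: tiles_def)
      from this[rule_format, of 0] this[rule_format, of "- 1"] show "norm w > 1 \<and> norm (w + 1) > 1" by simp
    next
      assume n: "norm w > 1 \<and> norm (w + 1) > 1"
      have mono: "norm w' \<le> norm w''" if "Im w' = Im w''" "\<bar>Re w'\<bar> \<le> \<bar>Re w''\<bar>" for w' w'' :: complex
        using that abs_le_square_iff[of "Re w'" "Re w''"] unfolding cmod_def by (intro real_sqrt_le_mono) auto
      have "norm (w - of_int m) > 1" for m :: int
      proof (cases "m \<ge> 0")
        case True
        have "norm w \<le> norm (w - of_int m)" by (rule mono) (use True w in auto)
        then show ?thesis using n by linarith
      next
        case False
        then have m: "m \<le> - 1" by simp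
        then have "real_of_int m \<le> - 1" by (simp only: of_int_le_iff[symmetric, where 'a = real] of_int_minus of_int_1)
        then have "norm (w + 1) \<le> norm (w - of_int m)" by (intro mono) (use w in auto)
        then show ?thesis using n by linarith
      qed
      then show "w \<in> tiles" using w(1) by (simp add: tiles_def)
    qed
    note t1
    moreover note t2
    moreover note good[OF z]
    moreover have "\<forall>\<^sub>F \<epsilon> in at_right 0. \<epsilon> > (0::real)" by (simp add: eventually_at_right_less)
    \<comment> \<open>The description \<open>tile\<close> of \<open>tiles\<close> by two circles is
      available only for real parts between -1 and 0, so \<open>w\<close> and both its images must
      stay close to \<rho>.\<close>
    moreover have "\<forall>\<^sub>F \<epsilon> in at_right 0. \<forall>w\<in>near_solutions F \<rho> (r \<rho>) \<epsilon>.
        - 1 \<le> Re w \<and> Re w \<le> 0 \<and> - 1 \<le> Re (\<gamma> w) \<and> Re (\<gamma> w) \<le> 0 \<and> - 1 \<le> Re (\<gamma>' w) \<and> Re (\<gamma>' w) \<le> 0"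
    proof -
      have c: "isCont \<gamma> \<rho>" "isCont \<gamma>' \<rho>" unfolding \<gamma>_def \<gamma>'_def using r0 by (intro continuous_intros; auto)+
      have h4: "0 < (1/4 :: real)" by simp
      obtain d1 where d1: "d1 > 0" "\<And>w. dist w \<rho> < d1 \<Longrightarrow> dist (\<gamma> w) \<rho> < 1/4"
        using c(1) h4 fix1 unfolding continuous_at_eps_delta by metis
      obtain d2 where d2: "d2 > 0" "\<And>w. dist w \<rho> < d2 \<Longrightarrow> dist (\<gamma>' w) \<rho> < 1/4"
        using c(2) h4 fix2 unfolding continuous_at_eps_delta by metis
      define s' where "s' = min (min d1 d2) (r \<rho>)"
      have s': "0 < s'" "s' \<le> d1" "s' \<le> d2" "s' < R \<rho>" "s' \<le> r \<rho>" using d1 d2 r[OF z] by (auto simp: s'_def)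
      have cl: "- 1 \<le> Re x \<and> Re x \<le> 0" if "dist x \<rho> < 1/4" for x
        using abs_Re_le_cmod[of "x - \<rho>"] that rho_simps(1) by (simp add: dist_norm) linarith
      have "\<forall>\<^sub>F \<epsilon> in at_right 0. near_solutions F \<rho> (r \<rho>) \<epsilon> = near_solutions F \<rho> s' \<epsilon>"
        by (rule near_solutions_eq[OF R(1)[OF z] r[OF z] s'(1,4)])
      then show ?thesis
      proof eventually_elim
        case (elim \<epsilon>)
        show ?case unfolding elim
        proof
          fix w assume "w \<in> near_solutions F \<rho> s' \<epsilon>"
          then have w: "dist w \<rho> < s'" by (simp add: near_solutions_def dist_commute)
          have "dist w \<rho> < 1/4" using w s' r[OF z] R(2)[OF z] by linarith
          moreover have "dist (\<gamma> w) \<rho> < 1/4" "dist (\<gamma>' w) \<rho> < 1/4" using d1(2) d2(2) w s' by auto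
          ultimately show "- 1 \<le> Re w \<and> Re w \<le> 0 \<and> - 1 \<le> Re (\<gamma> w) \<and> Re (\<gamma> w) \<le> 0 \<and> - 1 \<le> Re (\<gamma>' w) \<and> Re (\<gamma>' w) \<le> 0"
            using cl by blast
        qed
      qed
    qed
    ultimately show ?thesis
    proof eventually_elim
      case (elim \<epsilon>)
      define X where "X = near_solutions F \<rho> (r \<rho>) \<epsilon>"
      have Xb: "w \<in> ball \<rho> (R \<rho>)" if "w \<in> X" for w
        using that rsub(1)[OF z] unfolding X_def near_solutions_def by blast
      \<comment> \<open>Membership of \<open>w\<close>, \<open>\<gamma> w\<close> or
        \<open>\<gamma>' w\<close> in \<open>tiles\<close> means that 1, \<open>norm (w + 1)\<close>
        or \<open>norm w\<close>, respectively, is strictly the smallest of these three numbers. No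
        two of them are equal because \<open>F w\<close> is not real, so exactly one case
        occurs.\<close>
      have key: "(w \<in> tiles \<or> \<gamma> w \<in> tiles \<or> \<gamma>' w \<in> tiles) \<and> \<not> (w \<in> tiles \<and> \<gamma> w \<in> tiles) \<and>
          \<not> (w \<in> tiles \<and> \<gamma>' w \<in> tiles) \<and> \<not> (\<gamma> w \<in> tiles \<and> \<gamma>' w \<in> tiles)" if w: "w \<in> X" for w
      proof -
        have u: "w \<in> uhp" "w \<noteq> 0" "w + 1 \<noteq> 0" "w + 1 \<in> uhp" using wu[OF Xb[OF w]] by auto
        have gu: "\<gamma> w \<in> uhp" unfolding \<gamma>_def by (rule uhp_inversion[OF u(4)])
        have gu': "\<gamma>' w \<in> uhp"
          using uhp_add_of_int[OF uhp_inversion[OF u(1)], of "- 1"] by (simp add: \<gamma>'_def algebra_simps)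
        have e1: "norm (\<gamma> w) = 1 / norm (w + 1)" "norm (\<gamma> w + 1) = norm w / norm (w + 1)"
        proof -
          have "\<gamma> w + 1 = w / (w + 1)" using u by (simp add: \<gamma>_def field_simps)
          then show "norm (\<gamma> w) = 1 / norm (w + 1)" "norm (\<gamma> w + 1) = norm w / norm (w + 1)"
            by (simp_all add: \<gamma>_def norm_divide)
        qed
        have e2: "norm (\<gamma>' w) = norm (w + 1) / norm w" "norm (\<gamma>' w + 1) = 1 / norm w"
        proof -
          have "\<gamma>' w = - (w + 1) / w" using u by (simp add: \<gamma>'_def field_simps)
          then show "norm (\<gamma>' w) = norm (w + 1) / norm w" by (simp add: norm_divide del: minus_add_distrib) 
          show "norm (\<gamma>' w + 1) = 1 / norm w" by (simp add: \<gamma>'_def norm_divide)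
        qed
        have p: "norm w > 0" "norm (w + 1) > 0" using u by auto
        have "norm w \<noteq> 1" "norm (w + 1) \<noteq> 1" "norm (w + 1) \<noteq> norm w"
          using nonreal[of w \<epsilon> \<rho> "r \<rho>"] Freal1[OF u(1)] Freal2[OF u(1)] Freal3[OF u(1)] elim w by (auto simp: X_def)
        moreover have "w \<in> tiles \<longleftrightarrow> norm w > 1 \<and> norm (w + 1) > 1"
          using tile[OF u(1)] elim w by (auto simp: X_def)
        moreover have "\<gamma> w \<in> tiles \<longleftrightarrow> norm (w + 1) < 1 \<and> norm (w + 1) < norm w"
          using tile[OF gu] elim w p unfolding e1 by (auto simp: X_def field_simps)
        moreover have "\<gamma>' w \<in> tiles \<longleftrightarrow> norm w < norm (w + 1) \<and> norm w < 1"
          using tile[OF gu'] elim w p unfolding e2 by (auto simp: X_def field_simps)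
        ultimately show ?thesis by linarith
      qed
      have finX: "finite X" using elim by (simp add: X_def)
      have "X = ({w\<in>X. w \<in> tiles} \<union> {w\<in>X. \<gamma> w \<in> tiles}) \<union> {w\<in>X. \<gamma>' w \<in> tiles}" using key by blast
      also have "card \<dots> = card {w\<in>X. w \<in> tiles} + card {w\<in>X. \<gamma> w \<in> tiles} + card {w\<in>X. \<gamma>' w \<in> tiles}"
        using key finX by (subst card_Un_disjoint, simp, simp, blast, subst card_Un_disjoint, simp, simp, blast, simp)
      finally have "card X = 3 * \<kappa> \<epsilon> \<rho>" using elim by (simp add: X_def \<kappa>_def)
      then show ?case using elim by (simp add: X_def)
    qed
  qed
  have "\<forall>\<^sub>F \<epsilon> in at_right 0. \<forall>z\<in>Zl. int (\<kappa> \<epsilon> z + \<kappa> \<epsilon> (- cnj z)) = 12 * zorder g z"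
  proof (rule eventually_ball_finite[OF finZl], rule ballI)
    fix z assume z: "z \<in> Zl"
    then have "z \<in> Z" "- cnj z \<in> Z" "z \<noteq> \<rho>" using Zlc by (auto simp: Zl_def')
    moreover have "- cnj z \<noteq> \<rho>"
    proof
      assume "- cnj z = \<rho>"
      then have "Re (- cnj z) = - (1/2)" by (simp add: rho_simps)
      then show False using z by (simp add: Zl_def')
    qed
    ultimately show "\<forall>\<^sub>F \<epsilon> in at_right 0. int (\<kappa> \<epsilon> z + \<kappa> \<epsilon> (- cnj z)) = 12 * zorder g z" by (rule pairS)
  qed
  moreover have "\<forall>\<^sub>F \<epsilon> in at_right 0. \<i> \<in> Z \<longrightarrow> 2 * int (\<kappa> \<epsilon> \<i>) = 12 * zorder g \<i>" using pairi by (cases "\<i> \<in> Z") auto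
  moreover have "\<forall>\<^sub>F \<epsilon> in at_right 0. \<rho> \<in> Z \<longrightarrow> 3 * int (\<kappa> \<epsilon> \<rho>) = 12 * zorder g \<rho>" using triple by (cases "\<rho> \<in> Z") auto
  moreover note pert
  moreover have "\<forall>\<^sub>F \<epsilon> in at_right 0. \<forall>z\<in>Z. finite (near_solutions F z (r z) \<epsilon>)"
    by (rule eventually_ball_finite[OF finZ]) (use good in \<open>auto simp: eventually_conj_iff\<close>)
  moreover have "\<forall>\<^sub>F \<epsilon> in at_right 0. \<epsilon> > (0::real)" by (simp add: eventually_at_right_less)
  ultimately have "\<forall>\<^sub>F \<epsilon> in at_right (0::real). \<epsilon> > 0 \<and> ?thesis"
  proof eventually_elim
    case (elim \<epsilon>)
    let ?h = "\<lambda>q. F1 q + of_real \<epsilon> * (- \<i> * F2 q)"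
    have "zcount ?h (disc_domain \<inter> N) = (\<Sum>z\<in>Z. zcount ?h (disc_domain \<inter> B z))"
      by (rule zcount_disjoint_Union[OF finZ _ disjB]) (use local elim in \<open>auto simp: N_def\<close>)
    also have "\<dots> = (\<Sum>z\<in>Z. int (\<kappa> \<epsilon> z))" using local elim by (intro sum.cong) auto
    also have "\<dots> = int (sum (\<kappa> \<epsilon>) Z)" by simp
    finally have "int b = 12 * zcount G disc_domain + int a + int (sum (\<kappa> \<epsilon>) Z)"
      using elim total[of \<epsilon>] F1count by simp
    then have "k = 12 * zcount G disc_domain + int (sum (\<kappa> \<epsilon>) Z)" using kab by simp
    also have "int (sum (\<kappa> \<epsilon>) Z) = (\<Sum>z\<in>Zl. 12 * zorder g z) + (if \<i> \<in> Z then int (\<kappa> \<epsilon> \<i>) else 0) + (if \<rho> \<in> Z then int (\<kappa> \<epsilon> \<rho>) else 0)"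
      unfolding sumZ using elim by (simp add: of_nat_sum)
    finally have kk: "real_of_int k = 12 * of_int (zcount G disc_domain) + 12 * (\<Sum>z\<in>Zl. of_int (zorder g z)) +
        (if \<i> \<in> Z then real (\<kappa> \<epsilon> \<i>) else 0) + (if \<rho> \<in> Z then real (\<kappa> \<epsilon> \<rho>) else 0)"
      by (simp add: sum_distrib_left)
    have ki: "real (\<kappa> \<epsilon> \<i>) = 12 * (1/2 * of_int (zorder g \<i>))" if "\<i> \<in> Z"
    proof -
      have "real_of_int (2 * int (\<kappa> \<epsilon> \<i>)) = real_of_int (12 * zorder g \<i>)" using elim that by simp
      then show ?thesis by simp
    qed
    have kr: "real (\<kappa> \<epsilon> \<rho>) = 12 * (1/3 * of_int (zorder g \<rho>))" if "\<rho> \<in> Z"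
    proof -
      have "real_of_int (3 * int (\<kappa> \<epsilon> \<rho>)) = real_of_int (12 * zorder g \<rho>)" using elim that by simp
      then show ?thesis by simp
    qed
    define f where "f z = ell_weight z * of_int (zorder g z)" for z
    have "(\<Sum>z\<in>{z\<in>arc_left. g z = 0}. f z) = sum f Zl + (if \<i> \<in> Z then f \<i> else 0) + (if \<rho> \<in> Z then f \<rho> else 0)"
      unfolding inZ Zl_def by (rule sum_arc_left_zeros)
    also have "sum f Zl = (\<Sum>z\<in>Zl. of_int (zorder g z))"
      by (rule sum.cong) (auto simp: f_def ell_weight_def Zl_def')
    also have "(if \<i> \<in> Z then f \<i> else 0) = (if \<i> \<in> Z then 1/2 * of_int (zorder g \<i>) else 0)"
      using ine by (auto simp: f_def ell_weight_def)
    also have "(if \<rho> \<in> Z then f \<rho> else 0) = (if \<rho> \<in> Z then 1/3 * of_int (zorder g \<rho>) else 0)"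
      by (auto simp: f_def ell_weight_def)
    finally have "real_of_int k / 12 = of_int (zcount G disc_domain) + (\<Sum>z\<in>{z\<in>arc_left. g z = 0}. f z)"
      unfolding kk using ki kr by (auto simp: field_simps)
    then show ?case using elim unfolding f_def by blast
  qed
  then show ?thesis using eventually_happens'[OF trivial_limit_at_right_real] by blast
qed

end


section \<open>Zeros of the pencil in the fundamental strip\<close>

definition strip :: "real \<Rightarrow> complex set" where
  "strip Y = {z. \<bar>Re z\<bar> < 1/2 \<and> norm z > 1 \<and> 0 < Im z \<and> Im z < Y}"

definition strip_closed :: "real \<Rightarrow> complex set" where
  "strip_closed Y = {z. \<bar>Re z\<bar> \<le> 1/2 \<and> norm z \<ge> 1 \<and> 0 \<le> Im z \<and> Im z \<le> Y}"

lemma open_strip: "open (strip Y)"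
  unfolding strip_def by (intro open_Collect_conj open_Collect_less continuous_intros)

lemma strip_closed_uhp: "strip_closed Y \<subseteq> uhp"
  using unit_norm_strip_uhp(1) by (auto simp: strip_closed_def)

lemma closure_strip: "closure (strip Y) \<subseteq> strip_closed Y"
proof (rule closure_minimal)
  show "closed (strip_closed Y)"
    unfolding strip_closed_def by (intro closed_Collect_conj closed_Collect_le continuous_intros)
qed (auto simp: strip_def strip_closed_def)

lemma bounded_strip: "bounded (strip Y)"
proof (rule bounded_subset[OF bounded_cball])
  show "strip Y \<subseteq> cball 0 (1 + \<bar>Y\<bar>)"
  proof
    fix z assume "z \<in> strip Y"
    then show "z \<in> cball 0 (1 + \<bar>Y\<bar>)" using cmod_le[of z] by (auto simp: strip_def)
  qed
qed

lemma closure_strip_uhp: "closure (strip Y) \<subseteq> uhp"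
  using closure_strip strip_closed_uhp by blast

lemma frontier_strip:
  assumes "z \<in> frontier (strip Y)"
  shows "z \<in> strip_closed Y" "\<bar>Re z\<bar> = 1/2 \<or> norm z = 1 \<or> Im z = Y"
proof -
  have *: "z \<in> closure (strip Y)" "z \<notin> strip Y"
    using assms open_strip[of Y] by (auto simp: frontier_def interior_open)
  then show zc: "z \<in> strip_closed Y" using closure_strip by blast
  then have "Im z > 0" using strip_closed_uhp by (auto simp: uhp_def)
  then show "\<bar>Re z\<bar> = 1/2 \<or> norm z = 1 \<or> Im z = Y"
    using zc *(2) by (auto simp: strip_def strip_closed_def)
qed

lemma points_intoI:
  assumes "\<delta> > 0" "\<eta> > 0" "\<And>s u'. 0 < s \<Longrightarrow> s < \<delta> \<Longrightarrow> norm (u' - u) < \<eta> \<Longrightarrow> z + of_real s * u' \<in> U"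
  shows "points_into U z u"
  using assms unfolding points_into_def by blast

lemma points_into_Int: "points_into A z u \<Longrightarrow> points_into B z u \<Longrightarrow> points_into (A \<inter> B) z u"
  unfolding points_into_def
proof (elim exE conjE, goal_cases)
  case (1 d1 d2 e1 e2)
  then show ?case by (intro exI[of _ "min d1 d2"] conjI exI[of _ "min e1 e2"]) auto
qed

lemma points_into_mono: "points_into A z u \<Longrightarrow> A \<subseteq> B \<Longrightarrow> points_into B z u"
  unfolding points_into_def by (meson subsetD)

lemma points_into_open:
  assumes "open A" "z \<in> A"
  shows "points_into A z u"
proof -
  obtain e where e: "e > 0" "ball z e \<subseteq> A" using assms openE by blast
  show ?thesis
  proof (rule points_intoI[of "e / (norm u + 1)" 1])
    fix s :: real and u' :: complex assume s: "0 < s" "s < e / (norm u + 1)" "norm (u' - u) < 1"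
    have "norm u' \<le> norm u + norm (u' - u)" by (rule norm_triangle_sub)
    then have "norm (of_real s * u') \<le> s * (norm u + 1)"
      using s by (simp add: norm_mult)
    also have "\<dots> < e" using s by (simp add: pos_less_divide_eq add_nonneg_pos)
    finally show "z + of_real s * u' \<in> A" using e(2) by (auto simp: dist_norm)
  qed (use e in \<open>auto simp: add_nonneg_pos\<close>)
qed

lemma points_into_halfplane:
  assumes "Re (c * u) > 0"
  shows "points_into {x. Re (c * x) > Re (c * z)} z u"
proof (rule points_intoI[of 1 "Re (c * u) / (norm c + 1)"])
  fix s :: real and u' :: complex assume s: "0 < s" "s < 1" "norm (u' - u) < Re (c * u) / (norm c + 1)"
  have "norm (c * (u' - u)) \<le> (norm c + 1) * norm (u' - u)" unfolding norm_mult by (intro mult_right_mono) auto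
  also have "\<dots> < Re (c * u)" using s(3) by (simp add: pos_less_divide_eq add_nonneg_pos mult.commute)
  finally have "\<bar>Re (c * (u' - u))\<bar> < Re (c * u)" using abs_Re_le_cmod order_le_less_trans by blast
  then have "Re (c * u') > 0" by (simp add: algebra_simps)
  then have "s * Re (c * u') > 0" using s by simp
  moreover have "Re (c * (z + of_real s * u')) = Re (c * z) + s * Re (c * u')" by (simp add: algebra_simps)
  ultimately show "z + of_real s * u' \<in> {x. Re (c * x) > Re (c * z)}" by simp
qed (use assms in \<open>auto simp: add_nonneg_pos\<close>)

lemma norm_add_sq: "(norm (z + w))\<^sup>2 = (norm z)\<^sup>2 + 2 * Re (cnj z * w) + (norm w)\<^sup>2" for z w :: complex
  unfolding cmod_power2 by (simp add: power2_eq_square algebra_simps)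

text \<open>The open half plane beyond the tangent at \<open>z\<close> lies outside the
  circle.\<close>

lemma points_into_outside_circle:
  assumes "Re (cnj z * u) > 0"
  shows "points_into {x. norm x > norm z} z u"
proof -
  have "{x. Re (cnj z * x) > Re (cnj z * z)} \<subseteq> {x. norm x > norm z}"
  proof clarify
    fix x assume x: "Re (cnj z * x) > Re (cnj z * z)"
    have "Re (cnj z * (x - z)) > 0" using x by (simp add: algebra_simps)
    then have "(norm z)\<^sup>2 < (norm (z + (x - z)))\<^sup>2"
      unfolding norm_add_sq using zero_le_power2[of "norm (x - z)"] by linarith
    then show "norm x > norm z" by (simp add: power_less_imp_less_base)
  qed
  then show ?thesis using points_into_halfplane[OF assms] points_into_mono by blast
qed

text \<open>A tangent half plane is not contained in the disc, so the quadratic term of the squared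
  norm has to be beaten by the linear one. This fixes the bound on \<open>s\<close>.\<close>

lemma points_into_inside_circle:
  assumes "Re (cnj z * u) < 0"
  shows "points_into {x. norm x < norm z} z u"
proof (rule points_intoI[of "- Re (cnj z * u) / (norm u + 1)\<^sup>2" "min 1 (- Re (cnj z * u) / (2 * (norm z + 1)))"])
  have n1: "norm u + 1 > 0" "norm z + 1 > 0" by (simp_all add: add_nonneg_pos)
  then show "- Re (cnj z * u) / (norm u + 1)\<^sup>2 > 0" "min 1 (- Re (cnj z * u) / (2 * (norm z + 1))) > 0"
    using assms by auto
  fix s :: real and u' :: complex
  assume s: "0 < s" "s < - Re (cnj z * u) / (norm u + 1)\<^sup>2" "norm (u' - u) < min 1 (- Re (cnj z * u) / (2 * (norm z + 1)))"
  have "norm (cnj z * (u' - u)) \<le> (norm z + 1) * norm (u' - u)" unfolding norm_mult by (intro mult_right_mono) auto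
  also have "\<dots> < - Re (cnj z * u) / 2"
  proof -
    have "norm (u' - u) < - Re (cnj z * u) / (2 * (norm z + 1))" using s(3) by linarith
    then have "norm (u' - u) * (2 * (norm z + 1)) < - Re (cnj z * u)" using n1(2) by (subst (asm) pos_less_divide_eq) auto
    then show ?thesis by (simp add: algebra_simps)
  qed
  finally have "\<bar>Re (cnj z * (u' - u))\<bar> < - Re (cnj z * u) / 2" using abs_Re_le_cmod order_le_less_trans by blast
  moreover have "Re (cnj z * (u' - u)) = Re (cnj z * u') - Re (cnj z * u)" by (simp add: algebra_simps)
  ultimately have 1: "2 * Re (cnj z * u') < Re (cnj z * u)" by linarith
  have "norm u' \<le> norm u + 1" using norm_triangle_sub[of u' u] s(3) by simp
  then have "(norm u')\<^sup>2 \<le> (norm u + 1)\<^sup>2" by (intro power_mono) auto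
  then have "s * (norm u')\<^sup>2 \<le> s * (norm u + 1)\<^sup>2" using s(1) by simp
  also have "\<dots> < - Re (cnj z * u)" using s(2) n1(1) by (simp add: pos_less_divide_eq)
  finally have "2 * Re (cnj z * u') + s * (norm u')\<^sup>2 < 0" using 1 by simp
  then have "s * (2 * Re (cnj z * u') + s * (norm u')\<^sup>2) < 0" using s(1) by (simp add: mult_pos_neg)
  moreover have "(norm (z + of_real s * u'))\<^sup>2 = (norm z)\<^sup>2 + s * (2 * Re (cnj z * u') + s * (norm u')\<^sup>2)"
    unfolding norm_add_sq using s(1) by (simp add: norm_mult power_mult_distrib algebra_simps power2_eq_square)
  ultimately have "(norm (z + of_real s * u'))\<^sup>2 < (norm z)\<^sup>2" by simp
  then show "z + of_real s * u' \<in> {x. norm x < norm z}" by (simp add: power_less_imp_less_base)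
qed

lemma points_into_strip:
  assumes z: "\<bar>Re z\<bar> \<le> 1/2" "norm z \<ge> 1" "0 < Im z" "Im z < Y"
    and u: "Re z = 1/2 \<Longrightarrow> Re u < 0" "Re z = - (1/2) \<Longrightarrow> Re u > 0" "norm z = 1 \<Longrightarrow> Re (cnj z * u) > 0"
  shows "points_into (strip Y) z u"
proof -
  have 1: "points_into {x. Re x < 1/2} z u"
  proof (cases "Re z = 1/2")
    case True
    then have "points_into {x. Re (- 1 * x) > Re (- 1 * z)} z u" by (intro points_into_halfplane) (use u(1) in simp)
    then show ?thesis using True by simp
  next
    case False
    then show ?thesis using z(1) by (intro points_into_open open_halfspace_Re_lt) auto
  qed
  have 2: "points_into {x. Re x > - (1/2)} z u"
  proof (cases "Re z = - (1/2)")
    case True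
    then have "points_into {x. Re (1 * x) > Re (1 * z)} z u" by (intro points_into_halfplane) (use u(2) in simp)
    then show ?thesis using True by simp
  next
    case False
    then show ?thesis using z(1) by (intro points_into_open open_halfspace_Re_gt) auto
  qed
  have 3: "points_into {x. norm x > 1} z u"
  proof (cases "norm z = 1")
    case True
    then show ?thesis using points_into_outside_circle[OF u(3)[OF True]] by simp
  next
    case False
    have "open {x::complex. norm x > 1}" by (intro open_Collect_less continuous_intros)
    then show ?thesis using z(2) False by (intro points_into_open) auto
  qed
  have 4: "points_into {x. Im x > 0} z u" "points_into {x. Im x < Y} z u"
    using z by (auto intro!: points_into_open open_halfspace_Im_gt open_halfspace_Im_lt)
  have "points_into ({x. Re x < 1/2} \<inter> {x. Re x > - (1/2)} \<inter> {x. norm x > 1} \<inter> {x. Im x > 0} \<inter> {x. Im x < Y}) z u"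
    by (intro points_into_Int 1 2 3 4)
  then show ?thesis by (rule points_into_mono) (auto simp: strip_def)
qed

lemma points_out_of_strip:
  assumes "(Re z = 1/2 \<and> Re u > 0) \<or> (Re z = - (1/2) \<and> Re u < 0) \<or> (norm z = 1 \<and> Re (cnj z * u) < 0)"
  shows "points_into (- strip Y) z u"
  using assms
proof (elim disjE conjE)
  assume *: "Re z = 1/2" "Re u > 0"
  have "points_into {x. Re (1 * x) > Re (1 * z)} z u" by (rule points_into_halfplane) (use * in simp)
  then show ?thesis by (rule points_into_mono) (use * in \<open>auto simp: strip_def\<close>)
next
  assume *: "Re z = - (1/2)" "Re u < 0"
  have "points_into {x. Re (- 1 * x) > Re (- 1 * z)} z u" by (rule points_into_halfplane) (use * in simp)
  then show ?thesis by (rule points_into_mono) (use * in \<open>auto simp: strip_def\<close>)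
next
  assume *: "norm z = 1" "Re (cnj z * u) < 0"
  show ?thesis by (rule points_into_mono[OF points_into_inside_circle[OF *(2)]]) (use * in \<open>auto simp: strip_def\<close>)
qed

text \<open>All segments from the bottom arc towards \<open>w\<close> leave it to the same side of the unit circle, the outer one
  iff \<open>out\<close>. The boundary points in \<open>entering w out\<close> are those at which the segment enters the strip.\<close>

definition one_sided :: "complex \<Rightarrow> bool \<Rightarrow> bool" where
  "one_sided w out \<longleftrightarrow> Re w \<noteq> 1/2 \<and> Re w \<noteq> - (1/2) \<and>
    (if out then \<forall>z. norm z = 1 \<longrightarrow> \<bar>Re z\<bar> \<le> 1/2 \<longrightarrow> Im z > 0 \<longrightarrow> Re (cnj z * w) > 1 else norm w < 1)"

definition entering :: "complex \<Rightarrow> bool \<Rightarrow> complex set" where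
  "entering w out = {z. (Re z = 1/2 \<longrightarrow> Re w < 1/2) \<and> (Re z = - (1/2) \<longrightarrow> Re w > - (1/2)) \<and> (norm z = 1 \<longrightarrow> out)}"

lemma Re_cnj_self: "Re (cnj z * z) = (norm z)\<^sup>2"
  unfolding cmod_power2 by (simp add: power2_eq_square)

section \<open>Positivity of the weight, and where the pencil cannot vanish\<close>

context real_modular_form
begin

definition boundary_zeros :: "complex set" where
  "boundary_zeros = {z\<in>uhp. g z = 0 \<and> \<bar>Re z\<bar> \<le> 1/2 \<and> norm z \<ge> 1 \<and> (\<bar>Re z\<bar> = 1/2 \<or> norm z = 1)}"

lemma zorder_g_nonneg: "z \<in> uhp \<Longrightarrow> zorder g z \<ge> 0"
  using zorder_g(2) g_holomorphic open_uhp analytic_at by (intro zorder_ge_0) (auto simp: eventually_frequently)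

lemma zorder_G_nonneg: "norm q < 1 \<Longrightarrow> zorder G q \<ge> 0"
  using G_eventually_nonzero G_holomorphic analytic_at[of G q]
  by (intro zorder_ge_0) (auto simp: eventually_frequently intro: exI[of _ "ball 0 1"])

lemma zcount_G_nonneg: "zcount G disc_domain \<ge> 0"
  unfolding zcount_def using zorder_G_nonneg closure_disc_domain_ball closure_subset[of disc_domain]
  by (intro sum_nonneg) auto

lemma zcount_G_pos:
  assumes "G 0 = 0"
  shows "zcount G disc_domain > 0"
proof -
  have fin: "finite {q\<in>disc_domain. G q = 0}"
  proof -
    have "finite {q\<in>closure disc_domain. G q = 0}"
      by (rule finite_zeros_in_compact[OF _ G_holomorphic open_ball closure_disc_domain_ball])
        (use bounded_disc_domain closure_disc_domain_ball G_eventually_nonzero in auto)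
    then show ?thesis by (rule rev_finite_subset) (use closure_subset in auto)
  qed
  have sub: "disc_domain \<subseteq> ball 0 1" using closure_disc_domain_ball closure_subset[of disc_domain] by blast
  have "G analytic_on {0}" using G_holomorphic analytic_at[of G 0] by (auto intro: exI[of _ "ball 0 1"])
  then have "zorder G 0 > 0"
    using G_eventually_nonzero[of 0] assms by (subst zorder_pos_iff') (auto simp: eventually_frequently)
  also have "zorder G 0 \<le> zcount G disc_domain"
    unfolding zcount_def
    by (rule member_le_sum[OF _ _ fin]) (use assms zorder_G_nonneg sub in \<open>auto simp: disc_domain_def\<close>)
  finally show ?thesis .
qed

lemma ell_sum_nonneg: "(\<Sum>z\<in>{z\<in>arc_left. g z = 0}. ell_weight z * of_int (zorder g z)) \<ge> 0"
  using zorder_g_nonneg by (intro sum_nonneg) (auto simp: ell_weight_def arc_left_def)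

text \<open>All terms of the valence formula are nonnegative, hence \<open>k \<ge> 0\<close>. In
  weight 0 the form \<open>g - c\<close>, with \<open>c\<close> the constant Fourier coefficient,
  would be a nonconstant form that vanishes at the cusp, which contradicts its own valence
  formula.\<close>

lemma k_pos: "k > 0"
proof -
  have "real_of_int k / 12 \<ge> 0" unfolding valence using zcount_G_nonneg ell_sum_nonneg by simp
  then have "k \<ge> 0" by simp
  moreover have "k \<noteq> 0"
  proof
    assume k0: "k = 0"
    define c where "c = fps_nth A 0"
    have c: "c = G 0" using q_exp has_fps_expansion_imp_0_eq_fps_nth_0 by (fastforce simp: q_expands_def c_def)
    have q: "q_expands (\<lambda>z. g z - c) (\<lambda>q. G q - c) (A - fps_const c)"
      using q_exp unfolding q_expands_def by (auto intro!: holomorphic_intros fps_expansion_intros)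
    interpret L: real_modular_form "\<lambda>z. g z - c" 0 "\<lambda>q. G q - c" "A - fps_const c"
    proof
      show "modular_form 0 (\<lambda>z. g z - c)"
        using modular q_expands_imp_fourier[OF q] unfolding k0 modular_form_def by (auto intro!: holomorphic_intros)
      show "\<not> (\<lambda>z. g z - c) constant_on uhp"
        using nonconst unfolding constant_on_def by (metis diff_add_cancel)
      show "q_expands (\<lambda>z. g z - c) (\<lambda>q. G q - c) (A - fps_const c)" by (rule q)
      show "fps_nth (A - fps_const c) n \<in> \<real>" for n
        using real_coeff[of n] real_coeff[of 0] by (auto simp: c_def)
    qed
    have "zcount (\<lambda>q. G q - c) disc_domain > 0" by (rule L.zcount_G_pos) (simp add: c)
    then show False using L.valence L.ell_sum_nonneg by simp
  qed
  ultimately show ?thesis by simp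
qed

text \<open>With \<open>f = (z - z0)^m u\<close> the first term has order at least m, while
  \<open>v f'\<close> has order m - 1 with the nonzero leading coefficient
  \<open>m u v\<close>.\<close>

lemma zorder_pencil:
  assumes f: "f holomorphic_on V" "open V" "z0 \<in> V" "f z0 = 0" "\<forall>\<^sub>F w in at z0. f w \<noteq> 0"
    and v: "v holomorphic_on V" "v z0 \<noteq> 0"
  shows "zorder (\<lambda>z. c * f z + v z * deriv f z) z0 = zorder f z0 - 1"
proof -
  obtain m u where u: "m \<ge> 1" "int m = zorder f z0" "u holomorphic_on V" "u z0 \<noteq> 0" "\<And>z. f z = (z - z0) ^ m * u z"
    using factor_zero_global[OF f] by metis
  obtain m' where m': "m = Suc m'" using u(1) by (cases m) auto
  show ?thesis
  proof (rule zorder_eqI[OF f(2,3)])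
    let ?h = "\<lambda>z. c * (z - z0) * u z + v z * (of_nat m * u z + (z - z0) * deriv u z)"
    show "?h holomorphic_on V" using u(3) v(1) f(2) by (intro holomorphic_intros holomorphic_deriv)
    show "?h z0 \<noteq> 0" using u(1,4) v(2) by simp
    fix z assume z: "z \<in> V" "z \<noteq> z0"
    have "(f has_field_derivative of_nat m * (z - z0) ^ m' * u z + (z - z0) ^ m * deriv u z) (at z)"
      unfolding u(5)[abs_def]
    proof (rule DERIV_cong[OF DERIV_mult[OF DERIV_power[where n = m, OF DERIV_diff[OF DERIV_ident DERIV_const]]]])
      show "(u has_field_derivative deriv u z) (at z)" by (rule holomorphic_derivI[OF u(3) f(2) z(1)])
    qed (simp add: m' algebra_simps)
    then have d: "deriv f z = of_nat m * (z - z0) ^ m' * u z + (z - z0) ^ m * deriv u z" by (rule DERIV_imp_deriv)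
    have "zorder f z0 - 1 = int m'" using u(2) m' by simp
    then have p: "(z - z0) powi (zorder f z0 - 1) = (z - z0) ^ m'" by simp
    show "c * f z + v z * deriv f z = ?h z * (z - z0) powi (zorder f z0 - 1)"
      unfolding d p u(5)[of z] by (simp add: m' algebra_simps)
  qed
qed

text \<open>If \<open>G = q^n u\<close> with \<open>u 0 \<noteq> 0\<close>, the logarithmic
  derivative of \<open>g\<close> is \<open>2 pi \<i> (n + q u' / u)\<close>. The exponential decay
  of the remainder matters because the pencil multiplies it by the linear factor
  \<open>z - w\<close>.\<close>

lemma log_deriv_top:
  obtains C Y0 where "C \<ge> 0" "Y0 \<ge> 1"
    "\<And>z. Im z \<ge> Y0 \<Longrightarrow> g z \<noteq> 0 \<and> (\<exists>x. norm x \<le> C * exp (- 2 * pi * Im z) \<and>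
        deriv g z = 2 * of_real pi * \<i> * (of_int (zorder G 0) + x) * g z)"
proof -
  have "\<exists>m u. int m = zorder G 0 \<and> u holomorphic_on ball 0 1 \<and> u 0 \<noteq> 0 \<and> (\<forall>q. G q = q ^ m * u q)"
  proof (cases "G 0 = 0")
    case True
    have "\<forall>\<^sub>F w in at 0. G w \<noteq> 0" using G_eventually_nonzero[of 0] by simp
    then obtain m u where "m \<ge> 1" "int m = zorder G 0" "u holomorphic_on ball 0 1" "u 0 \<noteq> 0" "\<And>z. G z = (z - 0) ^ m * u z"
      using factor_zero_global[OF G_holomorphic open_ball _ True] by (metis centre_in_ball zero_less_one)
    then show ?thesis by (metis diff_zero)
  next
    case False
    have "zorder G 0 = 0"
      by (rule zorder_eq_0I) (use False G_holomorphic analytic_at[of G 0] in \<open>auto intro: exI[of _ "ball 0 1"]\<close>)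
    then show ?thesis using False G_holomorphic by (intro exI[of _ 0] exI[of _ G]) auto
  qed
  then obtain m u where u: "int m = zorder G 0" "u holomorphic_on ball 0 1" "u 0 \<noteq> 0" "\<And>q. G q = q ^ m * u q" by blast
  have "isCont u 0"
    using u(2) continuous_on_eq_continuous_at[of "ball 0 1" u] holomorphic_on_imp_continuous_on by auto
  then obtain d where d: "d > 0" "\<And>q. dist q 0 < d \<Longrightarrow> dist (u q) (u 0) < norm (u 0)"
    using u(3) unfolding continuous_at_eps_delta by (metis zero_less_norm_iff)
  define r where "r = min d 1 / 2"
  have r: "0 < r" "r < 1" "r < d" using d(1) by (auto simp: r_def)
  have un: "u q \<noteq> 0" if "norm q \<le> r" for q
    using d(2)[of q] that r(3) by (auto simp: dist_norm)
  have sub: "cball 0 r \<subseteq> ball 0 1" using r by auto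
  have "(\<lambda>q. deriv u q / u q) holomorphic_on cball 0 r"
    by (rule holomorphic_on_divide[OF holomorphic_on_subset[OF holomorphic_deriv[OF u(2) open_ball] sub]
          holomorphic_on_subset[OF u(2) sub]]) (use un in auto)
  then have "compact ((\<lambda>q. deriv u q / u q) ` cball 0 r)"
    by (intro compact_continuous_image holomorphic_on_imp_continuous_on) auto
  then obtain K where K: "K > 0" "\<And>q. norm q \<le> r \<Longrightarrow> norm (deriv u q / u q) \<le> K"
    using compact_imp_bounded[of "(\<lambda>q. deriv u q / u q) ` cball 0 r"] unfolding bounded_pos by auto
  show ?thesis
  proof (rule that[of K "max 1 (- ln r / (2 * pi))"])
    fix z assume z: "max 1 (- ln r / (2 * pi)) \<le> Im z"
    have zu: "z \<in> uhp" using z by (simp add: uhp_def)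
    define q where "q = nome z"
    have "- ln r / (2 * pi) \<le> Im z" using z by simp
    then have "- ln r \<le> Im z * (2 * pi)" by (subst (asm) pos_divide_le_eq) auto
    then have "exp (- 2 * pi * Im z) \<le> exp (ln r)" by (simp add: mult_ac)
    then have qr: "norm q \<le> r" using r(1) by (simp add: q_def norm_nome)
    have q0: "q \<noteq> 0" by (simp add: q_def)
    have qb: "q \<in> ball 0 1" using qr r by simp
    have gz: "g z = q ^ m * u q" using g_eq[OF zu] u(4) by (simp add: q_def)
    have "(G has_field_derivative of_nat m * q ^ (m - 1) * u q + q ^ m * deriv u q) (at q)"
      unfolding u(4)[abs_def]
      by (rule DERIV_cong[OF DERIV_mult[OF DERIV_power[where n = m, OF DERIV_ident] holomorphic_derivI[OF u(2) open_ball qb]]])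
        (simp add: algebra_simps)
    then have dG: "deriv G q = of_nat m * q ^ (m - 1) * u q + q ^ m * deriv u q" by (rule DERIV_imp_deriv)
    define x where "x = q * (deriv u q / u q)"
    have qm: "of_nat m * (q * q ^ (m - 1)) = of_nat m * q ^ m" by (cases m) auto
    have "q * deriv G q = of_nat m * (q * q ^ (m - 1)) * u q + q ^ m * q * deriv u q"
      unfolding dG by (simp add: algebra_simps)
    also have "\<dots> = (of_nat m + x) * (q ^ m * u q)"
      unfolding qm x_def using un[OF qr] by (simp add: field_simps)
    finally have "q * deriv G q = (of_nat m + x) * g z" by (simp add: gz)
    moreover have "deriv g z = 2 * of_real pi * \<i> * (q * deriv G q)" using deriv_g[OF zu] by (simp add: q_def)
    moreover have "of_nat m = (of_int (zorder G 0) :: complex)" by (simp add: u(1)[symmetric])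
    ultimately have "deriv g z = 2 * of_real pi * \<i> * (of_int (zorder G 0) + x) * g z" by simp
    moreover have "norm x \<le> K * exp (- 2 * pi * Im z)"
    proof -
      have "norm x = norm q * norm (deriv u q / u q)" by (simp only: x_def norm_mult)
      also have "\<dots> \<le> norm q * K" by (rule mult_left_mono[OF K(2)[OF qr]]) simp
      finally show ?thesis by (simp add: q_def norm_nome mult.commute)
    qed
    moreover have "g z \<noteq> 0" using gz q0 un[OF qr] by simp
    ultimately show "g z \<noteq> 0 \<and> (\<exists>x. norm x \<le> K * exp (- 2 * pi * Im z) \<and>
        deriv g z = 2 * of_real pi * \<i> * (of_int (zorder G 0) + x) * g z)" by blast
  qed (use K in auto)
qed

text \<open>By \<open>circle_pencil_zero\<close> a zero on the circle would put the point
  \<open>z + \<epsilon> (w - z)\<close> of the segment towards \<open>w\<close> on the unit circle,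
  but \<open>one_sided\<close> keeps it strictly on one side: beyond the tangent at \<open>z\<close>
  if \<open>out\<close>, inside the disc by convexity otherwise. On the vertical lines it is enough
  that the real part of \<open>w\<close> differs.\<close>

lemma pencil_boundary_nonzero:
  assumes w: "one_sided w out" and e: "0 < \<epsilon>" "\<epsilon> \<le> 1"
    and z: "z \<in> uhp" "\<bar>Re z\<bar> \<le> 1/2" "norm z \<ge> 1" "\<bar>Re z\<bar> = 1/2 \<or> norm z = 1" and g0: "g z \<noteq> 0"
  shows "of_int k * g z + of_real \<epsilon> * ((z - w) * deriv g z) \<noteq> 0"
proof (cases "\<bar>Re z\<bar> = 1/2")
  case True
  then have l: "Re z = 1/2 \<or> Re z = - (1/2)" by linarith
  have "Re (of_real \<epsilon> * (z - w)) \<noteq> 0" using l w e by (auto simp: one_sided_def)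
  from line_pencil_nonzero[OF z(1) l g0 this] k_pos show ?thesis by (simp add: mult_ac)
next
  case False
  then have n: "norm z = 1" using z(4) by simp
  show ?thesis
  proof
    assume 0: "of_int k * g z + of_real \<epsilon> * ((z - w) * deriv g z) = 0"
    have "norm (z - of_real \<epsilon> * (z - w)) = 1"
      by (rule circle_pencil_zero[OF z(1) n g0]) (use 0 k_pos in \<open>auto simp: mult_ac\<close>)
    then have N: "(norm (z + of_real \<epsilon> * (w - z)))\<^sup>2 = 1" by (simp add: algebra_simps)
    show False
    proof (cases out)
      case True
      then have "Re (cnj z * w) > 1" using w n z by (auto simp: one_sided_def uhp_def)
      then have "Re (cnj z * (w - z)) > 0" using Re_cnj_self[of z] n by (simp add: algebra_simps)
      then have "\<epsilon> * Re (cnj z * (w - z)) > 0" using e by simp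
      moreover have "Re (cnj z * (of_real \<epsilon> * (w - z))) = \<epsilon> * Re (cnj z * (w - z))" by (simp add: algebra_simps)
      ultimately show False using N n unfolding norm_add_sq by (smt (verit) one_power2 zero_le_power2)
    next
      case F: False
      then have wn: "norm w < 1" using w by (simp add: one_sided_def)
      have "z + of_real \<epsilon> * (w - z) = of_real (1 - \<epsilon>) * z + of_real \<epsilon> * w" by (simp add: algebra_simps)
      then have "norm (z + of_real \<epsilon> * (w - z)) \<le> (1 - \<epsilon>) * norm z + \<epsilon> * norm w"
        using e norm_triangle_ineq[of "of_real (1 - \<epsilon>) * z" "of_real \<epsilon> * w"] by (simp only: norm_mult norm_of_real)
      also have "\<dots> < (1 - \<epsilon>) * 1 + \<epsilon> * 1" using e wn n by (intro add_le_less_mono) auto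
      finally have "norm (z + of_real \<epsilon> * (w - z)) < 1" by simp
      then show False using N power_strict_mono[of "norm (z + of_real \<epsilon> * (w - z))" 1 2] by (simp del: norm_power)
    qed
  qed
qed

lemma boundary_ne:
  assumes w: "one_sided w out" and z: "z \<in> uhp" "norm z \<ge> 1" "\<bar>Re z\<bar> = 1/2 \<or> (norm z = 1 \<and> \<bar>Re z\<bar> \<le> 1/2)"
  shows "z \<noteq> w"
proof
  assume "z = w"
  then show False using w z Re_cnj_self[of w] by (auto simp: one_sided_def uhp_def split: if_splits)
qed

text \<open>If \<open>g\<close> does not vanish at the cusp, its logarithmic derivative decays and
  the term \<open>k\<close> dominates, uniformly in \<epsilon>. If it does vanish, the other term
  grows with the height and dominates for \<open>\<epsilon> = 1\<close>; for small \<epsilon> the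
  terms can balance, which is the extra zero.\<close>

lemma pencil_top_nonzero:
  assumes "M \<ge> 0"
  obtains Y0 where "Y0 \<ge> 1" "\<And>w z :: complex. norm w \<le> M \<Longrightarrow> \<bar>Re z\<bar> \<le> 1/2 \<Longrightarrow> Im z \<ge> Y0 \<Longrightarrow>
    g z \<noteq> 0 \<and> of_int k * g z + (z - w) * deriv g z \<noteq> 0"
    "zorder G 0 = 0 \<Longrightarrow> (\<And>(w :: complex) z \<epsilon>. norm w \<le> M \<Longrightarrow> \<bar>Re z\<bar> \<le> 1/2 \<Longrightarrow> Im z \<ge> Y0 \<Longrightarrow> 0 < \<epsilon> \<Longrightarrow> \<epsilon> \<le> 1 \<Longrightarrow>
      of_int k * g z + of_real \<epsilon> * ((z - w) * deriv g z) \<noteq> 0)"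
    "\<And>z. Im z \<ge> Y0 \<Longrightarrow> g z \<noteq> 0 \<and> (\<exists>x. norm x \<le> 1/4 \<and> deriv g z = 2 * of_real pi * \<i> * (of_int (zorder G 0) + x) * g z)"
proof -
  obtain C Y1 where C: "C \<ge> 0" "Y1 \<ge> 1" "\<And>z. Im z \<ge> Y1 \<Longrightarrow> g z \<noteq> 0 \<and> (\<exists>x. norm x \<le> C * exp (- 2 * pi * Im z) \<and>
        deriv g z = 2 * of_real pi * \<i> * (of_int (zorder G 0) + x) * g z)"
    using log_deriv_top by blast
  define n where "n = zorder G 0"
  have n0: "n \<ge> 0" using zorder_G_nonneg[of 0] by (simp add: n_def)
  have kp: "real_of_int k > 0" using k_pos by simp
  \<comment> \<open>\<open>4 * C\<close> makes the remainder at most 1/4. The quotient by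
    \<open>k\<close> makes the derivative term smaller than \<open>k\<close> in the nonvanishing
    case. \<open>M + k\<close> together with \<open>Y1 \<ge> 1\<close> makes
    \<open>norm (z - w)\<close> at least \<open>k + 1\<close> in the vanishing case.\<close>
  define Y0 where "Y0 = Y1 + 4 * C + 2 * pi * C * (3/2 + M) / of_int k + M + of_int k"
  have p1: "2 * pi * C * (3/2 + M) / of_int k \<ge> 0" using C(1) assms kp by simp
  have Y: "Y0 \<ge> Y1" "Y0 \<ge> 1" "Y0 \<ge> 4 * C" "Y0 \<ge> 2 * pi * C * (3/2 + M) / of_int k" "Y0 \<ge> M + of_int k + 1"
    using C p1 assms kp k_pos unfolding Y0_def by linarith+
  have pi1: "2 * pi \<ge> 1" "pi > 3" using pi_gt3 by auto
  have expb: "exp (- 2 * pi * y) \<le> exp (- y) * exp (- y)" if "y \<ge> 0" for y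
  proof -
    have "- 2 * pi * y \<le> - y + - y" using that pi1 mult_right_mono[of 2 "2 * pi" y] by simp
    then show ?thesis by (simp only: exp_add[symmetric] exp_le_cancel_iff)
  qed
  have small: "C * exp (- 2 * pi * y) \<le> 1/4" if "y \<ge> Y0" for y
  proof -
    have y: "y \<ge> 1" "y \<ge> 4 * C" using that Y by auto
    have "exp (- 2 * pi * y) \<le> exp (- y)" using y(1) pi1 mult_right_mono[of 1 "2 * pi" y] by simp
    moreover have "exp y \<ge> 4 * C" using exp_ge_add_one_self[of y] y by linarith
    then have "4 * C * exp (- y) \<le> 1" by (simp add: exp_minus field_simps)
    ultimately show ?thesis using C(1) mult_left_mono[of "exp (- 2 * pi * y)" "exp (- y)" C] by simp
  qed
  have zero_case: "norm (z - w) * (2 * pi * norm x) < of_int k"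
    if "norm w \<le> M" "\<bar>Re z\<bar> \<le> 1/2" "Im z \<ge> Y0" "norm x \<le> C * exp (- 2 * pi * Im z)" for w z x :: complex
  proof -
    define y where "y = Im z"
    have y: "y \<ge> 1" "y \<ge> 2 * pi * C * (3/2 + M) / of_int k" using that Y by (auto simp: y_def)
    have "norm (z - w) \<le> norm z + norm w" by (rule norm_triangle_ineq4)
    also have "\<dots> \<le> (1/2 + y) + M" using cmod_le[of z] that y by (auto simp: y_def)
    also have "\<dots> \<le> (3/2 + M) * (1 + y)"
      using mult_nonneg_nonneg[OF assms, of y] y(1) by (simp add: field_simps)
    also have "\<dots> \<le> (3/2 + M) * exp y" using assms exp_ge_add_one_self[of y] by (intro mult_left_mono) auto
    finally have a: "norm (z - w) \<le> (3/2 + M) * exp y" .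
    have b: "2 * pi * norm x \<le> 2 * pi * (C * (exp (- y) * exp (- y)))"
      using that(4) expb[of y] y C(1) unfolding y_def[symmetric]
      by (intro mult_left_mono order_trans[OF that(4)[folded y_def]]) auto
    have "norm (z - w) * (2 * pi * norm x) \<le> ((3/2 + M) * exp y) * (2 * pi * (C * (exp (- y) * exp (- y))))"
      by (rule mult_mono[OF a b]) (use assms in auto)
    also have "\<dots> = 2 * pi * C * (3/2 + M) * exp (- y) * (exp y * exp (- y))" by (simp only: mult_ac)
    also have "\<dots> = 2 * pi * C * (3/2 + M) * exp (- y)" by (simp add: exp_minus)
    also have "\<dots> \<le> (of_int k * y) * exp (- y)"
      using y(2) kp by (intro mult_right_mono) (auto simp: pos_divide_le_eq mult_ac)
    also have "\<dots> < of_int k"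
    proof -
      have "y < exp y" using exp_ge_add_one_self[of y] by linarith
      then have "y * exp (- y) < 1" by (simp add: exp_minus field_simps)
      then show ?thesis using kp by (simp add: mult.assoc)
    qed
    finally show ?thesis .
  qed
  have top0: "of_int k * g z + of_real \<epsilon> * ((z - w) * deriv g z) \<noteq> 0"
    if *: "n = 0" "norm w \<le> M" "\<bar>Re z\<bar> \<le> 1/2" "Im z \<ge> Y0" "0 < \<epsilon>" "\<epsilon> \<le> 1" for w z :: complex and \<epsilon> :: real
  proof
    assume 0: "of_int k * g z + of_real \<epsilon> * ((z - w) * deriv g z) = 0"
    obtain x where x: "norm x \<le> C * exp (- 2 * pi * Im z)" "deriv g z = 2 * of_real pi * \<i> * (of_int n + x) * g z" "g z \<noteq> 0"
      using C(3)[of z] *(4) Y(1) unfolding n_def by fastforce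
    then have x: "norm x \<le> C * exp (- 2 * pi * Im z)" "deriv g z = 2 * of_real pi * \<i> * x * g z" "g z \<noteq> 0"
      using *(1) by simp_all
    have "g z * (of_int k + of_real \<epsilon> * ((z - w) * (2 * of_real pi * \<i> * x))) = 0"
      using 0 unfolding x(2) by (simp add: algebra_simps)
    then have "of_int k = - (of_real \<epsilon> * ((z - w) * (2 * of_real pi * \<i> * x)))" using x(3) by (simp add: eq_neg_iff_add_eq_0)
    then have "norm (of_int k :: complex) = norm (of_real \<epsilon> * ((z - w) * (2 * of_real pi * \<i> * x)))" by simp
    then have "of_int k = \<epsilon> * (norm (z - w) * (2 * pi * norm x))" using * kp by (simp add: norm_mult)
    also have "\<dots> \<le> 1 * (norm (z - w) * (2 * pi * norm x))" using * by (intro mult_right_mono) auto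
    also have "\<dots> < of_int k" using zero_case[OF *(2-4) x(1)] by simp
    finally show False by simp
  qed
  show ?thesis
  proof (rule that[OF Y(2)])
    fix w z :: complex assume wz: "norm w \<le> M" "\<bar>Re z\<bar> \<le> 1/2" "Im z \<ge> Y0"
    show "g z \<noteq> 0 \<and> of_int k * g z + (z - w) * deriv g z \<noteq> 0"
    proof
      show g0: "g z \<noteq> 0" using C(3)[of z] wz Y(1) by simp
      show "of_int k * g z + (z - w) * deriv g z \<noteq> 0"
      proof (cases "n = 0")
        case True
        then show ?thesis using top0[OF True wz, of 1] by simp
      next
        case False
        then have n1: "n \<ge> 1" using n0 by simp
        obtain x where x: "norm x \<le> C * exp (- 2 * pi * Im z)" "deriv g z = 2 * of_real pi * \<i> * (of_int n + x) * g z"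
          using C(3)[of z] wz Y(1) unfolding n_def by fastforce
        have "norm x \<le> 1/4" using x(1) small[OF wz(3)] by simp
        have "real_of_int n = norm (of_int n :: complex)" using n1 by simp
        also have "\<dots> \<le> norm (of_int n + x) + norm x" by norm
        finally have nx: "norm (of_int n + x) \<ge> 3/4" using \<open>norm x \<le> 1/4\<close> n1 by simp
        have "Im z - M \<le> norm (z - w)"
          using abs_Im_le_cmod[of z] norm_triangle_ineq2[of z w] wz(1) by linarith
        then have zw: "norm (z - w) \<ge> of_int k + 1" using wz Y(5) by linarith
        show ?thesis
        proof
          assume "of_int k * g z + (z - w) * deriv g z = 0"
          then have "g z * (of_int k + (z - w) * (2 * of_real pi * \<i> * (of_int n + x))) = 0"
            unfolding x(2) by (simp add: algebra_simps)
          then have "of_int k = - ((z - w) * (2 * of_real pi * \<i> * (of_int n + x)))" using g0 by (simp add: eq_neg_iff_add_eq_0)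
          then have "norm (of_int k :: complex) = norm ((z - w) * (2 * of_real pi * \<i> * (of_int n + x)))" by simp
          then have "of_int k = norm (z - w) * (2 * pi * norm (of_int n + x))" using kp by (simp add: norm_mult)
          also have "\<dots> \<ge> (of_int k + 1) * 1"
          proof (rule mult_mono[OF zw])
            have "1 \<le> 2 * 3 * (3/4 :: real)" by simp
            also have "\<dots> \<le> 2 * pi * norm (of_int n + x)" using pi1 nx by (intro mult_mono) auto
            finally show "1 \<le> 2 * pi * norm (of_int n + x)" .
          qed auto
          finally show False by simp
        qed
      qed
    qed
  next
    show "\<And>z. Im z \<ge> Y0 \<Longrightarrow> g z \<noteq> 0 \<and> (\<exists>x. norm x \<le> 1/4 \<and> deriv g z = 2 * of_real pi * \<i> * (of_int (zorder G 0) + x) * g z)"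
      using C(3) Y(1) small by (meson order_trans)
  qed (use top0 in \<open>auto simp: n_def\<close>)
qed

end


lemma points_into_closure:
  assumes "points_into U z u"
  shows "z \<in> closure U"
proof -
  obtain \<delta> \<eta> where d: "\<delta> > 0" "\<eta> > 0"
      "\<And>s u'. 0 < s \<Longrightarrow> s < \<delta> \<Longrightarrow> norm (u' - u) < \<eta> \<Longrightarrow> z + of_real s * u' \<in> U"
    using assms unfolding points_into_def by metis
  show ?thesis unfolding closure_approachable
  proof (intro allI impI)
    fix e :: real assume e: "e > 0"
    define m where "m = min \<delta> (e / (norm u + 1))"
    define s where "s = m / 2"
    have n: "norm u + 1 > 0" by (simp add: add_nonneg_pos)
    then have p: "e / (norm u + 1) > 0" using e by simp
    then have "m > 0" "m \<le> \<delta>" "m \<le> e / (norm u + 1)" using d(1) by (auto simp: m_def)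
    then have s: "0 < s" "s < \<delta>" "s < e / (norm u + 1)" unfolding s_def by linarith+
    have "norm (of_real s * u) \<le> s * (norm u + 1)" using s(1) by (simp add: norm_mult)
    also have "\<dots> < e" using s(3) n by (simp add: pos_less_divide_eq)
    finally have "dist (z + of_real s * u) z < e" by (simp add: dist_norm)
    moreover have "z + of_real s * u \<in> U" using d(2) by (intro d(3)[OF s(1,2)]) simp
    ultimately show "\<exists>y\<in>U. dist y z < e" by blast
  qed
qed

lemma zcount_same_zeros: "{z\<in>U. f z = 0} = {z\<in>W. f z = 0} \<Longrightarrow> zcount f U = zcount f W"
  unfolding zcount_def by simp

definition upper_strip :: "complex set" where
  "upper_strip = {z\<in>uhp. \<bar>Re z\<bar> < 1/2 \<and> norm z > 1}"

lemma zcount_upper_strip: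
  assumes "\<And>z. \<bar>Re z\<bar> \<le> 1/2 \<Longrightarrow> Im z \<ge> Y \<Longrightarrow> f z \<noteq> 0"
  shows "zcount f upper_strip = zcount f (strip Y)"
proof (rule zcount_same_zeros)
  have "Im z < Y" if "\<bar>Re z\<bar> < 1/2" "f z = 0" for z using assms[of z] that by force
  then show "{z\<in>upper_strip. f z = 0} = {z\<in>strip Y. f z = 0}" by (auto simp: upper_strip_def strip_def uhp_def)
qed

text \<open>To be placed on top of the truncated strip: at that height \<open>g\<close> has no zeros
  and a nearly constant logarithmic derivative, so the box isolates the pencil zero that comes from
  infinite height.\<close>

definition tall_box :: "real \<Rightarrow> real \<Rightarrow> complex set" where
  "tall_box Y1 Y = {z. \<bar>Re z\<bar> < 1/2 \<and> Y1 < Im z \<and> Im z < Y}"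

lemma open_box: "open (tall_box Y1 Y)"
  unfolding tall_box_def by (intro open_Collect_conj open_Collect_less continuous_intros)

lemma closure_box: "z \<in> closure (tall_box Y1 Y) \<Longrightarrow> \<bar>Re z\<bar> \<le> 1/2 \<and> Y1 \<le> Im z \<and> Im z \<le> Y"
proof -
  have "closure (tall_box Y1 Y) \<subseteq> {z. \<bar>Re z\<bar> \<le> 1/2 \<and> Y1 \<le> Im z \<and> Im z \<le> Y}"
    by (rule closure_minimal) (auto simp: tall_box_def intro!: closed_Collect_conj closed_Collect_le continuous_intros)
  then show "z \<in> closure (tall_box Y1 Y) \<Longrightarrow> \<bar>Re z\<bar> \<le> 1/2 \<and> Y1 \<le> Im z \<and> Im z \<le> Y" by auto
qed

lemma bounded_box: "bounded (tall_box Y1 Y)"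
proof (rule bounded_subset[OF bounded_cball])
  show "tall_box Y1 Y \<subseteq> cball 0 (1 + \<bar>Y1\<bar> + \<bar>Y\<bar>)"
  proof
    fix z assume "z \<in> tall_box Y1 Y"
    then show "z \<in> cball 0 (1 + \<bar>Y1\<bar> + \<bar>Y\<bar>)" using cmod_le[of z] by (auto simp: tall_box_def)
  qed
qed

lemma frontier_box:
  assumes "z \<in> frontier (tall_box Y1 Y)"
  shows "\<bar>Re z\<bar> \<le> 1/2" "Y1 \<le> Im z" "Im z \<le> Y" "\<bar>Re z\<bar> = 1/2 \<or> Im z = Y1 \<or> Im z = Y"
proof -
  have *: "z \<in> closure (tall_box Y1 Y)" "z \<notin> tall_box Y1 Y"
    using assms open_box[of Y1 Y] by (auto simp: frontier_def interior_open)
  then show "\<bar>Re z\<bar> \<le> 1/2" "Y1 \<le> Im z" "Im z \<le> Y" using closure_box by blast+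
  then show "\<bar>Re z\<bar> = 1/2 \<or> Im z = Y1 \<or> Im z = Y" using *(2) by (auto simp: tall_box_def)
qed

lemma real_factor_nonzero:
  assumes "c > 0" "\<epsilon> > 0" "Im y = 0" "Re y > 0" "Re z \<noteq> Re w"
  shows "of_real c + of_real \<epsilon> * (z - w) * (2 * of_real pi * \<i> * y) \<noteq> 0"
proof
  assume "of_real c + of_real \<epsilon> * (z - w) * (2 * of_real pi * \<i> * y) = 0"
  then have "Im (of_real c + of_real \<epsilon> * (z - w) * (2 * of_real pi * \<i> * y)) = 0" by simp
  then have "\<epsilon> * (Re z - Re w) * (2 * (pi * Re y)) = 0" using assms(3) by simp
  then show False using assms by auto
qed

lemma large_factor_nonzero:
  assumes "norm (\<epsilon> * (z - w) * (2 * of_real pi * \<i> * y)) \<noteq> c" "c \<ge> 0"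
  shows "of_real c + \<epsilon> * (z - w) * (2 * of_real pi * \<i> * y) \<noteq> 0"
proof
  assume "of_real c + \<epsilon> * (z - w) * (2 * of_real pi * \<i> * y) = 0"
  then have "\<epsilon> * (z - w) * (2 * of_real pi * \<i> * y) = - of_real c" by (simp add: eq_neg_iff_add_eq_0 add.commute)
  then have "norm (\<epsilon> * (z - w) * (2 * of_real pi * \<i> * y)) = norm (- of_real c :: complex)" by (rule arg_cong)
  then show False using assms by simp
qed

section \<open>Zero counts of the pencil\<close>

context real_modular_form
begin

definition pencil :: "complex \<Rightarrow> real \<Rightarrow> complex \<Rightarrow> complex" where
  "pencil w \<epsilon> z = of_int k * g z + of_real \<epsilon> * ((z - w) * deriv g z)"

lemma deriv_g_holomorphic: "deriv g holomorphic_on uhp"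
  by (rule holomorphic_deriv[OF g_holomorphic open_uhp])

lemma pencil_holomorphic: "pencil w \<epsilon> holomorphic_on uhp"
  unfolding pencil_def[abs_def] by (intro holomorphic_intros g_holomorphic deriv_g_holomorphic)

lemma pencil_finite:
  assumes "z0 \<in> uhp" "pencil w \<epsilon> z0 \<noteq> 0"
  shows "finite {z\<in>strip Y. pencil w \<epsilon> z = 0}"
proof -
  have "finite {z\<in>closure (strip Y). pencil w \<epsilon> z = 0}"
  proof (rule finite_zeros_in_compact[OF _ pencil_holomorphic open_uhp closure_strip_uhp])
    show "compact (closure (strip Y))" using bounded_strip by simp
    fix z assume "z \<in> closure (strip Y)"
    then have z: "z \<in> uhp" using closure_strip_uhp by blast
    have "\<forall>\<^sub>F w' in at z. pencil w \<epsilon> w' \<noteq> 0 \<and> w' \<in> uhp"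
      by (rule non_zero_neighbour_alt[OF pencil_holomorphic open_uhp convex_connected[OF convex_uhp] z assms])
    then show "\<forall>\<^sub>F w' in at z. pencil w \<epsilon> w' \<noteq> 0" by (rule eventually_mono) simp
  qed
  then show ?thesis by (rule rev_finite_subset) (use closure_subset in auto)
qed

lemma boundary_zeros_frontier:
  assumes "\<And>z. Im z \<ge> Y \<Longrightarrow> g z \<noteq> 0"
  shows "{z\<in>frontier (strip Y). g z = 0 \<and> z \<in> I} = {z\<in>boundary_zeros. z \<in> I}"
proof (intro set_eqI iffI)
  fix z assume z: "z \<in> {z\<in>frontier (strip Y). g z = 0 \<and> z \<in> I}"
  then have "Im z \<noteq> Y" using assms by force
  then show "z \<in> {z\<in>boundary_zeros. z \<in> I}"
    using z frontier_strip[of z Y] strip_closed_uhp by (auto simp: boundary_zeros_def strip_closed_def)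
next
  fix z assume z: "z \<in> {z\<in>boundary_zeros. z \<in> I}"
  then have z': "\<bar>Re z\<bar> \<le> 1/2" "norm z \<ge> 1" "0 < Im z" "g z = 0" by (auto simp: boundary_zeros_def uhp_def)
  have Y: "Im z < Y" using assms[of z] z'(4) by force
  \<comment> \<open>The direction \<open>Complex (- Re z) 2\<close> points into the strip at every
    boundary point below the ceiling: towards the imaginary axis, and steep enough to leave the unit
    disc.\<close>
  have "Re (cnj z * Complex (- Re z) 2) > 0"
  proof -
    have "sqrt 3 / 2 > 1/2" by (simp add: real_less_rsqrt)
    then have "Im z > 1/2" using unit_norm_strip_uhp(2)[of z] z' by linarith
    moreover have "\<bar>Re z\<bar> * \<bar>Re z\<bar> \<le> 1/2 * (1/2)" using z'(1) by (intro mult_mono) auto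
    ultimately show ?thesis by simp
  qed
  then have "points_into (strip Y) z (Complex (- Re z) 2)" using z' Y by (intro points_into_strip) auto
  then have "z \<in> closure (strip Y)" by (rule points_into_closure)
  moreover have "z \<notin> strip Y" using z by (auto simp: boundary_zeros_def strip_def)
  ultimately show "z \<in> {z\<in>frontier (strip Y). g z = 0 \<and> z \<in> I}"
    using z z' open_strip[of Y] by (auto simp: frontier_def interior_open)
qed

lemma strip_frontier_cases:
  assumes "z \<in> frontier (strip Y)"
  shows "z \<in> uhp" "\<bar>Re z\<bar> \<le> 1/2" "norm z \<ge> 1" "Im z = Y \<or> (\<bar>Re z\<bar> = 1/2 \<or> norm z = 1)"
  using frontier_strip[OF assms] strip_closed_uhp[of Y] by (auto simp: strip_closed_def)

text \<open>The limit theorem with \<open>v = z - w\<close>: boundary zeros depart towards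
  \<open>w\<close>, and \<open>one_sided\<close> ensures that each departure is strictly inwards or
  strictly outwards, never tangential.\<close>

lemma pencil_small:
  assumes w: "one_sided w out" and Y: "\<And>z. Im z \<ge> Y \<Longrightarrow> g z \<noteq> 0" and e0: "0 < e0" "e0 \<le> 1"
    and top: "\<And>\<epsilon> z. 0 < \<epsilon> \<Longrightarrow> \<epsilon> \<le> e0 \<Longrightarrow> \<bar>Re z\<bar> \<le> 1/2 \<Longrightarrow> Im z = Y \<Longrightarrow> pencil w \<epsilon> z \<noteq> 0"
  obtains \<epsilon> where "0 < \<epsilon>" "\<epsilon> \<le> e0"
    "zcount (pencil w \<epsilon>) (strip Y) = zcount g (strip Y) + int (card {z\<in>boundary_zeros. z \<in> entering w out})"
proof -
  have circ: "Re (cnj z * (w - z)) = Re (cnj z * w) - 1" if "norm z = 1" for z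
    using Re_cnj_self[of z] that by (simp add: algebra_simps)
  have ev: "\<forall>\<^sub>F \<epsilon> in at_right 0. zcount (\<lambda>z. of_real (of_int k) * g z + of_real \<epsilon> * ((z - w) * deriv g z)) (strip Y) =
      zcount g (strip Y) + int (card {z\<in>frontier (strip Y). g z = 0 \<and> z \<in> entering w out})"
  proof (rule zcount_pencil_limit[OF open_strip bounded_strip open_uhp closure_strip_uhp g_holomorphic _ _ _ e0(1)])
    show "\<forall>\<^sub>F w in at z. g w \<noteq> 0" if "z \<in> closure (strip Y)" for z
      using zorder_g(2) closure_strip_uhp that by blast
    show "(\<lambda>z. z - w) holomorphic_on uhp" by (intro holomorphic_intros)
    show "real_of_int k > 0" using k_pos by simp
    fix z assume z: "z \<in> frontier (strip Y)"
    note zc = strip_frontier_cases[OF z]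
    show "of_real (of_int k) * g z + of_real \<epsilon> * ((z - w) * deriv g z) \<noteq> 0" if "0 < \<epsilon>" "\<epsilon> \<le> e0" "g z \<noteq> 0" for \<epsilon>
    proof (cases "Im z = Y")
      case True
      then show ?thesis using top[OF that(1,2) zc(2)] by (simp add: pencil_def)
    next
      case False
      then show ?thesis using pencil_boundary_nonzero[OF w that(1) _ zc(1-3) _ that(3)] zc(4) that(2) e0 by simp
    qed
    assume g0: "g z = 0"
    then have Iz: "Im z < Y" "\<bar>Re z\<bar> = 1/2 \<or> norm z = 1" using Y[of z] zc(4) by force+
    show "z - w \<noteq> 0" using boundary_ne[OF w zc(1,3)] Iz zc(2) by auto
    have wz: "- (z - w) = w - z" by simp
    show "points_into (strip Y) z (- (z - w))" if "z \<in> entering w out" unfolding wz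
    proof (rule points_into_strip)
      show "Re (cnj z * (w - z)) > 0" if n: "norm z = 1"
      proof -
        have out using n \<open>z \<in> entering w out\<close> by (simp add: entering_def)
        then show ?thesis using w n zc circ[OF n] by (auto simp: one_sided_def uhp_def)
      qed
    qed (use that zc Iz in \<open>auto simp: entering_def uhp_def\<close>)
    show "points_into (- strip Y) z (- (z - w))" if ne: "z \<notin> entering w out" unfolding wz
    proof (rule points_out_of_strip)
      have "Re (cnj z * (w - z)) < 0" if "norm z = 1" "\<not> out"
      proof -
        have "Re (cnj z * w) \<le> norm (cnj z * w)" by (rule complex_Re_le_cmod)
        also have "\<dots> < 1" using w that by (simp add: norm_mult one_sided_def)
        finally show ?thesis using circ[OF that(1)] by simp
      qed
      then show "Re z = 1/2 \<and> Re (w - z) > 0 \<or> Re z = - (1/2) \<and> Re (w - z) < 0 \<or> norm z = 1 \<and> Re (cnj z * (w - z)) < 0"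
        using ne w unfolding entering_def one_sided_def by auto
    qed
  qed
  have "\<forall>\<^sub>F \<epsilon> in at_right 0. \<epsilon> \<in> {0<..<e0}" using e0(1) by (rule eventually_at_right_real)
  then obtain \<epsilon> where e: "\<epsilon> \<in> {0<..<e0}" "zcount (\<lambda>z. of_real (of_int k) * g z + of_real \<epsilon> * ((z - w) * deriv g z)) (strip Y) =
      zcount g (strip Y) + int (card {z\<in>frontier (strip Y). g z = 0 \<and> z \<in> entering w out})"
    using eventually_happens'[OF trivial_limit_at_right_real eventually_conj[OF _ ev]] by auto
  show ?thesis
    by (rule that[of \<epsilon>]) (use e boundary_zeros_frontier[OF Y, where I = "entering w out"] in \<open>auto simp: pencil_def[abs_def]\<close>)
qed

lemma pencil_scale:
  assumes w: "one_sided w out" and Y: "\<And>z. Im z \<ge> Y \<Longrightarrow> g z \<noteq> 0" and e: "0 < \<epsilon>1" "\<epsilon>1 \<le> 1"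
    and top: "\<And>\<epsilon> z. \<epsilon>1 \<le> \<epsilon> \<Longrightarrow> \<epsilon> \<le> 1 \<Longrightarrow> \<bar>Re z\<bar> \<le> 1/2 \<Longrightarrow> Im z = Y \<Longrightarrow> pencil w \<epsilon> z \<noteq> 0"
  shows "zcount (pencil w \<epsilon>1) (strip Y) = zcount (pencil w 1) (strip Y)"
proof -
  define e where "e t = \<epsilon>1 + t * (1 - \<epsilon>1)" for t
  have et: "\<epsilon>1 \<le> e t" "e t \<le> 1" if "t \<in> {0..1}" for t
    using that e mult_right_mono[of t 1 "1 - \<epsilon>1"] unfolding e_def by auto
  define p q where "p = (\<lambda>(t::real) (z::complex). of_int k :: complex)" and "q = (\<lambda>t z. of_real (e t) * (z - w))"
  have "zcount (\<lambda>z. p 0 z * g z + q 0 z * deriv g z) (strip Y) = zcount (\<lambda>z. p 1 z * g z + q 1 z * deriv g z) (strip Y)"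
  proof (rule zcount_pencil_homotopy[OF open_strip bounded_strip open_uhp closure_strip_uhp g_holomorphic])
    show "\<forall>\<^sub>F w in at z. g w \<noteq> 0" if "z \<in> frontier (strip Y)" for z
      using zorder_g(2) strip_frontier_cases(1)[OF that] by blast
    show "p t holomorphic_on uhp" "q t holomorphic_on uhp" for t
      unfolding p_def q_def by (intro holomorphic_intros)+
    show "continuous_on ({0..1} \<times> closure (strip Y)) (\<lambda>(t, z). p t z)"
      "continuous_on ({0..1} \<times> closure (strip Y)) (\<lambda>(t, z). q t z)"
      unfolding p_def q_def e_def case_prod_beta by (intro continuous_intros)+
    fix t :: real and z assume t: "t \<in> {0..1}" and z: "z \<in> frontier (strip Y)"
    note zc = strip_frontier_cases[OF z]
    have e0: "0 < e t" using et(1)[OF t] e by linarith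
    show "p t z * g z + q t z * deriv g z \<noteq> 0" if "g z \<noteq> 0"
    proof (cases "Im z = Y")
      case True
      then show ?thesis using top[OF et[OF t] zc(2)] by (simp add: pencil_def p_def q_def mult.assoc)
    next
      case False
      then show ?thesis using pencil_boundary_nonzero[OF w e0 et(2)[OF t] zc(1-3) _ that] zc(4) by (simp add: p_def q_def mult.assoc)
    qed
    assume g0: "g z = 0"
    then have "\<bar>Re z\<bar> = 1/2 \<or> norm z = 1" using Y[of z] zc(4) by force
    then show "q t z \<noteq> 0" using boundary_ne[OF w zc(1,3)] zc(2) e0 by (auto simp: q_def)
  qed
  then show ?thesis by (simp add: p_def q_def e_def pencil_def[abs_def] mult.assoc)
qed

text \<open>In the box \<open>deriv g = 2 pi \<i> (n + x) g\<close> with small \<open>x\<close>.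
  Deforming \<open>x\<close> to 0 turns the pencil into \<open>g\<close> times a linear function
  with root \<open>w + \<i> k / (2 pi n \<epsilon>)\<close>. On the bottom side \<open>low\<close>
  lets \<open>k\<close> dominate, on the top side \<open>high\<close> lets the other term dominate.
  On the vertical sides \<open>x\<close> is real by \<open>line_symmetry\<close>, so the factor has
  a nonzero imaginary part.\<close>

lemma pencil_box:
  assumes w: "one_sided w out" and n: "n \<ge> 1" and e: "\<epsilon> > 0"
    and Y1: "Y1 > 0" "\<And>z. Im z \<ge> Y1 \<Longrightarrow> g z \<noteq> 0 \<and> (\<exists>x. norm x \<le> 1/4 \<and> deriv g z = 2 * of_real pi * \<i> * (of_int n + x) * g z)"
    and low: "\<epsilon> * (4 * pi * n * (Y1 + 1 + norm w)) \<le> k" and high: "Y \<ge> norm w + k / \<epsilon> + 1"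
  shows "zcount (pencil w \<epsilon>) (tall_box Y1 Y) = of_bool (\<bar>Re w\<bar> < 1/2)"
proof -
  have kp: "real_of_int k > 0" using k_pos by simp
  have n1: "real_of_int n \<ge> 1" using n by simp
  \<comment> \<open>At time \<open>t\<close> the share \<open>t\<close> of \<open>deriv g\<close> is
    replaced by its main part \<open>2 pi \<i> n g\<close>. Written with coefficients of
    \<open>g\<close> and \<open>deriv g\<close>, this is again a pencil.\<close>
  define p q where "p = (\<lambda>t z. of_int k + of_real \<epsilon> * (z - w) * (of_real t * (2 * of_real pi * \<i> * of_int n)))"
    and "q = (\<lambda>t z. of_real \<epsilon> * (z - w) * of_real (1 - t))"
  have clb: "closure (tall_box Y1 Y) \<subseteq> uhp"
    using closure_box Y1(1) by (force simp: uhp_def)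
  have zn: "norm z \<le> 1/2 + Im z" if "\<bar>Re z\<bar> \<le> 1/2" "Im z > 0" for z using cmod_le[of z] that by simp
  have "zcount (\<lambda>z. p 0 z * g z + q 0 z * deriv g z) (tall_box Y1 Y) = zcount (\<lambda>z. p 1 z * g z + q 1 z * deriv g z) (tall_box Y1 Y)"
  proof (rule zcount_pencil_homotopy[OF open_box bounded_box open_uhp clb g_holomorphic])
    show "p t holomorphic_on uhp" "q t holomorphic_on uhp" for t
      unfolding p_def q_def by (intro holomorphic_intros)+
    show "continuous_on ({0..1} \<times> closure (tall_box Y1 Y)) (\<lambda>(t, z). p t z)"
      "continuous_on ({0..1} \<times> closure (tall_box Y1 Y)) (\<lambda>(t, z). q t z)"
      unfolding p_def q_def case_prod_beta by (intro continuous_intros)+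
    fix z assume z: "z \<in> frontier (tall_box Y1 Y)"
    note zc = frontier_box[OF z]
    obtain x where x: "g z \<noteq> 0" "norm x \<le> 1/4" "deriv g z = 2 * of_real pi * \<i> * (of_int n + x) * g z"
      using Y1(2)[OF zc(2)] by blast
    have zu: "z \<in> uhp" using zc Y1 by (auto simp: uhp_def)
    show "\<forall>\<^sub>F w in at z. g w \<noteq> 0" using zorder_g(2)[OF zu] .
    fix t :: real assume t: "t \<in> {0..1}"
    show "q t z \<noteq> 0" if "g z = 0" using that x by simp
    define y where "y = of_int n + of_real (1 - t) * x"
    have tx: "norm (of_real (1 - t) * x) \<le> 1/4"
      using t x(2) mult_mono[of "1 - t" 1 "norm x" "1/4"] by (simp add: norm_mult del: of_real_diff)
    have y1: "norm y \<le> n + 1/4" "norm y \<ge> n - 1/4" "Re y \<ge> n - 1/4"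
    proof -
      show "norm y \<le> n + 1/4" using norm_triangle_ineq[of "of_int n" "of_real (1 - t) * x"] tx n1 by (simp add: y_def)
      show "Re y \<ge> n - 1/4" using abs_Re_le_cmod[of "of_real (1 - t) * x"] tx unfolding y_def by simp
      then show "norm y \<ge> n - 1/4" using complex_Re_le_cmod[of y] by linarith
    qed
    have fac: "p t z * g z + q t z * deriv g z = g z * (of_real k + of_real \<epsilon> * (z - w) * (2 * of_real pi * \<i> * y))"
      unfolding p_def q_def y_def x(3) by (simp add: algebra_simps)
    have "of_real k + of_real \<epsilon> * (z - w) * (2 * of_real pi * \<i> * y) \<noteq> 0"
    proof (cases "\<bar>Re z\<bar> = 1/2")
      case True
      then have l: "Re z = 1/2 \<or> Re z = - (1/2)" by linarith
      have gr: "Im (g z) = 0" using line_symmetry(1)[OF zu l] by (simp add: complex_is_Real_iff)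
      then have "Re (g z) \<noteq> 0" using x(1) by (simp add: complex_eq_iff)
      moreover have "2 * (pi * Im x) * Re (g z) = 0"
        using line_symmetry(2)[OF zu l] gr unfolding x(3) by simp
      ultimately have "Im y = 0" by (simp add: y_def)
      then show ?thesis using kp e y1 n1 l w by (intro real_factor_nonzero) (auto simp: one_sided_def)
    next
      case False
      then have "Im z = Y1 \<or> Im z = Y" using zc(4) by blast
      moreover have nn: "norm (of_real \<epsilon> * (z - w) * (2 * of_real pi * \<i> * y)) = \<epsilon> * norm (z - w) * (2 * pi * norm y)"
        using e by (simp add: norm_mult)
      \<comment> \<open>As \<open>norm y\<close> is at most \<open>5/4 * n\<close>, the product is
        at most 5/8 of the quantity that \<open>low\<close> bounds by \<open>k\<close>.\<close>
      moreover have "\<epsilon> * norm (z - w) * (2 * pi * norm y) < k" if "Im z = Y1"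
      proof -
        have "norm (z - w) \<le> Y1 + 1 + norm w" using norm_triangle_ineq4[of z w] zn[OF zc(1)] zu that by (simp add: uhp_def)
        moreover have "2 * pi * norm y \<le> 2 * pi * (5/4 * n)" using y1(1) n1 by (intro mult_left_mono) auto
        ultimately have "\<epsilon> * norm (z - w) * (2 * pi * norm y) \<le> \<epsilon> * (Y1 + 1 + norm w) * (2 * pi * (5/4 * n))"
          using e Y1(1) by (intro mult_mono mult_left_mono) auto
        also have "\<dots> = 5/8 * (\<epsilon> * (4 * pi * n * (Y1 + 1 + norm w)))" by (simp add: algebra_simps)
        also have "\<dots> \<le> 5/8 * k" by (rule mult_left_mono[OF low]) simp
        also have "\<dots> < k" using kp by simp
        finally show ?thesis .
      qed
      moreover have "\<epsilon> * norm (z - w) * (2 * pi * norm y) > k" if "Im z = Y"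
      proof -
        have "k / \<epsilon> + 1 \<le> norm (z - w)"
          using abs_Im_le_cmod[of z] norm_triangle_ineq2[of z w] that high by linarith
        then have "\<epsilon> * (k / \<epsilon> + 1) \<le> \<epsilon> * norm (z - w)" using e by simp
        moreover have "\<epsilon> * (k / \<epsilon> + 1) = k + \<epsilon>" using e by (simp add: distrib_left)
        moreover have "1 \<le> 2 * pi * norm y"
          using mult_mono[of 4 "2 * pi" "1/4" "norm y"] y1(2) n1 pi_gt3 by simp
        ultimately have "(k + \<epsilon>) * 1 \<le> \<epsilon> * norm (z - w) * (2 * pi * norm y)"
          using kp e by (intro mult_mono) auto
        then show ?thesis using e by simp
      qed
      ultimately have "norm (of_real \<epsilon> * (z - w) * (2 * of_real pi * \<i> * y)) \<noteq> k" by auto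
      then show ?thesis using kp by (intro large_factor_nonzero) auto
    qed
    then show "p t z * g z + q t z * deriv g z \<noteq> 0" unfolding fac using x(1) by simp
  qed
  moreover have "zcount (\<lambda>z. p 1 z * g z + q 1 z * deriv g z) (tall_box Y1 Y) = of_bool (\<bar>Re w\<bar> < 1/2)"
  proof -
    define c where "c = of_real \<epsilon> * (2 * of_real pi * \<i> * of_int n)"
    define z0 where "z0 = w + \<i> * of_real (k / (2 * pi * n * \<epsilon>))"
    have c0: "c \<noteq> 0" using e n by (simp add: c_def)
    have "c * (\<i> * of_real (k / (2 * pi * n * \<epsilon>))) = - of_int k" using e n by (simp add: c_def field_simps)
    then have lin: "of_int k + c * (z - w) = c * (z - z0)" for z by (simp add: z0_def algebra_simps)
    have bu: "tall_box Y1 Y \<subseteq> uhp" using clb closure_subset by blast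
    have "zcount (\<lambda>z. p 1 z * g z + q 1 z * deriv g z) (tall_box Y1 Y) = zcount (\<lambda>z. c * (z - z0)) (tall_box Y1 Y)"
    proof (rule zcount_mult_nonzero[OF open_uhp g_holomorphic _ bu])
      show "g z \<noteq> 0" if "z \<in> tall_box Y1 Y" for z using Y1(2)[of z] that by (auto simp: tall_box_def)
      show "\<forall>\<^sub>F w in at z. c * (w - z0) \<noteq> 0" for z
        using c0 eventually_neq_at_within[of z0 z UNIV] by simp
      show "p 1 z * g z + q 1 z * deriv g z = g z * (c * (z - z0))" for z
        unfolding lin[symmetric] by (simp add: p_def q_def c_def algebra_simps)
    qed (intro holomorphic_intros)
    also have "\<dots> = of_bool (\<bar>Re w\<bar> < 1/2)"
    proof (cases "\<bar>Re w\<bar> < 1/2")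
      case True
      have r: "k / (2 * pi * n * \<epsilon>) \<ge> 2 * (Y1 + 1 + norm w)"
      proof -
        have "2 * (Y1 + 1 + norm w) * (2 * pi * n * \<epsilon>) = \<epsilon> * (4 * pi * n * (Y1 + 1 + norm w))" by (simp add: algebra_simps)
        then have "2 * (Y1 + 1 + norm w) * (2 * pi * n * \<epsilon>) \<le> k" using low by (simp only:)
        then show ?thesis using e n1 by (simp add: pos_le_divide_eq)
      qed
      have r2: "k / (2 * pi * n * \<epsilon>) \<le> k / \<epsilon>"
        using kp e n1 pi_gt3 mult_mono[of 1 "2 * pi" 1 n] by (intro divide_left_mono) (auto simp: mult_ac)
      have "z0 \<in> tall_box Y1 Y"
      proof -
        have "Re z0 = Re w" "Im z0 = Im w + k / (2 * pi * n * \<epsilon>)" by (simp_all add: z0_def)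
        moreover have "\<bar>Im w\<bar> \<le> norm w" by (rule abs_Im_le_cmod)
        moreover have "Y1 < m + R \<and> m + R < Y"
          if "\<bar>m\<bar> \<le> N" "2 * (Y1 + 1 + N) \<le> R" "R \<le> S" "N + S + 1 \<le> Y" for m N R S :: real
          using that Y1(1) by auto
        ultimately show ?thesis using True r r2 high unfolding tall_box_def mem_Collect_eq by metis
      qed
      then have "zcount (\<lambda>z. c * (z - z0)) (tall_box Y1 Y) = zorder (\<lambda>z. c * (z - z0)) z0"
        by (rule zcount_single) (use c0 in auto)
      also have "\<dots> = 1"
      proof (rule zorder_eq_1)
        have "((\<lambda>z. c * (z - z0)) has_field_derivative c) (at z0)" by (auto intro!: derivative_eq_intros)
        then show "deriv (\<lambda>z. c * (z - z0)) z0 \<noteq> 0" using c0 DERIV_imp_deriv by force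
      qed (auto intro!: analytic_intros)
      finally show ?thesis using True by simp
    next
      case False
      then have "z0 \<notin> tall_box Y1 Y" by (simp add: tall_box_def z0_def)
      then have "zcount (\<lambda>z. c * (z - z0)) (tall_box Y1 Y) = 0" using c0 by (intro zcount_empty) auto
      then show ?thesis using False by simp
    qed
    finally show ?thesis .
  qed
  ultimately show ?thesis by (simp add: p_def q_def pencil_def[abs_def] mult.assoc)
qed

text \<open>If \<open>g\<close> does not vanish at the cusp, one ceiling serves all \<epsilon>.
  Otherwise the extra zero, at height about \<open>k / (2 pi n \<epsilon>)\<close>, would cross a
  fixed ceiling as \<epsilon> grows. So a small \<epsilon> is fixed below the low ceiling
  \<open>Y0\<close>, the box from \<open>Y0\<close> up to a ceiling depending on this \<epsilon> is
  counted separately, and \<epsilon> is raised to 1 below the high ceiling only.\<close>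

lemma pencil_count_one_sided:
  assumes w: "one_sided w out"
  shows "zcount (pencil w 1) upper_strip = zcount g upper_strip + int (card {z\<in>boundary_zeros. z \<in> entering w out})
    + of_bool (zorder G 0 > 0 \<and> \<bar>Re w\<bar> < 1/2)"
proof -
  define n where "n = zorder G 0"
  obtain Y0 where Y0: "Y0 \<ge> 1" "\<And>z. \<bar>Re z\<bar> \<le> 1/2 \<Longrightarrow> Im z \<ge> Y0 \<Longrightarrow> pencil w 1 z \<noteq> 0"
    "\<And>z \<epsilon>. n = 0 \<Longrightarrow> \<bar>Re z\<bar> \<le> 1/2 \<Longrightarrow> Im z \<ge> Y0 \<Longrightarrow> 0 < \<epsilon> \<Longrightarrow> \<epsilon> \<le> 1 \<Longrightarrow> pencil w \<epsilon> z \<noteq> 0"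
    "\<And>z. Im z \<ge> Y0 \<Longrightarrow> g z \<noteq> 0 \<and> (\<exists>x. norm x \<le> 1/4 \<and> deriv g z = 2 * of_real pi * \<i> * (of_int n + x) * g z)"
  proof (rule pencil_top_nonzero[of "norm w"], simp, goal_cases)
    case (1 Y0)
    show ?case by (rule 1(1)[of Y0]) (use 1(2-5) in \<open>auto simp: pencil_def n_def\<close>)
  qed
  have kp: "real_of_int k > 0" using k_pos by simp
  have gY: "g z \<noteq> 0" if "Im z \<ge> Y" "Y \<ge> Y0" for z Y using Y0(4)[of z] that by simp
  have U1: "zcount g upper_strip = zcount g (strip Y0)" by (rule zcount_upper_strip) (use gY in blast)
  have U2: "zcount (pencil w 1) upper_strip = zcount (pencil w 1) (strip Y)" if "Y \<ge> Y0" for Y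
    by (rule zcount_upper_strip) (use Y0(2) that in auto)
  show ?thesis
  proof (cases "n = 0")
    case True
    note T = Y0(3)[OF True]
    obtain \<epsilon> where e: "0 < \<epsilon>" "\<epsilon> \<le> 1"
      "zcount (pencil w \<epsilon>) (strip Y0) = zcount g (strip Y0) + int (card {z\<in>boundary_zeros. z \<in> entering w out})"
      by (rule pencil_small[OF w gY[OF _ order_refl] zero_less_one order_refl]) (use T in auto)
    moreover have "zcount (pencil w \<epsilon>) (strip Y0) = zcount (pencil w 1) (strip Y0)"
      by (rule pencil_scale[OF w gY[OF _ order_refl] e(1,2)]) (use T e in auto)
    ultimately show ?thesis using U1 U2[OF order_refl] True by (simp add: n_def)
  next
    case False
    then have n: "n \<ge> 1" using zorder_G_nonneg[of 0] by (simp add: n_def)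
    then have n1: "real_of_int n \<ge> 1" by simp
    define d where "d = 4 * pi * n * (Y0 + 1 + norm w)"
    have d: "d > 0" using n1 Y0(1) unfolding d_def by (intro mult_pos_pos) (auto intro: add_pos_nonneg)
    define e0 where "e0 = min 1 (k / d)"
    have e0: "0 < e0" "e0 \<le> 1" using d kp by (auto simp: e0_def)
    have ed: "\<epsilon> * d \<le> k" if "\<epsilon> \<le> e0" for \<epsilon>
    proof -
      have "\<epsilon> \<le> k / d" using that by (simp add: e0_def)
      then show ?thesis using d by (simp add: pos_le_divide_eq)
    qed
    have fac: "pencil w \<epsilon> z = g z * (of_real k + of_real \<epsilon> * (z - w) * (2 * of_real pi * \<i> * (of_int n + x)))"
      if "deriv g z = 2 * of_real pi * \<i> * (of_int n + x) * g z" for \<epsilon> z x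
      unfolding pencil_def that by (simp add: algebra_simps)
    have low_top: "pencil w \<epsilon> z \<noteq> 0" if e: "0 < \<epsilon>" "\<epsilon> \<le> e0" and z: "\<bar>Re z\<bar> \<le> 1/2" "Im z = Y0" for \<epsilon> z
    proof -
      obtain x where x: "g z \<noteq> 0" "norm x \<le> 1/4" "deriv g z = 2 * of_real pi * \<i> * (of_int n + x) * g z"
        using Y0(4)[of z] z by auto
      have y: "norm (of_int n + x) \<le> 5/4 * n" using norm_triangle_ineq[of "of_int n" x] x(2) n1 by simp
      have "norm (z - w) \<le> Y0 + 1 + norm w" using norm_triangle_ineq4[of z w] cmod_le[of z] z Y0(1) by simp
      moreover have "2 * pi * norm (of_int n + x) \<le> 2 * pi * (5/4 * n)" using y by (intro mult_left_mono) auto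
      ultimately have "\<epsilon> * norm (z - w) * (2 * pi * norm (of_int n + x)) \<le> \<epsilon> * (Y0 + 1 + norm w) * (2 * pi * (5/4 * n))"
        using e Y0(1) by (intro mult_mono mult_left_mono) auto
      also have "\<dots> = 5/8 * (\<epsilon> * d)" by (simp add: algebra_simps d_def)
      also have "\<dots> < k" using ed[OF e(2)] kp by simp
      finally have "norm (of_real \<epsilon> * (z - w) * (2 * of_real pi * \<i> * (of_int n + x))) < k"
        using e by (simp add: norm_mult)
      then have "of_real k + of_real \<epsilon> * (z - w) * (2 * of_real pi * \<i> * (of_int n + x)) \<noteq> 0"
        using kp by (intro large_factor_nonzero) auto
      then show ?thesis unfolding fac[OF x(3)] using x(1) by simp
    qed
    obtain \<epsilon> where e: "0 < \<epsilon>" "\<epsilon> \<le> e0"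
      "zcount (pencil w \<epsilon>) (strip Y0) = zcount g (strip Y0) + int (card {z\<in>boundary_zeros. z \<in> entering w out})"
      by (rule pencil_small[OF w gY[OF _ order_refl] e0 low_top])
    define Y where "Y = norm w + k / \<epsilon> + 1 + Y0"
    have Y: "Y > Y0" using kp e by (simp add: Y_def add_nonneg_pos)
    have high_top: "pencil w \<epsilon>' z \<noteq> 0" if e': "\<epsilon> \<le> \<epsilon>'" "\<epsilon>' \<le> 1" and z: "\<bar>Re z\<bar> \<le> 1/2" "Im z = Y" for \<epsilon>' z
    proof -
      obtain x where x: "g z \<noteq> 0" "norm x \<le> 1/4" "deriv g z = 2 * of_real pi * \<i> * (of_int n + x) * g z"
        using Y0(4)[of z] z Y by auto
      have "Re (of_int n + x) \<ge> 3/4" using abs_Re_le_cmod[of x] x(2) n1 by simp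
      then have y: "norm (of_int n + x) \<ge> 3/4" using complex_Re_le_cmod[of "of_int n + x"] by linarith
      have "k / \<epsilon> + 1 \<le> norm (z - w)"
        using abs_Im_le_cmod[of z] norm_triangle_ineq2[of z w] z Y0(1) unfolding Y_def by linarith
      then have "\<epsilon> * (k / \<epsilon> + 1) \<le> \<epsilon>' * norm (z - w)" using e e' kp by (intro mult_mono) auto
      moreover have "\<epsilon> * (k / \<epsilon> + 1) = k + \<epsilon>" using e by (simp add: distrib_left)
      moreover have "1 \<le> 2 * pi * norm (of_int n + x)"
        using mult_mono[of 4 "2 * pi" "1/4" "norm (of_int n + x)"] y pi_gt3 by simp
      ultimately have "(k + \<epsilon>) * 1 \<le> \<epsilon>' * norm (z - w) * (2 * pi * norm (of_int n + x))"
        using kp e e' by (intro mult_mono) auto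
      then have "norm (of_real \<epsilon>' * (z - w) * (2 * of_real pi * \<i> * (of_int n + x))) > k"
        using e e' by (simp add: norm_mult)
      then have "of_real k + of_real \<epsilon>' * (z - w) * (2 * of_real pi * \<i> * (of_int n + x)) \<noteq> 0"
        using kp by (intro large_factor_nonzero) auto
      then show ?thesis unfolding fac[OF x(3)] using x(1) by simp
    qed
    have pt: "Complex 0 Y0 \<in> uhp" "pencil w \<epsilon> (Complex 0 Y0) \<noteq> 0"
      using Y0(1) low_top[OF e(1,2), of "Complex 0 Y0"] by (auto simp: uhp_def)
    have sub: "strip Y0 \<subseteq> strip Y" using Y by (auto simp: strip_def)
    have un: "{z\<in>strip Y. pencil w \<epsilon> z = 0} = {z\<in>strip Y0 \<union> tall_box Y0 Y. pencil w \<epsilon> z = 0}"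
    proof (intro set_eqI iffI)
      fix z assume z: "z \<in> {z\<in>strip Y. pencil w \<epsilon> z = 0}"
      then have "Im z \<noteq> Y0" using low_top[OF e(1,2), of z] by (auto simp: strip_def)
      then show "z \<in> {z\<in>strip Y0 \<union> tall_box Y0 Y. pencil w \<epsilon> z = 0}" using z by (auto simp: strip_def tall_box_def)
    next
      fix z assume z: "z \<in> {z\<in>strip Y0 \<union> tall_box Y0 Y. pencil w \<epsilon> z = 0}"
      moreover have "norm z > 1" if "z \<in> tall_box Y0 Y"
        using that abs_Im_le_cmod[of z] Y0(1) by (auto simp: tall_box_def)
      ultimately show "z \<in> {z\<in>strip Y. pencil w \<epsilon> z = 0}" using sub Y0(1) by (auto simp: strip_def tall_box_def)
    qed
    have fin: "finite {z\<in>strip Y. pencil w \<epsilon> z = 0}" by (rule pencil_finite[OF pt])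
    have "zcount (pencil w \<epsilon>) (strip Y) = zcount (pencil w \<epsilon>) (strip Y0 \<union> tall_box Y0 Y)"
      by (rule zcount_same_zeros[OF un])
    also have "\<dots> = zcount (pencil w \<epsilon>) (strip Y0) + zcount (pencil w \<epsilon>) (tall_box Y0 Y)"
      by (rule zcount_Un; (rule finite_subset[OF _ fin[unfolded un]])?) (auto simp: strip_def tall_box_def)
    also have "zcount (pencil w \<epsilon>) (tall_box Y0 Y) = of_bool (\<bar>Re w\<bar> < 1/2)"
      using ed[OF e(2)] Y0(1,4) unfolding d_def by (intro pencil_box[OF w n e(1)]) (auto simp: Y_def)
    finally have "zcount (pencil w \<epsilon>) (strip Y) = zcount g upper_strip + int (card {z\<in>boundary_zeros. z \<in> entering w out})
      + of_bool (\<bar>Re w\<bar> < 1/2)" using e(3) U1 by simp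
    moreover have "zcount (pencil w \<epsilon>) (strip Y) = zcount (pencil w 1) (strip Y)"
      by (rule pencil_scale[OF w _ e(1) _ high_top]) (use e e0 Y gY[where Y = Y] in auto)
    ultimately show ?thesis using U2[of Y] Y n by (simp add: n_def)
  qed
qed

lemma pencil_count_shift:
  fixes l M :: real
  assumes "\<bar>l\<bar> > 1"
  shows "zcount (pencil (of_real l) 1) upper_strip = zcount (pencil (Complex l M) 1) upper_strip"
proof -
  obtain Y where Y: "Y \<ge> 1" "\<And>w z. norm w \<le> \<bar>l\<bar> + \<bar>M\<bar> \<Longrightarrow> \<bar>Re z\<bar> \<le> 1/2 \<Longrightarrow> Im z \<ge> Y \<Longrightarrow> g z \<noteq> 0 \<and> pencil w 1 z \<noteq> 0"
  proof (rule pencil_top_nonzero[of "\<bar>l\<bar> + \<bar>M\<bar>"], simp, goal_cases)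
    case (1 Y0)
    show ?case by (rule 1(1)[of Y0]) (use 1(2,3) in \<open>auto simp: pencil_def\<close>)
  qed
  define w where "w t = of_real l + \<i> * of_real (t * M)" for t
  have w01: "of_real l = w 0" "Complex l M = w 1" by (simp_all add: w_def complex_eq_iff)
  have wM: "norm (w t) \<le> \<bar>l\<bar> + \<bar>M\<bar>" if "t \<in> {0..1}" for t
    using cmod_le[of "w t"] that mult_right_mono[of t 1 "\<bar>M\<bar>"] by (simp add: w_def abs_mult)
  have w1: "norm (w t) > 1" for t using abs_Re_le_cmod[of "w t"] assms by (simp add: w_def)
  define p q where "p = (\<lambda>(t::real) (z::complex). of_int k :: complex)" and "q = (\<lambda>t z. z - w t)"
  have k0: "k \<noteq> 0" using k_pos by simp
  have "zcount (\<lambda>z. p 0 z * g z + q 0 z * deriv g z) (strip Y) = zcount (\<lambda>z. p 1 z * g z + q 1 z * deriv g z) (strip Y)"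
  proof (rule zcount_pencil_homotopy[OF open_strip bounded_strip open_uhp closure_strip_uhp g_holomorphic])
    show "\<forall>\<^sub>F w in at z. g w \<noteq> 0" if "z \<in> frontier (strip Y)" for z
      using zorder_g(2) strip_frontier_cases(1)[OF that] by blast
    show "p t holomorphic_on uhp" "q t holomorphic_on uhp" for t
      unfolding p_def q_def by (intro holomorphic_intros)+
    show "continuous_on ({0..1} \<times> closure (strip Y)) (\<lambda>(t, z). p t z)"
      unfolding p_def case_prod_beta by (intro continuous_intros)
    show "continuous_on ({0..1} \<times> closure (strip Y)) (\<lambda>(t, z). q t z)"
      unfolding q_def w_def case_prod_beta by (intro continuous_intros)
    fix t :: real and z assume t: "t \<in> {0..1}" and z: "z \<in> frontier (strip Y)"
    note zc = strip_frontier_cases[OF z]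
    show "p t z * g z + q t z * deriv g z \<noteq> 0" if g0: "g z \<noteq> 0"
    proof -
      consider "Im z = Y" | "\<bar>Re z\<bar> = 1/2" | "norm z = 1" using zc(4) by blast
      then show ?thesis
      proof cases
        case 1
        then show ?thesis using Y(2)[OF wM[OF t] zc(2)] by (simp add: pencil_def p_def q_def)
      next
        case 2
        then have l: "Re z = 1/2 \<or> Re z = - (1/2)" by linarith
        have "Re (z - w t) \<noteq> 0" using l assms by (auto simp: w_def)
        from line_pencil_nonzero[OF zc(1) l g0 this k0] show ?thesis by (simp add: p_def q_def)
      next
        case 3
        show ?thesis
        proof
          assume "p t z * g z + q t z * deriv g z = 0"
          then have "norm (z - (z - w t)) = 1"
            by (intro circle_pencil_zero[OF zc(1) 3 g0 _ k0]) (simp add: p_def q_def)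
          then show False using w1[of t] by simp
        qed
      qed
    qed
    assume g0: "g z = 0"
    then have "\<bar>Re z\<bar> = 1/2 \<or> norm z = 1" using Y(2)[OF wM[OF t] zc(2)] zc(4) by force
    then show "q t z \<noteq> 0" using w1[of t] assms by (auto simp: q_def w_def)
  qed
  then have "zcount (pencil (of_real l) 1) (strip Y) = zcount (pencil (Complex l M) 1) (strip Y)"
    unfolding w01 by (simp add: p_def q_def pencil_def[abs_def])
  moreover have "zcount (pencil (w t) 1) upper_strip = zcount (pencil (w t) 1) (strip Y)" if "t \<in> {0..1}" for t
    by (rule zcount_upper_strip) (use Y(2)[OF wM[OF that]] in blast)
  from this[of 0] this[of 1] have "zcount (pencil (of_real l) 1) upper_strip = zcount (pencil (of_real l) 1) (strip Y)"
    "zcount (pencil (Complex l M) 1) upper_strip = zcount (pencil (Complex l M) 1) (strip Y)"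
    unfolding w01 by simp_all
  ultimately show ?thesis by simp
qed

theorem pencil_count:
  fixes l :: real
  assumes "\<bar>l\<bar> \<noteq> 1/2" "\<bar>l\<bar> \<noteq> 1"
  shows "zcount (pencil (of_real l) 1) upper_strip = zcount g upper_strip
    + int (card {z\<in>boundary_zeros. z \<in> entering (of_real l) (\<bar>l\<bar> > 1)}) + of_bool (zorder G 0 > 0 \<and> \<bar>l\<bar> < 1/2)"
proof (cases "\<bar>l\<bar> > 1")
  case False
  have "one_sided (of_real l) False" using assms False by (auto simp: one_sided_def)
  from pencil_count_one_sided[OF this] False show ?thesis by simp
next
  case True
  \<comment> \<open>On the arc \<open>Im z > 4/5\<close>, so \<open>Re (cnj z * w)\<close> is at
    least \<open>4/5 (\<bar>l\<bar> + 2) - \<bar>l\<bar> / 2\<close>, which exceeds 1.\<close>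
  define w where "w = Complex l (\<bar>l\<bar> + 2)"
  have "one_sided w True"
  proof -
    have "Re (cnj z * w) > 1" if "norm z = 1" "\<bar>Re z\<bar> \<le> 1/2" "Im z > 0" for z
    proof -
      have "sqrt 3 > 8/5" by (rule real_less_rsqrt) (simp add: power2_eq_square)
      then have "Im z > 4/5" using unit_norm_strip_uhp(2)[of z] that by simp
      then have "Im z * (\<bar>l\<bar> + 2) \<ge> 4/5 * (\<bar>l\<bar> + 2)" by (intro mult_right_mono) auto
      moreover have "\<bar>Re z * l\<bar> \<le> 1/2 * \<bar>l\<bar>" unfolding abs_mult using that by (intro mult_right_mono) auto
      ultimately show ?thesis by (simp add: w_def)
    qed
    then show ?thesis using assms True by (auto simp: one_sided_def w_def)
  qed
  from pencil_count_one_sided[OF this] pencil_count_shift[OF True, of "\<bar>l\<bar> + 2"] True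
  show ?thesis by (simp add: w_def entering_def)
qed

end


section \<open>The cusp at infinity and the total counts\<close>

lemma points_into_vimage:
  assumes d: "(\<psi> has_field_derivative d) (at q)" and A: "points_into A (\<psi> q) (d * u)"
  shows "points_into {x. \<psi> x \<in> A} q u"
proof -
  obtain \<delta> \<eta> where a: "\<delta> > 0" "\<eta> > 0"
      "\<And>s u'. 0 < s \<Longrightarrow> s < \<delta> \<Longrightarrow> norm (u' - d * u) < \<eta> \<Longrightarrow> \<psi> q + of_real s * u' \<in> A"
    using A unfolding points_into_def by metis
  have nu: "norm u + 1 > 0" "norm d + 1 > 0" by (simp_all add: add_nonneg_pos)
  define e where "e = \<eta> / (2 * (norm u + 1))"
  have e: "e > 0" using a(2) nu by (simp add: e_def)
  have "(\<psi> has_derivative (*) d) (at q)" using d by (simp add: has_field_derivative_def)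
  then obtain r where r: "r > 0" "\<And>x. norm (x - q) < r \<Longrightarrow> norm (\<psi> x - \<psi> q - d * (x - q)) \<le> e * norm (x - q)"
    unfolding has_derivative_at_alt using e by blast
  show ?thesis
  proof (rule points_intoI[of "min \<delta> (r / (norm u + 1))" "min 1 (\<eta> / (2 * (norm d + 1)))"])
    fix s :: real and u' :: complex
    assume s: "0 < s" "s < min \<delta> (r / (norm u + 1))" and u': "norm (u' - u) < min 1 (\<eta> / (2 * (norm d + 1)))"
    have u1: "norm u' \<le> norm u + 1" using norm_triangle_sub[of u' u] u' by simp
    have "s * norm u' \<le> s * (norm u + 1)" using u1 s(1) by simp
    also have "\<dots> < r" using s(2) nu(1) by (simp add: pos_less_divide_eq)
    finally have "norm (q + of_real s * u' - q) < r" using s(1) by (simp add: norm_mult)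
    from r(2)[OF this] have 1: "norm (\<psi> (q + of_real s * u') - \<psi> q - d * (of_real s * u')) \<le> e * (s * norm u')"
      using s(1) by (simp add: norm_mult)
    define y where "y = (\<psi> (q + of_real s * u') - \<psi> q) / of_real s"
    have y: "\<psi> (q + of_real s * u') = \<psi> q + of_real s * y" using s(1) by (simp add: y_def)
    have "s * norm (y - d * u') = norm (of_real s * (y - d * u'))" using s(1) by (simp add: norm_mult)
    also have "\<dots> \<le> e * (s * norm u')" using 1 unfolding y by (simp add: algebra_simps)
    finally have "s * norm (y - d * u') \<le> s * (e * norm u')" by (simp add: mult_ac)
    then have "norm (y - d * u') \<le> e * norm u'" using s(1) by simp
    also have "\<dots> \<le> e * (norm u + 1)" using u1 e by simp
    also have "\<dots> = \<eta> / 2"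
    proof -
      have "\<eta> / (2 * N) * N = \<eta> / 2" if "N > 0" for N using that by simp
      then show ?thesis using nu(1) unfolding e_def by blast
    qed
    finally have 2: "norm (y - d * u') \<le> \<eta> / 2" .
    have "norm (d * (u' - u)) \<le> (norm d + 1) * norm (u' - u)" unfolding norm_mult by (intro mult_right_mono) auto
    also have "\<dots> < \<eta> / 2"
    proof -
      have "norm (u' - u) < \<eta> / (2 * (norm d + 1))" using u' by linarith
      then have "norm (u' - u) * (2 * (norm d + 1)) < \<eta>" using nu(2) by (subst (asm) pos_less_divide_eq) auto
      then show ?thesis by (simp add: algebra_simps)
    qed
    finally have "norm (y - d * u) < \<eta>"
      using 2 norm_triangle_ineq[of "y - d * u'" "d * (u' - u)"] by (simp add: algebra_simps)
    then show "q + of_real s * u' \<in> {x. \<psi> x \<in> A}" using a(3)[of s y] s y by simp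
  qed (use a r nu in auto)
qed

text \<open>All integers have to be avoided at once. If the real part of \<open>x = z - n\<close> is
  at most 2 in absolute value, the steepness of the cone gives \<open>Re (cnj x * w) > 0\<close>, so
  the norm grows. Otherwise \<open>norm x > 2\<close>, and adding \<open>w\<close> with
  \<open>norm w < 1\<close> is harmless.\<close>

lemma cone_tiles:
  assumes z: "z \<in> uhp" "\<bar>Re z\<bar> \<le> 1/2" "norm z \<ge> 1" and w: "4 * \<bar>Re w\<bar> < Im w" "norm w < 1"
  shows "z + w \<in> tiles"
  unfolding tiles_def
proof (intro CollectI conjI allI)
  have "sqrt 3 > 1" "Im z \<ge> sqrt 3 / 2" using unit_norm_strip_uhp(2)[OF z(2,3)] z(1) by (auto simp: uhp_def)
  then have Iz: "Im z > 1/2" by linarith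
  show "z + w \<in> uhp" using Iz w by (simp add: uhp_def)
  fix n :: int
  define x where "x = z - of_int n"
  have x1: "norm x \<ge> 1" using norm_sub_int_ge[OF z(2), of n] z(3) by (simp add: x_def)
  have "norm (x + w) > 1"
  proof (cases "\<bar>Re x\<bar> \<le> 2")
    case True
    have "\<bar>Re x * Re w\<bar> \<le> 2 * \<bar>Re w\<bar>" unfolding abs_mult using True by (intro mult_right_mono) auto
    moreover have "1/2 * Im w < Im x * Im w" using Iz w(1) by (intro mult_strict_right_mono) (auto simp: x_def)
    ultimately have "Re (cnj x * w) > 0" using w(1) by simp
    moreover have "(norm x)\<^sup>2 \<ge> 1" using x1 by simp
    ultimately have "(norm (x + w))\<^sup>2 > 1" unfolding norm_add_sq using zero_le_power2[of "norm w"] by linarith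
    then show ?thesis using power_less_imp_less_base[of 1 2 "norm (x + w)"] by simp
  next
    case False
    then have "norm x > 2" using abs_Re_le_cmod[of x] by linarith
    then show ?thesis using norm_diff_ineq[of x w] w(2) by linarith
  qed
  then show "norm (z + w - of_int n) > 1" by (simp add: x_def algebra_simps)
qed

text \<open>Moving the nome radially towards 0 means moving \<open>z\<close> straight up: under the
  local inverse \<psi> of the nome the velocity \<open>- nome z\<close> becomes
  \<open>\<i> / (2 pi)\<close>.\<close>

lemma points_into_disc_domain:
  assumes z: "z \<in> arc"
  shows "points_into disc_domain (nome z) (- nome z)"
proof -
  have zu: "z \<in> uhp" "norm z = 1" using z by (auto simp: arc_def)
  define \<psi> where "\<psi> q = z + Ln (q / nome z) / (2 * of_real pi * \<i>)" for q
  have p0: "2 * of_real pi * \<i> \<noteq> 0" by simp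
  have d: "(\<psi> has_field_derivative 1 / (2 * of_real pi * \<i> * nome z)) (at (nome z))"
  proof -
    have *: "(Ln has_field_derivative inverse (nome z / nome z)) (at (nome z / nome z))"
      by (rule has_field_derivative_Ln) simp
    have "((\<lambda>q. q / nome z) has_field_derivative 1 / nome z) (at (nome z))"
      by (rule DERIV_cdivide[OF DERIV_ident])
    from DERIV_add[OF DERIV_const[of z] DERIV_cdivide[OF DERIV_chain2[OF * this], of "2 * of_real pi * \<i>"]]
    show ?thesis unfolding \<psi>_def by (simp add: mult_ac)
  qed
  have nome\<psi>: "nome (\<psi> q) = q" if "q \<noteq> 0" for q
  proof -
    have "2 * of_real pi * \<i> * \<psi> q = 2 * of_real pi * \<i> * z + Ln (q / nome z)"
      unfolding \<psi>_def by (simp add: distrib_left)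
    then have "nome (\<psi> q) = nome z * exp (Ln (q / nome z))"
      unfolding nome_def by (simp only: exp_add)
    then show ?thesis using that by simp
  qed
  have "points_into tiles z (\<i> / of_real (2 * pi))"
  proof (rule points_intoI[of 1 "1 / (12 * pi)"])
    fix s :: real and u' assume s: "0 < s" "s < 1" and u': "norm (u' - \<i> / of_real (2 * pi)) < 1 / (12 * pi)"
    \<comment> \<open>In this unit the upward speed \<open>1 / (2 pi)\<close> is
      \<open>6 * R\<close>. A perturbation smaller than \<open>R\<close> leaves an imaginary part
      above \<open>5 * R\<close> and a real part below \<open>R\<close>, well inside the cone of
      \<open>cone_tiles\<close>.\<close>
    define R where "R = 1 / (12 * pi)"
    have R: "R > 0" "R < 1/36" using pi_gt3 by (auto simp: R_def divide_simps)
    define y where "y = u' - \<i> / of_real (2 * pi)"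
    have six: "1 / (2 * pi) = 6 * R" by (simp add: R_def)
    have u: "u' = y + \<i> * of_real (6 * R)" by (simp add: y_def six[symmetric])
    have y: "norm y < R" using u' by (simp add: y_def R_def)
    have *: "\<bar>Re u'\<bar> < R" "Im u' > 5 * R"
      using abs_Re_le_cmod[of y] abs_Im_le_cmod[of y] y unfolding u by simp_all
    show "z + of_real s * u' \<in> tiles"
    proof (rule cone_tiles[OF zu(1)])
      have "4 * \<bar>Re u'\<bar> < Im u'" using * by linarith
      then have "s * (4 * \<bar>Re u'\<bar>) < s * Im u'" using s by simp
      then show "4 * \<bar>Re (of_real s * u')\<bar> < Im (of_real s * u')" using s by (simp add: abs_mult mult_ac)
      have "norm u' \<le> norm y + norm (\<i> * of_real (6 * R))" unfolding u by (rule norm_triangle_ineq)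
      also have "\<dots> = norm y + 6 * R" using R by (simp only: norm_mult norm_ii norm_of_real)
      finally have "norm u' < 1" using y R by linarith
      then have "s * norm u' < 1 * 1" using s by (intro mult_strict_mono') auto
      then show "norm (of_real s * u') < 1" using s by (simp add: norm_mult)
    qed (use z arc_strip zu in auto)
  qed (simp_all)
  moreover have "1 / (2 * of_real pi * \<i> * nome z) * - nome z = \<i> / of_real (2 * pi)"
    by (simp add: field_simps)
  moreover have "\<psi> (nome z) = z" by (simp add: \<psi>_def)
  ultimately have "points_into {q. \<psi> q \<in> tiles} (nome z) (- nome z)" using points_into_vimage[OF d] by simp
  then show ?thesis
  proof (rule points_into_mono)
    show "{q. \<psi> q \<in> tiles} \<subseteq> disc_domain"
      using nome\<psi> nome_mem_disc_domain by (metis (mono_tags) disc_domain_def insertI1 mem_Collect_eq subsetI)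
  qed
qed

text \<open>For the boundary curves, on which the pencil or the derivative vanishes only at zeros of
  \<open>g\<close>, each time with order one less.\<close>

lemma sum_shifted_orders:
  fixes wt :: "complex \<Rightarrow> real"
  assumes "finite {z\<in>W. g z = 0}" "\<And>z. z \<in> W \<Longrightarrow> g z \<noteq> 0 \<Longrightarrow> Q z \<noteq> 0"
    "\<And>z. z \<in> W \<Longrightarrow> g z = 0 \<Longrightarrow> zorder Q z = zorder g z - 1" "\<And>z. z \<in> W \<Longrightarrow> Q analytic_on {z}"
  shows "(\<Sum>z\<in>{z\<in>W. Q z = 0}. wt z * of_int (zorder Q z)) =
    (\<Sum>z\<in>{z\<in>W. g z = 0}. wt z * of_int (zorder g z)) - (\<Sum>z\<in>{z\<in>W. g z = 0}. wt z)"
proof -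
  have "(\<Sum>z\<in>{z\<in>W. Q z = 0}. wt z * of_int (zorder Q z)) = (\<Sum>z\<in>{z\<in>W. g z = 0}. wt z * of_int (zorder Q z))"
    by (rule sum.mono_neutral_left[OF assms(1)]) (use assms(2,4) zorder_eq_0I in auto)
  also have "\<dots> = (\<Sum>z\<in>{z\<in>W. g z = 0}. wt z * of_int (zorder g z) - wt z)"
  proof (rule sum.cong[OF refl])
    fix z assume "z \<in> {z\<in>W. g z = 0}"
    then have "zorder Q z = zorder g z - 1" using assms(3) by blast
    then show "wt z * of_int (zorder Q z) = wt z * of_int (zorder g z) - wt z" by (simp add: right_diff_distrib)
  qed
  finally show ?thesis by (simp add: sum_subtractf)
qed

definition line_left :: "complex set" where
  "line_left = {z\<in>uhp. Re z = - (1/2) \<and> norm z > 1}"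

lemma disc_domain_strip: "disc_domain = insert 0 (nome ` (upper_strip \<union> line_left))"
proof
  show "disc_domain \<subseteq> insert 0 (nome ` (upper_strip \<union> line_left))"
  proof
    fix q assume q: "q \<in> disc_domain"
    show "q \<in> insert 0 (nome ` (upper_strip \<union> line_left))"
    proof (cases "q = 0")
      case False
      then obtain z where z: "z \<in> tiles" "q = nome z" using q by (auto simp: disc_domain_def)
      define n where "n = \<lfloor>Re z + 1/2\<rfloor>"
      define w where "w = z + of_int (- n)"
      have w: "- (1/2) \<le> Re w" "Re w < 1/2" unfolding w_def n_def by (simp; linarith)+
      have "w \<in> tiles" unfolding w_def tiles_add_int by (rule z)
      then have "w \<in> uhp \<and> norm w > 1" using w tiles_strip[of w] by (simp add: abs_le_iff)
      then have "w \<in> upper_strip \<union> line_left" using w by (auto simp: upper_strip_def line_left_def)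
      moreover have "q = nome w" by (simp only: z(2) w_def nome_add_of_int)
      ultimately show ?thesis by blast
    qed simp
  qed
  show "insert 0 (nome ` (upper_strip \<union> line_left)) \<subseteq> disc_domain"
  proof -
    have "z \<in> tiles" if "z \<in> upper_strip \<union> line_left" for z
      using that tiles_strip[of z] by (auto simp: upper_strip_def line_left_def)
    then show ?thesis by (auto simp: disc_domain_def)
  qed
qed

lemma zcount_disc_domain:
  assumes H: "H holomorphic_on ball 0 1" "\<And>q. norm q < 1 \<Longrightarrow> \<forall>\<^sub>F w in at q. H w \<noteq> 0"
  shows "zcount H disc_domain = zorder H 0 + zcount (\<lambda>z. H (nome z)) upper_strip + zcount (\<lambda>z. H (nome z)) line_left"
    "finite {z\<in>upper_strip. H (nome z) = 0}" "finite {z\<in>line_left. H (nome z) = 0}"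
proof -
  let ?W = "upper_strip \<union> line_left"
  have Wu: "?W \<subseteq> uhp" by (auto simp: upper_strip_def line_left_def)
  have inj: "inj_on nome ?W"
  proof (rule inj_onI)
    fix z w assume *: "z \<in> ?W" "w \<in> ?W" "nome z = nome w"
    then obtain n :: int where n: "z = w + of_int n" unfolding nome_eq_iff by blast
    have "- (1/2) \<le> Re z" "Re z < 1/2" "- (1/2) \<le> Re w" "Re w < 1/2"
      using *(1,2) by (auto simp: upper_strip_def line_left_def)
    then have "\<bar>of_int n :: real\<bar> < 1" using n by auto
    then have "n = 0" by simp
    then show "z = w" using n by simp
  qed
  have "finite {q\<in>closure disc_domain. H q = 0}"
    by (rule finite_zeros_in_compact[OF _ H(1) open_ball closure_disc_domain_ball])
      (use bounded_disc_domain closure_disc_domain_ball H(2) in auto)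
  then have fin: "finite {q\<in>disc_domain. H q = 0}" by (rule rev_finite_subset) (use closure_subset in auto)
  have finW: "finite {q\<in>nome ` ?W. H q = 0}" by (rule finite_subset[OF _ fin]) (auto simp: disc_domain_strip)
  moreover have "nome ` {z\<in>?W. H (nome z) = 0} = {q\<in>nome ` ?W. H q = 0}" by auto
  ultimately have "finite (nome ` {z\<in>?W. H (nome z) = 0})" by simp
  then have "finite {z\<in>?W. H (nome z) = 0}"
    by (rule finite_imageD) (rule inj_on_subset[OF inj], auto)
  then show f: "finite {z\<in>upper_strip. H (nome z) = 0}" "finite {z\<in>line_left. H (nome z) = 0}"
    by (auto elim!: rev_finite_subset)
  have "zcount H disc_domain = zcount H ({0} \<union> nome ` ?W)" by (simp add: disc_domain_strip)
  also have "\<dots> = zcount H {0} + zcount H (nome ` ?W)"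
    using finW by (intro zcount_Un) auto
  also have "zcount H {0} = zorder H 0"
  proof (cases "H 0 = 0")
    case False
    have "H analytic_on {0}" using H(1) analytic_at[of H 0] by (auto intro: exI[of _ "ball 0 1"])
    then have "zorder H 0 = 0" using False by (rule zorder_eq_0I)
    moreover have "zcount H {0} = 0" using False by (intro zcount_empty) auto
    ultimately show ?thesis by simp
  qed (auto intro: zcount_single)
  also have "zcount H (nome ` ?W) = zcount (\<lambda>z. H (nome z)) ?W"
  proof (rule zcount_image[OF _ open_uhp Wu inj _ H(1) open_ball])
    show "nome holomorphic_on uhp" using nome_holomorphic[OF holomorphic_on_ident] .
    show "deriv nome z \<noteq> 0" for z using DERIV_imp_deriv[OF has_field_derivative_nome[of z]] by simp
    show "nome ` ?W \<subseteq> ball 0 1" using Wu norm_nome_less by auto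
    show "\<forall>\<^sub>F w in at (nome z). H w \<noteq> 0" if "z \<in> ?W" for z using Wu that norm_nome_less H(2) by auto
  qed
  also have "\<dots> = zcount (\<lambda>z. H (nome z)) upper_strip + zcount (\<lambda>z. H (nome z)) line_left"
    using f by (intro zcount_Un) (auto simp: upper_strip_def line_left_def)
  finally show "zcount H disc_domain = zorder H 0 + zcount (\<lambda>z. H (nome z)) upper_strip + zcount (\<lambda>z. H (nome z)) line_left"
    by simp
qed

lemma zcount_cong_on:
  assumes "\<And>z. z \<in> V \<Longrightarrow> f z = h z" "open V" "U \<subseteq> V"
  shows "zcount f U = zcount h U"
  unfolding zcount_def
proof (rule sum.cong)
  show "{z\<in>U. f z = 0} = {z\<in>U. h z = 0}" using assms by auto
  fix z assume "z \<in> {z\<in>U. h z = 0}"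
  then have "z \<in> V" using assms(3) by auto
  then have "\<forall>\<^sub>F w in nhds z. f w = h w" using assms(1,2) by (auto simp: eventually_nhds)
  then show "zorder f z = zorder h z" by (intro zorder_cong) (auto simp: eventually_nhds_conv_at)
qed

section \<open>Totals over the fundamental domain\<close>

context real_modular_form
begin

text \<open>On the circle \<open>- 1 / z = - cnj z\<close>, so by reflection the derivative would
  vanish at \<open>- 1 / z\<close> as well. The transformation law under the inversion then leaves
  only its correction term, which is a nonzero multiple of \<open>g z\<close>.\<close>

lemma deriv_g_circle_nonzero:
  assumes z: "z \<in> uhp" "norm z = 1" and g0: "g z \<noteq> 0"
  shows "deriv g z \<noteq> 0"
proof
  assume d: "deriv g z = 0"
  have z0: "z \<noteq> 0" using z by auto
  note S = inverse_on_circle[OF z(2)]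
  have "0 = deriv g (- cnj z)" using deriv_g_cnj[OF z(1)] d by simp
  also have "\<dots> = z powi (k + 2) * deriv g z + of_int k * z powi (k + 1) * g z"
    using deriv_g_moebius[of 0 0 "-1" 1 z] S z(1) by simp
  finally show False using d z0 g0 k_pos by simp
qed

lemma disc_pencil: "z \<in> uhp \<Longrightarrow> c * G (nome z) + b * (nome z * deriv G (nome z)) = c * g z + b / (2 * of_real pi * \<i>) * deriv g z"
proof -
  assume z: "z \<in> uhp"
  define a where "a = 2 * of_real pi * \<i>"
  have "deriv g z = a * (nome z * deriv G (nome z))" unfolding a_def by (simp only: deriv_g[OF z] mult.assoc)
  moreover have "a \<noteq> 0" by (simp add: a_def)
  ultimately show "c * G (nome z) + b * (nome z * deriv G (nome z)) = c * g z + b / (2 * of_real pi * \<i>) * deriv g z"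
    unfolding a_def[symmetric] g_eq[OF z] by simp
qed

text \<open>Here \<open>v q = q\<close>, so every arc zero moves along \<open>- q\<close> into the
  domain. Afterwards the coefficient of \<open>G\<close> is lowered to 0 while \<epsilon> rises to
  1. A frontier zero on the way is impossible: for a positive coefficient it would put
  \<open>z + \<i> s\<close> with \<open>s > 0\<close> on the unit circle next to \<open>z\<close>,
  and at the end \<open>deriv_g_circle_nonzero\<close> applies.\<close>

lemma infinity_count:
  "zcount (\<lambda>q. q * deriv G q) disc_domain = zcount G disc_domain + int (card {z\<in>arc. g z = 0})"
proof -
  have fr: "\<exists>z\<in>arc. q = nome z" if "q \<in> frontier disc_domain" for q using that frontier_disc_domain by auto
  have arcu: "z \<in> uhp" "norm z = 1" if "z \<in> arc" for z using that by (auto simp: arc_def)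
  have nonz: "of_real c * G q + of_real b * (q * deriv G q) \<noteq> 0"
    if q: "q \<in> frontier disc_domain" "G q \<noteq> 0" and cb: "0 < b" "0 \<le> c" "c \<le> of_int k" for q and b c :: real
  proof -
    obtain z where z: "z \<in> arc" "q = nome z" using fr[OF q(1)] by blast
    note zu = arcu[OF z(1)]
    have g0: "g z \<noteq> 0" using q(2) z(2) g_eq[OF zu(1)] by simp
    show ?thesis
    proof (cases "c = 0")
      case True
      then show ?thesis using deriv_g_circle_nonzero[OF zu g0] deriv_g[OF zu(1)] cb z(2) by simp
    next
      case False
      define v where "v = of_real (k / c * b) / (2 * of_real pi * \<i>)"
      show ?thesis
      proof
        assume "of_real c * G q + of_real b * (q * deriv G q) = 0"
        then have "of_real (k / c) * (of_real c * g z + of_real b / (2 * of_real pi * \<i>) * deriv g z) = 0"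
          using disc_pencil[OF zu(1), of "of_real c" "of_real b"] z(2) by simp
        then have "of_int k * g z + v * deriv g z = 0" using False by (simp add: v_def algebra_simps)
        then have "norm (z - v) = 1" using circle_pencil_zero[OF zu g0] k_pos by simp
        moreover have "x / (2 * of_real pi * \<i>) = - \<i> * (x / of_real (2 * pi))" for x
          by (simp only: of_real_mult of_real_numeral divide_divide_eq_left[symmetric] divide_i)
        then have "v = - \<i> * of_real (k / c * b / (2 * pi))" by (simp add: v_def)
        then have "Re (cnj z * (- v)) = Im z * (k / c * b / (2 * pi))" by simp
        moreover have "Im z * (k / c * b / (2 * pi)) > 0" using zu(1) cb False k_pos by (auto simp: uhp_def)
        moreover have "(norm (z + - v))\<^sup>2 = 1 + 2 * Re (cnj z * (- v)) + (norm (- v))\<^sup>2"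
          unfolding norm_add_sq zu(2) by simp
        ultimately have "(norm (z + - v))\<^sup>2 > 1" using zero_le_power2[of "norm (- v)"] by linarith
        then show False using \<open>norm (z - v) = 1\<close> by simp
      qed
    qed
  qed
  have kp: "real_of_int k > 0" using k_pos by simp
  have nzc: "\<forall>\<^sub>F w in at q. G w \<noteq> 0" if "q \<in> closure disc_domain" for q
    using G_eventually_nonzero[of q] closure_disc_domain_ball that by auto
  have q0: "q \<noteq> 0" if "q \<in> frontier disc_domain" for q using fr[OF that] by auto
  have ev: "\<forall>\<^sub>F \<epsilon> in at_right 0. zcount (\<lambda>q. of_real (of_int k) * G q + of_real \<epsilon> * (q * deriv G q)) disc_domain =
      zcount G disc_domain + int (card {q\<in>frontier disc_domain. G q = 0 \<and> q \<in> UNIV})"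
  proof (rule zcount_pencil_limit[OF open_disc_domain bounded_disc_domain open_ball closure_disc_domain_ball G_holomorphic nzc kp _ zero_less_one])
    show "points_into disc_domain q (- q)" if "q \<in> frontier disc_domain" for q
      using fr[OF that] points_into_disc_domain by auto
  qed (use nonz[of _ _ "of_int k"] k_pos q0 in \<open>auto intro: holomorphic_intros\<close>)
  have "\<forall>\<^sub>F \<epsilon> in at_right 0. \<epsilon> \<in> {0<..<1::real}" by (rule eventually_at_right_real) simp
  then obtain \<epsilon> where e: "\<epsilon> \<in> {0<..<1}" "zcount (\<lambda>q. of_real (of_int k) * G q + of_real \<epsilon> * (q * deriv G q)) disc_domain =
      zcount G disc_domain + int (card {q\<in>frontier disc_domain. G q = 0 \<and> q \<in> UNIV})"
    using eventually_happens'[OF trivial_limit_at_right_real eventually_conj[OF _ ev]] by auto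
  define b where "b t = \<epsilon> + t * (1 - \<epsilon>)" for t
  have bt: "0 < b t" if "t \<in> {0..1}" for t using that e(1) unfolding b_def by (auto intro!: add_pos_nonneg)
  define p q where "p = (\<lambda>t (z::complex). of_real (of_int k * (1 - t)) :: complex)" and "q = (\<lambda>t (z::complex). of_real (b t) * z)"
  have "zcount (\<lambda>z. p 0 z * G z + q 0 z * deriv G z) disc_domain = zcount (\<lambda>z. p 1 z * G z + q 1 z * deriv G z) disc_domain"
  proof (rule zcount_pencil_homotopy[OF open_disc_domain bounded_disc_domain open_ball closure_disc_domain_ball G_holomorphic])
    show "\<forall>\<^sub>F w in at z. G w \<noteq> 0" if "z \<in> frontier disc_domain" for z using nzc that by (auto simp: frontier_def)
    show "p t holomorphic_on ball 0 1" "q t holomorphic_on ball 0 1" for t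
      unfolding p_def q_def by (intro holomorphic_intros)+
    show "continuous_on ({0..1} \<times> closure disc_domain) (\<lambda>(t, z). p t z)"
      "continuous_on ({0..1} \<times> closure disc_domain) (\<lambda>(t, z). q t z)"
      unfolding p_def q_def b_def case_prod_beta by (intro continuous_intros)+
    fix t :: real and z assume t: "t \<in> {0..1}" and z: "z \<in> frontier disc_domain"
    show "q t z \<noteq> 0" using bt[OF t] q0[OF z] by (simp add: q_def)
    have "of_int k * (1 - t) \<le> of_int k * 1" using t kp by (intro mult_left_mono) auto
    then show "p t z * G z + q t z * deriv G z \<noteq> 0" if "G z \<noteq> 0"
      using nonz[OF z that bt[OF t], of "of_int k * (1 - t)"] t kp unfolding p_def q_def by (simp add: mult.assoc)
  qed
  moreover have "card {q\<in>frontier disc_domain. G q = 0} = card {z\<in>arc. g z = 0}"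
    unfolding frontier_zeros[symmetric] by (rule card_image) (rule inj_on_subset[OF inj_on_nome_arc], auto)
  ultimately show ?thesis using e(2) by (simp add: p_def q_def b_def mult.assoc)
qed

definition arc_zeros_weight :: real where
  "arc_zeros_weight = (\<Sum>z\<in>{z\<in>arc_left. g z = 0}. ell_weight z)"

text \<open>A zero strictly between \<rho> and \<i> is counted with its mirror image, and \<i> once
  with weight 1/2, so both fit the factor 2. The point \<rho> is counted once but has weight 1/3;
  the missing third is the delta term of the theorem.\<close>

lemma card_arc_zeros: "real (card {z\<in>arc. g z = 0}) = 2 * arc_zeros_weight + of_bool (g \<rho> = 0) / 3"
proof -
  have "real (card {z\<in>arc. g z = 0}) = (\<Sum>z\<in>{z\<in>arc. g z = 0}. 1)" by simp
  also have "\<dots> = 2 * real (card arc_inner_zeros) + of_bool (g \<i> = 0) + of_bool (g \<rho> = 0)"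
    unfolding sum_arc_zeros by simp
  moreover have "arc_zeros_weight = real (card arc_inner_zeros) + of_bool (g \<i> = 0) / 2 + of_bool (g \<rho> = 0) / 3"
  proof -
    have "ell_weight z = 1" if "z \<in> arc_inner_zeros" for z using that by (auto simp: arc_inner_zeros_def ell_weight_def)
    then have "sum ell_weight arc_inner_zeros = real (card arc_inner_zeros)" by simp
    then show ?thesis unfolding arc_zeros_weight_def sum_arc_left_zeros using i_neq_rho by (simp add: ell_weight_def)
  qed
  ultimately show ?thesis by (simp add: field_simps)
qed

lemma finite_boundary_zeros: "finite boundary_zeros"
proof -
  obtain C Y where Y: "\<And>z. Im z \<ge> Y \<Longrightarrow> g z \<noteq> 0" using log_deriv_top by metis
  have "finite {z\<in>frontier (strip Y). g z = 0}"
    by (rule finite_zeros_in_compact[OF _ g_holomorphic open_uhp])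
      (use bounded_strip strip_frontier_cases(1) zorder_g(2) in \<open>auto intro: compact_frontier_bounded\<close>)
  then show ?thesis using boundary_zeros_frontier[OF Y, where I = UNIV] by simp
qed

lemma boundary_zeros_reflect: "z \<in> boundary_zeros \<Longrightarrow> - cnj z \<in> boundary_zeros"
  using uhp_minus_cnj g_cnj by (auto simp: boundary_zeros_def)

lemma card_entering_uminus:
  fixes l :: real
  shows "card {z\<in>boundary_zeros. z \<in> entering (of_real (- l)) out} = card {z\<in>boundary_zeros. z \<in> entering (of_real l) out}"
proof (rule bij_betw_same_card)
  have "- cnj z \<in> {z\<in>boundary_zeros. z \<in> entering (of_real (- l)) out}" if "z \<in> boundary_zeros" "z \<in> entering (of_real l) out" for z l
    using boundary_zeros_reflect[OF that(1)] that(2) unfolding entering_def by auto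
  from this[of _ l] this[of _ "- l"]
  show "bij_betw (\<lambda>z. - cnj z) {z\<in>boundary_zeros. z \<in> entering (of_real (- l)) out} {z\<in>boundary_zeros. z \<in> entering (of_real l) out}"
    by (intro bij_betw_byWitness[where f' = "\<lambda>z. - cnj z"]) auto
qed

text \<open>By reflection \<open>l \<ge> 0\<close> may be assumed. Segments towards \<open>l\<close>
  enter through the left wall always, through the right wall only for \<open>l < 1/2\<close>, and
  through the arc only if \<open>l > 1\<close>. In the last case \<open>\<rho>\<close> is included,
  while the corner with real part 1/2 is excluded by the right wall, which matches the half-open
  \<open>arc\<close>.\<close>

lemma card_entering:
  fixes l :: real
  assumes "\<bar>l\<bar> \<noteq> 1/2"
  shows "card {z\<in>boundary_zeros. z \<in> entering (of_real l) (\<bar>l\<bar> > 1)} =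
    (if \<bar>l\<bar> > 1 then card {z\<in>line_left. g z = 0} + card {z\<in>arc. g z = 0}
     else if \<bar>l\<bar> > 1/2 then card {z\<in>line_left. g z = 0} else 2 * card {z\<in>line_left. g z = 0})"
proof -
  have *: "card {z\<in>boundary_zeros. z \<in> entering (of_real l) (l > 1)} =
    (if l > 1 then card {z\<in>line_left. g z = 0} + card {z\<in>arc. g z = 0}
     else if l > 1/2 then card {z\<in>line_left. g z = 0} else 2 * card {z\<in>line_left. g z = 0})"
    if l: "0 \<le> l" "l \<noteq> 1/2" for l :: real
  proof -
    let ?LL = "{z\<in>line_left. g z = 0}"
    have LB: "?LL \<subseteq> boundary_zeros" by (auto simp: line_left_def boundary_zeros_def)
    have finL: "finite ?LL" by (rule finite_subset[OF LB finite_boundary_zeros])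
    consider "l > 1" | "1/2 < l" "\<not> l > 1" | "l < 1/2" using l by linarith
    then show ?thesis
    proof cases
      case 1
      have "\<bar>x\<bar> \<le> 1/2 \<and> 1 \<le> n \<and> (\<bar>x\<bar> = 1/2 \<or> n = 1) \<and> x \<noteq> 1/2 \<longleftrightarrow>
          x = - (1/2) \<and> n > 1 \<or> n = 1 \<and> - (1/2) \<le> x \<and> x < 1/2" for x n :: real by arith
      moreover have "z \<in> entering (of_real l) True \<longleftrightarrow> Re z \<noteq> 1/2" for z using 1 by (auto simp: entering_def)
      ultimately have "{z\<in>boundary_zeros. z \<in> entering (of_real l) True} = ?LL \<union> {z\<in>arc. g z = 0}"
        unfolding boundary_zeros_def line_left_def arc_def by blast
      moreover have "card (?LL \<union> {z\<in>arc. g z = 0}) = card ?LL + card {z\<in>arc. g z = 0}"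
        by (rule card_Un_disjoint[OF finL finite_arc_zeros]) (auto simp: line_left_def arc_def)
      ultimately show ?thesis using 1 by simp
    next
      case 2
      then have "{z\<in>boundary_zeros. z \<in> entering (of_real l) False} = ?LL"
        by (auto simp: entering_def boundary_zeros_def line_left_def)
      then show ?thesis using 2 by simp
    next
      case 3
      have "{z\<in>boundary_zeros. z \<in> entering (of_real l) False} = ?LL \<union> (\<lambda>z. - cnj z) ` ?LL" (is "?A = ?B")
      proof
        have "?LL \<subseteq> ?A" using LB 3 l by (auto simp: entering_def line_left_def)
        moreover have "- cnj z \<in> ?A" if "z \<in> ?LL" for z
          using boundary_zeros_reflect[of z] LB that 3 l by (auto simp: entering_def line_left_def)
        ultimately show "?B \<subseteq> ?A" by blast
        show "?A \<subseteq> ?B"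
        proof
          fix z assume z: "z \<in> ?A"
          then have z': "z \<in> uhp" "g z = 0" "norm z > 1" "Re z = - (1/2) \<or> Re z = 1/2"
            by (auto simp: entering_def boundary_zeros_def)
          show "z \<in> ?B"
          proof (cases "Re z = - (1/2)")
            case False
            then have "- cnj z \<in> ?LL" using z' uhp_minus_cnj g_cnj by (auto simp: line_left_def)
            then show ?thesis by (intro UnI2 image_eqI[of _ _ "- cnj z"]) auto
          qed (use z' in \<open>auto simp: line_left_def\<close>)
        qed
      qed
      moreover have "card (?LL \<union> (\<lambda>z. - cnj z) ` ?LL) = card ?LL + card ((\<lambda>z. - cnj z) ` ?LL)"
        by (rule card_Un_disjoint[OF finL finite_imageI[OF finL]]) (auto simp: line_left_def)
      moreover have "card ((\<lambda>z. - cnj z) ` ?LL) = card ?LL" by (rule card_image) (auto intro: inj_onI)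
      ultimately show ?thesis using 3 by simp
    qed
  qed
  show ?thesis
  proof (cases "0 \<le> l")
    case True
    then show ?thesis using *[OF True] assms by simp
  next
    case False
    then show ?thesis using *[of "- l"] assms card_entering_uminus[of l "\<bar>l\<bar> > 1"] by simp
  qed
qed

lemma zorder_pencil_zero:
  assumes "z \<in> uhp" "g z = 0" "z \<noteq> w"
  shows "zorder (pencil w 1) z = zorder g z - 1"
  using zorder_pencil[OF g_holomorphic open_uhp assms(1,2) zorder_g(2)[OF assms(1)], of "\<lambda>z. z - w" "of_int k"] assms(3)
  by (simp add: pencil_def[abs_def] holomorphic_intros)

lemma zorder_deriv_zero:
  assumes "z \<in> uhp" "g z = 0"
  shows "zorder (deriv g) z = zorder g z - 1"
  using zorder_pencil[OF g_holomorphic open_uhp assms(1,2) zorder_g(2)[OF assms(1)], of "\<lambda>z. 1" 0] by simp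

lemma finite_arc_left_zeros: "finite {z\<in>arc_left. g z = 0}"
  by (rule finite_subset[OF _ finite_arc_zeros]) (auto simp: arc_left_def arc_def)

theorem infinity_total:
  "of_int (zcount (\<lambda>q. q * deriv G q) disc_domain) + (\<Sum>z\<in>{z\<in>arc_left. deriv g z = 0}. ell_weight z * of_int (zorder (deriv g) z))
   = k / 12 + arc_zeros_weight + of_bool (g \<rho> = 0) / 3"
proof -
  have "(\<Sum>z\<in>{z\<in>arc_left. deriv g z = 0}. ell_weight z * of_int (zorder (deriv g) z)) =
      (\<Sum>z\<in>{z\<in>arc_left. g z = 0}. ell_weight z * of_int (zorder g z)) - arc_zeros_weight"
    unfolding arc_zeros_weight_def
    by (rule sum_shifted_orders[OF finite_arc_left_zeros])
      (use deriv_g_circle_nonzero zorder_deriv_zero analytic_at deriv_g_holomorphic open_uhp in \<open>auto simp: arc_left_def\<close>)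
  then show ?thesis using valence infinity_count card_arc_zeros by simp
qed

text \<open>Compared with the valence formula, the open strip gains the entering zeros and possibly
  the one from the cusp, while each zero on \<open>line_left\<close> and \<open>arc_left\<close>
  loses one unit of order. By \<open>card_entering\<close> and \<open>card_arc_zeros\<close> the
  differences are those of the three cases.\<close>

theorem finite_total:
  fixes l :: real
  assumes l: "\<bar>l\<bar> \<noteq> 1/2" "\<bar>l\<bar> \<noteq> 1"
  shows "of_int (zorder G 0 + zcount (pencil (of_real l) 1) upper_strip + zcount (pencil (of_real l) 1) line_left)
     + (\<Sum>z\<in>{z\<in>arc_left. pencil (of_real l) 1 z = 0}. ell_weight z * of_int (zorder (pencil (of_real l) 1) z))
   = k / 12 + (if \<bar>l\<bar> > 1 then arc_zeros_weight + of_bool (g \<rho> = 0) / 3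
       else if \<bar>l\<bar> > 1/2 then - arc_zeros_weight
       else - arc_zeros_weight + real (card {z\<in>line_left. g z = 0} + of_bool (G 0 = 0)))"
proof -
  let ?P = "pencil (of_real l) 1"
  have k0: "k \<noteq> 0" using k_pos by simp
  have an: "?P analytic_on {z}" if "z \<in> uhp" for z using analytic_at pencil_holomorphic open_uhp that by blast
  have ne: "z \<noteq> of_real l" if "z \<in> uhp" for z using that by (auto simp: uhp_def)
  have "(\<Sum>z\<in>{z\<in>arc_left. ?P z = 0}. ell_weight z * of_int (zorder ?P z)) =
      (\<Sum>z\<in>{z\<in>arc_left. g z = 0}. ell_weight z * of_int (zorder g z)) - arc_zeros_weight"
    unfolding arc_zeros_weight_def
  proof (rule sum_shifted_orders[OF finite_arc_left_zeros])
    fix z assume "z \<in> arc_left"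
    then have z: "z \<in> uhp" "norm z = 1" by (auto simp: arc_left_def)
    show "?P analytic_on {z}" by (rule an[OF z(1)])
    show "zorder ?P z = zorder g z - 1" if "g z = 0" by (rule zorder_pencil_zero[OF z(1) that ne[OF z(1)]])
    show "?P z \<noteq> 0" if g0: "g z \<noteq> 0"
    proof
      assume "?P z = 0"
      then have "norm (z - (z - of_real l)) = 1"
        by (intro circle_pencil_zero[OF z g0 _ k0]) (simp add: pencil_def)
      then show False using l by simp
    qed
  qed
  moreover have finL: "finite {z\<in>line_left. g z = 0}"
    by (rule finite_subset[OF _ finite_boundary_zeros]) (auto simp: line_left_def boundary_zeros_def)
  have "(\<Sum>z\<in>{z\<in>line_left. ?P z = 0}. 1 * real_of_int (zorder ?P z)) =
      (\<Sum>z\<in>{z\<in>line_left. g z = 0}. 1 * of_int (zorder g z)) - (\<Sum>z\<in>{z\<in>line_left. g z = 0}. 1)"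
  proof (rule sum_shifted_orders[OF finL])
    fix z assume "z \<in> line_left"
    then have z: "z \<in> uhp" "Re z = 1/2 \<or> Re z = - (1/2)" by (auto simp: line_left_def)
    show "?P analytic_on {z}" by (rule an[OF z(1)])
    show "zorder ?P z = zorder g z - 1" if "g z = 0" by (rule zorder_pencil_zero[OF z(1) that ne[OF z(1)]])
    have "Re (z - of_real l) \<noteq> 0" using z(2) l(1) by auto
    then show "?P z \<noteq> 0" if g0: "g z \<noteq> 0"
      using line_pencil_nonzero[OF z g0 _ k0] by (simp add: pencil_def)
  qed
  then have "real_of_int (zcount ?P line_left) = zcount g line_left - card {z\<in>line_left. g z = 0}"
    by (simp add: zcount_def)
  moreover have "zcount G disc_domain = zorder G 0 + zcount g upper_strip + zcount g line_left"
  proof -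
    have "zcount (\<lambda>z. G (nome z)) W = zcount g W" if "W \<subseteq> uhp" for W
      using g_eq by (intro zcount_cong_on[OF _ open_uhp that]) auto
    then show ?thesis using zcount_disc_domain(1)[OF G_holomorphic G_eventually_nonzero]
      by (simp add: upper_strip_def line_left_def)
  qed
  moreover have "zorder G 0 > 0 \<longleftrightarrow> G 0 = 0"
  proof -
    have "G analytic_on {0}" using G_holomorphic analytic_at[of G 0] by (auto intro: exI[of _ "ball 0 1"])
    then show ?thesis
      using G_eventually_nonzero[of 0] by (subst zorder_pos_iff') (auto simp: eventually_frequently)
  qed
  ultimately show ?thesis
    using valence pencil_count[OF l] card_entering[OF l(1)] card_arc_zeros l by (auto simp: of_bool_def)
qed

end


section \<open>Stabilizers in the modular group\<close>

definition mat2 :: "int \<Rightarrow> int \<Rightarrow> int \<Rightarrow> int \<Rightarrow> int^2^2" where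
  "mat2 a b c d = vector [vector [a, b], vector [c, d]]"

lemma mat2_nth [simp]: "mat2 a b c d $ 1 $ 1 = a" "mat2 a b c d $ 1 $ 2 = b" "mat2 a b c d $ 2 $ 1 = c" "mat2 a b c d $ 2 $ 2 = d"
  by (simp_all add: mat2_def)

lemma mat2_eq_iff: "mat2 a b c d = mat2 a' b' c' d' \<longleftrightarrow> a = a' \<and> b = b' \<and> c = c' \<and> d = d'"
  by (metis mat2_nth)

lemma mat2_cases:
  obtains a b c d where "B = mat2 a b c d"
  by (rule that[of "B$1$1" "B$1$2" "B$2$1" "B$2$2"]) (simp add: vec_eq_iff forall_2)

lemma uminus_mat2 [simp]: "- mat2 a b c d = mat2 (- a) (- b) (- c) (- d)"
  by (simp add: vec_eq_iff forall_2)

lemma mat2_mult: "mat2 a b c d ** mat2 a' b' c' d' = mat2 (a * a' + b * c') (a * b' + b * d') (c * a' + d * c') (c * b' + d * d')"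
  by (simp add: vec_eq_iff forall_2 matrix_matrix_mult_def sum_2)

lemma mat2_SL2Z: "mat2 a b c d \<in> SL2Z \<longleftrightarrow> a * d - b * c = 1"
  by (simp add: SL2Z_def det_2)

lemma moebius_mat2: "moebius (mat2 a b c d) z = (of_int a * z + of_int b) / (of_int c * z + of_int d)"
  by (simp add: moebius_def)

lemma moebius_uhp: "B \<in> SL2Z \<Longrightarrow> z \<in> uhp \<Longrightarrow> moebius B z \<in> uhp"
  by (cases B rule: mat2_cases) (simp add: mat2_SL2Z moebius_mat2 moebius_uhp')

lemma moebius_mult:
  assumes "B \<in> SL2Z" "z \<in> uhp"
  shows "moebius (C ** B) z = moebius C (moebius B z)"
proof -
  obtain a b c d where B: "B = mat2 a b c d" by (rule mat2_cases)
  obtain a' b' c' d' where C: "C = mat2 a' b' c' d'" by (rule mat2_cases)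
  have m: "of_int c * z + of_int d \<noteq> 0" using moebius_denom_nonzero[of a d b c z] assms by (simp add: B mat2_SL2Z)
  have *: "(p * (x / y) + q) / (r * (x / y) + s) = (p * x + q * y) / (r * x + s * y)" if "y \<noteq> 0" for p q r s x y :: complex
  proof -
    have "p * (x / y) + q = (p * x + q * y) / y" "r * (x / y) + s = (r * x + s * y) / y" using that by (simp_all add: field_simps)
    then show ?thesis using that by simp
  qed
  show ?thesis unfolding B C mat2_mult moebius_mat2 *[OF m] by (simp add: algebra_simps)
qed

lemma SL2Z_mult: "B \<in> SL2Z \<Longrightarrow> C \<in> SL2Z \<Longrightarrow> B ** C \<in> SL2Z"
  by (simp add: SL2Z_def det_mul)

lemma SL2Z_inverse:
  assumes "B \<in> SL2Z"
  obtains B' where "B' \<in> SL2Z" "B ** B' = mat 1" "B' ** B = mat 1"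
proof -
  obtain a b c d where B: "B = mat2 a b c d" by (rule mat2_cases)
  have 1: "mat 1 = mat2 1 0 0 1" by (simp add: vec_eq_iff forall_2 mat_def)
  show ?thesis
    by (rule that[of "mat2 d (- b) (- c) a"]) (use assms in \<open>auto simp: B mat2_SL2Z mat2_mult 1 mat2_eq_iff algebra_simps\<close>)
qed

lemma moebius_one: "moebius (mat 1) z = z"
  by (simp add: moebius_def mat_def)

lemma moebius_inj:
  assumes "B \<in> SL2Z" "z \<in> uhp" "w \<in> uhp" "moebius B z = moebius B w"
  shows "z = w"
proof -
  obtain B' where B': "B' \<in> SL2Z" "B' ** B = mat 1" using SL2Z_inverse[OF assms(1)] by blast
  show ?thesis
    using moebius_mult[OF assms(1,2), of B'] moebius_mult[OF assms(1,3), of B'] assms(4) B'(2) moebius_one by simp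
qed

text \<open>Conjugation by \<open>B\<close> maps one stabilizer onto the other and commutes with the
  sign, hence with passing to classes.\<close>

lemma stab_order_moebius:
  assumes B: "B \<in> SL2Z" and z: "z \<in> uhp"
  shows "stab_order (Pt (moebius B z)) = stab_order (Pt z)"
proof -
  obtain B' where B': "B' \<in> SL2Z" "B ** B' = mat 1" "B' ** B = mat 1" using SL2Z_inverse[OF B] by blast
  define S where "S w = {C\<in>SL2Z. moebius C w = w}" for w
  define \<phi> where "\<phi> C = B ** C ** B'" for C
  define \<psi> where "\<psi> C = B' ** C ** B" for C
  have cancel: "B' ** (B ** X) = X" "B ** (B' ** X) = X" for X :: "int^2^2"
    using B' by (simp_all add: matrix_mul_assoc)
  have inv: "\<psi> (\<phi> C) = C" "\<phi> (\<psi> C) = C" for C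
    unfolding \<phi>_def \<psi>_def using B' cancel by (simp_all add: matrix_mul_assoc[symmetric])
  have inj: "inj \<phi>" using inv(1) by (rule inj_on_inverseI)
  have Bz: "moebius B' (moebius B z) = z" using moebius_mult[OF B z, of B'] B'(3) moebius_one by simp
  have "S (moebius B z) = \<phi> ` S z"
  proof (intro set_eqI iffI)
    fix C assume C: "C \<in> S (moebius B z)"
    have "\<psi> C \<in> SL2Z" unfolding \<psi>_def using B B' C by (auto simp: S_def intro!: SL2Z_mult)
    moreover have "moebius (\<psi> C) z = z"
    proof -
      have "moebius (\<psi> C) z = moebius (B' ** C) (moebius B z)" unfolding \<psi>_def by (rule moebius_mult[OF B z])
      also have "\<dots> = moebius B' (moebius C (moebius B z))"
        by (rule moebius_mult) (use C moebius_uhp[OF B z] in \<open>auto simp: S_def\<close>)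
      also have "\<dots> = z" using C Bz by (simp add: S_def)
      finally show ?thesis .
    qed
    ultimately show "C \<in> \<phi> ` S z" using inv(2)[of C] by (intro image_eqI[of _ _ "\<psi> C"]) (auto simp: S_def)
  next
    fix C assume "C \<in> \<phi> ` S z"
    then obtain D where D: "D \<in> SL2Z" "moebius D z = z" "C = \<phi> D" by (auto simp: S_def)
    have "moebius C (moebius B z) = moebius (B ** D) (moebius B' (moebius B z))"
      unfolding D(3) \<phi>_def by (rule moebius_mult[OF B'(1) moebius_uhp[OF B z]])
    also have "\<dots> = moebius B z" unfolding Bz using moebius_mult[OF D(1) z, of B] D(2) by simp
    finally show "C \<in> S (moebius B z)" using D B B' by (auto simp: S_def \<phi>_def intro!: SL2Z_mult)
  qed
  then have "(\<lambda>C. {C, - C}) ` S (moebius B z) = (\<lambda>C. {\<phi> C, - \<phi> C}) ` S z" by (simp add: image_image)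
  also have "\<dots> = (image \<phi>) ` ((\<lambda>C. {C, - C}) ` S z)"
  proof -
    have "- \<phi> C = \<phi> (- C)" for C
      by (simp add: \<phi>_def vec_eq_iff forall_2 matrix_matrix_mult_def sum_2 algebra_simps)
    then show ?thesis by (simp add: image_image)
  qed
  finally have "card ((\<lambda>C. {C, - C}) ` S (moebius B z)) = card ((\<lambda>C. {C, - C}) ` S z)"
    using inj by (simp add: card_image inj_on_def inj_image_eq_iff)
  then show ?thesis by (simp add: S_def)
qed

text \<open>For \<open>c \<noteq> 0\<close>, \<open>z\<close> and \<open>cnj z\<close> are the two
  roots of \<open>c z^2 + (d - a) z - b\<close>, so these are the formulas for their sum and
  product. Cleared of denominators they remain correct for \<open>c = 0\<close>.\<close>

lemma moebius_fixed_iff: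
  assumes det: "a * d - b * c = 1" and z: "z \<in> uhp"
  shows "moebius (mat2 a b c d) z = z \<longleftrightarrow> real_of_int (a - d) = 2 * of_int c * Re z \<and> real_of_int b = - of_int c * (norm z)\<^sup>2"
proof -
  have y: "Im z > 0" using z by (simp add: uhp_def)
  have "moebius (mat2 a b c d) z = z \<longleftrightarrow> of_int a * z + of_int b = z * (of_int c * z + of_int d)"
    unfolding moebius_mat2 using moebius_denom_nonzero[OF det z] by (simp add: divide_eq_eq)
  also have "\<dots> \<longleftrightarrow> a * Re z + b = c * ((Re z)\<^sup>2 - (Im z)\<^sup>2) + d * Re z \<and> Im z * a = Im z * (2 * c * Re z + d)"
    by (simp add: complex_eq_iff algebra_simps power2_eq_square)
  also have "\<dots> \<longleftrightarrow> a * Re z + b = c * ((Re z)\<^sup>2 - (Im z)\<^sup>2) + d * Re z \<and> real_of_int a = 2 * c * Re z + d"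
    using y by (simp only: mult_cancel_left) auto
  also have "\<dots> \<longleftrightarrow> real_of_int (a - d) = 2 * of_int c * Re z \<and> real_of_int b = - of_int c * (norm z)\<^sup>2"
  proof (rule trans[OF conj_commute conj_cong])
    show "real_of_int a = 2 * c * Re z + d \<longleftrightarrow> real_of_int (a - d) = 2 * of_int c * Re z" by auto
    assume "real_of_int (a - d) = 2 * of_int c * Re z"
    then have "real_of_int a = 2 * c * Re z + d" by simp
    then show "a * Re z + b = c * ((Re z)\<^sup>2 - (Im z)\<^sup>2) + d * Re z \<longleftrightarrow> real_of_int b = - of_int c * (norm z)\<^sup>2"
      unfolding cmod_power2 by (simp add: algebra_simps power2_eq_square) linarith
  qed
  finally show ?thesis .
qed

section \<open>Stabilizers of points of the fundamental domain\<close>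

definition fund_points :: "complex set" where
  "fund_points = {z \<in> uhp. norm z > 1 \<and> \<bar>Re z\<bar> < 1/2} \<union> {z \<in> uhp. norm z \<ge> 1 \<and> - (1/2) \<le> Re z \<and> Re z \<le> 0}"

lemma fund_points_eq: "fund_points = upper_strip \<union> line_left \<union> arc_left"
  by (auto simp: fund_points_def upper_strip_def line_left_def arc_left_def)

text \<open>The square of the trace equals \<open>4 c^2 (Re z)^2 + 4 - 4 c^2 (norm z)^2\<close> and
  is nonnegative. In the fundamental domain this gives \<open>3 c^2 \<le> 4\<close>, so
  \<open>c\<close> is 1 or -1; then the squared norm is the integer \<open>\<bar>b\<bar>\<close> and
  at most 5/4, hence 1. Finally \<open>a - d\<close> is one of 0, 1, -1, which leaves two real
  parts.\<close>

lemma fund_points_fixed: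
  assumes z: "z \<in> fund_points" and det: "a * d - b * c = 1" and fx: "moebius (mat2 a b c d) z = z" and c: "c \<noteq> 0"
  shows "z = \<i> \<or> z = \<rho>"
proof -
  have zu: "z \<in> uhp" "norm z \<ge> 1" "- (1/2) \<le> Re z" "Re z < 1/2" using z by (auto simp: fund_points_def)
  define n where "n = (norm z)\<^sup>2"
  have n1: "n \<ge> 1" using zu(2) by (simp add: n_def)
  have e: "real_of_int (a - d) = 2 * of_int c * Re z" "real_of_int b = - of_int c * n"
    using moebius_fixed_iff[OF det zu(1)] fx by (auto simp: n_def)
  have x2: "4 * (Re z)\<^sup>2 \<le> 1"
  proof -
    have "\<bar>Re z\<bar> \<le> 1/2" using zu by auto
    then have "(Re z)\<^sup>2 \<le> (1/2)\<^sup>2" by (simp only: abs_le_square_iff[symmetric])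
    then show ?thesis by (simp add: power2_eq_square)
  qed
  have "real_of_int (a * d - b * c) = 1" using det by simp
  then have dr: "real_of_int a * d = 1 - (real_of_int c)\<^sup>2 * n" using e(2) by (simp add: power2_eq_square algebra_simps)
  have "(real_of_int (a + d))\<^sup>2 = (real_of_int (a - d))\<^sup>2 + 4 * (real_of_int a * d)" by (simp add: power2_eq_square algebra_simps)
  also have "(real_of_int (a - d))\<^sup>2 = (real_of_int c)\<^sup>2 * (4 * (Re z)\<^sup>2)" unfolding e(1) by (simp add: power2_eq_square)
  finally have s: "(real_of_int (a + d))\<^sup>2 = (real_of_int c)\<^sup>2 * (4 * (Re z)\<^sup>2) + 4 - 4 * ((real_of_int c)\<^sup>2 * n)" unfolding dr by simp
  have c2: "(real_of_int c)\<^sup>2 * (4 * (Re z)\<^sup>2) \<le> (real_of_int c)\<^sup>2 * 1" "(real_of_int c)\<^sup>2 * 1 \<le> (real_of_int c)\<^sup>2 * n"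
    by (rule mult_left_mono[OF x2 zero_le_power2]) (rule mult_left_mono[OF n1 zero_le_power2])
  have "3 * (real_of_int c)\<^sup>2 \<le> 4" using s c2 zero_le_power2[of "real_of_int (a + d)"] by linarith
  then have "\<bar>real_of_int c\<bar>\<^sup>2 < 2\<^sup>2" by simp
  then have "\<bar>real_of_int c\<bar> < 2" by (rule power_less_imp_less_base) simp
  then have "\<bar>c\<bar> = 1" using c by linarith
  then have cc: "c * c = 1" "(real_of_int c)\<^sup>2 = 1" "c = 1 \<or> c = - 1" by (auto simp: abs_if split: if_splits)
  have "4 * n \<le> 5" using s[unfolded cc(2)] x2 zero_le_power2[of "real_of_int (a + d)"] by linarith
  moreover have nb: "n = real_of_int \<bar>b\<bar>" using e(2) cc(3) n1 by auto
  ultimately have "real_of_int (4 * \<bar>b\<bar>) \<le> real_of_int 5" "real_of_int 1 \<le> real_of_int \<bar>b\<bar>" using n1 by simp_all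
  then have "\<bar>b\<bar> = 1" unfolding of_int_le_iff by linarith
  then have n: "n = 1" using nb by simp
  then have nz: "norm z = 1" by (simp add: n_def power2_eq_1_iff) (smt (verit) norm_ge_zero)
  have "\<bar>2 * of_int c * Re z\<bar> \<le> 1" using cc(3) zu by auto
  then have "\<bar>a - d\<bar> \<le> 1" unfolding e(1)[symmetric] by linarith
  then have "a - d = 0 \<or> a - d = 1 \<or> a - d = - 1" by linarith
  then have "Re z = 0 \<or> Re z = - (1/2)" using e(1) cc(3) zu(4) by auto
  then show ?thesis
  proof
    assume "Re z = 0"
    then show ?thesis using arc_eqI[OF zu(1), of \<i>] nz by (simp add: uhp_def)
  next
    assume "Re z = - (1/2)"
    then show ?thesis using arc_eqI[OF zu(1), of \<rho>] nz rho_simps by simp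
  qed
qed

text \<open>At \<i> the determinant condition becomes \<open>a^2 + c^2 = 1\<close>, at \<rho> it
  becomes \<open>(2a + c)^2 + 3 c^2 = 4\<close>. Up to sign these have two and three solutions. At
  all other points \<open>c = 0\<close>, which leaves the identity up to sign.\<close>

lemma stab_order_fund_points:
  assumes z: "z \<in> fund_points"
  shows "1 / real (stab_order (Pt z)) = ell_weight z"
proof -
  have zu: "z \<in> uhp" using z by (auto simp: fund_points_def)
  let ?q = "\<lambda>C :: int^2^2. {C, - C}"
  have c0: "?q (mat2 a b c d) = ?q (mat2 1 0 0 1)"
    if "a * d - b * c = 1" "moebius (mat2 a b c d) z = z" "c = 0" for a b c d
  proof -
    have "real_of_int (a - d) = 0" "real_of_int b = 0" using moebius_fixed_iff[OF that(1) zu] that(2,3) by auto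
    then have "a = d" "b = 0" by auto
    then have "a * a = 1" using that by simp
    then have "a = 1 \<or> a = - 1" by (simp add: square_eq_1_iff)
    then show ?thesis using \<open>a = d\<close> \<open>b = 0\<close> that(3) by auto
  qed
  have S: "stab_order (Pt z) = card (?q ` {C\<in>SL2Z. moebius C z = z})" by simp
  have fixI: "mat2 a b c d \<in> {C\<in>SL2Z. moebius C z = z}"
    if "a * d - b * c = 1" "real_of_int (a - d) = 2 * of_int c * Re z" "real_of_int b = - of_int c * (norm z)\<^sup>2" for a b c d
    using that moebius_fixed_iff[OF that(1) zu] by (simp add: mat2_SL2Z)
  have id: "mat2 1 0 0 1 \<in> {C\<in>SL2Z. moebius C z = z}" by (rule fixI) auto
  show ?thesis
  proof (cases "z = \<i> \<or> z = \<rho>")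
    case False
    have "?q ` {C\<in>SL2Z. moebius C z = z} = {?q (mat2 1 0 0 1)}"
    proof
      show "?q ` {C\<in>SL2Z. moebius C z = z} \<subseteq> {?q (mat2 1 0 0 1)}"
      proof clarify
        fix C assume C: "C \<in> SL2Z" "moebius C z = z"
        obtain a b c d where Ce: "C = mat2 a b c d" by (rule mat2_cases)
        then have det: "a * d - b * c = 1" and fx: "moebius (mat2 a b c d) z = z" using C by (auto simp: mat2_SL2Z)
        show "?q C = ?q (mat2 1 0 0 1)"
          unfolding Ce by (rule c0[OF det fx]) (use fund_points_fixed[OF z det fx] False in blast)
      qed
    qed (use id in auto)
    then show ?thesis unfolding S using False by (simp add: ell_weight_def)
  next
    case True
    then show ?thesis
    proof
      assume zi: "z = \<i>"
      have "?q ` {C\<in>SL2Z. moebius C z = z} = {?q (mat2 1 0 0 1), ?q (mat2 0 (- 1) 1 0)}"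
      proof
        show "?q ` {C\<in>SL2Z. moebius C z = z} \<subseteq> {?q (mat2 1 0 0 1), ?q (mat2 0 (- 1) 1 0)}"
        proof (rule image_subsetI)
          fix C assume "C \<in> {C\<in>SL2Z. moebius C z = z}"
          then have C: "C \<in> SL2Z" "moebius C z = z" by auto
          obtain a b c d where Ce: "C = mat2 a b c d" by (rule mat2_cases)
          have det: "a * d - b * c = 1" using C Ce by (simp add: mat2_SL2Z)
          have "real_of_int (a - d) = 0" "real_of_int b = real_of_int (- c)"
            using moebius_fixed_iff[OF det zu] C Ce zi by auto
          then have e: "d = a" "b = - c" by (auto simp only: of_int_eq_iff of_int_eq_0_iff)
          then have s: "a * a + c * c = 1" using det by simp
          show "?q C \<in> {?q (mat2 1 0 0 1), ?q (mat2 0 (- 1) 1 0)}"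
          proof (cases "c = 0")
            case True
            have "?q C = ?q (mat2 1 0 0 1)" unfolding Ce by (intro c0[OF det]) (use C Ce True in auto)
            then show ?thesis by blast
          next
            case False
            then have "c * c > 0" using zero_less_power2[of c] by (simp add: power2_eq_square)
            then have "a * a \<le> 0" using s by linarith
            then have a: "a = 0" by (auto simp: mult_le_0_iff)
            then have "c = 1 \<or> c = - 1" using s by (simp add: square_eq_1_iff)
            then have "?q C = ?q (mat2 0 (- 1) 1 0)" unfolding Ce e a by auto
            then show ?thesis by blast
          qed
        qed
        have "mat2 0 (- 1) 1 0 \<in> {C\<in>SL2Z. moebius C z = z}" by (rule fixI) (auto simp: zi)
        then show "{?q (mat2 1 0 0 1), ?q (mat2 0 (- 1) 1 0)} \<subseteq> ?q ` {C\<in>SL2Z. moebius C z = z}" using id by blast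
      qed
      moreover have "?q (mat2 1 0 0 1) \<noteq> ?q (mat2 0 (- 1) 1 0)" by (auto simp: doubleton_eq_iff mat2_eq_iff)
      ultimately have "stab_order (Pt z) = 2" unfolding S by simp
      then show ?thesis using zi i_neq_rho by (simp add: ell_weight_def del: stab_order.simps)
    next
      assume zr: "z = \<rho>"
      have "?q ` {C\<in>SL2Z. moebius C z = z} = {?q (mat2 1 0 0 1), ?q (mat2 0 (- 1) 1 1), ?q (mat2 1 1 (- 1) 0)}"
      proof
        show "?q ` {C\<in>SL2Z. moebius C z = z} \<subseteq> {?q (mat2 1 0 0 1), ?q (mat2 0 (- 1) 1 1), ?q (mat2 1 1 (- 1) 0)}"
        proof (rule image_subsetI)
          fix C assume "C \<in> {C\<in>SL2Z. moebius C z = z}"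
          then have C: "C \<in> SL2Z" "moebius C z = z" by auto
          obtain a b c d where Ce: "C = mat2 a b c d" by (rule mat2_cases)
          have det: "a * d - b * c = 1" using C Ce by (simp add: mat2_SL2Z)
          have "real_of_int (a - d) = real_of_int (- c)" "real_of_int b = real_of_int (- c)"
            using moebius_fixed_iff[OF det zu] C Ce zr rho_simps by auto
          then have e: "d = a + c" "b = - c" by (simp_all only: of_int_eq_iff)
          then have s: "(2 * a + c) * (2 * a + c) + 3 * (c * c) = 4" using det by (simp add: algebra_simps)
          show "?q C \<in> {?q (mat2 1 0 0 1), ?q (mat2 0 (- 1) 1 1), ?q (mat2 1 1 (- 1) 0)}"
          proof (cases "c = 0")
            case True
            have "?q C = ?q (mat2 1 0 0 1)" unfolding Ce by (intro c0[OF det]) (use C Ce True in auto)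
            then show ?thesis by blast
          next
            case c: False
            have "(2 * a + c) * (2 * a + c) \<ge> 0" by simp
            then have "c * c < 2 * 2" using s by linarith
            then have "\<bar>c\<bar>\<^sup>2 < 2\<^sup>2" by (simp add: power2_eq_square)
            then have "\<bar>c\<bar> < 2" by (rule power_less_imp_less_base) simp
            then have c1: "c = 1 \<or> c = - 1" using c by auto
            then have "(2 * a + c) * (2 * a + c) = 1" using s by auto
            then have "2 * a + c = 1 \<or> 2 * a + c = - 1" by (simp only: square_eq_1_iff)
            then have "c = 1 \<and> (a = 0 \<or> a = - 1) \<or> c = - 1 \<and> (a = 1 \<or> a = 0)" using c1 by auto
            then have "?q C = ?q (mat2 0 (- 1) 1 1) \<or> ?q C = ?q (mat2 1 1 (- 1) 0)" unfolding Ce e by auto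
            then show ?thesis by blast
          qed
        qed
        have "mat2 0 (- 1) 1 1 \<in> {C\<in>SL2Z. moebius C z = z}" "mat2 1 1 (- 1) 0 \<in> {C\<in>SL2Z. moebius C z = z}"
          by (rule fixI; simp add: zr rho_simps)+
        then show "{?q (mat2 1 0 0 1), ?q (mat2 0 (- 1) 1 1), ?q (mat2 1 1 (- 1) 0)} \<subseteq> ?q ` {C\<in>SL2Z. moebius C z = z}"
          using id by blast
      qed
      moreover have "?q (mat2 1 0 0 1) \<noteq> ?q (mat2 0 (- 1) 1 1)" "?q (mat2 1 0 0 1) \<noteq> ?q (mat2 1 1 (- 1) 0)"
        "?q (mat2 0 (- 1) 1 1) \<noteq> ?q (mat2 1 1 (- 1) 0)"
        by (auto simp: doubleton_eq_iff mat2_eq_iff)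
      ultimately have "stab_order (Pt z) = 3" unfolding S by simp
      then show ?thesis using zr by (simp add: ell_weight_def del: stab_order.simps)
    qed
  qed
qed

lemma matrix_cusp_exists: "\<exists>B. B \<in> SL2Z \<and> matrix_cusp B = l"
proof (cases l)
  case Infinity
  then show ?thesis by (intro exI[of _ "mat2 1 0 0 1"]) (simp add: mat2_SL2Z matrix_cusp_def)
next
  case (Rational r)
  obtain p q where pq: "quotient_of r = (p, q)" by (cases "quotient_of r")
  have q: "q > 0" "gcd p q = 1" "r = of_int p / of_int q"
    using quotient_of_denom_pos[OF pq] quotient_of_coprime[OF pq] quotient_of_div[OF pq] by auto
  obtain u v where uv: "u * p + v * q = 1" using bezout_int[of p q] q by auto
  show ?thesis using uv q Rational
    by (intro exI[of _ "mat2 (- u) (- v) q (- p)"]) (simp add: mat2_SL2Z matrix_cusp_def algebra_simps)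
qed

text \<open>Pulls the sum back to the fundamental domain. The order function \<open>ord\<close> is
  left abstract because it will be that of \<open>deriv g\<close> or of a pencil. The cusp of the
  translate is the image of infinity under \<open>B\<close>, not \<open>l\<close>.\<close>

lemma zero_count_eq:
  assumes f: "\<And>z. z \<in> fund_points \<Longrightarrow> zorder f (moebius B z) = ord z" "finite {z\<in>fund_points. ord z \<noteq> 0}"
    and B: "B = (SOME B. B \<in> SL2Z \<and> matrix_cusp B = l)"
  shows "zero_count k p l f = real_of_int (vanishing_order k p f (Cusp (cusp_action B Infinity)))
    + (\<Sum>z\<in>{z\<in>fund_points. ord z \<noteq> 0}. ell_weight z * of_int (ord z))"
proof -
  have BS: "B \<in> SL2Z" unfolding B using someI_ex[OF matrix_cusp_exists[of l]] by simp
  have Fu: "fund_points \<subseteq> uhp" by (auto simp: fund_points_def)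
  have F: "fundamental_domain = insert (Cusp Infinity) (Pt ` fund_points)"
    by (auto simp: fundamental_domain_def fund_points_def)
  let ?h = "\<lambda>x. real_of_int (vanishing_order k p f x) / real (stab_order x)"
  let ?T = "{z\<in>fund_points. ord z \<noteq> 0}"
  have inj: "inj_on (ext_action B) fundamental_domain"
    unfolding F using moebius_inj[OF BS] Fu by (auto simp: inj_on_def)
  have "zero_count k p l f = infsum ?h (ext_action B ` fundamental_domain)" by (simp add: zero_count_def B)
  also have "\<dots> = infsum (?h \<circ> ext_action B) fundamental_domain" by (rule infsum_reindex[OF inj])
  also have "\<dots> = infsum (?h \<circ> ext_action B) (insert (Cusp Infinity) (Pt ` ?T))"
  proof (rule infsum_cong_neutral)
    fix x assume "x \<in> fundamental_domain - insert (Cusp Infinity) (Pt ` ?T)"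
    then obtain z where "z \<in> fund_points" "ord z = 0" "x = Pt z" by (auto simp: F)
    then show "(?h \<circ> ext_action B) x = 0" using f(1) by simp
  qed (auto simp: F)
  also have "\<dots> = sum (?h \<circ> ext_action B) (insert (Cusp Infinity) (Pt ` ?T))" using f(2) by simp
  also have "\<dots> = ?h (Cusp (cusp_action B Infinity)) + sum (?h \<circ> ext_action B) (Pt ` ?T)"
    using f(2) by (subst sum.insert) auto
  also have "sum (?h \<circ> ext_action B) (Pt ` ?T) = (\<Sum>z\<in>?T. ?h (Pt (moebius B z)))"
    by (subst sum.reindex) (auto simp: inj_on_def)
  also have "\<dots> = (\<Sum>z\<in>?T. ell_weight z * of_int (ord z))"
  proof (rule sum.cong[OF refl])
    fix z assume z: "z \<in> ?T"
    then have "stab_order (Pt (moebius B z)) = stab_order (Pt z)" using Fu by (intro stab_order_moebius[OF BS]) auto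
    moreover have "zorder f (moebius B z) = ord z" "ell_weight z = 1 / real (stab_order (Pt z))"
      using z f(1) stab_order_fund_points[of z] by auto
    ultimately show "?h (Pt (moebius B z)) = ell_weight z * of_int (ord z)" by (simp del: stab_order.simps)
  qed
  finally show ?thesis by simp
qed


section \<open>Quasimodularity of the derivative\<close>

lemma q_expands_cong:
  "q_expands f F B \<Longrightarrow> (\<And>z. z \<in> uhp \<Longrightarrow> h z = f z) \<Longrightarrow> q_expands h F B"
  by (auto simp: q_expands_def)

lemma q_expands_order:
  assumes "q_expands h H B" "\<forall>\<^sub>F q in at 0. H q \<noteq> 0"
  shows "zorder H 0 = int (LEAST n. fps_nth B n \<noteq> 0)"
proof -
  have H: "H has_fps_expansion B" using assms(1) by (simp add: q_expands_def)
  have B0: "B \<noteq> 0"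
  proof
    assume "B = 0"
    then have "\<forall>\<^sub>F q in at 0. H q = 0" using H by (auto simp: has_fps_expansion_0_iff eventually_nhds_conv_at)
    from eventually_conj[OF this assms(2)] show False by (simp add: eventually_False)
  qed
  then show ?thesis using has_fps_expansion_zorder_0[OF H B0] by (simp add: subdegree_def)
qed

lemma fund_points_sum:
  assumes P: "P holomorphic_on uhp"
    and fin: "finite {z\<in>upper_strip. P z = 0}" "finite {z\<in>line_left. P z = 0}" "finite {z\<in>arc_left. P z = 0}"
  shows "finite {z\<in>fund_points. zorder P z \<noteq> 0}"
    "(\<Sum>z\<in>{z\<in>fund_points. zorder P z \<noteq> 0}. ell_weight z * of_int (zorder P z)) =
      of_int (zcount P upper_strip + zcount P line_left) + (\<Sum>z\<in>{z\<in>arc_left. P z = 0}. ell_weight z * of_int (zorder P z))"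
proof -
  let ?S = "\<lambda>W. {z\<in>W. P z = 0}" and ?h = "\<lambda>z. ell_weight z * of_int (zorder P z)"
  have Fu: "fund_points \<subseteq> uhp" by (auto simp: fund_points_def)
  have T: "?S fund_points = ?S (upper_strip \<union> line_left) \<union> ?S arc_left" "?S (upper_strip \<union> line_left) = ?S upper_strip \<union> ?S line_left"
    unfolding fund_points_eq by auto
  have finT: "finite (?S fund_points)" unfolding T using fin by simp
  have sub: "{z\<in>fund_points. zorder P z \<noteq> 0} \<subseteq> ?S fund_points"
    using zorder_eq_0I analytic_at P open_uhp Fu by blast
  then show "finite {z\<in>fund_points. zorder P z \<noteq> 0}" by (rule finite_subset[OF _ finT])
  have ell: "ell_weight z = 1" if "norm z > 1" for z using that rho_simps(3) by (auto simp: ell_weight_def)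
  have "sum ?h {z\<in>fund_points. zorder P z \<noteq> 0} = sum ?h (?S fund_points)"
    by (rule sum.mono_neutral_left[OF finT sub]) auto
  also have "\<dots> = sum ?h (?S (upper_strip \<union> line_left)) + sum ?h (?S arc_left)"
    unfolding T(1) by (rule sum.union_disjoint) (use fin T(2) in \<open>auto simp: upper_strip_def line_left_def arc_left_def\<close>)
  also have "sum ?h (?S (upper_strip \<union> line_left)) = sum ?h (?S upper_strip) + sum ?h (?S line_left)"
    unfolding T(2) by (rule sum.union_disjoint) (use fin in \<open>auto simp: upper_strip_def line_left_def\<close>)
  also have "sum ?h (?S upper_strip) = of_int (zcount P upper_strip)"
    unfolding zcount_def of_int_sum by (rule sum.cong) (auto simp: upper_strip_def ell)
  also have "sum ?h (?S line_left) = of_int (zcount P line_left)"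
    unfolding zcount_def of_int_sum by (rule sum.cong) (auto simp: line_left_def ell)
  finally show "sum ?h {z\<in>fund_points. zorder P z \<noteq> 0} =
      of_int (zcount P upper_strip + zcount P line_left) + sum ?h (?S arc_left)" by simp
qed

context real_modular_form
begin

lemma deriv_g_nonzero_point: obtains z0 where "z0 \<in> uhp" "deriv g z0 \<noteq> 0"
proof -
  have "\<exists>z0\<in>uhp. deriv g z0 \<noteq> 0"
  proof (rule ccontr)
    assume "\<not> ?thesis"
    then have "(g has_field_derivative 0) (at z within uhp)" if "z \<in> uhp" for z
      using holomorphic_derivI[OF g_holomorphic open_uhp that] that by (simp add: has_field_derivative_at_within)
    then have "\<exists>c. \<forall>z\<in>uhp. g z = c" by (intro has_field_derivative_zero_constant[OF convex_uhp])
    then show False using nonconst by (simp add: constant_on_def)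
  qed
  then show ?thesis using that by blast
qed

lemma normalized_deriv_holomorphic: "normalized_deriv g holomorphic_on uhp"
  unfolding normalized_deriv_def[abs_def] by (intro holomorphic_intros deriv_g_holomorphic) auto

lemma normalized_deriv_eventually:
  assumes "z \<in> uhp"
  shows "\<forall>\<^sub>F w in at z. normalized_deriv g w \<noteq> 0"
proof -
  obtain z0 where "z0 \<in> uhp" "deriv g z0 \<noteq> 0" by (rule deriv_g_nonzero_point)
  then have "z0 \<in> uhp" "normalized_deriv g z0 \<noteq> 0" by (auto simp: normalized_deriv_def)
  then have "\<forall>\<^sub>F w in at z. normalized_deriv g w \<noteq> 0 \<and> w \<in> uhp"
    by (rule non_zero_neighbour_alt[OF normalized_deriv_holomorphic open_uhp convex_connected[OF convex_uhp] assms])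
  then show ?thesis by (rule eventually_mono) simp
qed

lemma qG'_expands: "q_expands (normalized_deriv g) (\<lambda>q. q * deriv G q) (fps_X * fps_deriv A)"
  by (rule q_expands_normalized_deriv[OF q_exp])

lemma qG'_holomorphic: "(\<lambda>q. q * deriv G q) holomorphic_on ball 0 1"
  using qG'_expands by (simp add: q_expands_def)

lemma qG'_eventually:
  assumes "norm q < 1"
  shows "\<forall>\<^sub>F w in at q. w * deriv G w \<noteq> 0"
proof -
  obtain z0 where z0: "z0 \<in> uhp" "deriv g z0 \<noteq> 0" by (rule deriv_g_nonzero_point)
  then have "nome z0 * deriv G (nome z0) \<noteq> 0" "nome z0 \<in> ball 0 1"
    using deriv_g[OF z0(1)] norm_nome_less[OF z0(1)] by auto
  then have "\<forall>\<^sub>F w in at q. w * deriv G w \<noteq> 0 \<and> w \<in> ball 0 1"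
    using assms by (intro non_zero_neighbour_alt[OF qG'_holomorphic open_ball]) auto
  then show ?thesis by (rule eventually_mono) simp
qed

lemma zorder_moebius:
  assumes B: "B \<in> SL2Z" and z: "z \<in> uhp" and Q: "Q holomorphic_on uhp" and P: "P holomorphic_on uhp"
    and QP: "\<And>w. w \<in> uhp \<Longrightarrow> Q w \<noteq> 0 \<and> normalized_deriv g (moebius B w) = Q w * P w"
  shows "zorder (normalized_deriv g) (moebius B z) = zorder P z"
proof -
  obtain a b c d where Be: "B = mat2 a b c d" by (rule mat2_cases)
  have det: "a * d - b * c = 1" using B by (simp add: Be mat2_SL2Z)
  note D = has_field_derivative_moebius[OF det, folded moebius_mat2, folded Be]
  have hol: "moebius B holomorphic_on uhp" using D open_uhp by (auto simp: holomorphic_on_open)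
  have dn: "deriv (moebius B) z \<noteq> 0" using DERIV_imp_deriv[OF D[OF z]] moebius_denom_nonzero[OF det z] by simp
  note C = compose_local_biholomorphic[OF hol open_uhp z dn normalized_deriv_holomorphic open_uhp moebius_uhp[OF B z]
      normalized_deriv_eventually[OF moebius_uhp[OF B z]]]
  have "\<forall>\<^sub>F w in at z. w \<in> uhp" using eventually_at_in_open'[OF open_uhp z] .
  then have ev: "\<forall>\<^sub>F w in at z. P w \<noteq> 0" using C(2) by eventually_elim (use QP in auto)
  have "zorder (\<lambda>w. normalized_deriv g (moebius B w)) z = zorder (\<lambda>w. Q w * P w) z"
    by (rule zorder_cong_on[OF open_uhp z]) (use QP in blast)
  also have "\<dots> = zorder P z" by (rule zorder_mult_nonzero[OF open_uhp z Q P _ ev]) (use QP z in blast)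
  finally show ?thesis using C(1) by simp
qed

lemma normalized_deriv_moebius:
  assumes det: "a * d - b * c = 1" and z: "z \<in> uhp"
  shows "normalized_deriv g (moebius (mat2 a b c d) z) = (of_int c * z + of_int d) powi (k + 2) * normalized_deriv g z +
    of_int k * of_int c * (of_int c * z + of_int d) powi (k + 1) * g z / (2 * of_real pi * \<i>)"
  unfolding normalized_deriv_def moebius_mat2 deriv_g_moebius[OF det z] by (simp add: add_divide_distrib)

text \<open>As \<open>c z + d = c (z - \<lambda>)\<close> with \<open>\<lambda> = - d / c\<close>,
  the two terms of the transformation law of the derivative combine to the pencil at \<lambda>. The
  remaining factor has no zeros in \<open>uhp\<close>, so orders on the translate become orders of
  the pencil.\<close>

lemma normalized_deriv_moebius_pencil:
  assumes det: "a * d - b * c = 1" and z: "z \<in> uhp" and c: "c \<noteq> 0"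
  shows "normalized_deriv g (moebius (mat2 a b c d) z) =
    of_int c * (of_int c * z + of_int d) powi (k + 1) / (2 * of_real pi * \<i>) * pencil (of_real (- of_int d / of_int c)) 1 z"
proof -
  define j where "j = of_int c * z + of_int d"
  have j0: "j \<noteq> 0" unfolding j_def by (rule moebius_denom_nonzero[OF det z])
  have jz: "j = of_int c * (z - of_real (- of_int d / of_int c))" using c by (simp add: j_def field_simps)
  have "j powi (k + 2) = j powi (k + 1) * j" using j0 power_int_add_1[of j "k + 1"] by (simp add: add.assoc)
  then have "j powi (k + 2) * deriv g z + of_int k * of_int c * j powi (k + 1) * g z = j powi (k + 1) * (j * deriv g z + of_int c * of_int k * g z)"
    by (simp add: algebra_simps)
  also have "j * deriv g z + of_int c * of_int k * g z = of_int c * pencil (of_real (- of_int d / of_int c)) 1 z"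
    unfolding pencil_def by (subst jz) (simp add: algebra_simps)
  finally show ?thesis
    unfolding normalized_deriv_def moebius_mat2 deriv_g_moebius[OF det z] unfolding j_def[symmetric] by simp
qed

text \<open>\<open>quasimodular_coeffs\<close> is an arbitrary choice, so the coefficient has to be
  identified for every expansion. The derivative at \<open>- 1 / z\<close> is computed from its own
  transformation law and from that of the expansion; comparing the nonmodular terms determines
  \<open>F 1\<close>.\<close>

lemma quasimodular_coeff_1:
  assumes F: "quasimodular_expansion (k + 2) 1 (normalized_deriv g) F" and z: "z \<in> uhp"
  shows "F 1 z = of_int k / 12 * g z"
proof -
  let ?f = "normalized_deriv g"
  have z0: "z \<noteq> 0" using z by (auto simp: uhp_def)
  have m: "modular_form (k + 2) (F 0)" "modular_form k (F 1)" and f: "\<And>w. w \<in> uhp \<Longrightarrow> ?f w = F 0 w + F 1 w * E2 w"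
    using F by (auto simp: quasimodular_expansion_def dest: spec[of _ 0] spec[of _ 1])
  have S: "h (- 1 / z) = z powi r * h z" if "modular_form r h" for h r
    using that z unfolding modular_form_def by (auto dest!: bspec[of _ _ "mat2 0 (- 1) 1 0"] simp: mat2_SL2Z moebius_mat2)
  have p: "z powi (k + 2) = z powi k * z\<^sup>2" "z powi (k + 1) = z powi k * z"
    using z0 by (simp_all add: power_int_add)
  have "?f (- 1 / z) = z powi (k + 2) * ?f z + of_int k * z powi (k + 1) * g z / (2 * of_real pi * \<i>)"
    using normalized_deriv_moebius[of 0 0 "- 1" 1 z] z by (simp add: moebius_mat2)
  moreover have "?f (- 1 / z) = z powi (k + 2) * F 0 z + z powi k * F 1 z * (z\<^sup>2 * E2 z + 6 * z / (of_real pi * \<i>))"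
    unfolding f[OF uhp_inversion[OF z]] S[OF m(1)] S[OF m(2)] E2_inversion[OF z] ..
  ultimately have "z powi k * (6 * z / (of_real pi * \<i>)) * F 1 z = z powi k * (6 * z / (of_real pi * \<i>)) * (of_int k / 12 * g z)"
    unfolding f[OF z] p by (simp add: algebra_simps)
  then show ?thesis by (rule mult_left_cancel[THEN iffD1, rotated]) (use z0 in simp)
qed

text \<open>The remaining part \<open>u\<close> is the Serre derivative
  \<open>g' - k/12 E2 g\<close>, in which the nonmodular terms of \<open>g'\<close> and of
  \<open>E2\<close> cancel.\<close>

lemma quasimodular_expansion_exists: "\<exists>F. quasimodular_expansion (k + 2) 1 (normalized_deriv g) F"
proof -
  let ?f = "normalized_deriv g"
  obtain E EA where E: "q_expands E2 E EA" by (rule E2_q_expands)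
  define h where "h z = of_int k / 12 * g z" for z
  define u where "u z = ?f z - h z * E2 z" for z
  have qh: "q_expands h (\<lambda>q. of_int k / 12 * G q) (fps_const (of_int k / 12) * A)"
    unfolding h_def[abs_def] by (rule q_expands_cmult[OF q_exp])
  have qu: "q_expands u (\<lambda>q. q * deriv G q - of_int k / 12 * G q * E q) (fps_X * fps_deriv A - fps_const (of_int k / 12) * A * EA)"
    unfolding u_def[abs_def] by (rule q_expands_diff[OF qG'_expands q_expands_mult[OF qh E]])
  have hm: "modular_form k h"
    using modular q_expands_imp_fourier[OF qh] q_expands_holomorphic[OF qh] unfolding modular_form_def h_def by auto
  have um: "modular_form (k + 2) u"
    unfolding modular_form_def
  proof (intro conjI ballI exI)
    fix B z assume B: "B \<in> SL2Z" and z: "z \<in> uhp"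
    obtain a b c d where Be: "B = mat2 a b c d" by (rule mat2_cases)
    have det: "a * d - b * c = 1" using B by (simp add: Be mat2_SL2Z)
    define j where "j = of_int c * z + of_int d"
    have j0: "j \<noteq> 0" unfolding j_def by (rule moebius_denom_nonzero[OF det z])
    have p: "j powi (k + 2) = j powi k * j\<^sup>2" "j powi (k + 1) = j powi k * j"
      using j0 by (simp_all add: power_int_add)
    have h: "h (moebius B z) = j powi k * h z" using g_moebius[OF det z] by (simp add: Be moebius_mat2 h_def j_def)
    have e: "E2 (moebius B z) = j\<^sup>2 * E2 z + 6 * of_int c * j / (of_real pi * \<i>)"
      using E2_moebius[OF det z] by (simp add: Be moebius_mat2 j_def)
    have f: "?f (moebius B z) = j powi (k + 2) * ?f z + of_int k * of_int c * j powi (k + 1) * g z / (2 * of_real pi * \<i>)"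
      using normalized_deriv_moebius[OF det z] by (simp add: Be j_def)
    have "u (moebius B z) = j powi (k + 2) * u z"
      unfolding u_def h e f p unfolding h_def by (simp add: algebra_simps)
    then show "u (moebius B z) = (of_int (B$2$1) * z + of_int (B$2$2)) powi (k + 2) * u z" by (simp add: Be j_def)
  qed (rule q_expands_holomorphic[OF qu], rule q_expands_imp_fourier[OF qu])
  have "quasimodular_expansion (k + 2) 1 ?f (\<lambda>j. if j = 0 then u else h)"
    unfolding quasimodular_expansion_def using um hm by (auto simp: le_Suc_eq u_def)
  then show ?thesis by blast
qed

lemma frak_d_iter_values:
  assumes "z \<in> uhp"
  shows "frak_d_iter (k + 2) 1 0 (normalized_deriv g) z = normalized_deriv g z"
    "frak_d_iter (k + 2) 1 1 (normalized_deriv g) z = of_int k * g z"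
proof -
  let ?F = "quasimodular_coeffs (k + 2) 1 (normalized_deriv g)"
  have F: "quasimodular_expansion (k + 2) 1 (normalized_deriv g) ?F"
    unfolding quasimodular_coeffs_def by (rule someI_ex[OF quasimodular_expansion_exists])
  then show "frak_d_iter (k + 2) 1 0 (normalized_deriv g) z = normalized_deriv g z"
    using assms by (simp add: frak_d_iter_def quasimodular_expansion_def)
  show "frak_d_iter (k + 2) 1 1 (normalized_deriv g) z = of_int k * g z"
    using quasimodular_coeff_1[OF F assms] by (simp add: frak_d_iter_def field_simps)
qed

text \<open>The derivation sends the derivative of \<open>g\<close> to \<open>k g\<close>, so the
  polynomial is the coefficient \<open>fps_nth A n\<close> times a polynomial of degree at most
  1.\<close>

lemma cusp_coeff_poly_deriv:
  "cusp_coeff_poly (k + 2) 1 (normalized_deriv g) c d n = smult (of_nat n * fps_nth A n) 1 + smult (of_int k * fps_nth A n)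
     [: - of_int (c * d) / (2 * of_real pi * \<i>), - of_int (c * c) / (2 * of_real pi * \<i>) :]"
proof -
  have 0: "q_expands (frak_d_iter (k + 2) 1 0 (normalized_deriv g)) (\<lambda>q. q * deriv G q) (fps_X * fps_deriv A)"
    by (rule q_expands_cong[OF qG'_expands frak_d_iter_values(1)])
  have 1: "q_expands (frak_d_iter (k + 2) 1 1 (normalized_deriv g)) (\<lambda>q. of_int k * G q) (fps_const (of_int k) * A)"
    by (rule q_expands_cong[OF q_expands_cmult[OF q_exp] frak_d_iter_values(2)])
  have "fps_nth (fps_X * fps_deriv A) n = of_nat n * fps_nth A n" by (cases n) auto
  then show ?thesis
    unfolding cusp_coeff_poly_def using fourier_coeff_q_expands[OF 0] fourier_coeff_q_expands[OF 1] by simp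
qed

text \<open>At infinity \<open>c = 0\<close>, so the linear term disappears and the coefficients
  \<open>n a_n\<close> of the derivative remain; a nonzero constant term of \<open>g\<close> is not
  seen.\<close>

lemma vanishing_order_Infinity:
  "vanishing_order (k + 2) 1 (normalized_deriv g) (Cusp Infinity) = zorder (\<lambda>q. q * deriv G q) 0"
proof -
  have n: "fps_nth (fps_X * fps_deriv A) n = of_nat n * fps_nth A n" for n by (cases n) auto
  have ev: "\<forall>\<^sub>F q in at 0. q * deriv G q \<noteq> 0" by (rule qG'_eventually) simp
  show ?thesis
    unfolding q_expands_order[OF qG'_expands ev] n
    by (simp add: cusp_coeff_poly_deriv[unfolded One_nat_def])
qed

text \<open>At a finite cusp \<open>c \<noteq> 0\<close>, and the linear coefficient is a nonzero
  multiple of \<open>k a_n\<close>. Hence every finite cusp carries the order of \<open>g\<close>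
  itself at infinity.\<close>

lemma vanishing_order_Rational:
  "vanishing_order (k + 2) 1 (normalized_deriv g) (Cusp (Rational r)) = zorder G 0"
proof -
  define c d where "c = snd (quotient_of r)" and "d = - fst (quotient_of r)"
  have c: "c > 0" by (simp add: c_def quotient_of_denom_pos')
  have "cusp_coeff_poly (k + 2) 1 (normalized_deriv g) c d n \<noteq> 0 \<longleftrightarrow> fps_nth A n \<noteq> 0" for n
  proof -
    have "coeff (cusp_coeff_poly (k + 2) 1 (normalized_deriv g) c d n) 1 = of_int k * fps_nth A n * (- of_int (c * c) / (2 * of_real pi * \<i>))"
      by (simp add: cusp_coeff_poly_deriv[unfolded One_nat_def])
    then have "fps_nth A n \<noteq> 0 \<Longrightarrow> coeff (cusp_coeff_poly (k + 2) 1 (normalized_deriv g) c d n) 1 \<noteq> 0"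
      using k_pos c by (simp del: One_nat_def)
    moreover have "fps_nth A n = 0 \<Longrightarrow> cusp_coeff_poly (k + 2) 1 (normalized_deriv g) c d n = 0"
      by (simp add: cusp_coeff_poly_deriv[unfolded One_nat_def])
    ultimately show ?thesis by (metis coeff_0)
  qed
  then show ?thesis
    unfolding q_expands_order[OF q_exp G_eventually_nonzero[of 0, simplified]] by (simp add: c_def d_def)
qed

section \<open>Assembly of the theorem\<close>

lemma arc_count_eq: "arc_count g = arc_zeros_weight"
proof -
  have "arc_left \<subseteq> fund_points" unfolding fund_points_eq by blast
  moreover have "{z \<in> uhp. g z = 0 \<and> norm z = 1 \<and> - (1/2) \<le> Re z \<and> Re z \<le> 0} = {z\<in>arc_left. g z = 0}"
    by (auto simp: arc_left_def)
  ultimately show ?thesis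
    unfolding arc_count_def arc_zeros_weight_def using stab_order_fund_points by (intro sum.cong) auto
qed

lemma line_count_eq: "line_count g = card {z\<in>line_left. g z = 0} + of_bool (G 0 = 0)"
proof -
  have "fourier_coeff g 0 = G 0"
    using fourier_coeff_q_expands[OF q_exp] q_exp has_fps_expansion_imp_0_eq_fps_nth_0 by (fastforce simp: q_expands_def)
  moreover have "{z \<in> uhp. g z = 0 \<and> Re z = - (1/2) \<and> norm z > 1} = {z\<in>line_left. g z = 0}"
    by (auto simp: line_left_def)
  ultimately show ?thesis by (simp add: line_count_def)
qed

lemma zero_count_Infinity:
  "zero_count (k + 2) 1 Infinity (normalized_deriv g) = k / 12 + arc_count g + of_bool (g \<rho> = 0) / 3"
proof -
  define B where "B = (SOME B. B \<in> SL2Z \<and> matrix_cusp B = Infinity)"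
  have B: "B \<in> SL2Z" "matrix_cusp B = Infinity" using someI_ex[OF matrix_cusp_exists[of Infinity]] by (auto simp: B_def)
  obtain a b c d where Be: "B = mat2 a b c d" by (rule mat2_cases)
  have c: "c = 0" using B(2) by (simp add: Be matrix_cusp_def split: if_splits)
  have det: "a * d - b * c = 1" using B(1) by (simp add: Be mat2_SL2Z)
  let ?Q = "\<lambda>z::complex. of_int d powi (k + 2) / (2 * of_real pi * \<i>) :: complex"
  have d0: "d \<noteq> 0" using det c by auto
  have zord: "zorder (normalized_deriv g) (moebius B z) = zorder (deriv g) z" if "z \<in> fund_points" for z
  proof (rule zorder_moebius[OF B(1) _ _ deriv_g_holomorphic])
    show "z \<in> uhp" using that by (auto simp: fund_points_def)
    show "?Q w \<noteq> 0 \<and> normalized_deriv g (moebius B w) = ?Q w * deriv g w" if "w \<in> uhp" for w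
      using normalized_deriv_moebius[OF det that] c d0 unfolding Be by (simp add: normalized_deriv_def)
  qed (intro holomorphic_intros)
  let ?H = "\<lambda>q. q * deriv G q"
  note Z = zcount_disc_domain[OF qG'_holomorphic qG'_eventually]
  have Hz: "?H (nome z) = 1 / (2 * of_real pi * \<i>) * deriv g z" if "z \<in> uhp" for z
    using qG'_expands that unfolding q_expands_def normalized_deriv_def by (metis mult_1 times_divide_eq_left)
  have zc: "zcount (\<lambda>z. ?H (nome z)) W = zcount (deriv g) W" and zs: "{z\<in>W. ?H (nome z) = 0} = {z\<in>W. deriv g z = 0}" if "W \<subseteq> uhp" for W
  proof -
    have "\<forall>\<^sub>F w in at z. deriv g w \<noteq> 0" if "z \<in> W" for z
      using normalized_deriv_eventually[of z] that \<open>W \<subseteq> uhp\<close> by (auto simp: normalized_deriv_def)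
    then show "zcount (\<lambda>z. ?H (nome z)) W = zcount (deriv g) W"
      by (intro zcount_mult_nonzero[OF open_uhp _ deriv_g_holomorphic \<open>W \<subseteq> uhp\<close> _ _ Hz]) auto
    have "?H (nome z) = 0 \<longleftrightarrow> deriv g z = 0" if "z \<in> W" for z unfolding Hz[OF subsetD[OF \<open>W \<subseteq> uhp\<close> that]] by simp
    then show "{z\<in>W. ?H (nome z) = 0} = {z\<in>W. deriv g z = 0}" by blast
  qed
  have W: "upper_strip \<subseteq> uhp" "line_left \<subseteq> uhp" by (auto simp: upper_strip_def line_left_def)
  have "{z\<in>arc_left. deriv g z = 0} \<subseteq> {z\<in>arc_left. g z = 0}"
    using deriv_g_circle_nonzero by (auto simp: arc_left_def)
  then have fin: "finite {z\<in>arc_left. deriv g z = 0}" by (rule finite_subset[OF _ finite_arc_left_zeros])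
  note S = fund_points_sum[OF deriv_g_holomorphic Z(2)[unfolded zs[OF W(1)]] Z(3)[unfolded zs[OF W(2)]] fin]
  have "cusp_action B Infinity = Infinity" using c by (simp add: Be)
  then have "zero_count (k + 2) 1 Infinity (normalized_deriv g) = zorder ?H 0 +
    (\<Sum>z\<in>{z\<in>fund_points. zorder (deriv g) z \<noteq> 0}. ell_weight z * of_int (zorder (deriv g) z))"
    using zero_count_eq[of "normalized_deriv g" B "zorder (deriv g)", OF zord S(1) B_def, of "k + 2" 1] vanishing_order_Infinity by simp
  then show ?thesis using S(2) Z(1) zc[OF W(1)] zc[OF W(2)] infinity_total arc_count_eq by simp
qed

lemma zero_count_Rational:
  defines "x \<equiv> \<lambda>r. real_of_rat r"
  assumes x: "\<bar>x r\<bar> \<noteq> 1/2" "\<bar>x r\<bar> \<noteq> 1"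
  shows "zero_count (k + 2) 1 (Rational r) (normalized_deriv g) = k / 12 +
    (if \<bar>x r\<bar> > 1 then arc_count g + of_bool (g \<rho> = 0) / 3
     else if \<bar>x r\<bar> > 1/2 then - arc_count g else - arc_count g + real (line_count g))"
proof -
  define B where "B = (SOME B. B \<in> SL2Z \<and> matrix_cusp B = Rational r)"
  have B: "B \<in> SL2Z" "matrix_cusp B = Rational r" using someI_ex[OF matrix_cusp_exists[of "Rational r"]] by (auto simp: B_def)
  obtain a b c d where Be: "B = mat2 a b c d" by (rule mat2_cases)
  have c: "c \<noteq> 0" and r: "r = - of_int d / of_int c" using B(2) by (simp_all add: Be matrix_cusp_def split: if_splits)
  have xr: "x r = - of_int d / of_int c" by (simp add: x_def r of_rat_minus of_rat_divide)
  have det: "a * d - b * c = 1" using B(1) by (simp add: Be mat2_SL2Z)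
  let ?P = "pencil (of_real (x r)) 1"
  let ?Q = "\<lambda>z. of_int c * (of_int c * z + of_int d) powi (k + 1) / (2 * of_real pi * \<i>) :: complex"
  have k0: "k \<noteq> 0" using k_pos by simp
  have zord: "zorder (normalized_deriv g) (moebius B z) = zorder ?P z" if "z \<in> fund_points" for z
  proof (rule zorder_moebius[OF B(1) _ _ pencil_holomorphic])
    show "z \<in> uhp" using that by (auto simp: fund_points_def)
    show "?Q w \<noteq> 0 \<and> normalized_deriv g (moebius B w) = ?Q w * ?P w" if "w \<in> uhp" for w
      using normalized_deriv_moebius_pencil[OF det that c] moebius_denom_nonzero[OF det that] c unfolding Be xr by simp
    show "?Q holomorphic_on uhp" using moebius_denom_nonzero[OF det] by (intro holomorphic_intros) auto
  qed
  have fin1: "finite {z\<in>upper_strip. ?P z = 0}"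
  proof -
    obtain Y where Y: "Y \<ge> 1" "\<And>z. \<bar>Re z\<bar> \<le> 1/2 \<Longrightarrow> Im z \<ge> Y \<Longrightarrow> ?P z \<noteq> 0"
    proof (rule pencil_top_nonzero[of "norm (of_real (x r) :: complex)"], simp, goal_cases)
      case (1 Y0)
      show ?case by (rule 1(1)[of Y0]) (use 1(2,3) in \<open>auto simp: pencil_def\<close>)
    qed
    have "finite {z\<in>strip Y. ?P z = 0}"
      by (rule pencil_finite[of "Complex 0 Y"]) (use Y in \<open>auto simp: uhp_def\<close>)
    moreover have "{z\<in>upper_strip. ?P z = 0} \<subseteq> {z\<in>strip Y. ?P z = 0}"
      using Y(2) by (force simp: upper_strip_def strip_def uhp_def)
    ultimately show ?thesis by (rule finite_subset[rotated])
  qed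
  have gz: "g z = 0" if "?P z = 0" "z \<in> uhp" "norm z = 1 \<or> Re z = - (1/2)" for z
  proof (rule ccontr)
    assume g0: "g z \<noteq> 0"
    have 0: "of_int k * g z + (z - of_real (x r)) * deriv g z = 0" using that(1) by (simp add: pencil_def)
    show False
    proof (cases "norm z = 1")
      case True
      then show False using circle_pencil_zero[OF that(2) True g0 0 k0] x(2) by simp
    next
      case False
      then have "Re (z - of_real (x r)) \<noteq> 0" using that(3) x(1) by auto
      then show False using line_pencil_nonzero[OF that(2) _ g0 _ k0] that(3) False 0 by blast
    qed
  qed
  have fin2: "finite {z\<in>line_left. ?P z = 0}"
    by (rule finite_subset[OF _ finite_boundary_zeros]) (use gz in \<open>auto simp: line_left_def boundary_zeros_def\<close>)
  have fin3: "finite {z\<in>arc_left. ?P z = 0}"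
    by (rule finite_subset[OF _ finite_arc_left_zeros]) (use gz in \<open>auto simp: arc_left_def\<close>)
  note S = fund_points_sum[OF pencil_holomorphic fin1 fin2 fin3]
  \<comment> \<open>The cusp contained in the translate is \<open>a / c\<close>, in general
    different from \<lambda>. Only its finiteness matters, as all finite cusps have the same
    vanishing order.\<close>
  obtain r' where "cusp_action B Infinity = Rational r'" using c by (simp add: Be)
  then have "zero_count (k + 2) 1 (Rational r) (normalized_deriv g) = zorder G 0 +
    (\<Sum>z\<in>{z\<in>fund_points. zorder ?P z \<noteq> 0}. ell_weight z * of_int (zorder ?P z))"
    using zero_count_eq[of "normalized_deriv g" B "zorder ?P", OF zord S(1) B_def, of "k + 2" 1] vanishing_order_Rational[of r'] by simp
  then show ?thesis using S(2) finite_total[OF x] unfolding arc_count_eq line_count_eq of_int_add by linarith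
qed

end

theorem theorem1p1:
  fixes g :: "complex \<Rightarrow> complex" and k :: int and l :: cusp
  assumes "modular_form k g"
    and "\<not> g constant_on uhp"
    and "\<And>n. fourier_coeff g n \<in> \<real>"
    and "cusp_abs l \<notin> {1/2, 1}"
  shows "zero_count (k + 2) 1 l (normalized_deriv g) =
    real_of_int k / 12 +
      (if 1 < cusp_abs l then arc_count g + 1/3 * of_bool (g \<rho> = 0)
       else if 1/2 < cusp_abs l then - arc_count g
       else - arc_count g + real (line_count g))"
proof -
  obtain a where "has_fourier_expansion g a" using assms(1) by (auto simp: modular_form_def)
  then obtain G where G: "q_expands g G (Abs_fps a)" by (rule fourier_imp_q_expands)
  interpret real_modular_form g k G "Abs_fps a"
    using assms(1-3) fourier_coeff_q_expands[OF G] G by unfold_locales auto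
  \<comment> \<open>In the theorem the thresholds are extended reals; this moves the division into
    the reals.\<close>
  have half: "(1/2 :: ereal) = ereal (1/2)" by (simp add: one_ereal_def)
  show ?thesis
  proof (cases l)
    case Infinity
    then show ?thesis using zero_count_Infinity by simp
  next
    case (Rational r)
    define y where "y = \<bar>real_of_rat r\<bar>"
    have y: "cusp_abs l = ereal y" by (simp add: Rational y_def)
    have "y \<noteq> 1/2" "y \<noteq> 1" using assms(4) unfolding y half by (auto simp: one_ereal_def)
    then show ?thesis
      using zero_count_Rational[of r] unfolding y half unfolding Rational y_def by (simp add: one_ereal_def)
  qed
qed


end
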